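(* Let $E\subset\mathbb{R}^4$ be a (nondegenerate) $2$-dimensional affine plane. If $E$ has weak local rules, then (the direction of) $E$ is generated by vectors with entries in some quadratic number field $\mathbb{Q}(\sqrt d)$.
   Context: Octagonal tilings. Fix pairwise non-colinear vectors $\vec v_1,\dots,\vec v_4\in\mathbb{R}^2$. The proto-tiles are $T_{ij}=\{\lambda\vec v_i+\mu\vec v_j : 0\le\lambda,\mu\le 1\}$, $1\le i<j\le 4$; a tile is a translated proto-tile. An octagonal tiling is a covering of $\mathbb{R}^2$ by tiles that is edge-to-edge: two distinct tiles intersect in the empty set, a common vertex, or a common whole edge. A lift of an octagonal tiling is the surface in $\mathbb{R}^4$ obtained by mapping an arbitrary vertex of the tiling to an arbitrary point of $\mathbb{Z}^4$ and each tile that is a translate of $T_{ij}$ to a unit square face generated by the standard basis vectors $\vec e_i,\vec e_j$, so that tiles adjacent along an edge $\vec v_i$ are mapped to faces adjacent along $\vec e_i$ (the lift is thus defined up to translation by $\mathbb{Z}^4$). Planarity. "Plane" means $2$-dimensional affine plane of $\mathbb{R}^4$. An octagonal tiling is planar with slope $E$ (a plane) and thickness $t\ge 1$ if it has a lift contained in $E+[0,t]^4$. Weak local rules. An $r$-map of a tiling is the pattern (finite set of tiles, considered up to translation) formed by exactly the tiles intersecting some closed ball of diameter $r$ of $\mathbb{R}^2$. A plane $E$ has weak local rules of diameter $r\geq 0$ and thickness $t\geq 1$ if every octagonal tiling, all of whose $r$-maps are also $r$-maps of a planar octagonal tiling with slope $E$ and thickness $1$, is itself planar with slope $E$ and thickness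 $t$. $E$ has (admits) weak local rules if it does so for some $r\ge 0$ and $t\ge 1$. Nondegeneracy. If the direction of $E$ is spanned by $(u_1,\dots,u_4)$ and $(v_1,\dots,v_4)$, its Grassmann coordinates are $G_{ij}=u_iv_j-u_jv_i$, $1\le i<j\le 4$ (defined up to a common nonzero factor). $E$ is nondegenerate if all $G_{ij}\neq 0$; only nondegenerate planes are considered.
   Formalization: It is additionally assumed that at least one planar octagonal tiling with slope E and thickness 1 exists for the fixed vectors v_i; otherwise E has weak local rules vacuously and the claim fails for suitable non-quadratic E. *)

theory Defs
  imports "HOL-Analysis.Analysis"
begin

definition parallelogram :: "'a::real_vector \<Rightarrow> 'a \<Rightarrow> 'a \<Rightarrow> 'a set" where
  "parallelogram x a b = {x + l *\<^sub>R a + m *\<^sub>R b | l m. 0 \<le> l \<and> l \<le> 1 \<and> 0 \<le> m \<and> m \<le> 1}"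

text \<open>The edge vectors are a family \<open>v :: 4 \<Rightarrow> real ^ 2\<close>. Tiles are indexed by \<open>i \<noteq> j\<close> rather than
  \<open>i < j\<close>, which gives the same sets because \<open>parallelogram x a b = parallelogram x b a\<close>.\<close>

definition pairwise_noncollinear :: "(4 \<Rightarrow> real ^ 2) \<Rightarrow> bool" where
  "pairwise_noncollinear v \<longleftrightarrow> (\<forall>i j. i \<noteq> j \<longrightarrow> \<not> collinear {0, v i, v j})"

definition tiles :: "(4 \<Rightarrow> real ^ 2) \<Rightarrow> (real ^ 2) set set" where
  "tiles v = {parallelogram x (v i) (v j) | x i j. i \<noteq> j}"

definition edge_to_edge :: "(real ^ 2) set set \<Rightarrow> bool" where
  "edge_to_edge \<T> \<longleftrightarrow> (\<forall>S\<in>\<T>. \<forall>T\<in>\<T>. S \<noteq> T \<longrightarrow>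
      S \<inter> T = {}
    \<or> (\<exists>p. p extreme_point_of S \<and> p extreme_point_of T \<and> S \<inter> T = {p})
    \<or> (S \<inter> T) edge_of S \<and> (S \<inter> T) edge_of T)"

definition octagonal_tiling :: "(4 \<Rightarrow> real ^ 2) \<Rightarrow> (real ^ 2) set set \<Rightarrow> bool" where
  "octagonal_tiling v \<T> \<longleftrightarrow> \<T> \<subseteq> tiles v \<and> \<Union>\<T> = UNIV \<and> edge_to_edge \<T>"

text \<open>A lift is given by its values on the vertices of the tiling; the values of \<open>h\<close> elsewhere are
  irrelevant. Since \<open>h\<close> is a function of the vertex, tiles sharing an edge parallel to \<open>v i\<close> are sent
  to faces sharing the corresponding edge parallel to \<open>axis i 1\<close>.\<close>

definition is_lift :: "(4 \<Rightarrow> real ^ 2) \<Rightarrow> (real ^ 2) set set \<Rightarrow> (real ^ 2 \<Rightarrow> real ^ 4) \<Rightarrow> bool" where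
  "is_lift v \<T> h \<longleftrightarrow> (\<forall>x i j. i \<noteq> j \<and> parallelogram x (v i) (v j) \<in> \<T> \<longrightarrow>
      (\<forall>k. h x $ k \<in> \<int>)
    \<and> h (x + v i) = h x + axis i 1
    \<and> h (x + v j) = h x + axis j 1
    \<and> h (x + v i + v j) = h x + axis i 1 + axis j 1)"

definition lift_surface ::
    "(4 \<Rightarrow> real ^ 2) \<Rightarrow> (real ^ 2) set set \<Rightarrow> (real ^ 2 \<Rightarrow> real ^ 4) \<Rightarrow> (real ^ 4) set" where
  "lift_surface v \<T> h =
     \<Union>{parallelogram (h x) (axis i 1) (axis j 1) | x i j.
        i \<noteq> j \<and> parallelogram x (v i) (v j) \<in> \<T>}"

definition planar_tiling ::
    "(4 \<Rightarrow> real ^ 2) \<Rightarrow> (real ^ 4) set \<Rightarrow> real \<Rightarrow> (real ^ 2) set set \<Rightarrow> bool" where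
  "planar_tiling v E t \<T> \<longleftrightarrow> octagonal_tiling v \<T> \<and>
     (\<exists>h. is_lift v \<T> h \<and>
        lift_surface v \<T> h \<subseteq> {x + y | x y. x \<in> E \<and> (\<forall>k. 0 \<le> y $ k \<and> y $ k \<le> t)})"

text \<open>Patterns are considered up to translation, so the set of \<open>r\<close>-maps is closed under translation
  by construction. The ball has diameter (not radius) \<open>r\<close>.\<close>

definition r_maps :: "real \<Rightarrow> (real ^ 2) set set \<Rightarrow> (real ^ 2) set set set" where
  "r_maps r \<T> = {(\<lambda>T. (+) w ` T) ` {T \<in> \<T>. T \<inter> cball c (r / 2) \<noteq> {}} | c w. True}"

definition weak_local_rules_of ::
    "(4 \<Rightarrow> real ^ 2) \<Rightarrow> (real ^ 4) set \<Rightarrow> real \<Rightarrow> real \<Rightarrow> bool" where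
  "weak_local_rules_of v E r t \<longleftrightarrow>
     (\<forall>\<T>. octagonal_tiling v \<T> \<and> (\<exists>\<T>'. planar_tiling v E 1 \<T>' \<and> r_maps r \<T> \<subseteq> r_maps r \<T>')
        \<longrightarrow> planar_tiling v E t \<T>)"

definition weak_local_rules :: "(4 \<Rightarrow> real ^ 2) \<Rightarrow> (real ^ 4) set \<Rightarrow> bool" where
  "weak_local_rules v E \<longleftrightarrow> (\<exists>r t. 0 \<le> r \<and> 1 \<le> t \<and> weak_local_rules_of v E r t)"

definition affine_plane :: "(real ^ 4) set \<Rightarrow> bool" where
  "affine_plane E \<longleftrightarrow> affine E \<and> aff_dim E = 2"

definition direction :: "(real ^ 4) set \<Rightarrow> (real ^ 4) set" where
  "direction E = {x - y | x y. x \<in> E \<and> y \<in> E}"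

definition grassmann :: "real ^ 4 \<Rightarrow> real ^ 4 \<Rightarrow> 4 \<Rightarrow> 4 \<Rightarrow> real" where
  "grassmann u w i j = u $ i * w $ j - u $ j * w $ i"

text \<open>For a plane, another choice of \<open>u\<close> and \<open>w\<close> multiplies all Grassmann coordinates by the same
  nonzero factor, so the existential could equally be a universal quantifier.\<close>

definition nondegenerate :: "(real ^ 4) set \<Rightarrow> bool" where
  "nondegenerate E \<longleftrightarrow>
     (\<exists>u w. direction E = span {u, w} \<and> (\<forall>i j. i \<noteq> j \<longrightarrow> grassmann u w i j \<noteq> 0))"

text \<open>Only real quadratic fields are needed: the entries below are real, and the real elements of an
  imaginary quadratic field are rational. Irrationality of \<open>sqrt d\<close> says that \<open>d\<close> is not a square.\<close>

definition real_quadratic_field :: "real set \<Rightarrow> bool" where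
  "real_quadratic_field K \<longleftrightarrow>
     (\<exists>d::nat. sqrt (real d) \<notin> \<rat> \<and> K = {a + b * sqrt (real d) | a b. a \<in> \<rat> \<and> b \<in> \<rat>})"

definition generated_over :: "real set \<Rightarrow> (real ^ 4) set \<Rightarrow> bool" where
  "generated_over K V \<longleftrightarrow> (\<exists>B. (\<forall>u\<in>B. \<forall>k. u $ k \<in> K) \<and> V = span B)"

end

theory Submission
  imports Defs
begin

text \<open>Write the plane as \<open>{x. cmb f x = \<theta>}\<close> for a linear map \<open>cmb f\<close> onto the window plane. A unit face lies in
  the tube around it iff \<open>cmb f\<close> sends its base point to a parallelogram, that is, iff the base point has
  prescribed signs with respect to the lines parallel to the \<open>f l\<close>. The brackets \<open>det2 (f i) (f j)\<close> are
  the Grassmann coordinates up to order, sign and a common factor. Weak local rules imply: if a system of faces stays near a plane close to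
  the given one and all its local patterns occur for the given plane, then both planes have the same
  direction. So a plane that is not quadratic has to be moved without creating new patterns.

  If the direction contains a nonzero integer vector, the tiling is periodic along it; repeating
  periodically a thick slab between two occurrences of the same large pattern gives a second integer
  direction, so that the plane is rational. Otherwise, the Grassmann coordinates are a point of the
  Pluecker quadric, and unless they generate a quadratic field, it can be moved by maps that are linear
  over the rationals and close to the identity. These preserve all coincidences among the lines whose
  types admit a period. The remaining types never have two lines in the same position, so the signs of
  their lines can be changed individually wherever the moved plane shows a new pattern.

  Following the ribbons of the given planar tiling shows that the orientations of the \<open>v i\<close> and the
  \<open>f i\<close> are compatible, which makes the projections of lifted faces tile the plane.\<close>

section \<open>Linear algebra of four vectors in the plane\<close>

text \<open>Two obstacles shape the argument. The projected lattice need not be dense in the window: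
  its closure may consist of equally spaced parallel lines, and then a window position can be moved
  only along them. This is why \<open>c\<close> and \<open>N\<close> accompany every deformation,
  and why types whose lines such moves cannot cross are treated apart. Also, a plane near the given
  one may really show a new pattern: lines that are concurrent for the given plane can separate into
  an arrangement that no shift of it produces. Infinitely many lines of a periodic type share one
  position, so a change of sign there could not be kept local; hence their coincidences have to
  survive exactly. A change for an aperiodic type concerns a bounded cluster, and clusters do not
  interact. The edited signs are no longer those of a plane; that they give a tiling at all is
  derived from local agreement with planes. The assumption that a planar tiling exists supplies the
  compatible orientations; without one, weak local rules hold vacuously.\<close>

definition det2 :: "real ^ 2 \<Rightarrow> real ^ 2 \<Rightarrow> real" where
  "det2 a b = a $ 1 * b $ 2 - a $ 2 * b $ 1"

definition cmb :: "(4 \<Rightarrow> real ^ 2) \<Rightarrow> real ^ 4 \<Rightarrow> real ^ 2" where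
  "cmb f x = (\<Sum>i\<in>UNIV. x $ i *\<^sub>R f i)"

definition rv :: "int ^ 4 \<Rightarrow> real ^ 4" where
  "rv H = (\<chi> i. of_int (H $ i))"

lemma det2_add_left: "det2 (a + b) c = det2 a c + det2 b c"
  and det2_add_right: "det2 a (b + c) = det2 a b + det2 a c"
  and det2_diff_left: "det2 (a - b) c = det2 a c - det2 b c"
  and det2_diff_right: "det2 a (b - c) = det2 a b - det2 a c"
  and det2_scale_left: "det2 (r *\<^sub>R a) b = r * det2 a b"
  and det2_scale_right: "det2 a (r *\<^sub>R b) = r * det2 a b"
  and det2_minus_left: "det2 (- a) b = - det2 a b"
  and det2_minus_right: "det2 a (- b) = - det2 a b"
  and det2_self [simp]: "det2 a a = 0"
  and det2_zero_left [simp]: "det2 0 a = 0"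
  and det2_zero_right [simp]: "det2 a 0 = 0"
  by (simp_all add: det2_def algebra_simps)

lemmas det2_linear = det2_add_left det2_add_right det2_diff_left det2_diff_right
  det2_scale_left det2_scale_right det2_minus_left det2_minus_right

lemma det2_commute: "det2 a b = - det2 b a"
  by (simp add: det2_def)

lemma det2_sum_right: "det2 a (\<Sum>i\<in>A. g i) = (\<Sum>i\<in>A. det2 a (g i))"
  by (induction A rule: infinite_finite_induct) (auto simp: det2_linear)

lemma det2_cmb: "det2 a (cmb f x) = (\<Sum>i\<in>UNIV. x $ i * det2 a (f i))"
  by (simp add: cmb_def det2_sum_right det2_linear)

lemma det2_cramer:
  assumes "det2 a b \<noteq> 0"
  shows "w = (det2 b w / det2 b a) *\<^sub>R a + (det2 a w / det2 a b) *\<^sub>R b"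
proof -
  have "det2 a b *\<^sub>R w = (- det2 b w) *\<^sub>R a + det2 a w *\<^sub>R b"
    by (simp add: vec_eq_iff forall_2 det2_def algebra_simps)
  then have "(1 / det2 a b) *\<^sub>R (det2 a b *\<^sub>R w) = (1 / det2 a b) *\<^sub>R ((- det2 b w) *\<^sub>R a + det2 a w *\<^sub>R b)"
    by (rule arg_cong)
  then have "w = (1 / det2 a b) *\<^sub>R ((- det2 b w) *\<^sub>R a + det2 a w *\<^sub>R b)"
    using assms by simp
  then show ?thesis
    using det2_commute[of b a] by (simp add: algebra_simps)
qed

lemma det2_eq_0_iff_parallel:
  assumes "a \<noteq> 0"
  shows "det2 a b = 0 \<longleftrightarrow> (\<exists>t. b = t *\<^sub>R a)"
proof
  assume d: "det2 a b = 0"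
  show "\<exists>t. b = t *\<^sub>R a"
  proof (cases "a $ 1 = 0")
    case True
    then have "a $ 2 \<noteq> 0" using assms by (simp add: vec_eq_iff forall_2)
    then have "b = (b $ 2 / a $ 2) *\<^sub>R a"
      using d True by (simp add: vec_eq_iff forall_2 det2_def)
    then show ?thesis by blast
  next
    case False
    then have "b = (b $ 1 / a $ 1) *\<^sub>R a"
      using d by (simp add: vec_eq_iff forall_2 det2_def field_simps)
    then show ?thesis by blast
  qed
qed (auto simp: det2_linear)

lemma det2_both_zero:
  assumes "det2 a b \<noteq> 0" "det2 a w = 0" "det2 b w = 0"
  shows "w = 0"
  using det2_cramer[OF assms(1), of w] assms(2,3) by simp

lemma abs_det2_le: "\<bar>det2 a b\<bar> \<le> norm a * norm b"
proof -
  define a' :: "real ^ 2" where "a' = vector [- (a $ 2), a $ 1]"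
  have "det2 a b = a' \<bullet> b"
    by (simp add: a'_def det2_def inner_vec_def sum_2 vector_2)
  moreover have "norm a' = norm a"
    by (simp add: a'_def norm_vec_def L2_set_def sum_2 vector_2 add.commute)
  ultimately show ?thesis
    using Cauchy_Schwarz_ineq2[of a' b] by simp
qed

lemma det2_tendsto [tendsto_intros]:
  assumes "(f \<longlongrightarrow> a) F" "(g \<longlongrightarrow> b) F"
  shows "((\<lambda>x. det2 (f x) (g x)) \<longlongrightarrow> det2 a b) F"
  unfolding det2_def by (intro tendsto_intros assms)

lemma linear_cmb: "linear (cmb f)"
  by (intro linearI) (simp_all add: cmb_def algebra_simps sum.distrib scaleR_sum_right)

lemmas cmb_add = linear_add[OF linear_cmb]
  and cmb_diff = linear_diff[OF linear_cmb]
  and cmb_scale = linear_scale[OF linear_cmb]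

lemma cmb_axis [simp]: "cmb f (axis i c) = c *\<^sub>R f i"
  by (simp add: cmb_def axis_def if_distrib[of "\<lambda>r. r *\<^sub>R _"] cong: if_cong)

lemma cmb_tendsto [tendsto_intros]:
  assumes "\<And>i. ((\<lambda>k. f k i) \<longlongrightarrow> g i) F" "(x \<longlongrightarrow> y) F"
  shows "((\<lambda>k. cmb (f k) (x k)) \<longlongrightarrow> cmb g y) F"
  unfolding cmb_def by (intro tendsto_intros assms)

lemma cmb_fun_diff: "cmb f x - cmb g x = cmb (\<lambda>i. f i - g i) x"
  by (simp add: cmb_def sum_subtractf algebra_simps)

lemma norm_cmb_le: "norm (cmb f x) \<le> (\<Sum>i\<in>UNIV. norm (f i)) * norm x"
proof -
  have "norm (cmb f x) \<le> (\<Sum>i\<in>UNIV. norm (x $ i *\<^sub>R f i))"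
    unfolding cmb_def by (rule norm_sum)
  also have "\<dots> \<le> (\<Sum>i\<in>UNIV. norm (f i) * norm x)"
    by (intro sum_mono) (simp add: mult.commute[of "norm (f _)"] mult_right_mono component_le_norm_cart)
  finally show ?thesis by (simp add: sum_distrib_right)
qed

lemma rv_nth [simp]: "rv H $ i = of_int (H $ i)"
  by (simp add: rv_def)

lemma rv_add: "rv (a + b) = rv a + rv b"
  and rv_diff: "rv (a - b) = rv a - rv b"
  and rv_0 [simp]: "rv 0 = 0"
  and rv_axis [simp]: "rv (axis i c) = axis i (of_int c)"
  by (simp_all add: vec_eq_iff axis_def)

lemma rv_scale: "rv (j *s a) = of_int j *\<^sub>R rv a"
  by (simp add: vec_eq_iff vector_scalar_mult_def)

lemma rv_eq_iff [simp]: "rv a = rv b \<longleftrightarrow> a = b"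
  by (simp add: vec_eq_iff)

lemma four_complement:
  fixes i j :: 4
  assumes "i \<noteq> j"
  obtains k l where "distinct [i, j, k, l]"
proof -
  have "\<exists>x. x \<notin> A" if "card A < 4" for A :: "4 set"
    using that UNIV_eq_I[of A] by fastforce
  from this[of "{i, j}"] obtain k where k: "k \<notin> {i, j}"
    using assms by auto
  have "card {i, j, k} < 4" using card_insert_le_m1[of 3 "{j, k}" i] by (simp add: card_insert_if)
  then obtain l where "l \<notin> {i, j, k}"
    using \<open>\<And>A. card A < 4 \<Longrightarrow> \<exists>x. x \<notin> A\<close> by blast
  with k assms have "distinct [i, j, k, l]" by auto
  then show ?thesis using that by blast
qed

lemma UNIV_distinct4:
  fixes i :: 4
  assumes "distinct [i, j, k, l]"
  shows "UNIV = {i, j, k, l}"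
proof -
  have "card {i, j, k, l} = CARD(4)" using assms by simp
  then show ?thesis
    by (metis card_subset_eq finite subset_UNIV)
qed

lemma sum_distinct4:
  fixes i :: 4
  assumes "distinct [i, j, k, l]"
  shows "(\<Sum>m\<in>UNIV. g m) = g i + g j + g k + (g l :: 'a :: comm_monoid_add)"
  using assms by (simp add: UNIV_distinct4[OF assms] add.assoc)

lemma all_distinct4:
  fixes i :: 4
  assumes "distinct [i, j, k, l]"
  shows "(\<forall>m. P m) \<longleftrightarrow> P i \<and> P j \<and> P k \<and> P l"
proof -
  have "(\<forall>m. P m) \<longleftrightarrow> (\<forall>m\<in>UNIV. P m)" by simp
  then show ?thesis unfolding UNIV_distinct4[OF assms] by simp
qed

lemma cmb_distinct4:
  assumes "distinct [i, j, k, l]"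
  shows "cmb f x = x $ i *\<^sub>R f i + x $ j *\<^sub>R f j + x $ k *\<^sub>R f k + x $ l *\<^sub>R f l"
  unfolding cmb_def by (rule sum_distinct4[OF assms])

lemma finite_int_box: "finite {m :: int ^ 4. \<forall>i. \<bar>m $ i\<bar> \<le> R}"
proof -
  have "{m :: int ^ 4. \<forall>i. \<bar>m $ i\<bar> \<le> R} \<subseteq> vec_lambda ` {g. \<forall>i. g i \<in> {-R..R}}"
  proof
    fix m :: "int ^ 4" assume "m \<in> {m. \<forall>i. \<bar>m $ i\<bar> \<le> R}"
    then have "vec_nth m \<in> {g. \<forall>i. g i \<in> {-R..R}}" by (auto simp: abs_le_iff minus_le_iff)
    then show "m \<in> vec_lambda ` {g. \<forall>i. g i \<in> {-R..R}}"
      by (intro image_eqI[of _ _ "vec_nth m"]) (simp_all add: vec_nth_inverse)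
  qed
  moreover have "finite {g :: 4 \<Rightarrow> int. \<forall>i. g i \<in> {-R..R}}"
    using finite_set_of_finite_funs[of "UNIV :: 4 set" "{-R..R}" 0] by simp
  ultimately show ?thesis by (meson finite_imageI finite_subset)
qed

lemma finite_rv_bounded: "finite {m. norm (rv m) \<le> R}"
proof (rule finite_subset[OF _ finite_int_box[of "\<lceil>R\<rceil>"]])
  show "{m. norm (rv m) \<le> R} \<subseteq> {m. \<forall>i. \<bar>m $ i\<bar> \<le> \<lceil>R\<rceil>}"
  proof safe
    fix m i assume "norm (rv m) \<le> R"
    then have "\<bar>rv m $ i\<bar> \<le> R" using component_le_norm_cart order_trans by blast
    then show "\<bar>m $ i\<bar> \<le> \<lceil>R\<rceil>" by (simp add: le_ceiling_iff)
  qed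
qed

section \<open>Faces of parallelograms\<close>

lemma mem_parallelogram_iff:
  assumes "det2 a b \<noteq> 0"
  shows "y \<in> parallelogram x a b \<longleftrightarrow>
    0 \<le> det2 a (y - x) / det2 a b \<and> det2 a (y - x) / det2 a b \<le> 1 \<and>
    0 \<le> det2 b (y - x) / det2 b a \<and> det2 b (y - x) / det2 b a \<le> 1"
    (is "_ \<longleftrightarrow> ?r")
proof
  assume "y \<in> parallelogram x a b"
  then obtain l m where y: "y = x + l *\<^sub>R a + m *\<^sub>R b" and lm: "0 \<le> l" "l \<le> 1" "0 \<le> m" "m \<le> 1"
    unfolding parallelogram_def by blast
  have "det2 b a \<noteq> 0" using assms det2_commute[of b a] by simp
  with y have "det2 a (y - x) / det2 a b = m" "det2 b (y - x) / det2 b a = l"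
    using assms by (simp_all add: det2_linear)
  with lm show ?r by simp
next
  assume ?r
  moreover have "y = x + (det2 b (y - x) / det2 b a) *\<^sub>R a + (det2 a (y - x) / det2 a b) *\<^sub>R b"
    using det2_cramer[OF assms, of "y - x"] by (simp add: algebra_simps)
  ultimately show "y \<in> parallelogram x a b"
    unfolding parallelogram_def by blast
qed

lemma parallelogram_commute: "parallelogram x a b = parallelogram x b a"
proof -
  have "parallelogram x a b \<subseteq> parallelogram x b a" for a b
    unfolding parallelogram_def by (force simp: add.assoc add.commute add.left_commute)
  then show ?thesis by blast
qed

lemma parallelogram_translate: "(+) w ` parallelogram x a b = parallelogram (w + x) a b"
  unfolding parallelogram_def by (force simp: add.assoc image_iff)

lemma parallelogram_flip: "parallelogram x a (- b) = parallelogram (x - b) a b"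
proof -
  have "parallelogram x a (- b) \<subseteq> parallelogram (x - b) a b" for x b
  proof
    fix y assume "y \<in> parallelogram x a (- b)"
    then obtain l m where "y = x + l *\<^sub>R a + m *\<^sub>R (- b)" "0 \<le> l" "l \<le> 1" "0 \<le> m" "m \<le> 1"
      unfolding parallelogram_def by blast
    then have "y = x - b + l *\<^sub>R a + (1 - m) *\<^sub>R b" "0 \<le> 1 - m" "1 - m \<le> 1"
      by (simp_all add: algebra_simps)
    then show "y \<in> parallelogram (x - b) a b"
      using \<open>0 \<le> l\<close> \<open>l \<le> 1\<close> unfolding parallelogram_def by blast
  qed
  from this[of x b] this[of "x - b" "- b"] show ?thesis by simp
qed

lemma parallelogram_bounded: "y \<in> parallelogram x a b \<Longrightarrow> dist x y \<le> norm a + norm b"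
proof -
  assume "y \<in> parallelogram x a b"
  then obtain l m where y: "y = x + l *\<^sub>R a + m *\<^sub>R b" and lm: "0 \<le> l" "l \<le> 1" "0 \<le> m" "m \<le> 1"
    unfolding parallelogram_def by blast
  have "y - x = l *\<^sub>R a + m *\<^sub>R b" by (simp add: y)
  then have "dist x y = norm (l *\<^sub>R a + m *\<^sub>R b)"
    by (metis dist_commute dist_norm)
  also have "\<dots> \<le> norm (l *\<^sub>R a) + norm (m *\<^sub>R b)" by (rule norm_triangle_ineq)
  also have "\<dots> \<le> norm a + norm b"
    using lm by (intro add_mono) (simp_all add: mult_left_le_one_le)
  finally show ?thesis .
qed

lemma det2_inner: "det2 a y = vector [- (a $ 2), a $ 1] \<bullet> y"
  by (simp add: det2_def inner_vec_def sum_2 vector_2)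

lemma
  assumes "det2 a b \<noteq> 0"
  shows convex_parallelogram: "convex (parallelogram x a b)"
    and closed_parallelogram: "closed (parallelogram x a b)"
proof -
  have "parallelogram x a b = (\<lambda>p. x + p) ` ((\<lambda>p. fst p *\<^sub>R a + snd p *\<^sub>R b) ` ({0..1} \<times> {0..1}))"
    unfolding parallelogram_def by (force simp: image_iff add.assoc)
  moreover have lin: "linear (\<lambda>p :: real \<times> real. fst p *\<^sub>R a + snd p *\<^sub>R b)"
    by (intro linearI) (simp_all add: algebra_simps)
  ultimately show "convex (parallelogram x a b)" "closed (parallelogram x a b)"
    by (auto intro!: convex_translation convex_linear_image[OF lin] convex_Times closed_translation
        compact_imp_closed compact_continuous_image compact_Times continuous_intros)
qed

lemma side_face_of_parallelogram:
  assumes d: "det2 a b \<noteq> 0" and \<mu>: "\<mu> = 0 \<or> \<mu> = (1 :: real)"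
  shows "closed_segment (x + \<mu> *\<^sub>R b) (x + \<mu> *\<^sub>R b + a) face_of parallelogram x a b"
proof -
  let ?S = "parallelogram x a b"
  define p where "p = (1 / det2 a b) *\<^sub>R (vector [- (a $ 2), a $ 1] :: real ^ 2)"
  have p: "p \<bullet> y = det2 a y / det2 a b" for y
    by (simp add: p_def det2_inner[symmetric])
  have p_in: "p \<bullet> x \<le> p \<bullet> y \<and> p \<bullet> y \<le> p \<bullet> x + 1" if "y \<in> ?S" for y
    using that unfolding mem_parallelogram_iff[OF d]
    by (simp add: p det2_linear diff_divide_distrib)
  have "?S \<inter> {y. p \<bullet> y = p \<bullet> x + \<mu>} face_of ?S"
    using \<mu>
  proof
    assume "\<mu> = 0"
    then show ?thesis
      using p_in by (intro face_of_Int_supporting_hyperplane_ge convex_parallelogram[OF d]) auto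
  next
    assume "\<mu> = 1"
    then show ?thesis
      using p_in by (intro face_of_Int_supporting_hyperplane_le convex_parallelogram[OF d]) auto
  qed
  moreover have "?S \<inter> {y. p \<bullet> y = p \<bullet> x + \<mu>} = closed_segment (x + \<mu> *\<^sub>R b) (x + \<mu> *\<^sub>R b + a)"
  proof safe
    fix y assume y: "y \<in> ?S" and e: "p \<bullet> y = p \<bullet> x + \<mu>"
    obtain l m where yy: "y = x + l *\<^sub>R a + m *\<^sub>R b" and lm: "0 \<le> l" "l \<le> 1"
      using y unfolding parallelogram_def by blast
    have "p \<bullet> y = p \<bullet> x + m" using d unfolding yy by (simp add: inner_add_right p det2_linear)
    with e have "m = \<mu>" by simp
    with yy have "y = (1 - l) *\<^sub>R (x + \<mu> *\<^sub>R b) + l *\<^sub>R (x + \<mu> *\<^sub>R b + a)" by (simp add: algebra_simps)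
    with lm show "y \<in> closed_segment (x + \<mu> *\<^sub>R b) (x + \<mu> *\<^sub>R b + a)"
      unfolding closed_segment_def by blast
  next
    fix y assume "y \<in> closed_segment (x + \<mu> *\<^sub>R b) (x + \<mu> *\<^sub>R b + a)"
    then obtain l where l: "0 \<le> l" "l \<le> 1"
      and y: "y = (1 - l) *\<^sub>R (x + \<mu> *\<^sub>R b) + l *\<^sub>R (x + \<mu> *\<^sub>R b + a)"
      unfolding closed_segment_def by blast
    have y': "y = x + l *\<^sub>R a + \<mu> *\<^sub>R b" unfolding y by (simp add: algebra_simps)
    show "y \<in> ?S" using l \<mu> unfolding y' parallelogram_def
      by (intro CollectI exI[of _ l] exI[of _ \<mu>]) auto
    show "p \<bullet> y = p \<bullet> x + \<mu>" using d unfolding y' by (simp add: inner_add_right p det2_linear)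
  qed
  ultimately show ?thesis by simp
qed

lemma side_edge_of_parallelogram:
  assumes d: "det2 a b \<noteq> 0" and \<mu>: "\<mu> = 0 \<or> \<mu> = (1 :: real)"
  shows "closed_segment (x + \<mu> *\<^sub>R b) (x + \<mu> *\<^sub>R b + a) edge_of parallelogram x a b"
proof -
  have "a \<noteq> 0" using d by auto
  then show ?thesis
    using side_face_of_parallelogram[OF assms]
    by (simp add: edge_of_def segment_convex_hull aff_dim_convex_hull aff_dim_2)
qed

lemma corner_of_parallelogram:
  assumes d: "det2 a b \<noteq> 0" and \<mu>: "\<mu> = 0 \<or> \<mu> = (1 :: real)" and \<nu>: "\<nu> = 0 \<or> \<nu> = (1 :: real)"
  shows "(x + \<nu> *\<^sub>R a + \<mu> *\<^sub>R b) extreme_point_of parallelogram x a b"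
proof -
  have "a \<noteq> 0" using d by auto
  have "(x + \<nu> *\<^sub>R a + \<mu> *\<^sub>R b) extreme_point_of closed_segment (x + \<mu> *\<^sub>R b) (x + \<mu> *\<^sub>R b + a)"
    using \<nu> by (auto simp: extreme_point_of_segment algebra_simps)
  then show ?thesis
    using side_face_of_parallelogram[OF d \<mu>, of x] face_of_trans
    unfolding face_of_singleton[symmetric] by blast
qed

lemma aff_dim_parallelogram:
  assumes d: "det2 a b \<noteq> 0"
  shows "aff_dim (parallelogram x a b) = 2"
proof -
  define g where "g = (\<lambda>y :: real ^ 2. x + y $ 1 *\<^sub>R a + y $ 2 *\<^sub>R b)"
  have "(x + a) \<notin> {x}" using d by auto
  have "x + b \<notin> affine hull {x, x + a}"
  proof
    assume "x + b \<in> affine hull {x, x + a}"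
    then obtain u w where "x + b = u *\<^sub>R x + w *\<^sub>R (x + a)" "u + w = 1"
      unfolding affine_hull_2 by blast
    moreover from this have "u = 1 - w" by simp
    ultimately have "b = w *\<^sub>R a" by (simp add: algebra_simps)
    then show False using d by (simp add: det2_linear)
  qed
  then have "aff_dim {x + b, x, x + a} = 2"
    using \<open>(x + a) \<notin> {x}\<close> by (simp add: aff_dim_insert[of "x + b"] aff_dim_2)
  moreover have "{x + b, x, x + a} \<subseteq> parallelogram x a b"
    using d det2_commute[of b a] by (auto simp: mem_parallelogram_iff)
  ultimately have "2 \<le> aff_dim (parallelogram x a b)" by (metis aff_dim_subset)
  moreover have "aff_dim (parallelogram x a b) \<le> 2"
    using aff_dim_le_DIM[of "parallelogram x a b"] by simp
  ultimately show ?thesis by simp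
qed

text \<open>The segment from any point \<open>y\<close> to the interior point can be prolonged a
  little inside the parallelogram, up to \<open>w\<close>. The interior point then lies strictly
  between \<open>y\<close> and \<open>w\<close>, and a face through it must contain
  \<open>y\<close>.\<close>

lemma face_through_interior:
  assumes d: "det2 a b \<noteq> 0" and F: "F face_of parallelogram x a b"
    and z: "x + l *\<^sub>R a + m *\<^sub>R b \<in> F" and lm: "0 < l" "l < 1" "0 < m" "m < 1"
  shows "F = parallelogram x a b"
proof
  show "F \<subseteq> parallelogram x a b" using F by (rule face_of_imp_subset)
  show "parallelogram x a b \<subseteq> F"
  proof
    fix y assume y: "y \<in> parallelogram x a b"
    let ?z = "x + l *\<^sub>R a + m *\<^sub>R b"
    obtain p q where yy: "y = x + p *\<^sub>R a + q *\<^sub>R b" and pq: "0 \<le> p" "p \<le> 1" "0 \<le> q" "q \<le> 1"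
      using y unfolding parallelogram_def by blast
    \<comment> \<open>Distance of the coefficients from the boundary: prolonging by the factor
      \<open>t\<close> changes each of them by at most \<open>t\<close>.\<close>
    define t where "t = Min {l, 1 - l, m, 1 - m}"
    have t: "0 < t" "t \<le> l" "t \<le> 1 - l" "t \<le> m" "t \<le> 1 - m"
      using lm by (simp_all add: t_def)
    define w where "w = ?z + t *\<^sub>R (?z - y)"
    have w: "w = x + (l + t * (l - p)) *\<^sub>R a + (m + t * (m - q)) *\<^sub>R b"
      unfolding w_def yy by (simp add: algebra_simps)
    have *: "0 \<le> l + t * (l - p)" "l + t * (l - p) \<le> 1" if "0 < l" "l < 1" "0 \<le> p" "p \<le> 1" "t \<le> l" "t \<le> 1 - l"
      for l p :: real
    proof -
      have "t * (l - p) \<ge> t * (- 1)" "t * (l - p) \<le> t * 1"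
        using that t(1) by (intro mult_left_mono; simp)+
      then show "0 \<le> l + t * (l - p)" "l + t * (l - p) \<le> 1" using that by linarith+
    qed
    have "w \<in> parallelogram x a b"
      unfolding w parallelogram_def using * lm pq t by blast
    show "y \<in> F"
    proof (cases "y = ?z")
      case True then show ?thesis using z by simp
    next
      case False
      have "?z = (1 - t / (1 + t)) *\<^sub>R w + (t / (1 + t)) *\<^sub>R y"
      proof -
        have "(1 + t) *\<^sub>R ?z = w + t *\<^sub>R y" by (simp add: w_def algebra_simps)
        then have "(1 / (1 + t)) *\<^sub>R ((1 + t) *\<^sub>R ?z) = (1 / (1 + t)) *\<^sub>R (w + t *\<^sub>R y)" by simp
        moreover have "1 - t / (1 + t) = 1 / (1 + t)" using t(1) by (simp add: field_simps)
        ultimately show ?thesis using t(1) by (simp add: scaleR_add_right)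
      qed
      moreover have "w \<noteq> y"
      proof
        assume "w = y"
        then have "(1 + t) *\<^sub>R (?z - y) = 0" unfolding w_def by (simp add: algebra_simps)
        then show False using t(1) False by simp
      qed
      ultimately have "?z \<in> open_segment w y"
        unfolding in_segment using t(1) by (intro conjI exI[of _ "t / (1 + t)"]) auto
      then show ?thesis
        using F y \<open>w \<in> parallelogram x a b\<close> z unfolding face_of_def by blast
    qed
  qed
qed

section \<open>Projected unit faces of the integer lattice\<close>

definition meet_nicely :: "(real ^ 2) set \<Rightarrow> (real ^ 2) set \<Rightarrow> bool" where
  "meet_nicely S T \<longleftrightarrow> S \<inter> T = {}
    \<or> (\<exists>p. p extreme_point_of S \<and> p extreme_point_of T \<and> S \<inter> T = {p})
    \<or> (S \<inter> T) edge_of S \<and> (S \<inter> T) edge_of T"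

text \<open>Described coordinatewise, so that intersections and common vertices of two faces can be
  computed one coordinate at a time.\<close>

definition face :: "int ^ 4 \<Rightarrow> 4 \<Rightarrow> 4 \<Rightarrow> (real ^ 4) set" where
  "face H i j = {P. \<forall>m. if m = i \<or> m = j then of_int (H $ m) \<le> P $ m \<and> P $ m \<le> of_int (H $ m) + 1
     else P $ m = of_int (H $ m)}"

lemma parallelogram_conv_face:
  assumes "i \<noteq> j"
  shows "parallelogram (cmb v (rv H)) (v i) (v j) = cmb v ` face H i j"
proof safe
  fix y assume "y \<in> parallelogram (cmb v (rv H)) (v i) (v j)"
  then obtain l m where "y = cmb v (rv H) + l *\<^sub>R v i + m *\<^sub>R v j" and lm: "0 \<le> l" "l \<le> 1" "0 \<le> m" "m \<le> 1"
    unfolding parallelogram_def by blast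
  then have "y = cmb v (rv H + axis i l + axis j m)" by (simp add: cmb_add)
  moreover have "rv H + axis i l + axis j m \<in> face H i j"
    using lm assms by (auto simp: face_def axis_def)
  ultimately show "y \<in> cmb v ` face H i j" by blast
next
  fix P assume P: "P \<in> face H i j"
  let ?l = "P $ i - of_int (H $ i)" and ?m = "P $ j - of_int (H $ j)"
  have Pn: "if n = i \<or> n = j then of_int (H $ n) \<le> P $ n \<and> P $ n \<le> of_int (H $ n) + 1
     else P $ n = of_int (H $ n)" for n
    using P unfolding face_def by blast
  have "P $ n = (rv H + axis i ?l + axis j ?m) $ n" for n
    using Pn[of n] assms by (cases "n = i"; cases "n = j") (simp_all add: axis_def)
  then have "P = rv H + axis i ?l + axis j ?m" unfolding vec_eq_iff by blast
  then have "cmb v P = cmb v (rv H) + ?l *\<^sub>R v i + ?m *\<^sub>R v j"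
    by (metis cmb_add cmb_axis)
  moreover have "0 \<le> ?l" "?l \<le> 1" "0 \<le> ?m" "?m \<le> 1"
    using Pn[of i] Pn[of j] by simp_all
  ultimately show "cmb v P \<in> parallelogram (cmb v (rv H)) (v i) (v j)"
    unfolding parallelogram_def by blast
qed

lemma rv_mem_face_iff:
  "rv Q \<in> face H i j \<longleftrightarrow>
    (\<forall>m. if m = i \<or> m = j then Q $ m = H $ m \<or> Q $ m = H $ m + 1 else Q $ m = H $ m)"
proof -
  have "of_int a \<le> (of_int b :: real) \<and> of_int b \<le> (of_int a + 1 :: real) \<longleftrightarrow> b = a \<or> b = a + 1" for a b :: int
    by linarith
  then show ?thesis unfolding face_def by simp
qed

lemma face_Int_coord:
  fixes x :: real and a b :: int
  assumes "of_int a \<le> x" "x \<le> of_int a + 1" "of_int b \<le> x" "x \<le> of_int b + 1" "a \<noteq> b"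
  shows "x = of_int (max a b)"
proof -
  have "a < b + 2" "b < a + 2" using assms by linarith+
  with assms show ?thesis by (cases "a < b") auto
qed

lemma corner_of_face:
  assumes "i \<noteq> j" "det2 (v i) (v j) \<noteq> 0" "rv Q \<in> face H i j"
  shows "cmb v (rv Q) extreme_point_of (cmb v ` face H i j)"
proof -
  have Q: "\<And>m. if m = i \<or> m = j then Q $ m = H $ m \<or> Q $ m = H $ m + 1 else Q $ m = H $ m"
    using assms(3) unfolding rv_mem_face_iff by simp
  have *: "real_of_int (Q $ i - H $ i) = 0 \<or> real_of_int (Q $ i - H $ i) = 1"
    "real_of_int (Q $ j - H $ j) = 0 \<or> real_of_int (Q $ j - H $ j) = 1"
    using Q[of i] Q[of j] by auto
  have "rv Q $ m = (rv H + axis i (real_of_int (Q $ i - H $ i)) + axis j (real_of_int (Q $ j - H $ j))) $ m" for m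
    using Q[of m] assms(1) by (auto simp: axis_def split: if_splits)
  then have "rv Q = rv H + axis i (real_of_int (Q $ i - H $ i)) + axis j (real_of_int (Q $ j - H $ j))"
    unfolding vec_eq_iff by blast
  then have "cmb v (rv Q) = cmb v (rv H) + real_of_int (Q $ i - H $ i) *\<^sub>R v i
      + real_of_int (Q $ j - H $ j) *\<^sub>R v j"
    by (metis cmb_add cmb_axis)
  then show ?thesis
    using corner_of_parallelogram[OF assms(2) *(2) *(1), of "cmb v (rv H)"]
    by (simp add: parallelogram_conv_face[OF assms(1)])
qed

lemma side_of_face:
  assumes "i \<noteq> j" "det2 (v i) (v j) \<noteq> 0" "p = i \<or> p = j"
    and Q: "rv Q \<in> face H i j" "Q $ p = H $ p"
  shows "closed_segment (cmb v (rv Q)) (cmb v (rv Q) + v p) edge_of (cmb v ` face H i j)"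
proof -
  define q where "q = (if p = i then j else i)"
  have pq: "p \<noteq> q" "{p, q} = {i, j}" using assms(1,3) by (auto simp: q_def)
  have d: "det2 (v p) (v q) \<noteq> 0"
    using assms(2,3) det2_commute[of "v j" "v i"] by (auto simp: q_def)
  have f: "face H i j = face H p q"
    using pq(2) unfolding face_def doubleton_eq_iff by auto
  have Qm: "if m = q then Q $ m = H $ m \<or> Q $ m = H $ m + 1 else Q $ m = H $ m" for m
    using Q[unfolded f rv_mem_face_iff] by (cases "m = p") auto
  have *: "real_of_int (Q $ q - H $ q) = 0 \<or> real_of_int (Q $ q - H $ q) = 1"
    using Qm[of q] by auto
  have "rv Q $ m = (rv H + axis q (real_of_int (Q $ q - H $ q))) $ m" for m
    using Qm[of m] by (auto simp: axis_def split: if_splits)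
  then have "rv Q = rv H + axis q (real_of_int (Q $ q - H $ q))"
    unfolding vec_eq_iff by blast
  then have "cmb v (rv Q) = cmb v (rv H) + real_of_int (Q $ q - H $ q) *\<^sub>R v q"
    by (metis cmb_add cmb_axis)
  then show ?thesis
    using side_edge_of_parallelogram[OF d *, of "cmb v (rv H)"]
    by (simp add: parallelogram_conv_face[OF pq(1)] f)
qed

text \<open>Injectivity turns the intersection of two tiles into the image of an intersection of two
  lattice faces. That intersection is again a lattice cell, of dimension 0, 1 or 2: a corner, a side
  or the whole face.\<close>

lemma meet_nicely_faces:
  assumes ij: "i \<noteq> j" "i' \<noteq> j'" and v: "\<And>i j. i \<noteq> j \<Longrightarrow> det2 (v i) (v j) \<noteq> 0"
    and inj: "\<And>P P'. P \<in> face H i j \<Longrightarrow> P' \<in> face H' i' j' \<Longrightarrow> cmb v P = cmb v P' \<Longrightarrow> P = P'"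
    and ne: "cmb v ` face H i j \<noteq> cmb v ` face H' i' j'"
  shows "meet_nicely (cmb v ` face H i j) (cmb v ` face H' i' j')"
proof -
  let ?A = "face H i j" and ?B = "face H' i' j'"
  have I: "cmb v ` ?A \<inter> cmb v ` ?B = cmb v ` (?A \<inter> ?B)"
    using inj by blast
  show ?thesis
  proof (cases "?A \<inter> ?B = {}")
    case True
    then show ?thesis using I by (simp add: meet_nicely_def)
  next
    case False
    then obtain P0 where P0: "P0 \<in> ?A" "P0 \<in> ?B" by blast
    \<comment> \<open>The directions in which the intersection is a full unit interval. In any other
      coordinate one of the faces is constant, or two adjacent intervals touch in one
      integer.\<close>
    define J where "J = {m. (m = i \<or> m = j) \<and> (m = i' \<or> m = j') \<and> H $ m = H' $ m}"
    define Q :: "int ^ 4" where "Q = (\<chi> m. if m \<in> J then H $ m else \<lfloor>P0 $ m\<rfloor>)"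
    have QJ: "Q $ m = H $ m" "Q $ m = H' $ m" if "m \<in> J" for m
      using that by (simp_all add: Q_def J_def)
    have eqQ: "P $ m = real_of_int (Q $ m)" if P: "P \<in> ?A" "P \<in> ?B" and m: "m \<notin> J" for P m
    proof -
      have 1: "P $ m = P0 $ m \<and> P0 $ m \<in> \<int>"
      proof (cases "(m = i \<or> m = j) \<and> (m = i' \<or> m = j')")
        case True
        then have "H $ m \<noteq> H' $ m" using m by (simp add: J_def)
        then have "P $ m = of_int (max (H $ m) (H' $ m))" "P0 $ m = of_int (max (H $ m) (H' $ m))"
          using True P P0 unfolding face_def
          by (auto intro!: face_Int_coord dest!: spec[of _ m])
        then show ?thesis by (metis Ints_of_int)
      next
        case False
        then show ?thesis using P P0 unfolding face_def by (auto dest!: spec[of _ m])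
      qed
      then show ?thesis using m by (auto simp: Q_def of_int_floor)
    qed
    have Qin: "rv Q \<in> ?A" "rv Q \<in> ?B"
    proof -
      have "if m = i \<or> m = j then of_int (H $ m) \<le> rv Q $ m \<and> rv Q $ m \<le> of_int (H $ m) + 1
         else rv Q $ m = of_int (H $ m)" for m
        using P0 eqQ[OF P0, of m] QJ[of m] unfolding face_def by (cases "m \<in> J") (auto dest!: spec[of _ m] simp: J_def)
      then show "rv Q \<in> ?A" unfolding face_def by blast
      have "if m = i' \<or> m = j' then of_int (H' $ m) \<le> rv Q $ m \<and> rv Q $ m \<le> of_int (H' $ m) + 1
         else rv Q $ m = of_int (H' $ m)" for m
        using P0 eqQ[OF P0, of m] QJ[of m] unfolding face_def by (cases "m \<in> J") (auto dest!: spec[of _ m] simp: J_def)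
      then show "rv Q \<in> ?B" unfolding face_def by blast
    qed
    have AB: "?A \<inter> ?B = {P. \<forall>m. if m \<in> J then of_int (Q $ m) \<le> P $ m \<and> P $ m \<le> of_int (Q $ m) + 1
        else P $ m = of_int (Q $ m)}" (is "_ = ?R")
    proof safe
      fix P m assume "P \<in> ?A" "P \<in> ?B"
      then show "if m \<in> J then of_int (Q $ m) \<le> P $ m \<and> P $ m \<le> of_int (Q $ m) + 1
        else P $ m = of_int (Q $ m)"
        using eqQ[of P m] QJ[of m] unfolding face_def J_def by (auto dest!: spec[of _ m])
    next
      fix P :: "real ^ 4" assume P: "\<forall>m. if m \<in> J then of_int (Q $ m) \<le> P $ m \<and> P $ m \<le> of_int (Q $ m) + 1
        else P $ m = of_int (Q $ m)"
      have "if m = i \<or> m = j then of_int (H $ m) \<le> P $ m \<and> P $ m \<le> of_int (H $ m) + 1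
         else P $ m = of_int (H $ m)" for m
        using P[rule_format, of m] Qin(1) QJ[of m] unfolding face_def
        by (cases "m \<in> J") (auto dest!: spec[of _ m] simp: J_def)
      then show "P \<in> ?A" unfolding face_def by blast
      have "if m = i' \<or> m = j' then of_int (H' $ m) \<le> P $ m \<and> P $ m \<le> of_int (H' $ m) + 1
         else P $ m = of_int (H' $ m)" for m
        using P[rule_format, of m] Qin(2) QJ[of m] unfolding face_def
        by (cases "m \<in> J") (auto dest!: spec[of _ m] simp: J_def)
      then show "P \<in> ?B" unfolding face_def by blast
    qed
    have Jsub: "J \<subseteq> {i, j}" by (auto simp: J_def)
    then consider "J = {}" | p where "J = {p}" | "J = {i, j}"
      by (cases "i \<in> J"; cases "j \<in> J") auto
    then show ?thesis
    proof cases
      case 1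
      then have "?A \<inter> ?B = {rv Q}" unfolding AB by (auto simp: vec_eq_iff)
      then have "cmb v ` ?A \<inter> cmb v ` ?B = {cmb v (rv Q)}" using I by simp
      then show ?thesis
        using corner_of_face[OF ij(1) v[OF ij(1)] Qin(1)] corner_of_face[OF ij(2) v[OF ij(2)] Qin(2)]
        unfolding meet_nicely_def by blast
    next
      case 2
      then have p: "p = i \<or> p = j" "p = i' \<or> p = j'" "Q $ p = H $ p" "Q $ p = H' $ p"
        using QJ[of p] by (auto simp: J_def)
      have seg: "cmb v ` (?A \<inter> ?B) = closed_segment (cmb v (rv Q)) (cmb v (rv Q) + v p)"
      proof safe
        fix P assume "P \<in> ?A" "P \<in> ?B"
        then have P: "P \<in> ?R" using AB by blast
        let ?l = "P $ p - of_int (Q $ p)"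
        have "P = rv Q + axis p ?l" using P 2 by (auto simp: vec_eq_iff axis_def)
        then have "cmb v P = cmb v (rv Q) + ?l *\<^sub>R v p" by (metis cmb_add cmb_axis)
        then have "cmb v P = (1 - ?l) *\<^sub>R cmb v (rv Q) + ?l *\<^sub>R (cmb v (rv Q) + v p)"
          by (simp add: algebra_simps)
        moreover have "0 \<le> ?l" "?l \<le> 1" using P 2 by (auto dest: spec[of _ p])
        ultimately show "cmb v P \<in> closed_segment (cmb v (rv Q)) (cmb v (rv Q) + v p)"
          unfolding closed_segment_def by blast
      next
        fix y assume "y \<in> closed_segment (cmb v (rv Q)) (cmb v (rv Q) + v p)"
        then obtain l where l: "0 \<le> l" "l \<le> 1"
          and y: "y = (1 - l) *\<^sub>R cmb v (rv Q) + l *\<^sub>R (cmb v (rv Q) + v p)"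
          unfolding closed_segment_def by blast
        have "y = cmb v (rv Q + axis p l)" unfolding y by (simp add: cmb_add algebra_simps)
        moreover have "rv Q + axis p l \<in> ?R" using l 2 by (auto simp: axis_def)
        ultimately show "y \<in> cmb v ` (?A \<inter> ?B)" unfolding AB by blast
      qed
      then show ?thesis
        using side_of_face[where v = v, OF ij(1) v[OF ij(1)] p(1) Qin(1) p(3)]
          side_of_face[where v = v, OF ij(2) v[OF ij(2)] p(2) Qin(2) p(4)]
        unfolding meet_nicely_def I seg by blast
    next
      case 3
      then have "i \<in> J" "j \<in> J" by blast+
      then have "i = i' \<or> i = j'" "j = i' \<or> j = j'" unfolding J_def by blast+
      then have s: "{i, j} = {i', j'}" using ij by fastforce
      have "H $ m = H' $ m" for m
      proof (cases "m \<in> J")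
        case True then show ?thesis by (simp add: J_def)
      next
        case False
        then have "m \<notin> {i, j}" "m \<notin> {i', j'}" using 3 s by simp_all
        with P0 have "P0 $ m = of_int (H $ m)" "P0 $ m = of_int (H' $ m)"
          unfolding face_def by (metis (mono_tags, lifting) insertCI mem_Collect_eq)+
        then show ?thesis by simp
      qed
      then have "H = H'" unfolding vec_eq_iff by blast
      moreover from this s have "?A = ?B" unfolding face_def doubleton_eq_iff by auto
      ultimately show ?thesis using ne by simp
    qed
  qed
qed

section \<open>Sign systems and lifted faces\<close>

text \<open>If \<open>\<tau> l n\<close> is the sign of \<open>det2 (f l) (cmb f (rv n) - \<theta>)\<close>, then \<open>(H, i, j) \<in> faces f \<tau>\<close> says that the
  unit face at \<open>H\<close> in directions \<open>i\<close> and \<open>j\<close> lies in the tube around the plane \<open>{x. cmb f x = \<theta>}\<close>: these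
  determinants give the coordinates of \<open>cmb f (rv H) - \<theta>\<close> with respect to the two remaining \<open>f k\<close>, \<open>f l\<close>.
  Other sign systems \<open>\<tau>\<close> describe tilings that need not be planar.\<close>

definition faces :: "(4 \<Rightarrow> real ^ 2) \<Rightarrow> (4 \<Rightarrow> int ^ 4 \<Rightarrow> bool) \<Rightarrow> ((int ^ 4) \<times> 4 \<times> 4) set" where
  "faces f \<tau> = {(H, i, j). i \<noteq> j \<and> (\<forall>k l. distinct [i, j, k, l] \<longrightarrow>
     \<tau> l H = (0 < det2 (f l) (f k)) \<and> \<tau> l (H - axis k 1) \<noteq> (0 < det2 (f l) (f k)))}"

definition tile_of :: "(4 \<Rightarrow> real ^ 2) \<Rightarrow> (int ^ 4) \<times> 4 \<times> 4 \<Rightarrow> (real ^ 2) set" where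
  "tile_of v = (\<lambda>(H, i, j). parallelogram (cmb v (rv H)) (v i) (v j))"

definition gap :: "(4 \<Rightarrow> real ^ 2) \<Rightarrow> real ^ 2 \<Rightarrow> 4 \<Rightarrow> int ^ 4 \<Rightarrow> real" where
  "gap f \<theta> l n = det2 (f l) (cmb f (rv n) - \<theta>)"

text \<open>The sign of the gap of the plane pushed infinitesimally in direction \<open>\<delta>\<close>, so that ties are broken
  consistently.\<close>

definition sgp :: "(4 \<Rightarrow> real ^ 2) \<Rightarrow> real ^ 2 \<Rightarrow> real ^ 2 \<Rightarrow> 4 \<Rightarrow> int ^ 4 \<Rightarrow> bool" where
  "sgp f \<theta> \<delta> l n \<longleftrightarrow> 0 < gap f \<theta> l n \<or> gap f \<theta> l n = 0 \<and> 0 < det2 (f l) \<delta>"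

definition generic :: "(4 \<Rightarrow> real ^ 2) \<Rightarrow> real ^ 2 \<Rightarrow> bool" where
  "generic f \<theta> \<longleftrightarrow> (\<forall>l n. gap f \<theta> l n \<noteq> 0)"

lemma gap_diff_axis: "gap f \<theta> l (n - axis k 1) = gap f \<theta> l n - det2 (f l) (f k)"
  by (simp add: gap_def rv_diff cmb_diff det2_linear)

text \<open>For \<open>t\<close> the quotient \<open>e m / w m\<close> of least absolute value is
  taken: there a coordinate reaches zero, and none has passed through zero before.\<close>

lemma hit_zero:
  fixes e w :: "'a::finite \<Rightarrow> real"
  assumes "w m0 \<noteq> 0"
  obtains t i where "e i = t * w i" "\<And>m. 0 \<le> (e m - t * w m) * e m"
proof -
  let ?A = "{m. w m \<noteq> 0}"
  obtain i where i: "i \<in> ?A" "\<And>m. m \<in> ?A \<Longrightarrow> \<bar>e i / w i\<bar> \<le> \<bar>e m / w m\<bar>"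
    using ex_min_if_finite[of "(\<lambda>m. \<bar>e m / w m\<bar>) ` ?A"] assms
    by (auto simp: not_less)
  have le: "\<bar>e i / w i * w m\<bar> \<le> \<bar>e m\<bar>" for m
  proof (cases "w m = 0")
    case False
    then have "\<bar>e i / w i\<bar> * \<bar>w m\<bar> \<le> \<bar>e m / w m\<bar> * \<bar>w m\<bar>"
      using i(2)[of m] by (intro mult_right_mono) auto
    with False show ?thesis by (simp add: abs_mult)
  qed simp
  have "0 \<le> (x - u) * x" if "\<bar>u\<bar> \<le> \<bar>x\<bar>" for x u :: real
    using that by (cases "x \<ge> 0") (auto simp: zero_le_mult_iff abs_le_iff)
  from this[OF le] have "0 \<le> (e m - e i / w i * w m) * e m" for m .
  with i(1) show ?thesis by (intro that[of i "e i / w i"]) auto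
qed

lemma cmb_two_zeros:
  assumes f: "\<And>i j. i \<noteq> j \<Longrightarrow> det2 (f i) (f j) \<noteq> 0"
    and "cmb f e = 0" "e $ i = 0" "e $ j = 0" "i \<noteq> j"
  shows "e = 0"
proof -
  obtain k l where d: "distinct [i, j, k, l]" using four_complement[OF \<open>i \<noteq> j\<close>] .
  have c: "e $ k *\<^sub>R f k + e $ l *\<^sub>R f l = 0"
    using assms by (simp add: cmb_distinct4[OF d])
  have "det2 (f k) (e $ k *\<^sub>R f k + e $ l *\<^sub>R f l) = 0" "det2 (f l) (e $ k *\<^sub>R f k + e $ l *\<^sub>R f l) = 0"
    unfolding c by simp_all
  moreover have "det2 (f k) (f l) \<noteq> 0" "det2 (f l) (f k) \<noteq> 0" using f d by auto
  ultimately have "e $ l = 0" "e $ k = 0" by (simp_all add: det2_linear)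
  then have "\<forall>m. e $ m = 0" using assms unfolding all_distinct4[OF d] by blast
  then show ?thesis by (simp add: vec_eq_iff)
qed

section \<open>Bounded perturbations of the identity and continuous rounding\<close>

lemma perturbation_of_id_surj:
  fixes g :: "'a::euclidean_space \<Rightarrow> 'a"
  assumes "continuous_on UNIV g" "\<And>x. norm (g x - x) \<le> B"
  obtains x where "g x = y"
proof -
  have "0 \<le> B" using assms(2)[of 0] norm_ge_zero order_trans by blast
  \<comment> \<open>A fixed point of this map is a solution of \<open>g x = y\<close>; Brouwer's
    theorem applies because the map keeps the ball of radius \<open>B\<close> around
    \<open>y\<close>.\<close>
  have "(\<lambda>x. y - (g x - x)) \<in> cball y B \<rightarrow> cball y B"
    using assms(2) by (auto simp: dist_norm norm_minus_commute)
  moreover have "continuous_on (cball y B) (\<lambda>x. y - (g x - x))"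
    using assms(1) by (auto intro!: continuous_intros intro: continuous_on_subset)
  ultimately obtain x where "y - (g x - x) = x"
    using brouwer[of "cball y B" "\<lambda>x. y - (g x - x)"] \<open>0 \<le> B\<close> by auto
  then have "g x = y" by (simp add: algebra_simps)
  then show ?thesis by (rule that)
qed

text \<open>A continuous approximation of the ceiling function that tends to its set-valued completion.\<close>

definition stair :: "real \<Rightarrow> real \<Rightarrow> real" where
  "stair \<epsilon> x = of_int \<lfloor>x\<rfloor> + min 1 (frac x / \<epsilon>)"

lemma stair_bounds:
  assumes "0 < \<epsilon>"
  shows "of_int \<lfloor>x\<rfloor> \<le> stair \<epsilon> x" "stair \<epsilon> x \<le> of_int \<lfloor>x\<rfloor> + 1" "\<bar>stair \<epsilon> x - x\<bar> \<le> 1"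
proof -
  have "0 \<le> frac x / \<epsilon>" "0 \<le> frac x" "frac x < 1"
    using assms by (simp_all add: frac_ge_0 frac_lt_1)
  then show 1: "of_int \<lfloor>x\<rfloor> \<le> stair \<epsilon> x" "stair \<epsilon> x \<le> of_int \<lfloor>x\<rfloor> + 1"
    unfolding stair_def by (auto simp: min_def)
  show "\<bar>stair \<epsilon> x - x\<bar> \<le> 1"
    using 1 by linarith
qed

lemma continuous_on_stair:
  assumes "0 < \<epsilon>" "\<epsilon> \<le> 1"
  shows "continuous_on UNIV (stair \<epsilon>)"
proof -
  have le: "\<bar>stair \<epsilon> y - stair \<epsilon> x\<bar> \<le> (y - x) / \<epsilon>" if "x \<le> y" for x y
  proof (cases "\<lfloor>x\<rfloor> = \<lfloor>y\<rfloor>")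
    case True
    then have "frac y - frac x = y - x" by (simp add: frac_def)
    then have "frac y / \<epsilon> - frac x / \<epsilon> = (y - x) / \<epsilon>" by (simp add: diff_divide_distrib[symmetric])
    moreover have "0 \<le> (y - x) / \<epsilon>" using that assms by simp
    ultimately show ?thesis unfolding stair_def True by (auto simp: min_def)
  next
    case False
    then have fl: "\<lfloor>x\<rfloor> + 1 \<le> \<lfloor>y\<rfloor>" using floor_mono[OF that] by linarith
    have 1: "stair \<epsilon> y - of_int \<lfloor>y\<rfloor> \<le> frac y / \<epsilon>" by (simp add: stair_def)
    have 2: "of_int \<lfloor>x\<rfloor> + 1 - stair \<epsilon> x \<le> (1 - frac x) / \<epsilon>"
    proof -
      have "1 - frac x / \<epsilon> \<le> (1 - frac x) / \<epsilon>" "0 \<le> (1 - frac x) / \<epsilon>"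
        using assms frac_lt_1[of x] by (simp_all add: field_simps)
      then show ?thesis by (auto simp: stair_def min_def)
    qed
    have "a \<le> a / \<epsilon>" if "0 \<le> a" for a
      using that assms by (simp add: pos_le_divide_eq mult_left_le)
    then have 3: "of_int \<lfloor>y\<rfloor> - (of_int \<lfloor>x\<rfloor> + 1) \<le> (of_int \<lfloor>y\<rfloor> - (of_int \<lfloor>x\<rfloor> + 1)) / \<epsilon>"
      using fl by simp
    have "stair \<epsilon> x \<le> stair \<epsilon> y"
      using stair_bounds[OF assms(1), of x] stair_bounds[OF assms(1), of y] fl by linarith
    moreover have "frac y / \<epsilon> + (1 - frac x) / \<epsilon> + (of_int \<lfloor>y\<rfloor> - (of_int \<lfloor>x\<rfloor> + 1)) / \<epsilon> = (y - x) / \<epsilon>"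
      unfolding frac_def by (simp add: add_divide_distrib[symmetric] diff_divide_distrib[symmetric])
    ultimately show ?thesis using 1 2 3 by linarith
  qed
  have "dist (stair \<epsilon> x) (stair \<epsilon> y) \<le> (1 / \<epsilon>) * dist x y" for x y
  proof (cases "x \<le> y")
    case True
    then show ?thesis using le[OF True] by (simp add: dist_real_def abs_minus_commute)
  next
    case False
    then have "y \<le> x" by simp
    then show ?thesis using le[OF \<open>y \<le> x\<close>] by (simp add: dist_real_def abs_minus_commute)
  qed
  then have "(1 / \<epsilon>)-lipschitz_on UNIV (stair \<epsilon>)"
    using assms by (intro lipschitz_onI) auto
  then show ?thesis by (rule lipschitz_on_continuous_on)
qed

text \<open>Away from the integers the approximations are eventually equal to the ceiling. Near an
  integer \<open>x\<close> they take values between \<open>x\<close> and \<open>x + 1\<close> only,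
  and every such value is allowed in the completion.\<close>

lemma stair_limit:
  fixes x P :: real
  assumes x: "X \<longlonglongrightarrow> x" and P: "(\<lambda>n. stair (E n) (X n)) \<longlonglongrightarrow> P"
    and E: "E \<longlonglongrightarrow> 0" "\<And>n. 0 < E n"
  shows "if x \<in> \<int> then x \<le> P \<and> P \<le> x + 1 else P = of_int \<lceil>x\<rceil>"
proof (cases "x \<in> \<int>")
  case True
  then obtain k where k: "x = of_int k" by (elim Ints_cases)
  have "\<forall>\<^sub>F n in sequentially. \<bar>X n - x\<bar> < 1 / 2"
    using x[THEN tendstoD, of "1 / 2"] by (simp add: dist_real_def)
  moreover have "\<forall>\<^sub>F n in sequentially. E n < 1 / 2"
    using E(1) by (rule order_tendstoD) simp
  ultimately have ev: "\<forall>\<^sub>F n in sequentially. x \<le> stair (E n) (X n) \<and> stair (E n) (X n) \<le> x + 1"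
  proof eventually_elim
    case (elim n)
    show ?case
    proof (cases "X n \<ge> x")
      case True
      then have "\<lfloor>X n\<rfloor> = k" using elim k by (simp add: floor_eq_iff)
      then show ?thesis using stair_bounds[OF E(2)[of n], of "X n"] k by simp
    next
      case False
      \<comment> \<open>Just below an integer the floor is one smaller, but the ramp is already
        finished there, so the value is \<open>k\<close>.\<close>
      then have fl: "\<lfloor>X n\<rfloor> = k - 1" using elim k by (simp add: floor_eq_iff)
      have "E n \<le> X n - (of_int k - 1)" using elim unfolding k by linarith
      then have "frac (X n) \<ge> E n" by (simp add: frac_def fl)
      then have "1 \<le> frac (X n) / E n" using E(2)[of n] by (simp add: field_simps)
      then show ?thesis using fl k by (simp add: stair_def min_def)
    qed
  qed
  have "x \<le> P" "P \<le> x + 1"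
    using ev by (auto intro!: tendsto_lowerbound[OF P] tendsto_upperbound[OF P] elim: eventually_mono)
  with True show ?thesis by simp
next
  case False
  have "0 < frac x" "frac x < 1" using False by (simp_all add: frac_lt_1 frac_gt_0_iff)
  then obtain d where d: "0 < d" and d2: "d \<le> frac x / 2" "d \<le> (1 - frac x) / 2"
    by (intro that[of "min (frac x) (1 - frac x) / 2"]) (auto simp: min_def)
  have "\<forall>\<^sub>F n in sequentially. \<bar>X n - x\<bar> < d"
    using x[THEN tendstoD, OF d] by (simp add: dist_real_def)
  moreover have "\<forall>\<^sub>F n in sequentially. E n < d"
    using E(1) d by (rule order_tendstoD)
  ultimately have ev: "\<forall>\<^sub>F n in sequentially. stair (E n) (X n) = of_int \<lceil>x\<rceil>"
  proof eventually_elim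
    case (elim n)
    have fl: "\<lfloor>X n\<rfloor> = \<lfloor>x\<rfloor>"
    proof -
      have "z \<le> a \<and> a < z + 1" if "\<bar>a - x\<bar> < d" "d \<le> (x - z) / 2" "d \<le> (1 - (x - z)) / 2" for z a
        using that d by (auto simp: abs_less_iff)
      from this[OF elim(1) d2[unfolded frac_def]] show ?thesis by (simp only: floor_eq_iff)
    qed
    have "frac (X n) = frac x + (X n - x)" unfolding frac_def fl by simp
    then have "frac (X n) \<ge> E n" using elim d2 by linarith
    then have "1 \<le> frac (X n) / E n" using E(2)[of n] by (simp add: field_simps)
    moreover have "\<lceil>x\<rceil> = \<lfloor>x\<rfloor> + 1"
      using False by (metis Ints_of_int ceiling_altdef)
    ultimately show ?case using fl by (simp add: stair_def min_def)
  qed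
  then have "P = of_int \<lceil>x\<rceil>"
    using tendsto_unique[OF _ P] tendsto_eventually by fastforce
  with False show ?thesis by simp
qed

text \<open>The last assumption says that the two vector configurations have compatible orientations: it is
  what an existing planar tiling provides.\<close>

locale chart =
  fixes v f :: "4 \<Rightarrow> real ^ 2"
  assumes v_indep: "i \<noteq> j \<Longrightarrow> det2 (v i) (v j) \<noteq> 0"
    and f_indep: "i \<noteq> j \<Longrightarrow> det2 (f i) (f j) \<noteq> 0"
    and compat: "\<exists>c. c $ i = 0 \<and> cmb f c = 0 \<and> (\<forall>m. m \<noteq> i \<longrightarrow> 0 < c $ m * det2 (v i) (v m))"
begin

text \<open>The algebraic form of compatible orientations. Without sign changes \<open>e\<close> is
  reduced to a kernel vector with a vanishing coordinate \<open>i\<close>; it is then a multiple of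
  the vector from \<open>compat\<close>, so that all terms of
  \<open>det2 (v i) (cmb v d) = 0\<close> have the same sign and must vanish.\<close>

lemma ker_conformal_0:
  assumes e: "cmb f e = 0" "e \<noteq> 0" and d: "cmb v d = 0" "\<And>m. 0 \<le> d $ m * e $ m"
  shows "d = 0"
proof -
  obtain i e' where e': "cmb f e' = 0" "e' \<noteq> 0" "e' $ i = 0" "\<And>m. 0 \<le> d $ m * e' $ m"
  proof (cases "\<exists>i. e $ i = 0")
    case True
    then show ?thesis using that e d by blast
  next
    case False
    obtain c where c: "c $ 1 = 0" "cmb f c = 0" "\<forall>m. m \<noteq> 1 \<longrightarrow> 0 < c $ m * det2 (v 1) (v m)"
      using compat[of 1] by blast
    have "(2 :: 4) \<noteq> 1" by simp
    with c(3) have "c $ 2 \<noteq> 0" by fastforce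
    then obtain t i where t: "e $ i = t * c $ i" "\<And>m. 0 \<le> (e $ m - t * c $ m) * e $ m"
      using hit_zero[of "($) c" 2 "($) e"] by metis
    \<comment> \<open>The vector \<open>c\<close> vanishes at the index 1, so this coordinate of
      \<open>e\<close> is kept and the difference is nonzero.\<close>
    let ?e = "e - t *\<^sub>R c"
    have "?e $ 1 \<noteq> 0" using False c(1) by simp
    then have "?e \<noteq> 0" by (metis zero_index)
    moreover have "cmb f ?e = 0" using e c by (simp add: cmb_diff cmb_scale)
    moreover have "?e $ i = 0" using t by simp
    moreover have "0 \<le> d $ m * ?e $ m" for m
      using t(2)[of m] d(2)[of m] False by (auto simp: zero_le_mult_iff)
    ultimately show ?thesis using that[of ?e i] by blast
  qed
  obtain c where c: "c $ i = 0" "cmb f c = 0" "\<And>m. m \<noteq> i \<Longrightarrow> 0 < c $ m * det2 (v i) (v m)"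
    using compat[of i] by blast
  have "i \<noteq> i + 1" by simp
  then obtain k l where "distinct [i, i + 1, k, l]" by (rule four_complement)
  then obtain j where dd: "distinct [i, j, k, l]" by blast
  then have cj: "c $ j \<noteq> 0" using c(3)[of j] by auto
  define s where "s = e' $ j / c $ j"
  have "e' - s *\<^sub>R c = 0"
    using e' c cj dd by (intro cmb_two_zeros[OF f_indep, where i = i and j = j])
      (auto simp: cmb_diff cmb_scale s_def)
  then have e's: "e' = s *\<^sub>R c" by simp
  with e' have "s \<noteq> 0" by auto
  have nonneg: "0 \<le> s * (d $ m * det2 (v i) (v m))" for m
  proof (cases "m = i")
    case False
    have "0 \<le> d $ m * (s * c $ m)" using e'(4)[of m] e's by simp
    then have "0 \<le> (d $ m * (s * c $ m)) * (c $ m * det2 (v i) (v m))"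
      using c(3)[OF False] by simp
    also have "\<dots> = (c $ m)\<^sup>2 * (s * (d $ m * det2 (v i) (v m)))" by (simp add: power2_eq_square)
    finally show ?thesis using c(3)[OF False] by (auto simp: zero_le_mult_iff)
  qed simp
  have "(\<Sum>m\<in>UNIV. s * (d $ m * det2 (v i) (v m))) = s * det2 (v i) (cmb v d)"
    by (simp add: det2_cmb sum_distrib_left)
  also have "\<dots> = 0" using d by simp
  finally have "s * (d $ m * det2 (v i) (v m)) = 0" for m
    using nonneg sum_nonneg_eq_0_iff[of UNIV "\<lambda>m. s * (d $ m * det2 (v i) (v m))"] by auto
  then have "d $ j = 0" "d $ k = 0"
    using \<open>s \<noteq> 0\<close> v_indep[of i j] v_indep[of i k] dd by auto
  then show ?thesis
    using cmb_two_zeros[OF v_indep d(1), of j k] dd by auto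
qed

text \<open>A vector is conformal to itself, so \<open>ker_conformal_0\<close> applies with both
  vectors equal. Window and physical projection together are thus linear coordinates of the
  four-dimensional space.\<close>

lemma cmb_pair_inj:
  assumes "cmb f d = 0" "cmb v d = 0"
  shows "d = 0"
  using ker_conformal_0[OF assms(1) _ assms(2)] by (metis zero_le_square)

lemma cmb_pair_surj:
  obtains x where "cmb f x = a" "cmb v x = b"
proof -
  let ?g = "\<lambda>x. (cmb f x, cmb v x)"
  have lin: "linear ?g" by (intro linearI) (simp_all add: cmb_add cmb_scale)
  have inj: "inj ?g"
    unfolding linear_injective_0[OF lin] using cmb_pair_inj by (simp add: zero_prod_def)
  have dim: "dim (UNIV :: ((real ^ 2) \<times> (real ^ 2)) set) = dim (UNIV :: (real ^ 4) set)"
    unfolding dim_UNIV DIM_prod DIM_cart DIM_real by simp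
  have "surj ?g"
    by (rule linear_injective_imp_surjective[OF lin inj dim])
  from surjD[OF this, of "(a, b)"] obtain x where "(a, b) = (cmb f x, cmb v x)" by blast
  then show ?thesis using that by simp
qed

lemma cmb_pair_bound_perturbed:
  obtains \<eta> \<mu> where "0 < \<eta>" "0 < \<mu>"
    "\<And>f' d. (\<And>i. norm (f' i - f i) < \<eta>) \<Longrightarrow> \<mu> * norm d \<le> norm (cmb f' d) + norm (cmb v d)"
proof -
  let ?g = "\<lambda>x. (cmb f x, cmb v x)"
  have lin: "linear ?g" by (intro linearI) (simp_all add: cmb_add cmb_scale)
  have "inj ?g"
    unfolding linear_injective_0[OF lin] using cmb_pair_inj by (simp add: zero_prod_def)
  then obtain B where B: "0 < B" "\<And>x. B * norm x \<le> norm (?g x)"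
    using linear_inj_bounded_below_pos[OF lin] by blast
  \<comment> \<open>A change of \<open>B / 8\<close> in each of the four vectors costs at most half
    of the lower bound \<open>B\<close>.\<close>
  have "B / 2 * norm d \<le> norm (cmb f' d) + norm (cmb v d)"
    if "\<And>i. norm (f' i - f i) < B / 8" for f' d
  proof -
    have "B * norm d \<le> norm (cmb f d) + norm (cmb v d)"
      using B(2)[of d] norm_Pair_le[of "cmb f d" "cmb v d"] by linarith
    moreover have "norm (cmb f d) \<le> norm (cmb f' d) + norm (cmb (\<lambda>i. f' i - f i) d)"
      using norm_triangle_ineq4[of "cmb f' d" "cmb (\<lambda>i. f' i - f i) d"]
      by (simp add: cmb_fun_diff[symmetric])
    moreover have "norm (cmb (\<lambda>i. f' i - f i) d) \<le> B / 2 * norm d"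
    proof -
      have "(\<Sum>i\<in>UNIV. norm (f' i - f i)) \<le> (\<Sum>i\<in>(UNIV :: 4 set). B / 8)"
        using that by (intro sum_mono) (simp add: less_imp_le)
      then have "(\<Sum>i\<in>UNIV. norm (f' i - f i)) \<le> B / 2" by simp
      then show ?thesis
        using norm_cmb_le[of "\<lambda>i. f' i - f i" d] mult_right_mono[of _ "B / 2" "norm d"]
        by (smt (verit) norm_ge_zero)
    qed
    ultimately show ?thesis by (simp add: algebra_simps)
  qed
  with B(1) show ?thesis by (intro that[of "B / 8" "B / 2"]) auto
qed

text \<open>The sign conditions place the two window coefficients of \<open>H\<close> strictly
  between 0 and 1. Subtracting them from \<open>H\<close> gives a point of the plane from which the
  face is recovered by rounding up.\<close>

lemma generic_face_base:
  assumes g: "generic f \<theta>" and F: "(H, i, j) \<in> faces f (sgp f \<theta> 0)"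
  obtains x where "cmb f x = \<theta>" "x $ i = of_int (H $ i)" "x $ j = of_int (H $ j)"
    "\<And>m. m \<noteq> i \<Longrightarrow> m \<noteq> j \<Longrightarrow> of_int (H $ m) - 1 < x $ m \<and> x $ m < of_int (H $ m)"
proof -
  have "i \<noteq> j" using F by (simp add: faces_def)
  then obtain k l where d: "distinct [i, j, k, l]" using four_complement by blast
  then have d': "distinct [i, j, l, k]" by auto
  have *: "0 < gap f \<theta> l H / det2 (f l) (f k) \<and> gap f \<theta> l H / det2 (f l) (f k) < 1"
    if "distinct [i, j, k, l]" for k l
  proof -
    have "gap f \<theta> l H \<noteq> 0" "gap f \<theta> l H - det2 (f l) (f k) \<noteq> 0"
      using g gap_diff_axis[of f \<theta> l H k] unfolding generic_def by metis+
    moreover have "(0 < gap f \<theta> l H) = (0 < det2 (f l) (f k))"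
      "(0 < gap f \<theta> l H - det2 (f l) (f k)) \<noteq> (0 < det2 (f l) (f k))"
      using F that g unfolding faces_def sgp_def generic_def by (auto simp: gap_diff_axis)
    moreover have "det2 (f l) (f k) \<noteq> 0" using f_indep[of l k] that by auto
    ultimately show ?thesis by (cases "0 < det2 (f l) (f k)") (auto simp: field_simps)
  qed
  define s t where "s = gap f \<theta> l H / det2 (f l) (f k)" and "t = gap f \<theta> k H / det2 (f k) (f l)"
  define x where "x = rv H - axis k s - axis l t"
  have "cmb f (rv H) - \<theta> = s *\<^sub>R f k + t *\<^sub>R f l"
    using det2_cramer[of "f k" "f l"] f_indep[of k l] d unfolding s_def t_def gap_def by auto
  then have "cmb f x = \<theta>" by (simp add: x_def cmb_diff cmb_add algebra_simps)
  moreover have "x $ i = of_int (H $ i)" "x $ j = of_int (H $ j)"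
    using d by (auto simp: x_def axis_def)
  moreover have "of_int (H $ m) - 1 < x $ m \<and> x $ m < of_int (H $ m)" if "m \<noteq> i" "m \<noteq> j" for m
  proof -
    have "m = k \<or> m = l" using UNIV_distinct4[OF d] that by blast
    then show ?thesis
      using *[OF d] *[OF d'] d by (auto simp: x_def axis_def s_def t_def)
  qed
  ultimately show ?thesis by (rule that)
qed

text \<open>Each coordinate of a point of a face is a value of the set-valued ceiling at the
  coordinate of the base point in the plane. This relation is monotone, so \<open>P - P'\<close> and
  \<open>x - x'\<close> have conformal signs and \<open>ker_conformal_0\<close> applies.\<close>

lemma generic_inj:
  assumes g: "generic f \<theta>"
    and F: "(H, i, j) \<in> faces f (sgp f \<theta> 0)" "(H', i', j') \<in> faces f (sgp f \<theta> 0)"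
    and P: "P \<in> face H i j" "P' \<in> face H' i' j'" and eq: "cmb v P = cmb v P'"
  shows "P = P'"
proof -
  obtain x where x: "cmb f x = \<theta>" "x $ i = of_int (H $ i)" "x $ j = of_int (H $ j)"
    "\<And>m. m \<noteq> i \<Longrightarrow> m \<noteq> j \<Longrightarrow> of_int (H $ m) - 1 < x $ m \<and> x $ m < of_int (H $ m)"
    using generic_face_base[OF g F(1)] by blast
  obtain x' where x': "cmb f x' = \<theta>" "x' $ i' = of_int (H' $ i')" "x' $ j' = of_int (H' $ j')"
    "\<And>m. m \<noteq> i' \<Longrightarrow> m \<noteq> j' \<Longrightarrow> of_int (H' $ m) - 1 < x' $ m \<and> x' $ m < of_int (H' $ m)"
    using generic_face_base[OF g F(2)] by blast
  define rel where "rel a p \<longleftrightarrow> (\<exists>n. a = of_int n \<and> a \<le> p \<and> p \<le> a + 1)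
      \<or> (\<exists>n. p = of_int n \<and> p - 1 < a \<and> a < p)" for a p :: real
  have relI: "rel (y $ m) (R $ m)"
    if R: "R \<in> face K a b" and y: "y $ a = of_int (K $ a)" "y $ b = of_int (K $ b)"
      "\<And>m. m \<noteq> a \<Longrightarrow> m \<noteq> b \<Longrightarrow> of_int (K $ m) - 1 < y $ m \<and> y $ m < of_int (K $ m)"
    for y R K a b m
  proof (cases "m = a \<or> m = b")
    case True
    then have "of_int (K $ m) \<le> R $ m \<and> R $ m \<le> of_int (K $ m) + 1" using R unfolding face_def by auto
    moreover have "y $ m = of_int (K $ m)" using True y by blast
    ultimately show ?thesis unfolding rel_def by metis
  next
    case False
    then have "R $ m = of_int (K $ m)" using R unfolding face_def by auto
    then show ?thesis using y(3)[of m] False unfolding rel_def by metis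
  qed
  have rel: "rel (x $ m) (P $ m)" "rel (x' $ m) (P' $ m)" for m
    using relI[OF P(1) x(2,3,4)] relI[OF P(2) x'(2,3,4)] by blast+
  have "real_of_int n + 1 \<le> of_int n'" if "real_of_int n < of_int n'" for n n'
    using that by (simp add: int_less_real_le[symmetric])
  then have mono: "p \<le> p'" if "rel a p" "rel a' p'" "a < a'" for a p a' p'
    using that unfolding rel_def by (smt (verit, best))
  have conf: "0 \<le> (P - P') $ m * (x - x') $ m" for m
    using mono[OF rel(1) rel(2), of m] mono[OF rel(2) rel(1), of m]
    by (cases "x $ m" "x' $ m" rule: linorder_cases) (auto simp: zero_le_mult_iff)
  show ?thesis
  proof (cases "x = x'")
    case False
    then have "P - P' = 0"
      using x(1) x'(1) eq conf by (intro ker_conformal_0[of "x - x'"]) (auto simp: cmb_diff)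
    then show ?thesis by simp
  next
    case True
    have ne: "i \<noteq> j" using F by (simp add: faces_def)
    obtain k l where d: "distinct [i, j, k, l]" using four_complement[OF ne] .
    \<comment> \<open>Over a common base point the noninteger coordinates are rounded up alike, and
      two equal coordinates suffice.\<close>
    have "P $ m = P' $ m" if m: "m = k \<or> m = l" for m
    proof -
      have 1: "of_int (H $ m) - 1 < x $ m \<and> x $ m < of_int (H $ m)" "P $ m = of_int (H $ m)"
        using x(4)[of m] m d P(1) by (auto simp: face_def)
      then have "x $ m \<noteq> of_int n" for n by auto
      with x' True have "m \<noteq> i'" "m \<noteq> j'" by metis+
      then have "of_int (H' $ m) - 1 < x $ m \<and> x $ m < of_int (H' $ m)" "P' $ m = of_int (H' $ m)"
        using x'(4)[of m] P(2) True by (auto simp: face_def)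
      with 1 show ?thesis by simp
    qed
    then have "P - P' = 0"
      using eq d by (intro cmb_two_zeros[OF v_indep, where e = "P - P'" and i = k and j = l]) (auto simp: cmb_diff)
    then show ?thesis by simp
  qed
qed

end

section \<open>Tilings from generic planes\<close>

lemma dense_compl_countable_segments:
  fixes w :: "'b::countable \<Rightarrow> real ^ 2"
  assumes "\<And>b. a b \<noteq> 0"
  shows "closure (- (\<Union>b. {y. det2 (a b) (y - w b) = 0})) = UNIV"
proof -
  let ?N = "\<Union>b. {y. det2 (a b) (y - w b) = 0}"
  have "negligible {y. det2 (a b) (y - w b) = 0}" for b
  proof -
    let ?p = "vector [- (a b $ 2), a b $ 1] :: real ^ 2"
    have "?p \<noteq> 0" using assms[of b] by (auto simp: vec_eq_iff forall_2)
    then have "negligible {y. ?p \<bullet> y = det2 (a b) (w b)}"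
      by (intro negligible_hyperplane) simp
    moreover have "{y. det2 (a b) (y - w b) = 0} = {y. ?p \<bullet> y = det2 (a b) (w b)}"
      by (simp add: det2_linear det2_inner[symmetric])
    ultimately show ?thesis by simp
  qed
  then have neg: "negligible ?N"
    by (intro negligible_countable_Union) auto
  have "negligible (interior ?N)"
    using neg interior_subset by (rule negligible_subset)
  then have "interior ?N = {}"
    using open_not_negligible[OF open_interior] by blast
  then show ?thesis by (simp add: closure_interior)
qed

lemma closed_Union_locally_finite:
  fixes T :: "'i \<Rightarrow> 'a::metric_space set"
  assumes cl: "\<And>i. i \<in> I \<Longrightarrow> closed (T i)"
    and fin: "\<And>y. finite {i \<in> I. T i \<inter> ball y 1 \<noteq> {}}"
  shows "closed (\<Union>i\<in>I. T i)"
proof -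
  have "y \<in> (\<Union>i\<in>I. T i)" if y: "y \<in> closure (\<Union>i\<in>I. T i)" for y
  proof -
    let ?J = "{i \<in> I. T i \<inter> ball y 1 \<noteq> {}}"
    have "closed (\<Union>i\<in>?J. T i)" using fin[of y] cl by (intro closed_UN) auto
    moreover have "y \<in> closure (\<Union>i\<in>?J. T i)"
      unfolding closure_approachable
    proof safe
      fix e :: real assume "0 < e"
      then obtain z where z: "z \<in> (\<Union>i\<in>I. T i)" "dist z y < min e 1"
        using y unfolding closure_approachable by (metis zero_less_one min_less_iff_conj)
      then obtain i where "i \<in> I" "z \<in> T i" "z \<in> ball y 1" by (auto simp: dist_commute)
      then have "z \<in> (\<Union>i\<in>?J. T i)" by blast
      then show "\<exists>z\<in>\<Union>i\<in>?J. T i. dist z y < e" using z by auto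
    qed
    ultimately show ?thesis by (auto simp: closure_closed)
  qed
  then show ?thesis using closure_subset_eq by blast
qed

context chart
begin

lemma tile_of_face: "(H, i, j) \<in> faces f \<tau> \<Longrightarrow> tile_of v (H, i, j) = cmb v ` face H i j"
  by (simp add: tile_of_def faces_def parallelogram_conv_face)

lemma tile_of_bounded:
  assumes "y \<in> tile_of v (H, i, j)"
  shows "dist (cmb v (rv H)) y \<le> 2 * (\<Sum>i\<in>UNIV. norm (v i))"
proof -
  have "norm (v i) \<le> (\<Sum>i\<in>UNIV. norm (v i))" for i
    by (intro member_le_sum) auto
  then show ?thesis
    using parallelogram_bounded[of y "cmb v (rv H)" "v i" "v j"] assms
    unfolding tile_of_def by (smt (verit) case_prod_conv)
qed

text \<open>The estimate behind all local comparisons: nearness to a plane bounds the window part of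
  \<open>H - H'\<close>, the distance of the tiles bounds the physical part, and the pair of
  projections is bounded below.\<close>

lemma near_plane_bound:
  assumes f': "\<And>d. \<mu> * norm d \<le> norm (cmb f' d) + norm (cmb v d)"
    and C: "norm (cmb f' (rv H) - \<theta>) \<le> C" "norm (cmb f' (rv H') - \<theta>) \<le> C"
    and y: "y \<in> tile_of v (H, i, j)" "y' \<in> tile_of v (H', i', j')" "dist y y' \<le> \<rho>"
  shows "\<mu> * norm (rv (H - H')) \<le> 2 * C + 4 * (\<Sum>i\<in>UNIV. norm (v i)) + \<rho>"
proof -
  have e: "cmb f' (rv (H - H')) = (cmb f' (rv H) - \<theta>) - (cmb f' (rv H') - \<theta>)"
    by (simp add: rv_diff cmb_diff)
  have "norm (cmb f' (rv (H - H'))) \<le> 2 * C"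
    unfolding e using norm_triangle_ineq4[of "cmb f' (rv H) - \<theta>" "cmb f' (rv H') - \<theta>"] C by linarith
  moreover have "norm (cmb v (rv (H - H'))) = dist (cmb v (rv H)) (cmb v (rv H'))"
    by (simp add: rv_diff cmb_diff dist_norm)
  moreover have "dist (cmb v (rv H)) (cmb v (rv H')) \<le> dist (cmb v (rv H)) y + dist y y' + dist (cmb v (rv H')) y'"
    using dist_triangle[of "cmb v (rv H)" "cmb v (rv H')" y] dist_triangle[of y "cmb v (rv H')" y']
    by (simp add: dist_commute)
  ultimately show ?thesis
    using f'[of "rv (H - H')"] tile_of_bounded[OF y(1)] tile_of_bounded[OF y(2)] y(3) by linarith
qed

lemma finite_faces_near:
  assumes f': "\<And>d. \<mu> * norm d \<le> norm (cmb f' d) + norm (cmb v d)" and "0 < \<mu>"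
    and C: "\<And>H i j. (H, i, j) \<in> FF \<Longrightarrow> norm (cmb f' (rv H) - \<theta>) \<le> C"
  shows "finite {\<phi> \<in> FF. tile_of v \<phi> \<inter> cball y R \<noteq> {}}"
proof (cases "{\<phi> \<in> FF. tile_of v \<phi> \<inter> cball y R \<noteq> {}} = {}")
  case False
  then obtain H0 i0 j0 y0 where 0: "(H0, i0, j0) \<in> FF" "y0 \<in> tile_of v (H0, i0, j0)" "y0 \<in> cball y R"
    by auto
  let ?B = "(2 * C + 4 * (\<Sum>i\<in>UNIV. norm (v i)) + 2 * R) / \<mu>"
  have "{\<phi> \<in> FF. tile_of v \<phi> \<inter> cball y R \<noteq> {}}
      \<subseteq> (\<lambda>(m, i, j). (H0 + m, i, j)) ` ({m. norm (rv m) \<le> ?B} \<times> UNIV \<times> UNIV)"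
  proof
    fix \<phi> assume \<phi>: "\<phi> \<in> {\<phi> \<in> FF. tile_of v \<phi> \<inter> cball y R \<noteq> {}}"
    obtain H i j where "\<phi> = (H, i, j)" by (metis prod_cases3)
    with \<phi> obtain y1 where 1: "\<phi> = (H, i, j)" "(H, i, j) \<in> FF" "y1 \<in> tile_of v (H, i, j)" "y1 \<in> cball y R"
      by blast
    have "dist y1 y0 \<le> 2 * R"
      using 0(3) 1(4) dist_triangle_le[of y1 y y0 "2 * R"] by (simp add: dist_commute)
    then have "\<mu> * norm (rv (H - H0)) \<le> 2 * C + 4 * (\<Sum>i\<in>UNIV. norm (v i)) + 2 * R"
      using near_plane_bound[OF f' C[OF 1(2)] C[OF 0(1)] 1(3) 0(2)] by blast
    then have "norm (rv (H - H0)) \<le> ?B" using \<open>0 < \<mu>\<close> by (simp add: field_simps)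
    then show "\<phi> \<in> (\<lambda>(m, i, j). (H0 + m, i, j)) ` ({m. norm (rv m) \<le> ?B} \<times> UNIV \<times> UNIV)"
      unfolding 1(1) by (intro image_eqI[of _ _ "(H - H0, i, j)"]) auto
  qed
  then show ?thesis
    by (rule finite_subset) (intro finite_imageI finite_cartesian_product finite_rv_bounded finite)
next
  case True
  then show ?thesis by (simp only: finite.emptyI)
qed

lemma generic_near:
  assumes "generic f \<theta>" "(H, i, j) \<in> faces f (sgp f \<theta> 0)"
  shows "norm (cmb f (rv H) - \<theta>) \<le> 4 * (\<Sum>i\<in>UNIV. norm (f i))"
proof -
  obtain x where x: "cmb f x = \<theta>" "x $ i = of_int (H $ i)" "x $ j = of_int (H $ j)"
    "\<And>m. m \<noteq> i \<Longrightarrow> m \<noteq> j \<Longrightarrow> of_int (H $ m) - 1 < x $ m \<and> x $ m < of_int (H $ m)"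
    using generic_face_base[OF assms] by blast
  have "\<bar>(rv H - x) $ m\<bar> \<le> 1" for m
    using x(2,3) x(4)[of m] by (cases "m = i"; cases "m = j") auto
  then have "norm (rv H - x) \<le> (\<Sum>m\<in>(UNIV :: 4 set). 1)"
    by (intro order_trans[OF norm_le_l1_cart] sum_mono) auto
  then have "norm (rv H - x) \<le> 4" by simp
  then have "norm (cmb f (rv H - x)) \<le> (\<Sum>i\<in>UNIV. norm (f i)) * 4"
    using norm_cmb_le[of f "rv H - x"] mult_left_mono[of "norm (rv H - x)" 4 "\<Sum>i\<in>UNIV. norm (f i)"]
    by (simp add: sum_nonneg)
  then show ?thesis by (simp add: cmb_diff x(1))
qed

text \<open>When the plane is parametrized by its physical projection, rounding with
  \<open>stair\<close> moves points by a bounded amount. The resulting map of the physical plane to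
  itself is a bounded perturbation of the identity, hence surjective.\<close>

lemma stair_solution:
  assumes "0 < \<epsilon>" "\<epsilon> \<le> 1"
  obtains x where "cmb f x = \<theta>" "cmb v (\<chi> m. stair \<epsilon> (x $ m)) = y"
proof -
  let ?g = "\<lambda>x. (cmb f x, cmb v x)"
  have lin: "linear ?g" by (intro linearI) (simp_all add: cmb_add cmb_scale)
  have "surj ?g"
    unfolding surj_def
  proof
    fix p
    obtain x where "cmb f x = fst p" "cmb v x = snd p" by (rule cmb_pair_surj)
    then show "\<exists>x. p = ?g x" by (intro exI[of _ x]) simp
  qed
  then obtain g where g: "linear g" "?g \<circ> g = id"
    using linear_surjective_right_inverse[OF lin] by blast
  define G where "G z = cmb v (\<chi> m. stair \<epsilon> (g (\<theta>, z) $ m))" for z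
  have gfv: "cmb f (g (\<theta>, z)) = \<theta>" "cmb v (g (\<theta>, z)) = z" for z
    using fun_cong[OF g(2), of "(\<theta>, z)"] by simp_all
  have cont: "continuous_on UNIV (\<lambda>z. g (\<theta>, z))"
  proof -
    have "continuous_on UNIV g"
      by (rule linear_continuous_on) (use g(1) linear_conv_bounded_linear in blast)
    then show ?thesis
      by (rule continuous_on_compose2) (auto intro!: continuous_intros)
  qed
  have "continuous_on UNIV G"
    unfolding G_def cmb_def vec_lambda_beta
  proof (intro continuous_on_sum continuous_on_scaleR continuous_on_const)
    fix m
    have "continuous_on UNIV (\<lambda>z. g (\<theta>, z) $ m)"
      using cont by (rule continuous_on_component)
    then show "continuous_on UNIV (\<lambda>z. stair \<epsilon> (g (\<theta>, z) $ m))"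
      by (rule continuous_on_compose2[OF continuous_on_stair[OF assms]]) simp
  qed
  moreover have "norm (G z - z) \<le> (\<Sum>i\<in>UNIV. norm (v i)) * 4" for z
  proof -
    let ?d = "(\<chi> m. stair \<epsilon> (g (\<theta>, z) $ m)) - g (\<theta>, z)"
    have "G z - z = cmb v ?d"
      using gfv[of z] by (simp add: G_def cmb_diff)
    moreover have "norm ?d \<le> (\<Sum>m\<in>(UNIV :: 4 set). 1)"
      by (intro order_trans[OF norm_le_l1_cart] sum_mono) (simp add: stair_bounds(3)[OF assms(1)])
    then have "norm ?d \<le> 4" by simp
    ultimately show ?thesis
      using norm_cmb_le[of v ?d] mult_left_mono[of "norm ?d" 4 "\<Sum>i\<in>UNIV. norm (v i)"]
      by (simp add: sum_nonneg)
  qed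
  ultimately obtain z where "G z = y" by (rule perturbation_of_id_surj)
  then show ?thesis using gfv[of z] by (intro that[of "g (\<theta>, z)"]) (auto simp: G_def)
qed

text \<open>Solutions for ever steeper steps stay bounded, since the physical projection of the
  rounded point is fixed and rounding moves a point by at most 4. A limit point solves the equation
  for the set-valued ceiling.\<close>

lemma limit_solution:
  obtains x P where "cmb f x = \<theta>" "cmb v P = y"
    "\<And>m. if x $ m \<in> \<int> then x $ m \<le> P $ m \<and> P $ m \<le> x $ m + 1 else P $ m = of_int \<lceil>x $ m\<rceil>"
proof -
  define E where "E n = 1 / real (Suc n)" for n
  have E: "0 < E n" "E n \<le> 1" for n by (simp_all add: E_def)
  have E0: "E \<longlonglongrightarrow> 0" unfolding E_def by (rule LIMSEQ_Suc[OF lim_1_over_n])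
  have "\<exists>x. cmb f x = \<theta> \<and> cmb v (\<chi> m. stair (E n) (x $ m)) = y" for n
    using stair_solution[OF E] by metis
  then obtain X where X: "\<And>n. cmb f (X n) = \<theta>" "\<And>n. cmb v (\<chi> m. stair (E n) (X n $ m)) = y"
    by metis
  define S where "S n = (\<chi> m. stair (E n) (X n $ m))" for n
  have SX: "norm (S n - X n) \<le> 4" for n
  proof -
    have "norm (S n - X n) \<le> (\<Sum>m\<in>(UNIV :: 4 set). 1)"
      by (intro order_trans[OF norm_le_l1_cart] sum_mono) (simp add: S_def stair_bounds(3)[OF E(1)])
    then show ?thesis by simp
  qed
  obtain \<eta> \<mu> where em: "0 < \<eta>" "0 < \<mu>"
    "\<And>f' d. (\<And>i. norm (f' i - f i) < \<eta>) \<Longrightarrow> \<mu> * norm d \<le> norm (cmb f' d) + norm (cmb v d)"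
    using cmb_pair_bound_perturbed by blast
  let ?V = "\<Sum>i\<in>UNIV. norm (v i)"
  have Xb: "norm (X n) \<le> (norm \<theta> + (norm y + ?V * 4)) / \<mu>" for n
  proof -
    have "norm (cmb v (S n - X n)) \<le> ?V * 4"
      using norm_cmb_le[of v "S n - X n"] mult_left_mono[OF SX[of n], of ?V] by (simp add: sum_nonneg)
    then have "norm (cmb v (X n)) \<le> norm y + ?V * 4"
      using norm_triangle_ineq4[of y "cmb v (S n - X n)"] X(2)[of n]
      by (simp add: cmb_diff S_def)
    then show ?thesis
      using em(3)[of f "X n"] em(1,2) X(1)[of n] by (simp add: field_simps)
  qed
  have "bounded (range X)" using Xb unfolding bounded_iff by auto
  moreover have "norm (S n) \<le> (norm \<theta> + (norm y + ?V * 4)) / \<mu> + 4" for n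
    using norm_triangle_ineq[of "X n" "S n - X n"] Xb[of n] SX[of n] by simp
  then have "bounded (range S)" unfolding bounded_iff by auto
  ultimately have "bounded (range (\<lambda>n. (X n, S n)))"
    by (rule bounded_subset[OF bounded_Times]) auto
  then obtain l r where r: "strict_mono r" "((\<lambda>n. (X n, S n)) \<circ> r) \<longlonglongrightarrow> l"
    using bounded_imp_convergent_subsequence by blast
  define x P where "x = fst l" and "P = snd l"
  have lim: "(\<lambda>n. X (r n)) \<longlonglongrightarrow> x" "(\<lambda>n. S (r n)) \<longlonglongrightarrow> P"
    using tendsto_fst[OF r(2)] tendsto_snd[OF r(2)] by (simp_all add: x_def P_def comp_def)
  have "(\<lambda>n. cmb f (X (r n))) \<longlonglongrightarrow> cmb f x" "(\<lambda>n. cmb v (S (r n))) \<longlonglongrightarrow> cmb v P"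
    using lim by (auto intro!: tendsto_intros)
  then have "cmb f x = \<theta>" "cmb v P = y"
    using X by (simp_all add: S_def LIMSEQ_const_iff)
  moreover have "if x $ m \<in> \<int> then x $ m \<le> P $ m \<and> P $ m \<le> x $ m + 1 else P $ m = of_int \<lceil>x $ m\<rceil>" for m
  proof (rule stair_limit)
    show "(\<lambda>n. X (r n) $ m) \<longlonglongrightarrow> x $ m" using lim(1) by (rule tendsto_vec_nth)
    show "(\<lambda>n. stair ((E \<circ> r) n) (X (r n) $ m)) \<longlonglongrightarrow> P $ m"
      using tendsto_vec_nth[OF lim(2), of m] by (simp add: S_def)
    show "(E \<circ> r) \<longlonglongrightarrow> 0" using E0 r(1) by (rule LIMSEQ_subseq_LIMSEQ)
    show "0 < (E \<circ> r) n" for n using E by simp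
  qed
  ultimately show ?thesis by (rule that)
qed

text \<open>General position of \<open>y\<close> forces two noninteger coordinates of
  \<open>P\<close>, hence two integer coordinates of \<open>x\<close>; genericity of the plane
  forbids a third. So the solution lies on a two-dimensional face.\<close>

lemma generic_cover_aux:
  assumes g: "generic f \<theta>"
    and y: "\<And>H i. det2 (v i) (y - cmb v (rv H)) \<noteq> 0"
  shows "\<exists>\<phi>\<in>faces f (sgp f \<theta> 0). y \<in> tile_of v \<phi>"
proof -
  obtain x P where x: "cmb f x = \<theta>" and P: "cmb v P = y"
    and xP: "\<And>m. if x $ m \<in> \<int> then x $ m \<le> P $ m \<and> P $ m \<le> x $ m + 1 else P $ m = of_int \<lceil>x $ m\<rceil>"
    using limit_solution by blast
  have three: False if "distinct [i, j, k, l]" "x $ i \<in> \<int>" "x $ j \<in> \<int>" "x $ k \<in> \<int>" for i j k l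
  proof -
    define n :: "int ^ 4" where "n = (\<chi> m. \<lfloor>x $ m\<rfloor>)"
    have "\<forall>m. m \<noteq> l \<longrightarrow> (rv n - x) $ m = 0"
      unfolding all_distinct4[OF that(1)] using that by (auto simp: n_def of_int_floor)
    then have "rv n - x = axis l ((rv n - x) $ l)"
      unfolding vec_eq_iff axis_def by auto
    then have "cmb f (rv n) - \<theta> = ((rv n - x) $ l) *\<^sub>R f l"
      by (metis cmb_axis cmb_diff x)
    then have "gap f \<theta> l n = 0" by (simp add: gap_def det2_linear)
    with g show False by (simp add: generic_def)
  qed
  have two: "\<exists>i. i \<noteq> j \<and> P $ i \<notin> \<int>" for j
  proof (rule ccontr)
    assume "\<not> ?thesis"
    then have PZ: "P $ m \<in> \<int>" if "m \<noteq> j" for m using that by blast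
    define Z :: "int ^ 4" where "Z = (\<chi> m. \<lfloor>P $ m\<rfloor>)"
    have "(P - rv Z) $ m = axis j ((P - rv Z) $ j) $ m" for m
    proof (cases "m = j")
      case False
      then show ?thesis using PZ[OF False] by (simp add: Z_def axis_def of_int_floor)
    qed (simp add: axis_def)
    then have "P - rv Z = axis j ((P - rv Z) $ j)"
      unfolding vec_eq_iff by blast
    then have "y - cmb v (rv Z) = ((P - rv Z) $ j) *\<^sub>R v j"
      by (metis cmb_axis cmb_diff P)
    then show False using y[of j Z] by (simp add: det2_linear)
  qed
  obtain i j where ij: "i \<noteq> j" "P $ i \<notin> \<int>" "P $ j \<notin> \<int>"
    using two by metis
  then have xi: "x $ i \<in> \<int>" "x $ j \<in> \<int>"
    using xP[of i] xP[of j] by (auto split: if_splits)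
  obtain k0 l0 where d0: "distinct [i, j, k0, l0]" using four_complement[OF ij(1)] .
  have nint: "x $ m \<notin> \<int>" if m: "m \<noteq> i" "m \<noteq> j" for m
  proof
    assume xm: "x $ m \<in> \<int>"
    obtain l where "l \<notin> {i, j, m}"
      using d0 m UNIV_distinct4[OF d0] by (metis distinct_length_2_or_more insert_iff singletonD)
    then show False using three[of i j m l] m ij(1) xi xm by auto
  qed
  define H :: "int ^ 4" where "H = (\<chi> m. \<lceil>x $ m\<rceil>)"
  have Hij: "of_int (H $ i) = x $ i" "of_int (H $ j) = x $ j"
    using xi by (auto simp: H_def elim!: Ints_cases)
  have Hm: "of_int (H $ m) - 1 < x $ m \<and> x $ m < of_int (H $ m)" if m: "m \<noteq> i" "m \<noteq> j" for m
  proof -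
    have "x $ m \<noteq> of_int \<lceil>x $ m\<rceil>" using nint[OF m] by (metis Ints_of_int)
    then show ?thesis unfolding H_def by (simp) linarith
  qed
  have "P \<in> face H i j"
    unfolding face_def
  proof safe
    fix m
    show "if m = i \<or> m = j then real_of_int (H $ m) \<le> P $ m \<and> P $ m \<le> real_of_int (H $ m) + 1
         else P $ m = real_of_int (H $ m)"
      using xP[of m] xi Hij nint[of m] by (auto simp: H_def)
  qed
  moreover have "(H, i, j) \<in> faces f (sgp f \<theta> 0)"
    unfolding faces_def mem_Collect_eq prod.case
  proof (intro conjI allI impI)
    show "i \<noteq> j" by fact
    fix k l assume d: "distinct [i, j, k, l]"
    define s t where "s = (rv H - x) $ k" and "t = (rv H - x) $ l"
    have s: "0 < s" "s < 1" using Hm[of k] d by (auto simp: s_def)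
    have "\<forall>m. (rv H - x) $ m = (axis k s + axis l t) $ m"
      unfolding all_distinct4[OF d] using d Hij by (auto simp: s_def t_def axis_def)
    then have "rv H - x = axis k s + axis l t" unfolding vec_eq_iff .
    then have "cmb f (rv H) - \<theta> = s *\<^sub>R f k + t *\<^sub>R f l"
      by (metis cmb_add cmb_axis cmb_diff x)
    then have gap: "gap f \<theta> l H = s * det2 (f l) (f k)" by (simp add: gap_def det2_linear)
    have gap': "gap f \<theta> l (H - axis k 1) = (s - 1) * det2 (f l) (f k)"
      unfolding gap_diff_axis gap by (simp add: algebra_simps)
    have "det2 (f l) (f k) \<noteq> 0" using f_indep[of l k] d by auto
    then show "sgp f \<theta> 0 l H = (0 < det2 (f l) (f k))"
      "sgp f \<theta> 0 l (H - axis k 1) \<noteq> (0 < det2 (f l) (f k))"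
      unfolding sgp_def gap gap' using s by (auto simp: zero_less_mult_iff)
  qed
  ultimately show ?thesis using P tile_of_face by blast
qed

text \<open>Points in general position are dense, and a locally finite union of closed tiles is
  closed.\<close>

lemma generic_cover:
  assumes g: "generic f \<theta>"
  shows "\<exists>\<phi>\<in>faces f (sgp f \<theta> 0). y \<in> tile_of v \<phi>"
proof -
  let ?FF = "faces f (sgp f \<theta> 0)"
  obtain \<eta> \<mu> where em: "0 < \<eta>" "0 < \<mu>"
    "\<And>f' d. (\<And>i. norm (f' i - f i) < \<eta>) \<Longrightarrow> \<mu> * norm d \<le> norm (cmb f' d) + norm (cmb v d)"
    using cmb_pair_bound_perturbed by blast
  have \<mu>: "\<mu> * norm d \<le> norm (cmb f d) + norm (cmb v d)" for d using em(1,3) by simp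
  have "closed (\<Union>\<phi>\<in>?FF. tile_of v \<phi>)"
  proof (rule closed_Union_locally_finite)
    fix \<phi> assume "\<phi> \<in> ?FF"
    then show "closed (tile_of v \<phi>)"
      by (auto simp: tile_of_def faces_def intro!: closed_parallelogram v_indep)
  next
    fix y
    show "finite {\<phi> \<in> ?FF. tile_of v \<phi> \<inter> ball y 1 \<noteq> {}}"
      by (rule finite_subset[OF _ finite_faces_near[OF \<mu> em(2) generic_near[OF g], where FF = ?FF and y = y and R = 1]])
        (auto simp: subset_iff less_imp_le)
  qed
  moreover have "- (\<Union>b. {y. det2 (v (snd b)) (y - cmb v (rv (fst b))) = 0}) \<subseteq> (\<Union>\<phi>\<in>?FF. tile_of v \<phi>)"
  proof
    fix y assume "y \<in> - (\<Union>b. {y. det2 (v (snd b)) (y - cmb v (rv (fst b))) = 0})"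
    then have "det2 (v (snd b)) (y - cmb v (rv (fst b))) \<noteq> 0" for b by blast
    from this[of "(_, _)"] have "det2 (v i) (y - cmb v (rv H)) \<noteq> 0" for H i by simp
    from generic_cover_aux[OF g this] show "y \<in> (\<Union>\<phi>\<in>?FF. tile_of v \<phi>)" by blast
  qed
  moreover have "closure (- (\<Union>b. {y. det2 (v (snd b)) (y - cmb v (rv (fst b))) = 0})) = UNIV"
  proof (rule dense_compl_countable_segments)
    fix b :: "(int ^ 4) \<times> 4"
    show "v (snd b) \<noteq> 0"
      using v_indep[of "snd b" "snd b + 1"] by auto
  qed
  ultimately have "UNIV \<subseteq> (\<Union>\<phi>\<in>?FF. tile_of v \<phi>)"
    using closure_minimal by (metis (no_types, lifting))
  then show ?thesis by blast
qed

end

section \<open>Tilings that are locally generic\<close>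

text \<open>The midpoint of two points of the edge lies on a side, since an edge through the
  interior would be everything. That side contains both points, and two one-dimensional faces with a
  common segment coincide.\<close>

lemma edge_of_parallelogram_is_side:
  assumes d: "det2 a b \<noteq> 0" and F: "F edge_of parallelogram x a b"
  shows "\<exists>\<mu>. (\<mu> = 0 \<or> \<mu> = (1 :: real)) \<and>
    (F = closed_segment (x + \<mu> *\<^sub>R b) (x + \<mu> *\<^sub>R b + a) \<or>
     F = closed_segment (x + \<mu> *\<^sub>R a) (x + \<mu> *\<^sub>R a + b))"
proof -
  let ?S = "parallelogram x a b"
  have Ff: "F face_of ?S" and dim: "aff_dim F = 1" using F by (auto simp: edge_of_def)
  have cF: "convex F" using Ff by (rule face_of_imp_convex)
  have "F \<noteq> {}" using dim by auto
  then obtain p where p: "p \<in> F" by blast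
  have "F \<noteq> {p}" using dim by auto
  with p obtain q where q: "q \<in> F" "q \<noteq> p" by blast
  define z where "z = midpoint p q"
  have zF: "z \<in> F" using p q(1) cF midpoint_in_closed_segment[of p q]
    unfolding z_def convex_contains_segment by blast
  have zo: "z \<in> open_segment p q" using q(2) by (simp add: z_def)
  have FS: "F \<subseteq> ?S" using Ff by (rule face_of_imp_subset)
  obtain l m where z: "z = x + l *\<^sub>R a + m *\<^sub>R b" and lm: "0 \<le> l" "l \<le> 1" "0 \<le> m" "m \<le> 1"
    using FS zF unfolding parallelogram_def by blast
  have not_interior: "l = 0 \<or> l = 1 \<or> m = 0 \<or> m = 1"
  proof (rule ccontr)
    assume "\<not> ?thesis"
    then have "F = ?S"
      using face_through_interior[OF d Ff, of l m] zF lm unfolding z by force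
    then show False using dim aff_dim_parallelogram[OF d, of x] by simp
  qed
  have eq: "F = G" if G: "G edge_of ?S" and zG: "z \<in> G" for G
  proof -
    have Gf: "G face_of ?S" and Gdim: "aff_dim G = 1" using G by (auto simp: edge_of_def)
    have "p \<in> G" "q \<in> G" using Gf zG zo p q(1) FS unfolding face_of_def by blast+
    then have "{p, q} \<subseteq> F \<inter> G" using p q by blast
    then have "1 \<le> aff_dim (F \<inter> G)" using aff_dim_subset[of "{p, q}" "F \<inter> G"] q(2) by (simp add: aff_dim_2)
    moreover have FG: "F \<inter> G face_of ?S" using Ff Gf by (rule face_of_Int)
    have "F \<inter> G face_of F" "F \<inter> G face_of G"
      using face_of_subset[OF FG] FS face_of_imp_subset[OF Gf] by auto
    ultimately have "F \<inter> G = F" "F \<inter> G = G"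
      using face_of_aff_dim_lt[of F "F \<inter> G"] face_of_aff_dim_lt[of G "F \<inter> G"] cF
        face_of_imp_convex[OF Gf] dim Gdim by fastforce+
    then show ?thesis by simp
  qed
  have d': "det2 b a \<noteq> 0" using d det2_commute[of b a] by simp
  show ?thesis
  proof (cases "m = 0 \<or> m = 1")
    case True
    have "z = (1 - l) *\<^sub>R (x + m *\<^sub>R b) + l *\<^sub>R (x + m *\<^sub>R b + a)" by (simp add: z algebra_simps)
    then have "z \<in> closed_segment (x + m *\<^sub>R b) (x + m *\<^sub>R b + a)"
      using lm unfolding closed_segment_def by blast
    then show ?thesis using eq[OF side_edge_of_parallelogram[OF d True]] True by blast
  next
    case False
    then have l: "l = 0 \<or> l = 1" using not_interior by blast
    have "z = (1 - m) *\<^sub>R (x + l *\<^sub>R a) + m *\<^sub>R (x + l *\<^sub>R a + b)" by (simp add: z algebra_simps)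
    then have "z \<in> closed_segment (x + l *\<^sub>R a) (x + l *\<^sub>R a + b)"
      using lm unfolding closed_segment_def by blast
    then show ?thesis
      using eq[OF side_edge_of_parallelogram[OF d' l, of x, folded parallelogram_commute[of x a b]]] l by blast
  qed
qed

text \<open>Needed to read the lifted face off a tile. The sides recover the edge types, because no
  edge vector is plus or minus another; the base points agree because each has nonnegative
  coordinates relative to the other.\<close>

lemma parallelogram_eqD:
  fixes v :: "4 \<Rightarrow> real ^ 2"
  assumes v: "\<And>i j. i \<noteq> j \<Longrightarrow> det2 (v i) (v j) \<noteq> 0"
    and ij: "i \<noteq> j" "a \<noteq> b" and eq: "parallelogram x (v i) (v j) = parallelogram y (v a) (v b)"
  shows "x = y \<and> {i, j} = {a, b}"
proof -
  have par: "c = i" if "v i = v c \<or> v i = - v c" for c i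
    using that v[of i c] by (cases "c = i") (auto simp: det2_linear)
  have sub: "i = a \<or> i = b"
    if ij: "i \<noteq> j" and eq: "parallelogram x (v i) (v j) = parallelogram y (v a) (v b)" for i j
  proof -
    have "closed_segment x (x + v i) edge_of parallelogram y (v a) (v b)"
      using side_edge_of_parallelogram[OF v[OF ij], of 0 x] unfolding eq by simp
    then obtain \<mu> where "closed_segment x (x + v i) = closed_segment (y + \<mu> *\<^sub>R v b) (y + \<mu> *\<^sub>R v b + v a) \<or>
        closed_segment x (x + v i) = closed_segment (y + \<mu> *\<^sub>R v a) (y + \<mu> *\<^sub>R v a + v b)"
      using edge_of_parallelogram_is_side[OF v[OF \<open>a \<noteq> b\<close>]] by blast
    moreover have "c = i" if "closed_segment x (x + v i) = closed_segment w (w + v c)" for w c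
    proof -
      have "{x, x + v i} = {w, w + v c}" using that by (simp add: closed_segment_eq)
      then consider "x = w" "x + v i = w + v c" | "x = w + v c" "x + v i = w"
        unfolding doubleton_eq_iff by blast
      then have "v i = v c \<or> v i = - v c"
      proof cases
        case 2
        then have "w + (v c + v i) = w" by (simp add: add.assoc)
        then show ?thesis by (simp add: eq_neg_iff_add_eq_0 add.commute)
      qed simp
      then show ?thesis by (rule par)
    qed
    ultimately show ?thesis by blast
  qed
  have "i = a \<or> i = b" using sub[OF ij(1) eq] .
  moreover have "j = a \<or> j = b"
    using sub[of j i] ij(1) eq parallelogram_commute by metis
  ultimately have s: "{i, j} = {a, b}" using ij by auto
  then have eq': "parallelogram x (v i) (v j) = parallelogram y (v i) (v j)"
    using eq ij parallelogram_commute[of y "v a" "v b"] by (auto simp only: doubleton_eq_iff)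
  have base: "z \<in> parallelogram z (v i) (v j)" for z
    unfolding parallelogram_def by (auto intro!: exI[of _ 0])
  have d: "det2 (v i) (v j) \<noteq> 0" using v ij by blast
  have "0 \<le> det2 (v i) (x - y) / det2 (v i) (v j)" "0 \<le> det2 (v j) (x - y) / det2 (v j) (v i)"
    "0 \<le> det2 (v i) (y - x) / det2 (v i) (v j)" "0 \<le> det2 (v j) (y - x) / det2 (v j) (v i)"
    using base[of x] base[of y] eq' mem_parallelogram_iff[OF d] by blast+
  then have "det2 (v i) (x - y) / det2 (v i) (v j) = 0" "det2 (v j) (x - y) / det2 (v j) (v i) = 0"
    by (simp_all add: det2_diff_right diff_divide_distrib)
  then have "x - y = 0" using det2_cramer[OF d, of "x - y"] by (simp only: scaleR_zero_left add_0_left)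
  with s show ?thesis by simp
qed

section \<open>Local patterns of systems of faces\<close>

definition patch :: "((int ^ 4) \<times> 4 \<times> 4) set \<Rightarrow> int ^ 4 \<Rightarrow> real \<Rightarrow> ((int ^ 4) \<times> 4 \<times> 4) set" where
  "patch FF H R = {(m, i, j). norm (rv m) \<le> R \<and> (H + m, i, j) \<in> FF}"

lemma patch_eqD:
  assumes "patch FF H R = patch FF' H' R" "norm (rv m) \<le> R"
  shows "(H + m, i, j) \<in> FF \<longleftrightarrow> (H' + m, i, j) \<in> FF'"
  using assms unfolding patch_def by blast

text \<open>One more unit of radius is required since a face at \<open>H\<close> also reads the
  signs at \<open>H - axis k 1\<close>.\<close>

lemma patch_faces_cong:
  assumes "\<And>l m. norm (rv m) \<le> R + 1 \<Longrightarrow> \<tau> l (H + m) = \<tau>' l (H' + m)"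
  shows "patch (faces f \<tau>) H R = patch (faces f \<tau>') H' R"
proof -
  have "norm (axis k 1 :: real ^ 4) = 1" for k
    by (rule norm_Basis) (simp add: axis_in_Basis_iff)
  then have "norm (rv (m - axis k 1)) \<le> norm (rv m) + 1" for m k
    using norm_triangle_ineq4[of "rv m" "axis k 1"] by (simp add: rv_diff)
  then have "norm (rv m) \<le> R \<Longrightarrow> norm (rv (m - axis k 1)) \<le> R + 1" for m k
    by (smt (verit))
  then have "\<tau> l (H + m - axis k 1) = \<tau>' l (H' + m - axis k 1)" "\<tau> l (H + m) = \<tau>' l (H' + m)"
    if "norm (rv m) \<le> R" for l k m
    using assms[of "m - axis k 1" l] assms[of m l] that by (simp_all add: add_diff_eq)
  then show ?thesis unfolding patch_def faces_def by auto
qed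

lemma face_common_vertex:
  assumes "P \<in> face H i j" "P \<in> face H' i' j'"
  obtains Q where "rv Q \<in> face H i j" "rv Q \<in> face H' i' j'"
proof -
  define Q :: "int ^ 4" where "Q = (\<chi> m. \<lfloor>P $ m\<rfloor>)"
  have *: "rv Q \<in> face K a b" if "P \<in> face K a b" for K a b
    unfolding face_def mem_Collect_eq
  proof
    fix m
    show "if m = a \<or> m = b then real_of_int (K $ m) \<le> rv Q $ m \<and> rv Q $ m \<le> real_of_int (K $ m) + 1
         else rv Q $ m = real_of_int (K $ m)"
    proof (cases "m = a \<or> m = b")
      case True
      then have "real_of_int (K $ m) \<le> P $ m" "P $ m \<le> real_of_int (K $ m) + 1"
        using that unfolding face_def by auto
      then have "K $ m \<le> \<lfloor>P $ m\<rfloor>" "\<lfloor>P $ m\<rfloor> \<le> K $ m + 1" by linarith+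
      with True show ?thesis by (simp add: Q_def)
    next
      case False
      then have "P $ m = real_of_int (K $ m)" using that unfolding face_def by auto
      with False show ?thesis by (simp add: Q_def)
    qed
  qed
  show ?thesis using *[OF assms(1)] *[OF assms(2)] by (rule that)
qed

context chart
begin

lemma closed_face_base:
  assumes F: "(H, i, j) \<in> faces f (sgp f \<theta> \<delta>)"
  obtains x where "cmb f x = \<theta>" "x $ i = of_int (H $ i)" "x $ j = of_int (H $ j)"
    "\<And>m. m \<noteq> i \<Longrightarrow> m \<noteq> j \<Longrightarrow> of_int (H $ m) - 1 \<le> x $ m \<and> x $ m \<le> of_int (H $ m)"
proof -
  have "i \<noteq> j" using F by (simp add: faces_def)
  then obtain k l where d: "distinct [i, j, k, l]" using four_complement by blast
  then have d': "distinct [i, j, l, k]" by auto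
  have *: "0 \<le> gap f \<theta> l H / det2 (f l) (f k) \<and> gap f \<theta> l H / det2 (f l) (f k) \<le> 1"
    if "distinct [i, j, k, l]" for k l
  proof -
    have "sgp f \<theta> \<delta> l H = (0 < det2 (f l) (f k))"
      "sgp f \<theta> \<delta> l (H - axis k 1) \<noteq> (0 < det2 (f l) (f k))"
      using F that unfolding faces_def by auto
    moreover have "det2 (f l) (f k) \<noteq> 0" using f_indep[of l k] that by auto
    ultimately show ?thesis
      unfolding sgp_def gap_diff_axis by (cases "0 < det2 (f l) (f k)") (auto simp: field_simps)
  qed
  define s t where "s = gap f \<theta> l H / det2 (f l) (f k)" and "t = gap f \<theta> k H / det2 (f k) (f l)"
  define x where "x = rv H - axis k s - axis l t"
  have "cmb f (rv H) - \<theta> = s *\<^sub>R f k + t *\<^sub>R f l"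
    using det2_cramer[of "f k" "f l"] f_indep[of k l] d unfolding s_def t_def gap_def by auto
  then have "cmb f x = \<theta>" by (simp add: x_def cmb_diff cmb_add algebra_simps)
  moreover have "x $ i = of_int (H $ i)" "x $ j = of_int (H $ j)"
    using d by (auto simp: x_def axis_def)
  moreover have "of_int (H $ m) - 1 \<le> x $ m \<and> x $ m \<le> of_int (H $ m)" if "m \<noteq> i" "m \<noteq> j" for m
  proof -
    have "m = k \<or> m = l" using UNIV_distinct4[OF d] that by blast
    then show ?thesis
      using *[OF d] *[OF d'] d by (auto simp: x_def axis_def s_def t_def)
  qed
  ultimately show ?thesis by (rule that)
qed

lemma closed_near:
  assumes "(H, i, j) \<in> faces f (sgp f \<theta> \<delta>)"
  shows "norm (cmb f (rv H) - \<theta>) \<le> 4 * (\<Sum>i\<in>UNIV. norm (f i))"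
proof -
  obtain x where x: "cmb f x = \<theta>" "x $ i = of_int (H $ i)" "x $ j = of_int (H $ j)"
    "\<And>m. m \<noteq> i \<Longrightarrow> m \<noteq> j \<Longrightarrow> of_int (H $ m) - 1 \<le> x $ m \<and> x $ m \<le> of_int (H $ m)"
    using closed_face_base[OF assms] by blast
  have "\<bar>(rv H - x) $ m\<bar> \<le> 1" for m
    using x(2,3) x(4)[of m] by (cases "m = i"; cases "m = j") auto
  then have "norm (rv H - x) \<le> (\<Sum>m\<in>(UNIV :: 4 set). 1)"
    by (intro order_trans[OF norm_le_l1_cart] sum_mono) auto
  then have "norm (rv H - x) \<le> 4" by simp
  then have "norm (cmb f (rv H - x)) \<le> (\<Sum>i\<in>UNIV. norm (f i)) * 4"
    using norm_cmb_le[of f "rv H - x"] mult_left_mono[of "norm (rv H - x)" 4 "\<Sum>i\<in>UNIV. norm (f i)"]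
    by (simp add: sum_nonneg)
  then show ?thesis by (simp add: cmb_diff x(1))
qed

lemma closed_face_in_tube:
  assumes F: "(H, i, j) \<in> faces f (sgp f \<theta> \<delta>)" and P: "P \<in> face H i j"
  obtains x y where "P = x + y" "cmb f x = \<theta>" "\<And>m. 0 \<le> y $ m \<and> y $ m \<le> 1"
proof -
  obtain x where x: "cmb f x = \<theta>" "x $ i = of_int (H $ i)" "x $ j = of_int (H $ j)"
    "\<And>m. m \<noteq> i \<Longrightarrow> m \<noteq> j \<Longrightarrow> of_int (H $ m) - 1 \<le> x $ m \<and> x $ m \<le> of_int (H $ m)"
    using closed_face_base[OF F] by blast
  have "0 \<le> (P - x) $ m \<and> (P - x) $ m \<le> 1" for m
  proof (cases "m = i \<or> m = j")
    case True
    then have "of_int (H $ m) \<le> P $ m" "P $ m \<le> of_int (H $ m) + 1" using P unfolding face_def by auto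
    then show ?thesis using True x(2,3) by auto
  next
    case False
    then have "P $ m = of_int (H $ m)" using P unfolding face_def by auto
    then show ?thesis using False x(4)[of m] by auto
  qed
  then show ?thesis using x(1) by (intro that[of x "P - x"]) auto
qed

text \<open>For finitely many points, breaking ties by \<open>\<delta>\<close> amounts to moving the
  plane by a small multiple of \<open>\<delta>\<close>; only countably many multiples lead to a
  plane that is not generic.\<close>

lemma locally_generic:
  assumes \<delta>: "\<And>l. det2 (f l) \<delta> \<noteq> 0"
  shows "\<exists>\<theta>'. generic f \<theta>' \<and> patch (faces f (sgp f \<theta> \<delta>)) H R = patch (faces f (sgp f \<theta>' 0)) H R"
proof -
  define M where "M = {m. norm (rv m) \<le> R + 1}"
  have finM: "finite M" unfolding M_def by (rule finite_rv_bounded)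
  have "\<forall>\<^sub>F e in at_right (0 :: real). \<forall>l\<in>UNIV. \<forall>m\<in>M.
      sgp f \<theta> \<delta> l (H + m) = (0 < gap f \<theta> l (H + m) + e * det2 (f l) \<delta>)"
  proof (intro eventually_ball_finite finM finite ballI)
    fix l m
    let ?g = "gap f \<theta> l (H + m)" and ?d = "det2 (f l) \<delta>"
    have pos: "\<forall>\<^sub>F e in at_right (0 :: real). 0 < e" by (simp add: eventually_at_right_less)
    show "\<forall>\<^sub>F e in at_right (0 :: real). sgp f \<theta> \<delta> l (H + m) = (0 < ?g + e * ?d)"
    proof (cases "?g = 0")
      case True
      show ?thesis using pos by eventually_elim (auto simp: sgp_def True zero_less_mult_iff)
    next
      case False
      have "((\<lambda>e. ?g + e * ?d) \<longlongrightarrow> ?g + 0 * ?d) (at_right 0)" by (intro tendsto_intros)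
      then have lim: "((\<lambda>e. ?g + e * ?d) \<longlongrightarrow> ?g) (at_right 0)" by simp
      show ?thesis
      proof (cases "?g > 0")
        case True
        show ?thesis using order_tendstoD(1)[OF lim True] by eventually_elim (use True in \<open>auto simp: sgp_def\<close>)
      next
        case False
        with \<open>?g \<noteq> 0\<close> have "?g < 0" by simp
        show ?thesis using order_tendstoD(2)[OF lim \<open>?g < 0\<close>]
          by eventually_elim (use \<open>?g < 0\<close> in \<open>auto simp: sgp_def\<close>)
      qed
    qed
  qed
  then obtain b where b: "0 < b" "\<And>e l m. 0 < e \<Longrightarrow> e < b \<Longrightarrow> m \<in> M \<Longrightarrow>
      sgp f \<theta> \<delta> l (H + m) = (0 < gap f \<theta> l (H + m) + e * det2 (f l) \<delta>)"
    unfolding eventually_at_right_field by auto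
  let ?bad = "range (\<lambda>(l, n). - gap f \<theta> l n / det2 (f l) \<delta>)"
  have "countable ?bad" by simp
  then have "\<not> {0<..<b} \<subseteq> ?bad"
    using b(1) uncountable_open_interval[of 0 b] countable_subset by blast
  then obtain e where "e \<in> {0<..<b}" and e3: "e \<notin> ?bad" by blast
  then have e: "0 < e" "e < b" by simp_all
  define \<theta>' where "\<theta>' = \<theta> - e *\<^sub>R \<delta>"
  have g: "gap f \<theta>' l n = gap f \<theta> l n + e * det2 (f l) \<delta>" for l n
    by (simp add: gap_def \<theta>'_def det2_linear)
  have "generic f \<theta>'"
    unfolding generic_def
  proof (intro allI notI)
    fix l n assume "gap f \<theta>' l n = 0"
    then have "e = - gap f \<theta> l n / det2 (f l) \<delta>" unfolding g using \<delta>[of l] by (simp add: field_simps)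
    then have "e \<in> ?bad" by (intro image_eqI[of _ _ "(l, n)"]) simp_all
    with e3 show False by blast
  qed
  moreover have "patch (faces f (sgp f \<theta> \<delta>)) H R = patch (faces f (sgp f \<theta>' 0)) H R"
  proof (rule patch_faces_cong)
    fix l m assume "norm (rv m) \<le> R + 1"
    then have "m \<in> M" by (simp add: M_def)
    then show "sgp f \<theta> \<delta> l (H + m) = sgp f \<theta>' 0 l (H + m)"
      using b(2)[OF e(1,2)] unfolding sgp_def[of f \<theta>'] g by simp
  qed
  ultimately show ?thesis by blast
qed

text \<open>Local agreement with generic tilings implies global tiling: two overlapping tiles lift to nearby
  faces because both stay near a plane on which \<open>cmb v\<close> is injective, and the covered set is open
  and closed.\<close>

lemma locally_generic_tiling:
  fixes FF :: "((int ^ 4) \<times> 4 \<times> 4) set"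
  assumes \<mu>: "0 < \<mu>" "\<And>d. \<mu> * norm d \<le> norm (cmb f' d) + norm (cmb v d)"
      "\<And>d. \<mu> * norm d \<le> norm (cmb f d) + norm (cmb v d)"
    and near: "\<And>H i j. (H, i, j) \<in> FF \<Longrightarrow> norm (cmb f' (rv H) - \<theta>') \<le> C"
    and loc: "\<And>H i j. (H, i, j) \<in> FF \<Longrightarrow>
      \<exists>\<theta>. generic f \<theta> \<and> patch FF H R = patch (faces f (sgp f \<theta> 0)) H R"
    and C: "4 * (\<Sum>i\<in>UNIV. norm (f i)) \<le> C"
    and R: "2 * C + 4 * (\<Sum>i\<in>UNIV. norm (v i)) + 1 \<le> \<mu> * R"
    and ne: "FF \<noteq> {}"
  shows "octagonal_tiling v (tile_of v ` FF)"
    and "\<And>H i j H' i' j' P P'. (H, i, j) \<in> FF \<Longrightarrow> (H', i', j') \<in> FF \<Longrightarrow> P \<in> face H i j \<Longrightarrow>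
      P' \<in> face H' i' j' \<Longrightarrow> cmb v P = cmb v P' \<Longrightarrow> P = P'"
proof -
  have C0: "0 \<le> C" using C order_trans[OF _ C, of 0] by (simp add: sum_nonneg)
  have V0: "0 \<le> (\<Sum>i\<in>UNIV. norm (v i))" by (simp add: sum_nonneg)
  have ij: "i \<noteq> j" if F: "(H, i, j) \<in> FF" for H i j
  proof -
    obtain \<theta> where "patch FF H R = patch (faces f (sgp f \<theta> 0)) H R" using loc[OF F] by blast
    moreover have "norm (rv 0) \<le> R"
    proof -
      have "0 \<le> \<mu> * R" using R C0 V0 by linarith
      then show ?thesis using \<mu>(1) by (simp add: zero_le_mult_iff)
    qed
    ultimately have "(H, i, j) \<in> faces f (sgp f \<theta> 0)" using patch_eqD[of FF H R _ H 0] F by auto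
    then show ?thesis by (simp add: faces_def)
  qed
  have tile: "tile_of v (H, i, j) = cmb v ` face H i j" if "(H, i, j) \<in> FF" for H i j
    using ij[OF that] by (simp add: tile_of_def parallelogram_conv_face)
  \<comment> \<open>The purpose of \<open>R\<close>: faces whose tiles are at distance at most 1 lie
    in each other's patch.\<close>
  have close: "norm (rv (H' - H)) \<le> R"
    if "(H, i, j) \<in> FF" "(H', i', j') \<in> FF" "y \<in> tile_of v (H, i, j)" "y' \<in> tile_of v (H', i', j')"
      "dist y' y \<le> 1" for H i j H' i' j' y y'
  proof -
    have "\<mu> * norm (rv (H' - H)) \<le> \<mu> * R"
      using near_plane_bound[OF \<mu>(2) near[OF that(2)] near[OF that(1)] that(4,3,5)] R by linarith
    then show ?thesis using \<mu>(1) by simp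
  qed
  have common: "\<exists>\<theta>. generic f \<theta> \<and> (H, i, j) \<in> faces f (sgp f \<theta> 0) \<and> (H', i', j') \<in> faces f (sgp f \<theta> 0)"
    if F: "(H, i, j) \<in> FF" "(H', i', j') \<in> FF" and y: "y \<in> tile_of v (H, i, j)" "y \<in> tile_of v (H', i', j')"
    for H i j H' i' j' y
  proof -
    obtain \<theta> where g: "generic f \<theta>" and p: "patch FF H R = patch (faces f (sgp f \<theta> 0)) H R"
      using loc[OF F(1)] by blast
    have "norm (rv (H - H)) \<le> R" "norm (rv (H' - H)) \<le> R"
      using close[OF F(1) F(1) y(1) y(1)] close[OF F y] by simp_all
    then have "(H, i, j) \<in> faces f (sgp f \<theta> 0)" "(H', i', j') \<in> faces f (sgp f \<theta> 0)"
      using patch_eqD[OF p, of "H - H" i j] patch_eqD[OF p, of "H' - H" i' j'] F by simp_all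
    with g show ?thesis by blast
  qed
  show inj: "P = P'"
    if "(H, i, j) \<in> FF" "(H', i', j') \<in> FF" "P \<in> face H i j" "P' \<in> face H' i' j'" "cmb v P = cmb v P'"
    for H i j H' i' j' P P'
  proof -
    note T = that
    have "cmb v P \<in> tile_of v (H, i, j)"
      unfolding tile[OF T(1)] using T(3) by blast
    moreover have "cmb v P \<in> tile_of v (H', i', j')"
      unfolding tile[OF T(2)] T(5) using T(4) by blast
    ultimately obtain \<theta> where "generic f \<theta>" "(H, i, j) \<in> faces f (sgp f \<theta> 0)" "(H', i', j') \<in> faces f (sgp f \<theta> 0)"
      using common[OF T(1,2)] by blast
    then show ?thesis using generic_inj T(3-5) by blast
  qed
  let ?U = "\<Union>\<phi>\<in>FF. tile_of v \<phi>"
  have "closed ?U"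
  proof (rule closed_Union_locally_finite)
    fix \<phi> assume "\<phi> \<in> FF"
    then show "closed (tile_of v \<phi>)"
      using ij by (cases \<phi>) (auto simp: tile_of_def intro!: closed_parallelogram v_indep)
  next
    fix y
    show "finite {\<phi> \<in> FF. tile_of v \<phi> \<inter> ball y 1 \<noteq> {}}"
      by (rule finite_subset[OF _ finite_faces_near[OF \<mu>(2,1) near, where FF = FF and y = y and R = 1]])
        (auto simp: subset_iff less_imp_le)
  qed
  \<comment> \<open>Points within distance 1 of a tile are covered by the locally agreeing generic
    tiling, and the covering face belongs to the common patch.\<close>
  moreover have "open ?U"
    unfolding open_dist
  proof
    fix y assume "y \<in> ?U"
    then obtain \<phi> where \<phi>: "\<phi> \<in> FF" "y \<in> tile_of v \<phi>" by blast
    obtain H i j where e: "\<phi> = (H, i, j)" by (metis prod_cases3)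
    have F: "(H, i, j) \<in> FF" "y \<in> tile_of v (H, i, j)" using \<phi> e by simp_all
    obtain \<theta> where g: "generic f \<theta>" and p: "patch FF H R = patch (faces f (sgp f \<theta> 0)) H R"
      using loc[OF F(1)] by blast
    have F': "(H, i, j) \<in> faces f (sgp f \<theta> 0)" using common[OF F(1) F(1) F(2) F(2)] p
      patch_eqD[OF p, of 0 i j] F close[OF F(1) F(1) F(2) F(2)] by simp
    have "z \<in> ?U" if z: "dist z y < 1" for z
    proof -
      obtain \<psi> where \<psi>: "\<psi> \<in> faces f (sgp f \<theta> 0)" "z \<in> tile_of v \<psi>"
        using generic_cover[OF g] by blast
      obtain H' i' j' where e': "\<psi> = (H', i', j')" by (metis prod_cases3)
      have G: "(H', i', j') \<in> faces f (sgp f \<theta> 0)" "z \<in> tile_of v (H', i', j')" using \<psi> e' by simp_all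
      have "\<mu> * norm (rv (H' - H)) \<le> 2 * C + 4 * (\<Sum>i\<in>UNIV. norm (v i)) + 1"
        using near_plane_bound[OF \<mu>(3) order_trans[OF generic_near[OF g G(1)] C]
            order_trans[OF generic_near[OF g F'] C] G(2) F(2)] z by simp
      then have "\<mu> * norm (rv (H' - H)) \<le> \<mu> * R" using R by linarith
      then have "norm (rv (H' - H)) \<le> R" using \<mu>(1) by simp
      then have "(H', i', j') \<in> FF" using patch_eqD[OF p, of "H' - H" i' j'] G(1) by simp
      then show ?thesis using G(2) by blast
    qed
    then show "\<exists>e>0. \<forall>z. dist z y < e \<longrightarrow> z \<in> ?U" by (intro exI[of _ 1]) auto
  qed
  moreover have "?U \<noteq> {}"
  proof -
    obtain H i j where F: "(H, i, j) \<in> FF" using ne by (metis equals0I prod_cases3)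
    have "rv H \<in> face H i j" by (simp add: face_def)
    then have "cmb v (rv H) \<in> tile_of v (H, i, j)" unfolding tile[OF F] by blast
    then show ?thesis using F by blast
  qed
  ultimately have U: "?U = UNIV" using clopen[of ?U] by blast
  show "octagonal_tiling v (tile_of v ` FF)"
    unfolding octagonal_tiling_def
  proof (intro conjI)
    show "tile_of v ` FF \<subseteq> tiles v"
      using ij unfolding tiles_def tile_of_def by fast
    show "\<Union> (tile_of v ` FF) = UNIV" using U by simp
    show "edge_to_edge (tile_of v ` FF)"
      unfolding edge_to_edge_def meet_nicely_def[symmetric]
    proof (intro ballI impI)
      fix S T assume "S \<in> tile_of v ` FF" "T \<in> tile_of v ` FF" and ne: "S \<noteq> T"
      then obtain \<phi> \<psi> where "\<phi> \<in> FF" "\<psi> \<in> FF" "S = tile_of v \<phi>" "T = tile_of v \<psi>" by blast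
      moreover obtain H i j where "\<phi> = (H, i, j)" by (metis prod_cases3)
      moreover obtain H' i' j' where "\<psi> = (H', i', j')" by (metis prod_cases3)
      ultimately have F: "(H, i, j) \<in> FF" "(H', i', j') \<in> FF"
        and ST: "S = cmb v ` face H i j" "T = cmb v ` face H' i' j'"
        using tile by simp_all
      show "meet_nicely S T"
        unfolding ST
        using ne inj[OF F] by (intro meet_nicely_faces[OF ij[OF F(1)] ij[OF F(2)] v_indep]) (auto simp: ST)
    qed
  qed
qed

end

section \<open>Consequences of weak local rules\<close>

definition shift :: "'a::plus \<Rightarrow> 'a set \<Rightarrow> 'a set" where
  "shift w S = (+) w ` S"

lemma tile_of_shift: "shift (cmb v (rv z)) (tile_of v (H, i, j)) = tile_of v (H + z, i, j)"
proof -
  have "cmb v (rv (H + z)) = cmb v (rv z) + cmb v (rv H)" by (simp add: rv_add cmb_add)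
  then show ?thesis by (simp only: shift_def tile_of_def parallelogram_translate prod.case)
qed

context chart
begin

lemma closed_tiling:
  assumes \<delta>: "\<And>l. det2 (f l) \<delta> \<noteq> 0"
    and \<mu>: "0 < \<mu>" "\<And>d. \<mu> * norm d \<le> norm (cmb f d) + norm (cmb v d)"
    and ne: "faces f (sgp f \<theta> \<delta>) \<noteq> {}"
  shows "octagonal_tiling v (tile_of v ` faces f (sgp f \<theta> \<delta>))"
    and "\<And>H i j H' i' j' P P'. (H, i, j) \<in> faces f (sgp f \<theta> \<delta>) \<Longrightarrow>
      (H', i', j') \<in> faces f (sgp f \<theta> \<delta>) \<Longrightarrow> P \<in> face H i j \<Longrightarrow>
      P' \<in> face H' i' j' \<Longrightarrow> cmb v P = cmb v P' \<Longrightarrow> P = P'"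
proof -
  let ?C = "4 * (\<Sum>i\<in>UNIV. norm (f i))"
  let ?R = "(2 * ?C + 4 * (\<Sum>i\<in>UNIV. norm (v i)) + 1) / \<mu>"
  note * = locally_generic_tiling[OF \<mu> \<mu>(2) closed_near, where FF = "faces f (sgp f \<theta> \<delta>)" and R = ?R]
  show "octagonal_tiling v (tile_of v ` faces f (sgp f \<theta> \<delta>))"
    using \<mu>(1) ne by (intro *(1) locally_generic[OF \<delta>]) auto
  show "P = P'" if F: "(H, i, j) \<in> faces f (sgp f \<theta> \<delta>)"
      "(H', i', j') \<in> faces f (sgp f \<theta> \<delta>)" "P \<in> face H i j"
      "P' \<in> face H' i' j'" "cmb v P = cmb v P'" for H i j H' i' j' P P'
    by (rule *(2)[OF _ _ _ _ _ F(1) F(2) F(3) F(4) F(5)])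
      (use \<mu>(1) ne locally_generic[OF \<delta>] in auto)
qed

lemma closed_tiling_planar:
  assumes \<delta>: "\<And>l. det2 (f l) \<delta> \<noteq> 0"
    and \<mu>: "0 < \<mu>" "\<And>d. \<mu> * norm d \<le> norm (cmb f d) + norm (cmb v d)"
    and ne: "faces f (sgp f \<theta> \<delta>) \<noteq> {}"
  shows "planar_tiling v {x. cmb f x = \<theta>} 1 (tile_of v ` faces f (sgp f \<theta> \<delta>))"
proof -
  let ?FF = "faces f (sgp f \<theta> \<delta>)"
  \<comment> \<open>Injectivity of \<open>cmb v\<close> on the union of the faces makes this
    preimage unique; it is the lift.\<close>
  define h where "h y = (SOME P. \<exists>H i j. (H, i, j) \<in> ?FF \<and> P \<in> face H i j \<and> cmb v P = y)" for y
  have h: "h (cmb v P) = P" if F: "(H, i, j) \<in> ?FF" "P \<in> face H i j" for P H i j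
  proof -
    have "\<exists>Q. \<exists>H i j. (H, i, j) \<in> ?FF \<and> Q \<in> face H i j \<and> cmb v Q = cmb v P" using F by blast
    from someI_ex[OF this] obtain H' i' j' where
      "(H', i', j') \<in> ?FF" "h (cmb v P) \<in> face H' i' j'" "cmb v (h (cmb v P)) = cmb v P"
      unfolding h_def by blast
    then show ?thesis using closed_tiling(2)[OF \<delta> \<mu> ne _ F(1) _ F(2)] by blast
  qed
  have ne_ij: "i \<noteq> j" if "(H, i, j) \<in> ?FF" for H i j using that by (simp add: faces_def)
  have tile: "\<exists>H a b. (H, a, b) \<in> ?FF \<and> x = cmb v (rv H) \<and> {i, j} = {a, b}"
    if ij: "i \<noteq> j" and T: "parallelogram x (v i) (v j) \<in> tile_of v ` ?FF" for x i j
  proof -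
    obtain \<phi> where \<phi>: "\<phi> \<in> ?FF" "parallelogram x (v i) (v j) = tile_of v \<phi>" using T by blast
    obtain H a b where e: "\<phi> = (H, a, b)" by (metis prod_cases3)
    have F: "(H, a, b) \<in> ?FF" using \<phi>(1) e by simp
    have "parallelogram x (v i) (v j) = parallelogram (cmb v (rv H)) (v a) (v b)"
      using \<phi>(2) e by (simp add: tile_of_def)
    then have "x = cmb v (rv H) \<and> {i, j} = {a, b}"
      using parallelogram_eqD[where v = v, OF v_indep ij ne_ij[OF F]] by blast
    with F show ?thesis by blast
  qed
  have face_sub: "rv H + axis i l + axis j m \<in> face H a b"
    if "i \<noteq> j" "{i, j} = {a, b}" "0 \<le> l" "l \<le> 1" "0 \<le> m" "m \<le> 1" for H i j a b l m
    unfolding face_def mem_Collect_eq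
  proof
    fix n
    have "(n = a \<or> n = b) \<longleftrightarrow> (n = i \<or> n = j)" using that(2) by (auto simp: doubleton_eq_iff)
    then show "if n = a \<or> n = b then real_of_int (H $ n) \<le> (rv H + axis i l + axis j m) $ n \<and>
          (rv H + axis i l + axis j m) $ n \<le> real_of_int (H $ n) + 1
        else (rv H + axis i l + axis j m) $ n = real_of_int (H $ n)"
      using that by (auto simp: axis_def)
  qed
  have "is_lift v (tile_of v ` ?FF) h"
    unfolding is_lift_def
  proof (intro allI impI)
    fix x i j
    assume "i \<noteq> j \<and> parallelogram x (v i) (v j) \<in> tile_of v ` ?FF"
    then have ij: "i \<noteq> j" and T: "parallelogram x (v i) (v j) \<in> tile_of v ` ?FF" by auto
    obtain H a b where F: "(H, a, b) \<in> ?FF" and x: "x = cmb v (rv H)" and s: "{i, j} = {a, b}"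
      using tile[OF ij T] by blast
    have hv: "h (x + l *\<^sub>R v i + m *\<^sub>R v j) = rv H + axis i l + axis j m"
      if "0 \<le> l" "l \<le> 1" "0 \<le> m" "m \<le> 1" for l m
      using h[OF F face_sub[OF ij s that]] by (simp add: cmb_add x)
    show "(\<forall>k. h x $ k \<in> \<int>) \<and> h (x + v i) = h x + axis i 1 \<and> h (x + v j) = h x + axis j 1 \<and>
       h (x + v i + v j) = h x + axis i 1 + axis j 1"
      using hv[of 0 0] hv[of 1 0] hv[of 0 1] hv[of 1 1] by (simp add: axis_def vec_eq_iff)
  qed
  moreover have "lift_surface v (tile_of v ` ?FF) h \<subseteq>
      {x + y |x y. x \<in> {x. cmb f x = \<theta>} \<and> (\<forall>k. 0 \<le> y $ k \<and> y $ k \<le> 1)}"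
  proof
    fix p assume "p \<in> lift_surface v (tile_of v ` ?FF) h"
    then obtain x i j where p: "p \<in> parallelogram (h x) (axis i 1) (axis j 1)" and ij: "i \<noteq> j"
      and T: "parallelogram x (v i) (v j) \<in> tile_of v ` ?FF"
      unfolding lift_surface_def by blast
    obtain H a b where F: "(H, a, b) \<in> ?FF" and x: "x = cmb v (rv H)" and s: "{i, j} = {a, b}"
      using tile[OF ij T] by blast
    have "h x = rv H" unfolding x by (rule h[OF F]) (simp add: face_def)
    then obtain l m where "p = rv H + l *\<^sub>R axis i 1 + m *\<^sub>R axis j 1" and lm: "0 \<le> l" "l \<le> 1" "0 \<le> m" "m \<le> 1"
      using p unfolding parallelogram_def by auto
    moreover have "l *\<^sub>R axis i 1 = (axis i l :: real ^ 4)" for l i by (simp add: vec_eq_iff axis_def)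
    ultimately have "p \<in> face H a b" using face_sub[OF ij s lm] by simp
    then obtain e y where "p = e + y" "cmb f e = \<theta>" "\<And>m. 0 \<le> y $ m \<and> y $ m \<le> 1"
      using closed_face_in_tube[OF F] by blast
    then show "p \<in> {x + y |x y. x \<in> {x. cmb f x = \<theta>} \<and> (\<forall>k. 0 \<le> y $ k \<and> y $ k \<le> 1)}"
      by blast
  qed
  ultimately show ?thesis
    unfolding planar_tiling_def using closed_tiling(1)[OF \<delta> \<mu> ne] by blast
qed

text \<open>All tiles meeting a ball of diameter \<open>r\<close> come from the patch around a face
  over its centre. Equal patches at \<open>H\<close> and \<open>H'\<close> therefore give patterns
  that differ by the translation \<open>cmb v (rv (H' - H))\<close>.\<close>

lemma r_maps_subset:
  assumes \<mu>: "0 < \<mu>" "\<And>d. \<mu> * norm d \<le> norm (cmb f' d) + norm (cmb v d)"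
      "\<And>d. \<mu> * norm d \<le> norm (cmb f d) + norm (cmb v d)"
    and near: "\<And>H i j. (H, i, j) \<in> FF \<Longrightarrow> norm (cmb f' (rv H) - \<theta>') \<le> C"
    and near': "\<And>H i j. (H, i, j) \<in> FF' \<Longrightarrow> norm (cmb f (rv H) - \<theta>) \<le> C"
    and loc: "\<And>H i j. (H, i, j) \<in> FF \<Longrightarrow> \<exists>H'. patch FF H R = patch FF' H' R"
    and R: "2 * C + 4 * (\<Sum>i\<in>UNIV. norm (v i)) + r \<le> \<mu> * R" and r: "0 \<le> r"
    and cover: "(\<Union>\<phi>\<in>FF. tile_of v \<phi>) = UNIV"
  shows "r_maps r (tile_of v ` FF) \<subseteq> r_maps r (tile_of v ` FF')"
proof
  fix X assume "X \<in> r_maps r (tile_of v ` FF)"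
  then obtain c w where X: "X = (\<lambda>T. (+) w ` T) ` {T \<in> tile_of v ` FF. T \<inter> cball c (r / 2) \<noteq> {}}"
    unfolding r_maps_def by blast
  have "c \<in> (\<Union>\<phi>\<in>FF. tile_of v \<phi>)" using cover by simp
  then obtain \<phi> where \<phi>: "\<phi> \<in> FF" "c \<in> tile_of v \<phi>" by blast
  obtain H i j where e: "\<phi> = (H, i, j)" by (metis prod_cases3)
  have F: "(H, i, j) \<in> FF" "c \<in> tile_of v (H, i, j)" using \<phi> e by simp_all
  obtain H' where p: "patch FF H R = patch FF' H' R" using loc[OF F(1)] by blast
  define z where "z = H' - H"
  let ?z = "cmb v (rv z)"
  have close: "norm (rv (K - H)) \<le> R" if "(K, a, b) \<in> FF" "y \<in> tile_of v (K, a, b)" "dist c y \<le> r / 2" for K a b y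
  proof -
    have "\<mu> * norm (rv (K - H)) \<le> \<mu> * R"
      using near_plane_bound[OF \<mu>(2) near[OF that(1)] near[OF F(1)] that(2) F(2), of "r / 2"] that(3) R r
      by (simp add: dist_commute)
    then show ?thesis using \<mu>(1) by simp
  qed
  have "norm (rv (0 :: int ^ 4)) \<le> R" using close[OF F(1) F(2)] r by simp
  then have F0: "(H', i, j) \<in> FF'" using patch_eqD[OF p, of 0 i j] F(1) by simp
  have F0': "?z + c \<in> tile_of v (H', i, j)"
    using F(2) tile_of_shift[of v z H i j] by (simp add: z_def shift_def) blast
  have close': "norm (rv (K - H')) \<le> R"
    if "(K, a, b) \<in> FF'" "y \<in> tile_of v (K, a, b)" "dist (?z + c) y \<le> r / 2" for K a b y
  proof -
    have "\<mu> * norm (rv (K - H')) \<le> \<mu> * R"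
      using near_plane_bound[OF \<mu>(3) near'[OF that(1)] near'[OF F0] that(2) F0', of "r / 2"] that(3) R r
      by (simp add: dist_commute)
    then show ?thesis using \<mu>(1) by simp
  qed
  have "{T \<in> tile_of v ` FF'. T \<inter> cball (?z + c) (r / 2) \<noteq> {}}
      = shift ?z ` {T \<in> tile_of v ` FF. T \<inter> cball c (r / 2) \<noteq> {}}" (is "?L = ?M")
  proof
    show "?L \<subseteq> ?M"
    proof
      fix T assume T: "T \<in> ?L"
      then obtain \<psi> where \<psi>: "\<psi> \<in> FF'" "T = tile_of v \<psi>" by blast
      obtain K a b where e: "\<psi> = (K, a, b)" by (metis prod_cases3)
      obtain y where y: "y \<in> tile_of v (K, a, b)" "dist (?z + c) y \<le> r / 2" using T \<psi>(2) e by auto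
      have KF: "(K, a, b) \<in> FF'" using \<psi> e by simp
      have "(H + (K - H'), a, b) \<in> FF"
        using patch_eqD[OF p close'[OF KF y], of a b] KF by simp
      then have K: "(K - z, a, b) \<in> FF" by (simp add: z_def algebra_simps)
      have T': "T = shift ?z (tile_of v (K - z, a, b))" using \<psi>(2) e by (simp add: tile_of_shift)
      moreover have "tile_of v (K - z, a, b) \<inter> cball c (r / 2) \<noteq> {}"
      proof -
        obtain y' where "y' \<in> tile_of v (K - z, a, b)" "y = ?z + y'"
          using y(1) T' \<psi>(2) e unfolding shift_def by auto
        then show ?thesis using y(2) by auto
      qed
      ultimately show "T \<in> ?M" using K by blast
    qed
    show "?M \<subseteq> ?L"
    proof
      fix T assume "T \<in> ?M"
      then obtain \<psi> where \<psi>: "\<psi> \<in> FF" "T = shift ?z (tile_of v \<psi>)" "tile_of v \<psi> \<inter> cball c (r / 2) \<noteq> {}" by blast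
      obtain K a b where e: "\<psi> = (K, a, b)" by (metis prod_cases3)
      obtain y where y: "y \<in> tile_of v (K, a, b)" "dist c y \<le> r / 2" using \<psi>(3) e by auto
      have KF: "(K, a, b) \<in> FF" using \<psi> e by simp
      have "(H' + (K - H), a, b) \<in> FF'"
        using patch_eqD[OF p close[OF KF y], of a b] KF by simp
      then have K: "(K + z, a, b) \<in> FF'" by (simp add: z_def algebra_simps)
      have T': "T = tile_of v (K + z, a, b)" using \<psi>(2) e by (simp add: tile_of_shift)
      moreover have "?z + y \<in> T" using y(1) \<psi>(2) e unfolding shift_def by blast
      then have "T \<inter> cball (?z + c) (r / 2) \<noteq> {}" using y(2) by auto
      ultimately show "T \<in> ?L" using K by blast
    qed
  qed
  then have "(\<lambda>T. (+) (w - ?z) ` T) ` ?L = X"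
    unfolding X by (simp add: image_image shift_def add.assoc[symmetric])
  then show "X \<in> r_maps r (tile_of v ` FF')" unfolding r_maps_def by blast
qed

text \<open>Any lift differs from the given lattice heights by a constant, because tiles that meet
  share a lifted vertex and the physical plane is connected. So the same lattice points stay near
  both planes, and a direction of one plane, followed to infinity, belongs to the other.\<close>

lemma planar_slope_unique:
  assumes \<mu>: "0 < \<mu>" "\<And>d. \<mu> * norm d \<le> norm (cmb f' d) + norm (cmb v d)"
      "\<And>d. \<mu> * norm d \<le> norm (cmb f d) + norm (cmb v d)"
    and near: "\<And>H i j. (H, i, j) \<in> FF \<Longrightarrow> norm (cmb f' (rv H) - \<theta>') \<le> C"
    and ij: "\<And>H i j. (H, i, j) \<in> FF \<Longrightarrow> i \<noteq> j"
    and inj: "\<And>H i j H' i' j' P P'. (H, i, j) \<in> FF \<Longrightarrow> (H', i', j') \<in> FF \<Longrightarrow> P \<in> face H i j \<Longrightarrow>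
      P' \<in> face H' i' j' \<Longrightarrow> cmb v P = cmb v P' \<Longrightarrow> P = P'"
    and planar: "planar_tiling v {x. cmb f x = \<theta>} t (tile_of v ` FF)" and t: "0 \<le> t"
    and x: "cmb f x = 0"
  shows "cmb f' x = 0"
proof -
  obtain h where lift: "is_lift v (tile_of v ` FF) h"
    and tube: "lift_surface v (tile_of v ` FF) h \<subseteq>
        {x + y | x y. x \<in> {x. cmb f x = \<theta>} \<and> (\<forall>k. 0 \<le> y $ k \<and> y $ k \<le> t)}"
    and cover: "(\<Union>\<phi>\<in>FF. tile_of v \<phi>) = UNIV"
    using planar unfolding planar_tiling_def octagonal_tiling_def by auto
  have tile: "tile_of v (H, i, j) = cmb v ` face H i j" if "(H, i, j) \<in> FF" for H i j
    using ij[OF that] by (simp add: tile_of_def parallelogram_conv_face)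
  have mem: "parallelogram (cmb v (rv H)) (v i) (v j) \<in> tile_of v ` FF" if "(H, i, j) \<in> FF" for H i j
    using that by (intro image_eqI[of _ _ "(H, i, j)"]) (auto simp: tile_of_def)
  define g where "g H = h (cmb v (rv H)) - rv H" for H
  have vertex: "g Q = g H" if F: "(H, i, j) \<in> FF" and Q: "rv Q \<in> face H i j" for H i j Q
  proof -
    have L: "h (cmb v (rv H) + v i) = h (cmb v (rv H)) + axis i 1"
      "h (cmb v (rv H) + v j) = h (cmb v (rv H)) + axis j 1"
      "h (cmb v (rv H) + v i + v j) = h (cmb v (rv H)) + axis i 1 + axis j 1"
      using lift mem[OF F] ij[OF F] unfolding is_lift_def by blast+
    have Qm: "if m = i \<or> m = j then Q $ m = H $ m \<or> Q $ m = H $ m + 1 else Q $ m = H $ m" for m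
      using Q unfolding rv_mem_face_iff by blast
    define a b where "a = Q $ i - H $ i" and "b = Q $ j - H $ j"
    have ab: "a = 0 \<or> a = 1" "b = 0 \<or> b = 1" using Qm[of i] Qm[of j] by (auto simp: a_def b_def)
    have "rv Q $ m = (rv H + axis i (of_int a) + axis j (of_int b)) $ m" for m
      using Qm[of m] ij[OF F] by (auto simp: axis_def a_def b_def split: if_splits)
    then have "rv Q = rv H + axis i (of_int a) + axis j (of_int b)" unfolding vec_eq_iff by blast
    moreover have az: "axis n 0 = (0 :: real ^ 4)" for n by (simp add: vec_eq_iff axis_def)
    ultimately show ?thesis
      using ab L by (auto simp: g_def cmb_add az)
  qed
  have share: "g H = g H'"
    if F: "(H, i, j) \<in> FF" "(H', i', j') \<in> FF" and y: "y \<in> tile_of v (H, i, j)" "y \<in> tile_of v (H', i', j')"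
    for H i j H' i' j' y
  proof -
    obtain P P' where P: "P \<in> face H i j" "y = cmb v P" and P': "P' \<in> face H' i' j'" "y = cmb v P'"
      using y unfolding tile[OF F(1)] tile[OF F(2)] by blast
    have "P = P'" using inj[OF F P(1) P'(1)] P P' by simp
    then obtain Q where "rv Q \<in> face H i j" "rv Q \<in> face H' i' j'"
      using face_common_vertex[OF P(1)] P'(1) by blast
    then show ?thesis using vertex[OF F(1)] vertex[OF F(2)] by metis
  qed
  have cl: "closed (\<Union>\<phi>\<in>G. tile_of v \<phi>)" if G: "G \<subseteq> FF" for G
  proof (rule closed_Union_locally_finite)
    fix \<phi> assume "\<phi> \<in> G"
    then show "closed (tile_of v \<phi>)"
      using ij G by (cases \<phi>) (auto simp: tile_of_def intro!: closed_parallelogram v_indep)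
  next
    fix y
    show "finite {\<phi> \<in> G. tile_of v \<phi> \<inter> ball y 1 \<noteq> {}}"
      by (rule finite_subset[OF _ finite_faces_near[OF \<mu>(2,1) near, where FF = FF and y = y and R = 1]])
        (use G in \<open>auto simp: subset_iff less_imp_le\<close>)
  qed
  have "0 \<in> (\<Union>\<phi>\<in>FF. tile_of v \<phi>)" using cover by simp
  then obtain \<phi> where \<phi>: "\<phi> \<in> FF" "0 \<in> tile_of v \<phi>" by blast
  obtain H0 i0 j0 where e: "\<phi> = (H0, i0, j0)" by (metis prod_cases3)
  have F0: "(H0, i0, j0) \<in> FF" "0 \<in> tile_of v (H0, i0, j0)" using \<phi> e by simp_all
  \<comment> \<open>Faces with the same offset as \<open>H0\<close> and all others: their tiles form
    two disjoint closed sets covering the plane.\<close>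
  define A where "A = {\<phi> \<in> FF. g (fst \<phi>) = g H0}"
  define B where "B = {\<phi> \<in> FF. g (fst \<phi>) \<noteq> g H0}"
  let ?A = "\<Union>\<phi>\<in>A. tile_of v \<phi>" and ?B = "\<Union>\<phi>\<in>B. tile_of v \<phi>"
  have "?A \<union> ?B = UNIV" using cover unfolding A_def B_def by blast
  moreover have "?A \<inter> ?B = {}"
  proof (rule ccontr)
    assume "?A \<inter> ?B \<noteq> {}"
    then obtain y \<phi> \<psi> where "\<phi> \<in> A" "\<psi> \<in> B" "y \<in> tile_of v \<phi>" "y \<in> tile_of v \<psi>" by blast
    moreover obtain H i j where "\<phi> = (H, i, j)" by (metis prod_cases3)
    moreover obtain H' i' j' where "\<psi> = (H', i', j')" by (metis prod_cases3)
    ultimately show False using share[of H i j H' i' j' y] by (simp add: A_def B_def)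
  qed
  moreover have "closed ?A" "closed ?B" by (rule cl; auto simp: A_def B_def)+
  ultimately have "?A = - ?B" "closed ?A" "closed ?B" by auto
  then have "?A = {} \<or> ?A = UNIV" using clopen[of ?A] by (simp add: open_closed)
  moreover have "0 \<in> ?A" using F0 unfolding A_def by (intro UN_I[of "(H0, i0, j0)"]) auto
  ultimately have UA: "?A = UNIV" by blast
  define c where "c = g H0"
  let ?f = "\<Sum>i\<in>UNIV. norm (f i)" and ?v = "\<Sum>i\<in>UNIV. norm (v i)"
  have bound: "norm (cmb f (rv H)) \<le> norm \<theta> + ?f * (4 * t) + norm (cmb f c)" if F: "(H, i, j) \<in> FF" "g H = c" for H i j
  proof -
    have "h (cmb v (rv H)) \<in> parallelogram (h (cmb v (rv H))) (axis i 1) (axis j 1)"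
      unfolding parallelogram_def by (auto intro!: exI[of _ 0])
    then have "h (cmb v (rv H)) \<in> lift_surface v (tile_of v ` FF) h"
      unfolding lift_surface_def using mem[OF F(1)] ij[OF F(1)] by blast
    then obtain p q where pq: "h (cmb v (rv H)) = p + q" "cmb f p = \<theta>" "\<And>k. 0 \<le> q $ k \<and> q $ k \<le> t"
      using tube by blast
    have "norm q \<le> (\<Sum>m\<in>(UNIV :: 4 set). t)"
      using pq(3) by (intro order_trans[OF norm_le_l1_cart] sum_mono) auto
    then have "norm (cmb f q) \<le> ?f * (4 * t)"
      using norm_cmb_le[of f q] mult_left_mono[of "norm q" "4 * t" ?f] by (simp add: sum_nonneg)
    moreover have "rv H = p + q - c" using pq(1) F(2) by (simp add: g_def algebra_simps)
    then have "cmb f (rv H) = \<theta> + cmb f q - cmb f c" using pq(2) by (simp add: cmb_add cmb_diff)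
    ultimately show ?thesis
      using norm_triangle_ineq4[of "\<theta> + cmb f q" "cmb f c"] norm_triangle_ineq[of \<theta> "cmb f q"] by simp
  qed
  define K where "K = norm \<theta> + ?f * (4 * t) + norm (cmb f c)"
  define D where "D = (K + 2 * ?v) / \<mu>"
  define M where "M = C + norm \<theta>' + (\<Sum>i\<in>UNIV. norm (f' i)) * D"
  \<comment> \<open>The face over the \<open>N\<close>-th multiple of \<open>x\<close> is within
    \<open>D\<close> of it because of the first plane, and bounded under \<open>cmb f'\<close>
    because of the second; hence a bound independent of \<open>N\<close>.\<close>
  have M: "real N * norm (cmb f' x) \<le> M" for N
  proof -
    let ?y = "cmb v (real N *\<^sub>R x)"
    have "?y \<in> ?A" using UA by simp
    then obtain \<phi> where \<phi>: "\<phi> \<in> A" "?y \<in> tile_of v \<phi>" by blast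
    obtain H i j where e: "\<phi> = (H, i, j)" by (metis prod_cases3)
    have F: "(H, i, j) \<in> FF" "g H = c" "?y \<in> tile_of v (H, i, j)" using \<phi> e by (simp_all add: A_def c_def)
    let ?d = "rv H - real N *\<^sub>R x"
    have "norm (cmb f ?d) \<le> K" using bound[OF F(1,2)] x by (simp add: cmb_diff cmb_scale K_def)
    moreover have "norm (cmb v ?d) \<le> 2 * ?v"
      using tile_of_bounded[OF F(3)] by (simp add: cmb_diff dist_norm)
    ultimately have "\<mu> * norm ?d \<le> K + 2 * ?v" using \<mu>(3)[of ?d] by linarith
    then have "norm ?d \<le> D" using \<mu>(1) by (simp add: D_def field_simps)
    then have 1: "norm (cmb f' ?d) \<le> (\<Sum>i\<in>UNIV. norm (f' i)) * D"
      using norm_cmb_le[of f' ?d] mult_left_mono[of "norm ?d" D "\<Sum>i\<in>UNIV. norm (f' i)"]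
      by (simp add: sum_nonneg)
    have 2: "norm (cmb f' (rv H)) \<le> C + norm \<theta>'"
      using near[OF F(1)] norm_triangle_ineq[of "cmb f' (rv H) - \<theta>'" \<theta>'] by simp
    have "cmb f' (real N *\<^sub>R x) = cmb f' (rv H) - cmb f' ?d" by (simp add: cmb_diff)
    then have "norm (cmb f' (real N *\<^sub>R x)) \<le> M"
      using norm_triangle_ineq4[of "cmb f' (rv H)" "cmb f' ?d"] 1 2 by (simp add: M_def)
    then show ?thesis by (simp add: cmb_scale)
  qed
  show ?thesis
  proof (rule ccontr)
    assume "cmb f' x \<noteq> 0"
    then have "0 < norm (cmb f' x)" by simp
    then obtain N where "M < real N * norm (cmb f' x)" using reals_Archimedean3 by blast
    with M[of N] show False by simp
  qed
qed

text \<open>The form in which weak local rules are used. The order of the quantifiers matters: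
  \<open>\<eta>\<close> does not depend on \<open>C\<close>, so a deformation can be made small
  without knowing the thickness; only the radius \<open>R\<close> depends on
  \<open>C\<close>.\<close>

lemma transfer:
  assumes \<delta>: "\<And>l. det2 (f l) \<delta> \<noteq> 0"
    and wl: "weak_local_rules v {x. cmb f x = \<theta>}"
    and ne': "faces f (sgp f \<theta> \<delta>) \<noteq> {}"
  obtains \<eta> where "0 < \<eta>" "\<And>C. \<exists>R. \<forall>f' \<theta>' FF. (\<forall>i. norm (f' i - f i) < \<eta>) \<longrightarrow> FF \<noteq> {} \<longrightarrow>
      (\<forall>H i j. (H, i, j) \<in> FF \<longrightarrow> norm (cmb f' (rv H) - \<theta>') \<le> C) \<longrightarrow>
      (\<forall>H i j. (H, i, j) \<in> FF \<longrightarrow> (\<exists>H'. patch FF H R = patch (faces f (sgp f \<theta> \<delta>)) H' R)) \<longrightarrow>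
      (\<forall>x. cmb f x = 0 \<longrightarrow> cmb f' x = 0)"
proof -
  let ?FF' = "faces f (sgp f \<theta> \<delta>)"
  obtain r t where rt: "0 \<le> r" "1 \<le> t" "weak_local_rules_of v {x. cmb f x = \<theta>} r t"
    using wl unfolding weak_local_rules_def by blast
  obtain \<eta> \<mu> where em: "0 < \<eta>" "0 < \<mu>"
    "\<And>f' d. (\<And>i. norm (f' i - f i) < \<eta>) \<Longrightarrow> \<mu> * norm d \<le> norm (cmb f' d) + norm (cmb v d)"
    using cmb_pair_bound_perturbed by blast
  have \<mu>: "\<mu> * norm d \<le> norm (cmb f d) + norm (cmb v d)" for d using em(1,3) by simp
  let ?f = "4 * (\<Sum>i\<in>UNIV. norm (f i))" and ?v = "\<Sum>i\<in>UNIV. norm (v i)"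
  have "\<exists>R. \<forall>f' \<theta>' FF. (\<forall>i. norm (f' i - f i) < \<eta>) \<longrightarrow> FF \<noteq> {} \<longrightarrow>
      (\<forall>H i j. (H, i, j) \<in> FF \<longrightarrow> norm (cmb f' (rv H) - \<theta>') \<le> C) \<longrightarrow>
      (\<forall>H i j. (H, i, j) \<in> FF \<longrightarrow> (\<exists>H'. patch FF H R = patch ?FF' H' R)) \<longrightarrow>
      (\<forall>x. cmb f x = 0 \<longrightarrow> cmb f' x = 0)" for C
  proof -
    define C' where "C' = max C ?f"
    define R where "R = (2 * C' + 4 * ?v + max 1 r) / \<mu>"
    have R: "2 * C' + 4 * ?v + 1 \<le> \<mu> * R" "2 * C' + 4 * ?v + r \<le> \<mu> * R"
      using em(2) by (simp_all add: R_def)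
    show ?thesis
    proof (intro exI[of _ R] allI impI)
      fix f' \<theta>' FF x
      assume f': "\<forall>i. norm (f' i - f i) < \<eta>" and ne: "FF \<noteq> {}"
        and nearC: "\<forall>H i j. (H, i, j) \<in> FF \<longrightarrow> norm (cmb f' (rv H) - \<theta>') \<le> C"
        and loc: "\<forall>H i j. (H, i, j) \<in> FF \<longrightarrow> (\<exists>H'. patch FF H R = patch ?FF' H' R)"
        and x: "cmb f x = 0"
      have \<mu>': "\<mu> * norm d \<le> norm (cmb f' d) + norm (cmb v d)" for d using em(3) f' by blast
      have near: "norm (cmb f' (rv H) - \<theta>') \<le> C'" if "(H, i, j) \<in> FF" for H i j
        using nearC that unfolding C'_def by (meson max.coboundedI1)
      have near': "norm (cmb f (rv H) - \<theta>) \<le> C'" if "(H, i, j) \<in> ?FF'" for H i j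
        using closed_near[OF that] unfolding C'_def by (meson max.coboundedI2)
      have gen: "\<exists>\<theta>. generic f \<theta> \<and> patch FF H R = patch (faces f (sgp f \<theta> 0)) H R" if F: "(H, i, j) \<in> FF" for H i j
      proof -
        obtain H' where H': "patch FF H R = patch ?FF' H' R" using loc F by blast
        obtain \<theta>1 where \<theta>1: "generic f \<theta>1" "patch ?FF' H' R = patch (faces f (sgp f \<theta>1 0)) H' R"
          using locally_generic[OF \<delta>] by blast
        \<comment> \<open>The generic plane found above agrees around \<open>H'\<close>; translated
          by \<open>H - H'\<close> it agrees around \<open>H\<close>.\<close>
        define \<theta>2 where "\<theta>2 = \<theta>1 + cmb f (rv (H - H'))"
        have g: "gap f \<theta>2 l (n + (H - H')) = gap f \<theta>1 l n" for l n
          by (simp add: gap_def \<theta>2_def rv_add cmb_add)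
        have "generic f \<theta>2"
          unfolding generic_def
        proof (intro allI)
          fix l n
          show "gap f \<theta>2 l n \<noteq> 0"
            using g[of l "n - (H - H')"] \<theta>1(1) by (simp add: generic_def)
        qed
        moreover have "patch (faces f (sgp f \<theta>1 0)) H' R = patch (faces f (sgp f \<theta>2 0)) H R"
        proof (rule patch_faces_cong)
          fix l m
          have "H' + m + (H - H') = H + m" by simp
          then show "sgp f \<theta>1 0 l (H' + m) = sgp f \<theta>2 0 l (H + m)"
            unfolding sgp_def using g[of l "H' + m"] by metis
        qed
        ultimately show ?thesis using H' \<theta>1(2) by metis
      qed
      have C': "4 * (\<Sum>i\<in>UNIV. norm (f i)) \<le> C'" by (simp add: C'_def)
      note lgt = locally_generic_tiling[OF em(2) \<mu>' \<mu> _ _ C' R(1) ne]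
      have oct: "octagonal_tiling v (tile_of v ` FF)"
        by (rule lgt(1)) (use near gen in blast)+
      have inj: "P = P'" if "(H, i, j) \<in> FF" "(H', i', j') \<in> FF" "P \<in> face H i j"
        "P' \<in> face H' i' j'" "cmb v P = cmb v P'" for H i j H' i' j' P P'
        by (rule lgt(2)[OF _ _ that]) (use near gen in blast)+
      have ij: "i \<noteq> j" if F: "(H, i, j) \<in> FF" for H i j
      proof -
        have "0 \<le> 4 * (\<Sum>i\<in>UNIV. norm (f i))" "0 \<le> ?v" by (simp_all add: sum_nonneg)
        then have "0 \<le> \<mu> * R" using R(1) unfolding C'_def by linarith
        then have "0 \<le> R" using em(2) by (simp add: zero_le_mult_iff)
        moreover obtain H' where "patch FF H R = patch ?FF' H' R" using loc F by blast
        ultimately have "(H' + 0, i, j) \<in> ?FF'" using F patch_eqD[of FF H R ?FF' H' 0] by simp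
        then show ?thesis by (simp add: faces_def)
      qed
      have cover: "(\<Union>\<phi>\<in>FF. tile_of v \<phi>) = UNIV"
        using oct unfolding octagonal_tiling_def by simp
      have "r_maps r (tile_of v ` FF) \<subseteq> r_maps r (tile_of v ` ?FF')"
        by (rule r_maps_subset[OF em(2) \<mu>' \<mu> _ _ _ R(2) rt(1) cover])
          (use near near' loc in blast)+
      then have pl: "planar_tiling v {x. cmb f x = \<theta>} t (tile_of v ` FF)"
        using rt(3) oct closed_tiling_planar[OF \<delta> em(2) \<mu> ne'] unfolding weak_local_rules_of_def by blast
      have "0 \<le> t" using rt(2) by simp
      show "cmb f' x = 0"
        by (rule planar_slope_unique[OF em(2) \<mu>' \<mu> _ _ _ pl \<open>0 \<le> t\<close> x]) (fact near, fact ij, fact inj)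
    qed
  qed
  with em(1) show ?thesis by (rule that)
qed

end

section \<open>Deforming a plane without integer points\<close>

lemma gap_add: "gap f \<theta> l (n + m) = gap f \<theta> l n + det2 (f l) (cmb f (rv m))"
  by (simp add: gap_def rv_add cmb_add det2_linear)

lemma int_crossing:
  fixes p :: "int \<Rightarrow> bool"
  assumes "\<not> p a" "p b" "a \<le> b"
  obtains c where "p c" "\<not> p (c - 1)"
proof -
  have "\<exists>c. p c \<and> \<not> p (c - 1)"
  proof (rule ccontr)
    assume *: "\<nexists>c. p c \<and> \<not> p (c - 1)"
    have "\<not> p c" if "a \<le> c" for c
      using that
    proof (induction c rule: int_ge_induct)
      case base then show ?case by fact
    next
      case (step i)
      with * show ?case by (metis add_diff_cancel_right')
    qed
    with assms show False by blast
  qed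
  then show ?thesis using that by blast
qed

text \<open>Far from its line each type has the sign of the plane, so signs must switch along the
  axes \<open>k\<close> and \<open>l\<close>. The invariance of \<open>\<tau> l\<close> along its
  own axis lets both switches be combined at one lattice point.\<close>

lemma faces_of_signs_nonempty:
  assumes f: "\<And>i j. i \<noteq> j \<Longrightarrow> det2 (f i) (f j) \<noteq> 0"
    and sgn: "\<And>i j. i \<noteq> j \<Longrightarrow> (0 < det2 (f' i) (f' j)) = (0 < det2 (f i) (f j)) \<and> det2 (f' i) (f' j) \<noteq> 0"
    and inv: "\<And>l n c. \<tau> l (n + axis l c) = \<tau> l n"
    and \<tau>: "\<And>l n. B \<le> \<bar>gap f' \<theta>' l n\<bar> \<Longrightarrow> \<tau> l n = (0 < gap f' \<theta>' l n)"
  shows "faces f \<tau> \<noteq> {}"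
proof -
  have cross: "\<exists>c. \<tau> l (axis k c) = (0 < det2 (f l) (f k)) \<and> \<tau> l (axis k (c - 1)) \<noteq> (0 < det2 (f l) (f k))"
    if "l \<noteq> k" for l k
  proof -
    let ?e = "0 < det2 (f l) (f k)"
    let ?d = "det2 (f' l) (f' k)"
    have d: "?d \<noteq> 0" "(0 < ?d) = ?e" using sgn[OF that] by auto
    have g: "gap f' \<theta>' l (axis k c) = of_int c * ?d - det2 (f' l) \<theta>'" for c
      by (simp add: gap_def det2_linear)
    obtain N :: nat where N: "\<bar>B\<bar> + \<bar>det2 (f' l) \<theta>'\<bar> + 1 < real N * \<bar>?d\<bar>"
      using reals_Archimedean3[of "\<bar>?d\<bar>"] d(1) by auto
    have 1: "\<tau> l (axis k (int N)) = ?e"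
    proof (cases "0 < ?d")
      case True
      then have "B \<le> gap f' \<theta>' l (axis k (int N))" "0 < gap f' \<theta>' l (axis k (int N))"
        using N unfolding g by simp_all
      then show ?thesis using \<tau>[of l "axis k (int N)"] d True by simp
    next
      case False
      then have "B \<le> - gap f' \<theta>' l (axis k (int N))" "gap f' \<theta>' l (axis k (int N)) < 0"
        using N d(1) unfolding g by simp_all
      then show ?thesis using \<tau>[of l "axis k (int N)"] d False by simp
    qed
    have 2: "\<tau> l (axis k (- int N)) \<noteq> ?e"
    proof (cases "0 < ?d")
      case True
      then have "B \<le> - gap f' \<theta>' l (axis k (- int N))" "gap f' \<theta>' l (axis k (- int N)) < 0"
        using N unfolding g by simp_all
      then show ?thesis using \<tau>[of l "axis k (- int N)"] d True by simp
    next
      case False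
      then have "B \<le> gap f' \<theta>' l (axis k (- int N))" "0 < gap f' \<theta>' l (axis k (- int N))"
        using N d(1) unfolding g by simp_all
      then show ?thesis using \<tau>[of l "axis k (- int N)"] d False by simp
    qed
    show ?thesis
      using int_crossing[of "\<lambda>c. \<tau> l (axis k c) = ?e" "- int N" "int N"] 1 2 by auto
  qed
  obtain k l :: 4 where d: "distinct [1, 2, k, l]" by (rule four_complement[of 1 2]) simp
  then have kl: "k \<noteq> l" by simp
  obtain a where a: "\<tau> l (axis k a) = (0 < det2 (f l) (f k))" "\<tau> l (axis k (a - 1)) \<noteq> (0 < det2 (f l) (f k))"
    using cross[of l k] kl by auto
  obtain b where b: "\<tau> k (axis l b) = (0 < det2 (f k) (f l))" "\<tau> k (axis l (b - 1)) \<noteq> (0 < det2 (f k) (f l))"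
    using cross[of k l] kl by auto
  define H :: "int ^ 4" where "H = axis k a + axis l b"
  have ax: "axis k x - axis k 1 = axis k (x - 1)" for x :: int and k :: 4
    by (simp add: vec_eq_iff axis_def)
  have e: "H - axis k 1 = axis k (a - 1) + axis l b" "H - axis l 1 = axis l (b - 1) + axis k a"
    "H = axis l b + axis k a"
    by (simp_all add: H_def ax[symmetric])
  have t: "\<tau> l H = \<tau> l (axis k a)" "\<tau> l (H - axis k 1) = \<tau> l (axis k (a - 1))"
    "\<tau> k H = \<tau> k (axis l b)" "\<tau> k (H - axis l 1) = \<tau> k (axis l (b - 1))"
    using inv[of l "axis k a" b] inv[of l "axis k (a - 1)" b] inv[of k "axis l b" a] inv[of k "axis l (b - 1)" a]
    unfolding e(1,2) by (simp_all add: H_def add.commute)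
  have "(H, 1, 2) \<in> faces f \<tau>"
    unfolding faces_def mem_Collect_eq prod.case
  proof (intro conjI allI impI)
    show "(1 :: 4) \<noteq> 2" by simp
    fix k' l' :: 4 assume "distinct [1, 2, k', l']"
    then have "k' = k \<and> l' = l \<or> k' = l \<and> l' = k"
      using UNIV_distinct4[OF d] by (auto simp: set_eq_iff)
    then show "\<tau> l' H = (0 < det2 (f l') (f k'))" "\<tau> l' (H - axis k' 1) \<noteq> (0 < det2 (f l') (f k'))"
      using a b unfolding t[symmetric] by blast+
  qed
  then show ?thesis by blast
qed

text \<open>If a gap at \<open>H\<close> exceeded the bracket by more than \<open>B\<close>, both
  lattice points compared in \<open>faces\<close> would have the sign given by the plane, and these
  two signs would agree.\<close>

lemma faces_of_signs_near:
  assumes sgn: "\<And>i j. i \<noteq> j \<Longrightarrow> (0 < det2 (f' i) (f' j)) = (0 < det2 (f i) (f j))"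
    and \<beta>: "0 < \<beta>" "\<And>i j. i \<noteq> j \<Longrightarrow> \<beta> \<le> \<bar>det2 (f' i) (f' j)\<bar>"
    and M: "\<And>i. norm (f' i) \<le> M" and B: "0 \<le> B"
    and \<tau>: "\<And>l n. B \<le> \<bar>gap f' \<theta>' l n\<bar> \<Longrightarrow> \<tau> l n = (0 < gap f' \<theta>' l n)"
    and F: "(H, i, j) \<in> faces f \<tau>"
  shows "norm (cmb f' (rv H) - \<theta>') \<le> 2 * (B / \<beta> + 1) * M"
proof -
  have "i \<noteq> j" using F by (simp add: faces_def)
  then obtain k l where d: "distinct [i, j, k, l]" using four_complement by blast
  have *: "\<bar>gap f' \<theta>' l H / det2 (f' l) (f' k)\<bar> \<le> B / \<beta> + 1" if d: "distinct [i, j, k, l]" for k l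
  proof -
    let ?b = "det2 (f' l) (f' k)" and ?g = "gap f' \<theta>' l H"
    have lk: "l \<noteq> k" using d by auto
    have b: "\<beta> \<le> \<bar>?b\<bar>" using \<beta>(2)[OF lk] .
    have t: "\<tau> l H = (0 < ?b)" "\<tau> l (H - axis k 1) \<noteq> (0 < ?b)"
      using F d sgn[OF lk] unfolding faces_def by auto
    have "\<bar>?g\<bar> \<le> B + \<bar>?b\<bar>"
    proof (rule ccontr)
      assume "\<not> ?thesis"
      then have "B \<le> \<bar>?g\<bar>" "B \<le> \<bar>?g - ?b\<bar>" "(0 < ?g) = (0 < ?g - ?b)" using B by (auto simp: abs_if split: if_splits)
      then show False
        using t \<tau>[of l H] \<tau>[of l "H - axis k 1"] unfolding gap_diff_axis by simp
    qed
    then have "\<bar>?g\<bar> / \<bar>?b\<bar> \<le> (B + \<bar>?b\<bar>) / \<bar>?b\<bar>" using b \<beta>(1) by (intro divide_right_mono) auto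
    also have "\<dots> = B / \<bar>?b\<bar> + 1" using b \<beta>(1) by (simp add: add_divide_distrib)
    also have "\<dots> \<le> B / \<beta> + 1" using b \<beta>(1) B by (simp add: frac_le)
    finally show ?thesis by (simp add: abs_divide)
  qed
  have kl: "det2 (f' k) (f' l) \<noteq> 0" using \<beta>(1) \<beta>(2)[of k l] d by auto
  define s t where "s = gap f' \<theta>' l H / det2 (f' l) (f' k)" and "t = gap f' \<theta>' k H / det2 (f' k) (f' l)"
  have st: "\<bar>s\<bar> \<le> B / \<beta> + 1" "\<bar>t\<bar> \<le> B / \<beta> + 1" using *[of k l] *[of l k] d by (auto simp: s_def t_def)
  have "cmb f' (rv H) - \<theta>' = s *\<^sub>R f' k + t *\<^sub>R f' l"
    using det2_cramer[OF kl] unfolding s_def t_def gap_def by auto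
  then have "norm (cmb f' (rv H) - \<theta>') \<le> norm (s *\<^sub>R f' k) + norm (t *\<^sub>R f' l)"
    using norm_triangle_ineq[of "s *\<^sub>R f' k" "t *\<^sub>R f' l"] by (simp only:)
  also have "\<dots> \<le> (B / \<beta> + 1) * M + (B / \<beta> + 1) * M"
    using st M by (intro add_mono) (auto intro!: mult_mono)
  finally show ?thesis by (simp only: mult_2 distrib_right)
qed

lemma finite_pos_lower_bound:
  fixes A :: "real set"
  assumes "finite A" "\<And>a. a \<in> A \<Longrightarrow> 0 < a"
  obtains e where "0 < e" "\<And>a. a \<in> A \<Longrightarrow> e \<le> a"
proof (cases "A = {}")
  case False
  then show ?thesis using assms by (intro that[of "Min A"]) auto
qed (auto intro: that[of 1])

lemma eventually_eq_limit_of_ints: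
  fixes x :: "nat \<Rightarrow> real"
  assumes "x \<longlonglongrightarrow> L" "\<And>n. x n \<in> \<int>"
  shows "\<forall>\<^sub>F n in sequentially. x n = L"
proof -
  have "L \<in> \<int>"
    using closed_sequentially[of \<int> x L] assms by simp
  have "\<forall>\<^sub>F n in sequentially. dist (x n) L < 1" using assms(1) by (rule tendstoD) simp
  then show ?thesis
  proof eventually_elim
    case (elim n)
    obtain a b where "x n = of_int a" "L = of_int b" using assms(2)[of n] \<open>L \<in> \<int>\<close> by (auto elim!: Ints_cases)
    with elim show ?case by (simp add: dist_real_def)
  qed
qed

text \<open>The test behind \<open>sgp\<close>, freed from lattice points so that it also applies to
  limit positions.\<close>

definition ts :: "real ^ 2 \<Rightarrow> real ^ 2 \<Rightarrow> real ^ 2 \<Rightarrow> bool" where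
  "ts \<delta> a w \<longleftrightarrow> 0 < det2 a w \<or> det2 a w = 0 \<and> 0 < det2 a \<delta>"

lemma sgp_eq_ts: "sgp f \<theta> \<delta> l n = ts \<delta> (f l) (cmb f (rv n) - \<theta>)"
  by (simp add: sgp_def ts_def gap_def)

lemma sign_stable:
  fixes x y :: real
  assumes "\<bar>y - x\<bar> < \<bar>x\<bar>"
  shows "(0 < y) = (0 < x)" "y \<noteq> 0"
  using assms by (auto simp: abs_if split: if_splits)

text \<open>A sequence of planes tends to the plane of \<open>f\<close>. All integer relations \<open>c \<bullet> f i = N $ i\<close> and all
  parallel window lines persist along the sequence, and so do the concurrences of window lines whose
  types lie in \<open>S\<close>. The types outside \<open>S\<close> have no periods.\<close>

locale deform =
  fixes f :: "4 \<Rightarrow> real ^ 2" and \<theta> \<delta> c :: "real ^ 2" and N :: "int ^ 4" and S :: "4 set"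
    and fk :: "nat \<Rightarrow> 4 \<Rightarrow> real ^ 2" and \<theta>k ck :: "nat \<Rightarrow> real ^ 2"
  assumes f_indep: "i \<noteq> j \<Longrightarrow> det2 (f i) (f j) \<noteq> 0"
    and \<delta>: "det2 (f l) \<delta> \<noteq> 0"
    and lim: "(\<lambda>k. fk k i) \<longlonglongrightarrow> f i"
    and c: "c \<bullet> f i = of_int (N $ i)" and ck: "ck k \<bullet> fk k i = of_int (N $ i)"
    and ck_lim: "ck \<longlonglongrightarrow> c" and ck_\<theta>: "ck k \<bullet> \<theta>k k = c \<bullet> \<theta>"
    and dense: "c \<bullet> w = 0 \<Longrightarrow> 0 < e \<Longrightarrow> \<exists>z. c \<bullet> cmb f (rv z) = 0 \<and> norm (cmb f (rv z) - w) < e"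
    and parallel: "det2 (f l) (cmb f (rv z)) = 0 \<Longrightarrow> det2 (fk k l) (cmb (fk k) (rv z)) = 0"
    and aperiodic: "l \<notin> S \<Longrightarrow> det2 (f l) (cmb f (rv z)) = 0 \<Longrightarrow> i \<noteq> l \<Longrightarrow> z $ i = 0"
    and persist: "\<forall>\<^sub>F k in sequentially. \<forall>P. c \<bullet> (P + \<theta>) = 0 \<longrightarrow> (\<exists>d. c \<bullet> d = 0 \<and>
      (\<forall>l. (\<exists>w. c \<bullet> w = 0 \<and> det2 (f l) w \<noteq> 0) \<longrightarrow> det2 (f l) d \<noteq> 0) \<and>
      (\<forall>l\<in>S. \<forall>n. (\<exists>w. c \<bullet> w = 0 \<and> det2 (f l) w \<noteq> 0) \<longrightarrow> det2 (f l) (P + cmb f (rv n)) = 0 \<longrightarrow>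
        (0 < det2 (f l) d) = sgp (fk k) (\<theta>k k) \<delta> l n))"
begin

text \<open>Lattice positions are dense only along directions orthogonal to \<open>c\<close>. Moves
  in these directions can cross the lines of an active type; for an inactive type they run parallel
  to its lines, and the value of \<open>c\<close> alone decides the sign.\<close>

definition active :: "4 \<Rightarrow> bool" where
  "active l \<longleftrightarrow> (\<exists>w. c \<bullet> w = 0 \<and> det2 (f l) w \<noteq> 0)"

definition win :: "nat \<Rightarrow> int ^ 4 \<Rightarrow> real ^ 2" where
  "win k H = cmb (fk k) (rv H) - \<theta>k k"

abbreviation sg :: "nat \<Rightarrow> 4 \<Rightarrow> int ^ 4 \<Rightarrow> bool" where
  "sg k \<equiv> sgp (fk k) (\<theta>k k) \<delta>"

abbreviation pos :: "real ^ 2 \<Rightarrow> 4 \<Rightarrow> int ^ 4 \<Rightarrow> real" where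
  "pos P l n \<equiv> det2 (f l) (P + cmb f (rv n))"

lemma c_cmb: "c \<bullet> cmb f (rv n) = of_int (\<Sum>i\<in>UNIV. n $ i * N $ i)"
  by (simp add: cmb_def inner_sum_right c)

lemma ck_cmb: "ck k \<bullet> cmb (fk k) (rv n) = of_int (\<Sum>i\<in>UNIV. n $ i * N $ i)"
  by (simp add: cmb_def inner_sum_right ck)

lemma passive_const:
  assumes "\<not> active l" "c \<bullet> w = c \<bullet> w'"
  shows "det2 (f l) w = det2 (f l) w'"
proof -
  have "c \<bullet> (w - w') = 0" using assms(2) by (simp add: inner_diff_right)
  then have "det2 (f l) (w - w') = 0" using assms(1) by (auto simp: active_def)
  then show ?thesis by (simp add: det2_linear)
qed

text \<open>Finitely many signs survive a small actual move in direction \<open>d\<close>, after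
  which all active ones are strict with a margin \<open>e0\<close>. Density replaces the moved
  position by a lattice translation \<open>z\<close>; inactive signs depend only on the value of
  \<open>c\<close>, which is the right one for \<open>z\<close>.\<close>

lemma realize:
  assumes P: "c \<bullet> (P + \<theta>) = 0" and d: "c \<bullet> d = 0"
    and loose: "\<And>l m. norm (rv m) \<le> R \<Longrightarrow> active l \<Longrightarrow> pos P l (H + m) \<noteq> 0 \<Longrightarrow>
      \<tau> l (H + m) = (0 < pos P l (H + m))"
    and tight: "\<And>l m. norm (rv m) \<le> R \<Longrightarrow> active l \<Longrightarrow> pos P l (H + m) = 0 \<Longrightarrow>
      det2 (f l) d \<noteq> 0 \<and> \<tau> l (H + m) = (0 < det2 (f l) d)"
    and rigid: "\<And>l m. norm (rv m) \<le> R \<Longrightarrow> \<not> active l \<Longrightarrow> \<tau> l (H + m) = ts \<delta> (f l) (P + cmb f (rv (H + m)))"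
  obtains H' where "\<And>l m. norm (rv m) \<le> R \<Longrightarrow> \<tau> l (H + m) = sgp f \<theta> \<delta> l (H' + m)"
proof -
  define M where "M = {l. active l} \<times> {m. norm (rv m) \<le> R}"
  have finM: "finite M" unfolding M_def by (intro finite_cartesian_product finite_rv_bounded finite)
  let ?x = "\<lambda>e l m. pos P l (H + m) + e * det2 (f l) d"
  have "\<forall>\<^sub>F e in at_right (0 :: real). \<forall>(l, m)\<in>M. ?x e l m \<noteq> 0 \<and> \<tau> l (H + m) = (0 < ?x e l m)"
  proof (intro eventually_ball_finite finM ballI)
    fix lm assume lm: "lm \<in> M"
    obtain l m where e: "lm = (l, m)" by (cases lm)
    have l: "active l" and m: "norm (rv m) \<le> R" using lm e by (simp_all add: M_def)
    have pos: "\<forall>\<^sub>F e in at_right (0 :: real). 0 < e" by (simp add: eventually_at_right_less)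
    have "\<forall>\<^sub>F e in at_right (0 :: real). ?x e l m \<noteq> 0 \<and> \<tau> l (H + m) = (0 < ?x e l m)"
    proof (cases "pos P l (H + m) = 0")
      case True
      show ?thesis using pos
        by eventually_elim (use tight[OF m l True] True in \<open>auto simp: zero_less_mult_iff\<close>)
    next
      case False
      have "((\<lambda>e. ?x e l m) \<longlongrightarrow> pos P l (H + m) + 0 * det2 (f l) d) (at_right 0)" by (intro tendsto_intros)
      then have lim: "((\<lambda>e. ?x e l m) \<longlongrightarrow> pos P l (H + m)) (at_right 0)" by simp
      have "\<forall>\<^sub>F e in at_right 0. dist (?x e l m) (pos P l (H + m)) < \<bar>pos P l (H + m)\<bar>"
        using lim False by (intro tendstoD) auto
      then show ?thesis
        by eventually_elim (use loose[OF m l False] sign_stable in \<open>auto simp only: dist_real_def\<close>)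
    qed
    then show "\<forall>\<^sub>F e in at_right (0 :: real). case lm of (l, m) \<Rightarrow> ?x e l m \<noteq> 0 \<and> \<tau> l (H + m) = (0 < ?x e l m)"
      by (simp add: e)
  qed
  then obtain \<eta> where "\<forall>(l, m)\<in>M. ?x \<eta> l m \<noteq> 0 \<and> \<tau> l (H + m) = (0 < ?x \<eta> l m)"
    using eventually_happens'[OF trivial_limit_at_right_real] by blast
  then have \<eta>: "\<And>l m. (l, m) \<in> M \<Longrightarrow> ?x \<eta> l m \<noteq> 0 \<and> \<tau> l (H + m) = (0 < ?x \<eta> l m)" by blast
  let ?A = "(\<lambda>(l, m). \<bar>?x \<eta> l m\<bar>) ` M"
  have "finite ?A" using finM by (rule finite_imageI)
  moreover have "0 < a" if "a \<in> ?A" for a using that \<eta> by auto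
  ultimately obtain e0 where "0 < e0" and le: "\<And>a. a \<in> ?A \<Longrightarrow> e0 \<le> a"
    using finite_pos_lower_bound by blast
  have "e0 \<le> \<bar>?x \<eta> l m\<bar>" if "(l, m) \<in> M" for l m
    by (rule le) (use that in \<open>auto intro: rev_image_eqI\<close>)
  with \<open>0 < e0\<close> have e0: "0 < e0" "\<And>l m. (l, m) \<in> M \<Longrightarrow> e0 \<le> \<bar>?x \<eta> l m\<bar>" by blast+
  define B where "B = (\<Sum>i\<in>UNIV. norm (f i)) + 1"
  have fB: "norm (f l) < B" for l
    using member_le_sum[of l UNIV "\<lambda>i. norm (f i)"] by (simp add: B_def)
  have B: "0 < B" using fB[of 1] norm_ge_zero[of "f 1"] by linarith
  have cw: "c \<bullet> (P + \<theta> + \<eta> *\<^sub>R d) = 0" using P d by (simp add: inner_add_right)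
  obtain z where z: "c \<bullet> cmb f (rv z) = 0" "norm (cmb f (rv z) - (P + \<theta> + \<eta> *\<^sub>R d)) < e0 / B"
    using dense[OF cw, of "e0 / B"] e0(1) B by auto
  let ?y = "cmb f (rv z) - (P + \<theta> + \<eta> *\<^sub>R d)"
  show ?thesis
  proof (rule that[of "H + z"])
    fix l m assume m: "norm (rv m) \<le> R"
    have g: "gap f \<theta> l (H + z + m) = ?x \<eta> l m + det2 (f l) ?y"
      by (simp add: gap_def rv_add cmb_add det2_linear)
    show "\<tau> l (H + m) = sgp f \<theta> \<delta> l (H + z + m)"
    proof (cases "active l")
      case True
      then have lm: "(l, m) \<in> M" using m by (simp add: M_def)
      have "\<bar>det2 (f l) ?y\<bar> \<le> norm (f l) * norm ?y" by (rule abs_det2_le)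
      also have "\<dots> \<le> B * norm ?y" using fB[of l] by (intro mult_right_mono) auto
      also have "\<dots> < B * (e0 / B)" using z(2) B by (intro mult_strict_left_mono)
      also have "\<dots> = e0" using B by simp
      finally have "\<bar>gap f \<theta> l (H + z + m) - ?x \<eta> l m\<bar> < \<bar>?x \<eta> l m\<bar>" using e0(2)[OF lm] g by simp
      from sign_stable[OF this] show ?thesis using \<eta>[OF lm] by (simp add: sgp_def)
    next
      case False
      have "c \<bullet> (cmb f (rv (H + z + m)) - \<theta>) = c \<bullet> (P + cmb f (rv (H + m)))"
        using z(1) P by (simp add: rv_add cmb_add inner_add_right inner_diff_right)
      from passive_const[OF False this] show ?thesis
        using rigid[OF m False] by (simp add: sgp_eq_ts ts_def)
    qed
  qed
qed

text \<open>A position \<open>P\<close> from which the signs around \<open>H\<close> look as they do in the plane with index \<open>k\<close>, except for the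
  lines through \<open>P\<close> itself.\<close>

definition shadow :: "nat \<Rightarrow> real \<Rightarrow> real \<Rightarrow> int ^ 4 \<Rightarrow> real ^ 2 \<Rightarrow> bool" where
  "shadow k R \<epsilon> H P \<longleftrightarrow> c \<bullet> (P + \<theta>) = 0 \<and> norm (P + cmb f (rv H) - win k H) < \<epsilon> \<and>
    (\<forall>l m. norm (rv m) \<le> R \<longrightarrow> pos P l (H + m) \<noteq> 0 \<longrightarrow> sg k l (H + m) = (0 < pos P l (H + m)))"

text \<open>By compactness: counterexamples would have a limit \<open>w\<close> in the window, and
  \<open>w\<close> moved back by the lattice point is a shadow. The condition on \<open>c\<close>
  eventually holds exactly because the values of \<open>c\<close> on the lattice are
  integers.\<close>

lemma shadow_exists:
  assumes "0 < \<epsilon>"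
  shows "\<forall>\<^sub>F k in sequentially. \<forall>H. norm (win k H) \<le> C \<longrightarrow> (\<exists>P. shadow k R \<epsilon> H P)"
proof (rule ccontr)
  assume "\<not> ?thesis"
  then have "\<exists>k\<ge>n. \<exists>H. norm (win k H) \<le> C \<and> (\<nexists>P. shadow k R \<epsilon> H P)" for n
    unfolding eventually_sequentially by (metis not_le_imp_less)
  then obtain r H where rH: "\<And>n. n \<le> r n" "\<And>n. norm (win (r n) (H n)) \<le> C" "\<And>n P. \<not> shadow (r n) R \<epsilon> (H n) P"
    by metis
  have "bounded (range (\<lambda>n. win (r n) (H n)))" using rH(2) unfolding bounded_iff by auto
  then obtain w s where s: "strict_mono s" "((\<lambda>n. win (r n) (H n)) \<circ> s) \<longlonglongrightarrow> w"
    using bounded_imp_convergent_subsequence by blast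
  define q where "q n = r (s n)" for n
  define G where "G n = H (s n)" for n
  have qtop: "filterlim q at_top sequentially"
    unfolding filterlim_at_top eventually_sequentially q_def
    using rH(1) seq_suble[OF s(1)] by (metis order_trans)
  have w: "(\<lambda>n. win (q n) (G n)) \<longlonglongrightarrow> w" using s(2) by (simp add: comp_def q_def G_def)
  have fq: "(\<lambda>n. fk (q n) i) \<longlonglongrightarrow> f i" for i by (rule filterlim_compose[OF lim qtop])
  have cq: "(\<lambda>n. ck (q n)) \<longlonglongrightarrow> c" by (rule filterlim_compose[OF ck_lim qtop])
  define P where "P n = w - cmb f (rv (G n))" for n
  have posP: "pos (P n) l (G n + m) = det2 (f l) (w + cmb f (rv m))" for n l m
    by (simp add: P_def rv_add cmb_add)
  have "(\<lambda>n. ck (q n) \<bullet> win (q n) (G n) + c \<bullet> \<theta>) \<longlonglongrightarrow> c \<bullet> w + c \<bullet> \<theta>"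
    by (intro tendsto_intros cq w)
  moreover have int: "ck (q n) \<bullet> win (q n) (G n) + c \<bullet> \<theta> = c \<bullet> cmb f (rv (G n))" for n
    by (simp add: win_def inner_diff_right ck_\<theta> ck_cmb c_cmb)
  ultimately have "(\<lambda>n. c \<bullet> cmb f (rv (G n))) \<longlonglongrightarrow> c \<bullet> w + c \<bullet> \<theta>" by simp
  then have "\<forall>\<^sub>F n in sequentially. c \<bullet> cmb f (rv (G n)) = c \<bullet> w + c \<bullet> \<theta>"
    by (rule eventually_eq_limit_of_ints) (unfold c_cmb, rule Ints_of_int)
  then have ev1: "\<forall>\<^sub>F n in sequentially. c \<bullet> (P n + \<theta>) = 0"
    by eventually_elim (simp add: P_def inner_add_right inner_diff_right)
  have ev2: "\<forall>\<^sub>F n in sequentially. norm (P n + cmb f (rv (G n)) - win (q n) (G n)) < \<epsilon>"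
    using tendstoD[OF w assms] by eventually_elim (simp add: P_def dist_norm norm_minus_commute)
  have ev3: "\<forall>\<^sub>F n in sequentially. \<forall>l\<in>UNIV. \<forall>m\<in>{m. norm (rv m) \<le> R}.
      pos (P n) l (G n + m) \<noteq> 0 \<longrightarrow> sg (q n) l (G n + m) = (0 < pos (P n) l (G n + m))"
  proof (intro eventually_ball_finite finite finite_rv_bounded ballI)
    fix l m
    let ?L = "det2 (f l) (w + cmb f (rv m))"
    have g: "gap (fk (q n)) (\<theta>k (q n)) l (G n + m) = det2 (fk (q n) l) (win (q n) (G n) + cmb (fk (q n)) (rv m))" for n
      by (simp add: gap_def win_def rv_add cmb_add algebra_simps)
    show "\<forall>\<^sub>F n in sequentially. pos (P n) l (G n + m) \<noteq> 0 \<longrightarrow> sg (q n) l (G n + m) = (0 < pos (P n) l (G n + m))"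
    proof (cases "?L = 0")
      case False
      have "(\<lambda>n. det2 (fk (q n) l) (win (q n) (G n) + cmb (fk (q n)) (rv m))) \<longlonglongrightarrow> ?L"
        by (intro tendsto_intros fq w)
      then have "\<forall>\<^sub>F n in sequentially. dist (gap (fk (q n)) (\<theta>k (q n)) l (G n + m)) ?L < \<bar>?L\<bar>"
        unfolding g[symmetric] using False by (intro tendstoD) auto
      then show ?thesis
      proof eventually_elim
        case (elim n)
        then show ?case using sign_stable[of "gap (fk (q n)) (\<theta>k (q n)) l (G n + m)" ?L]
          unfolding posP dist_real_def by (simp add: sgp_def)
      qed
    qed (simp add: posP)
  qed
  have "\<forall>\<^sub>F n in sequentially. shadow (q n) R \<epsilon> (G n) (P n)"
    using ev1 ev2 ev3 by eventually_elim (simp add: shadow_def)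
  then obtain n where "shadow (q n) R \<epsilon> (G n) (P n)"
    using eventually_happens by force
  then show False using rH(3)[of "s n" "P n"] by (simp add: q_def G_def)
qed

text \<open>For an inactive type \<open>c\<close> is orthogonal to \<open>f l\<close>, so the
  bracket with \<open>f l\<close> and the product with \<open>c\<close> are proportional. The
  lattice values of \<open>ck k\<close> and \<open>c\<close> agree, hence both signs are read off
  the same number \<open>x\<close>.\<close>

lemma passive_signs:
  "\<forall>\<^sub>F k in sequentially. \<forall>l P n. c \<bullet> (P + \<theta>) = 0 \<longrightarrow> \<not> active l \<longrightarrow>
     sg k l n = ts \<delta> (f l) (P + cmb f (rv n))"
proof -
  have one: "\<forall>\<^sub>F k in sequentially. \<forall>P n. c \<bullet> (P + \<theta>) = 0 \<longrightarrow>
     sg k l n = ts \<delta> (f l) (P + cmb f (rv n))" if l: "\<not> active l" for l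
  proof -
    have c\<delta>: "c \<bullet> \<delta> \<noteq> 0"
      using passive_const[OF l, of \<delta> 0] \<delta>[of l] by auto
    have "c \<noteq> 0" using c\<delta> by auto
    have Nl: "N $ l = 0"
    proof -
      have "det2 (f l) (vector [- (c $ 2), c $ 1]) = 0"
        using passive_const[OF l, of "vector [- (c $ 2), c $ 1]" 0]
        by (simp add: inner_vec_def sum_2 vector_2)
      then have "c \<bullet> f l = 0" by (simp add: det2_def inner_vec_def sum_2 vector_2 algebra_simps)
      then show ?thesis using c[of l] by simp
    qed
    have key: "det2 a w * (b \<bullet> \<delta>) = det2 a \<delta> * (b \<bullet> w)" if "b \<bullet> a = 0" "b \<noteq> 0" for a b w :: "real ^ 2"
    proof -
      have ba: "b $ 1 * a $ 1 = - (b $ 2 * a $ 2)" using that(1) by (simp add: inner_vec_def sum_2)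
      have "det2 a w * (b \<bullet> \<delta>) - det2 a \<delta> * (b \<bullet> w)
        = (b $ 1 * a $ 1 + b $ 2 * a $ 2) * (w $ 2 * \<delta> $ 1 - w $ 1 * \<delta> $ 2)"
        by (simp add: det2_def inner_vec_def sum_2 algebra_simps)
      then show ?thesis using ba by simp
    qed
    have "(\<lambda>k. det2 (fk k l) \<delta>) \<longlonglongrightarrow> det2 (f l) \<delta>" by (intro tendsto_intros lim)
    then have e1: "\<forall>\<^sub>F k in sequentially. dist (det2 (fk k l) \<delta>) (det2 (f l) \<delta>) < \<bar>det2 (f l) \<delta>\<bar>"
      using \<delta>[of l] by (intro tendstoD) auto
    have "(\<lambda>k. ck k \<bullet> \<delta>) \<longlonglongrightarrow> c \<bullet> \<delta>" by (intro tendsto_intros ck_lim)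
    then have e2: "\<forall>\<^sub>F k in sequentially. dist (ck k \<bullet> \<delta>) (c \<bullet> \<delta>) < \<bar>c \<bullet> \<delta>\<bar>"
      using c\<delta> by (intro tendstoD) auto
    show ?thesis
      using e1 e2
    proof eventually_elim
      case (elim k)
      note s1 = sign_stable[OF elim(1)[unfolded dist_real_def]]
      note s2 = sign_stable[OF elim(2)[unfolded dist_real_def]]
      show ?case
      proof (intro allI impI)
        fix P n assume P: "c \<bullet> (P + \<theta>) = 0"
        define x where "x = c \<bullet> (P + cmb f (rv n))"
        let ?w = "cmb (fk k) (rv n) - \<theta>k k"
        have x': "x = ck k \<bullet> ?w"
          using P by (simp add: x_def inner_add_right inner_diff_right ck_cmb c_cmb ck_\<theta>)
        have p1: "det2 (f l) (P + cmb f (rv n)) = det2 (f l) \<delta> * x / (c \<bullet> \<delta>)"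
          using key[of c "f l" "P + cmb f (rv n)"] c[of l] Nl \<open>c \<noteq> 0\<close> c\<delta> by (simp add: x_def field_simps)
        have "ck k \<noteq> 0" using s2(2) by auto
        then have p2: "det2 (fk k l) ?w = det2 (fk k l) \<delta> * x / (ck k \<bullet> \<delta>)"
          using key[of "ck k" "fk k l" ?w] ck[of k l] Nl s2(2) by (simp add: x' field_simps)
        show "sg k l n = ts \<delta> (f l) (P + cmb f (rv n))"
          unfolding sgp_eq_ts ts_def p1 p2 using s1 s2 c\<delta> \<delta>[of l]
          by (auto simp: zero_less_divide_iff zero_less_mult_iff mult_less_0_iff)
      qed
    qed
  qed
  have "\<forall>\<^sub>F k in sequentially. \<forall>l\<in>{l. \<not> active l}. \<forall>P n. c \<bullet> (P + \<theta>) = 0 \<longrightarrow>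
     sg k l n = ts \<delta> (f l) (P + cmb f (rv n))"
    using one by (intro eventually_ball_finite) auto
  then show ?thesis by eventually_elim auto
qed

text \<open>In the good case the signs of the lines through \<open>P\<close> are also realized, by moving \<open>P\<close> slightly in a
  direction \<open>d\<close>; then the pattern at \<open>H\<close> occurs for the original plane. At a bad position the signs of
  all types linked to a visible aperiodic type are reset to those given by \<open>\<delta>\<close>.\<close>

definition good :: "nat \<Rightarrow> real \<Rightarrow> int ^ 4 \<Rightarrow> real ^ 2 \<Rightarrow> bool" where
  "good k R H P \<longleftrightarrow> (\<exists>d. c \<bullet> d = 0 \<and> (\<forall>l m. norm (rv m) \<le> R \<longrightarrow> active l \<longrightarrow> pos P l (H + m) = 0 \<longrightarrow>
     det2 (f l) d \<noteq> 0 \<and> sg k l (H + m) = (0 < det2 (f l) d)))"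

definition bad :: "nat \<Rightarrow> real \<Rightarrow> real \<Rightarrow> real \<Rightarrow> int ^ 4 \<Rightarrow> real ^ 2 \<Rightarrow> bool" where
  "bad k R C \<epsilon> H P \<longleftrightarrow> norm (win k H) \<le> C \<and> shadow k R \<epsilon> H P \<and> \<not> good k R H P"

definition vis :: "real \<Rightarrow> int ^ 4 \<Rightarrow> real ^ 2 \<Rightarrow> 4 \<Rightarrow> bool" where
  "vis R H P l \<longleftrightarrow> (\<exists>m. norm (rv m) \<le> R \<and> pos P l (H + m) = 0)"

text \<open>Linked types occur together in one pattern, so resetting one without the other could
  create a new pattern; this is why \<open>reset\<close> is closed under links.\<close>

definition linked :: "nat \<Rightarrow> real \<Rightarrow> real \<Rightarrow> real ^ 2 \<Rightarrow> (4 \<times> 4) set" where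
  "linked k R C P = {(l, l'). l \<notin> S \<and> l' \<notin> S \<and> active l \<and> active l' \<and>
     (\<exists>H. norm (win k H) \<le> C \<and> vis R H P l \<and> vis R H P l')}"

definition reset :: "nat \<Rightarrow> real \<Rightarrow> real \<Rightarrow> real \<Rightarrow> real ^ 2 \<Rightarrow> 4 set" where
  "reset k R C \<epsilon> P = {l'. \<exists>l H. l \<notin> S \<and> active l \<and> bad k R C \<epsilon> H P \<and> vis R H P l \<and> (l, l') \<in> (linked k R C P)\<^sup>*}"

text \<open>The visible lines leave \<open>Q\<close> no freedom as long as the value of
  \<open>c\<close> is kept. Only finitely many bounded positions are of this kind, which yields
  margins independent of \<open>k\<close>.\<close>

definition pins :: "real \<Rightarrow> real ^ 2 \<Rightarrow> bool" where
  "pins R Q \<longleftrightarrow> (\<forall>v. c \<bullet> v = 0 \<longrightarrow>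
     (\<forall>l m. norm (rv m) \<le> R \<longrightarrow> det2 (f l) (Q + cmb f (rv m)) = 0 \<longrightarrow> det2 (f l) v = 0) \<longrightarrow> v = 0)"

section \<open>Bad positions: finiteness and bounded clusters\<close>

lemma gap_win: "gap (fk k) (\<theta>k k) l (H + m) = det2 (fk k l) (win k H + cmb (fk k) (rv m))"
  by (simp add: gap_def win_def rv_add cmb_add algebra_simps)

lemma pos_add: "pos P l (n + m) = pos P l n + det2 (f l) (cmb f (rv m))"
  by (simp add: rv_add cmb_add det2_linear)

lemma sg_cong:
  assumes "pos P l n = 0" "pos P l n' = 0"
  shows "gap (fk k) (\<theta>k k) l n = gap (fk k) (\<theta>k k) l n'" "sg k l n = sg k l n'"
proof -
  have "det2 (f l) (cmb f (rv (n - n'))) = 0" using assms pos_add[where P = P and l = l and n = n' and m = "n - n'"] by simp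
  then have "det2 (fk k l) (cmb (fk k) (rv (n - n'))) = 0" by (rule parallel)
  then show "gap (fk k) (\<theta>k k) l n = gap (fk k) (\<theta>k k) l n'"
    using gap_add[of "fk k" "\<theta>k k" l n' "n - n'"] by simp
  then show "sg k l n = sg k l n'" by (simp add: sgp_def)
qed

lemma tight_diff:
  assumes "l \<notin> S" "pos P l n = 0" "pos P l n' = 0"
  obtains a where "n = n' + axis l a"
proof -
  have "det2 (f l) (cmb f (rv (n - n'))) = 0" using assms(2,3) pos_add[where P = P and l = l and n = n' and m = "n - n'"] by simp
  from aperiodic[OF assms(1) this] have "(n - n') $ i = 0" if "i \<noteq> l" for i using that by blast
  then have "(n - n') $ i = axis l ((n - n') $ l) $ i" for i by (simp add: axis_def)
  then have "n - n' = axis l ((n - n') $ l)" unfolding vec_eq_iff by blast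
  then have "n = n' + axis l ((n - n') $ l)" by (metis add.commute diff_add_cancel)
  then show ?thesis by (rule that)
qed

text \<open>If a direction were left free, all visible lines would be of one type. Lines of one type
  in the same position have the same sign, and a single sign is realized by choosing a side, so the
  position would be good.\<close>

lemma bad_pins:
  assumes "bad k R C \<epsilon> H P"
  shows "pins R (P + cmb f (rv H))"
  unfolding pins_def
proof (intro allI impI, rule ccontr)
  fix v assume cv: "c \<bullet> v = 0" and v0: "v \<noteq> 0"
    and kill: "\<forall>l m. norm (rv m) \<le> R \<longrightarrow> det2 (f l) (P + cmb f (rv H) + cmb f (rv m)) = 0 \<longrightarrow> det2 (f l) v = 0"
  have kill': "det2 (f l) v = 0" if "norm (rv m) \<le> R" "pos P l (H + m) = 0" for l m
    using kill that by (simp add: rv_add cmb_add add.assoc)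
  have same: "l = l'" if "norm (rv m) \<le> R" "pos P l (H + m) = 0" "norm (rv m') \<le> R" "pos P l' (H + m') = 0" for l l' m m'
  proof (rule ccontr)
    assume "l \<noteq> l'"
    then have "v = 0" using det2_both_zero[OF f_indep] kill'[OF that(1,2)] kill'[OF that(3,4)] by blast
    with v0 show False by simp
  qed
  have "good k R H P"
  proof (cases "\<exists>l m. norm (rv m) \<le> R \<and> active l \<and> pos P l (H + m) = 0")
    case False
    then show ?thesis unfolding good_def by (intro exI[of _ 0]) auto
  next
    case True
    then obtain l m where lm: "norm (rv m) \<le> R" "active l" "pos P l (H + m) = 0" by blast
    then obtain u where u: "c \<bullet> u = 0" "det2 (f l) u \<noteq> 0" unfolding active_def by blast
    define d where "d = (if sg k l (H + m) = (0 < det2 (f l) u) then u else - u)"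
    have d: "c \<bullet> d = 0" "det2 (f l) d \<noteq> 0" "sg k l (H + m) = (0 < det2 (f l) d)"
      using u by (auto simp: d_def det2_linear)
    show ?thesis
      unfolding good_def
    proof (intro exI[of _ d] conjI allI impI d(1))
      fix l' m' assume *: "norm (rv m') \<le> R" "active l'" "pos P l' (H + m') = 0"
      then have l': "l' = l" using same lm by blast
      then show "det2 (f l') d \<noteq> 0" using d by simp
      show "sg k l' (H + m') = (0 < det2 (f l') d)"
        using sg_cong(2)[where P = P and l = l and n = "H + m'" and n' = "H + m" and k = k] * lm d l' by simp
    qed
  qed
  with assms show False by (simp add: bad_def)
qed

text \<open>A pinned position is determined by the set of visible lines through it and the integer
  value of \<open>c\<close>; in a bounded region there are finitely many such data.\<close>

lemma finite_pinned: "finite {Q. norm Q \<le> C \<and> c \<bullet> (Q + \<theta>) \<in> \<int> \<and> pins R Q}" (is "finite ?V")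
proof -
  define key where "key Q = ({(l, m). norm (rv m) \<le> R \<and> det2 (f l) (Q + cmb f (rv m)) = 0}, c \<bullet> (Q + \<theta>))" for Q
  let ?B = "norm c * (C + norm \<theta>)"
  have "inj_on key ?V"
  proof (rule inj_onI)
    fix Q Q' assume Q: "Q \<in> ?V" "Q' \<in> ?V" and eq: "key Q = key Q'"
    have "c \<bullet> (Q - Q') = 0" using eq by (simp add: key_def inner_add_right inner_diff_right)
    moreover have "det2 (f l) (Q - Q') = 0" if "norm (rv m) \<le> R" "det2 (f l) (Q + cmb f (rv m)) = 0" for l m
    proof -
      have "(l, m) \<in> fst (key Q')" using that eq[symmetric] by (simp add: key_def)
      then have "det2 (f l) (Q' + cmb f (rv m)) = 0" by (simp add: key_def)
      with that(2) show ?thesis by (simp add: det2_linear)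
    qed
    ultimately show "Q = Q'" using Q(1) unfolding pins_def by auto
  qed
  moreover have "finite (key ` ?V)"
  proof (rule finite_subset)
    show "key ` ?V \<subseteq> Pow (UNIV \<times> {m. norm (rv m) \<le> R}) \<times> (of_int ` {- \<lceil>?B\<rceil>..\<lceil>?B\<rceil>})"
    proof
      fix p assume "p \<in> key ` ?V"
      then obtain Q where Q: "norm Q \<le> C" "c \<bullet> (Q + \<theta>) \<in> \<int>" "p = key Q" by blast
      obtain a where a: "c \<bullet> (Q + \<theta>) = of_int a" using Q(2) by (elim Ints_cases)
      have "\<bar>c \<bullet> (Q + \<theta>)\<bar> \<le> norm c * norm (Q + \<theta>)" by (rule Cauchy_Schwarz_ineq2)
      also have "\<dots> \<le> ?B"
        using norm_triangle_ineq[of Q \<theta>] Q(1) by (intro mult_left_mono) auto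
      finally have "\<bar>of_int a\<bar> \<le> ?B" unfolding a .
      then have "a \<in> {- \<lceil>?B\<rceil>..\<lceil>?B\<rceil>}" by (simp add: abs_le_iff) linarith
      then show "p \<in> Pow (UNIV \<times> {m. norm (rv m) \<le> R}) \<times> (of_int ` {- \<lceil>?B\<rceil>..\<lceil>?B\<rceil>})"
        unfolding Q(3) key_def a by auto
    qed
    show "finite (Pow ((UNIV :: 4 set) \<times> {m. norm (rv m) \<le> R}) \<times> ((of_int :: int \<Rightarrow> real) ` {- \<lceil>?B\<rceil>..\<lceil>?B\<rceil>}))"
      by (intro finite_cartesian_product finite_imageI finite_rv_bounded finite_Pow_iff[THEN iffD2]) auto
  qed
  ultimately show ?thesis by (rule finite_imageD[rotated])
qed

lemma reset_vis:
  assumes "l' \<in> reset k R C \<epsilon> P"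
  shows "l' \<notin> S" "active l'" "\<exists>H. norm (win k H) \<le> C \<and> vis R H P l'"
proof -
  obtain l H where l: "l \<notin> S" "active l" "bad k R C \<epsilon> H P" "vis R H P l" "(l, l') \<in> (linked k R C P)\<^sup>*"
    using assms unfolding reset_def by blast
  show "l' \<notin> S" "active l'" "\<exists>H. norm (win k H) \<le> C \<and> vis R H P l'"
    using l(5,1,2,3,4) by (cases rule: rtrancl.cases; auto simp: linked_def bad_def)+
qed

text \<open>By aperiodicity the two base points differ by two visible vectors and a multiple of the
  axis of \<open>l\<close>. Both window positions are bounded, which bounds the multiple.\<close>

lemma shadow_distance:
  assumes m0: "0 < m0" "m0 \<le> norm (fk k l)" and B: "(\<Sum>i\<in>UNIV. norm (fk k i)) \<le> B" "0 \<le> R"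
    and H: "norm (win k H1) \<le> C" "norm (win k H2) \<le> C" and l: "l \<notin> S" and v: "vis R H1 P l" "vis R H2 P l"
  shows "norm (rv (H1 - H2)) \<le> 2 * R + (2 * C + 2 * R * B) / m0"
proof -
  obtain m1 m2 where m: "norm (rv m1) \<le> R" "pos P l (H1 + m1) = 0" "norm (rv m2) \<le> R" "pos P l (H2 + m2) = 0"
    using v unfolding vis_def by blast
  obtain a where a: "H1 + m1 = H2 + m2 + axis l a" using tight_diff[OF l m(2,4)] by blast
  have e: "H1 - H2 = m2 - m1 + axis l a" using a by (simp add: algebra_simps)
  have nax: "norm (axis l (of_int a) :: real ^ 4) = \<bar>of_int a\<bar>"
    by (simp add: norm_vec_def L2_set_def axis_def if_distrib[of "\<lambda>x. x\<^sup>2"] cong: if_cong)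
  have bm: "norm (cmb (fk k) (rv m)) \<le> R * B" if "norm (rv m) \<le> R" for m
  proof -
    have "norm (cmb (fk k) (rv m)) \<le> (\<Sum>i\<in>UNIV. norm (fk k i)) * norm (rv m)" by (rule norm_cmb_le)
    also have "\<dots> \<le> B * R" using B(1) that sum_nonneg[of UNIV "\<lambda>i. norm (fk k i)"] by (intro mult_mono) auto
    finally show ?thesis by (simp add: mult.commute)
  qed
  have "win k H1 - win k H2 = cmb (fk k) (rv (H1 - H2))" by (simp add: win_def rv_diff cmb_diff)
  also have "\<dots> = cmb (fk k) (rv m2) - cmb (fk k) (rv m1) + of_int a *\<^sub>R fk k l"
    unfolding e by (simp add: rv_add rv_diff cmb_add cmb_diff)
  finally have "of_int a *\<^sub>R fk k l = (win k H1 - win k H2) - (cmb (fk k) (rv m2) - cmb (fk k) (rv m1))"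
    by (simp add: algebra_simps)
  then have "norm (of_int a *\<^sub>R fk k l) = norm ((win k H1 - win k H2) - (cmb (fk k) (rv m2) - cmb (fk k) (rv m1)))"
    by simp
  then have "norm (of_int a *\<^sub>R fk k l) \<le> 2 * C + 2 * (R * B)"
    using norm_triangle_ineq4[of "win k H1 - win k H2" "cmb (fk k) (rv m2) - cmb (fk k) (rv m1)"]
      norm_triangle_ineq4[of "win k H1" "win k H2"]
      norm_triangle_ineq4[of "cmb (fk k) (rv m2)" "cmb (fk k) (rv m1)"] H bm[OF m(1)] bm[OF m(3)] by linarith
  moreover have "\<bar>of_int a\<bar> * m0 \<le> norm (of_int a *\<^sub>R fk k l)" using m0 by (simp add: mult_left_mono)
  ultimately have "\<bar>of_int a\<bar> \<le> (2 * C + 2 * R * B) / m0" using m0(1) by (simp add: field_simps)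
  moreover have "norm (rv (H1 - H2)) \<le> norm (rv m2) + norm (rv m1) + \<bar>of_int a\<bar>"
    using norm_triangle_ineq[of "rv m2 - rv m1" "rv (axis l a)"] norm_triangle_ineq4[of "rv m2" "rv m1"]
    unfolding e by (simp add: rv_add rv_diff nax)
  ultimately show ?thesis using m by linarith
qed

text \<open>A chain of links can be shortened to at most 16 steps, the number of pairs of types.
  Each comparison through a common type costs at most \<open>D\<close>, and there is one more
  comparison than links, hence 17.\<close>

lemma reset_near:
  assumes m0: "0 < m0" "\<And>l. m0 \<le> norm (fk k l)" and B: "(\<Sum>i\<in>UNIV. norm (fk k i)) \<le> B" "0 \<le> R" "0 \<le> C"
    and l': "l' \<in> reset k R C \<epsilon> P"
  defines "D \<equiv> 2 * R + (2 * C + 2 * R * B) / m0"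
  obtains H where "bad k R C \<epsilon> H P"
    "\<And>H'. norm (win k H') \<le> C \<Longrightarrow> vis R H' P l' \<Longrightarrow> norm (rv (H' - H)) \<le> 17 * D"
proof -
  obtain l H where l: "l \<notin> S" "active l" "bad k R C \<epsilon> H P" "vis R H P l" "(l, l') \<in> (linked k R C P)\<^sup>*"
    using l' unfolding reset_def by blast
  have H: "norm (win k H) \<le> C" using l(3) by (simp add: bad_def)
  have "0 \<le> B" using B(1) sum_nonneg[of UNIV "\<lambda>i. norm (fk k i)"] by simp
  then have D0: "0 \<le> D" unfolding D_def using B m0(1) by simp
  let ?L = "linked k R C P"
  have "card ?L \<le> 16"
    using card_mono[of "UNIV :: (4 \<times> 4) set" ?L] by (simp add: card_prod)
  moreover obtain j where "j \<le> card ?L" and j2: "(l, l') \<in> ?L ^^ j"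
    using l(5) rtrancl_finite_eq_relpow[of ?L] by auto
  ultimately have j: "j \<le> 16" "(l, l') \<in> ?L ^^ j" by simp_all
  have "norm (rv (H' - H)) \<le> (real j + 1) * D" if "norm (win k H') \<le> C" "vis R H' P l'" for H'
    using j(2) that
  proof (induction j arbitrary: l' H')
    case 0
    then have "vis R H' P l" by simp
    then show ?case
      using shadow_distance[OF m0 B(1,2) 0(2) H l(1) _ l(4)] by (simp add: D_def)
  next
    case (Suc j)
    then obtain l1 where l1: "(l, l1) \<in> ?L ^^ j" "(l1, l') \<in> ?L" by auto
    then obtain H4 where H4: "l' \<notin> S" "norm (win k H4) \<le> C" "vis R H4 P l1" "vis R H4 P l'"
      unfolding linked_def by blast
    have "norm (rv (H4 - H)) \<le> (real j + 1) * D" using Suc.IH[OF l1(1) H4(2,3)] .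
    moreover have "norm (rv (H' - H4)) \<le> D"
      using shadow_distance[OF m0 B(1,2) Suc.prems(2) H4(2) H4(1) Suc.prems(3) H4(4)] by (simp add: D_def)
    moreover have "rv (H' - H) = rv (H' - H4) + rv (H4 - H)" by (simp add: rv_diff)
    ultimately show ?case
      using norm_triangle_ineq[of "rv (H' - H4)" "rv (H4 - H)"] by (simp add: algebra_simps)
  qed
  moreover have "(real j + 1) * D \<le> 17 * D" using j(1) D0 by (intro mult_right_mono) auto
  ultimately show ?thesis using that[OF l(3)] by (meson order_trans)
qed

lemma constants:
  obtains B m0 where "0 < B" "0 < m0" "\<And>l. norm (f l) \<le> B"
    "\<forall>\<^sub>F k in sequentially. (\<Sum>i\<in>UNIV. norm (fk k i)) \<le> B \<and> (\<forall>l. m0 \<le> norm (fk k l))"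
proof -
  define B where "B = (\<Sum>i\<in>UNIV. norm (f i)) + 1"
  have fB: "norm (f l) \<le> B" for l
    using member_le_sum[of l UNIV "\<lambda>i. norm (f i)"] by (simp add: B_def)
  have B: "0 < B" unfolding B_def using sum_nonneg[of UNIV "\<lambda>i. norm (f i)"] by simp
  have f0: "f l \<noteq> 0" for l using \<delta>[of l] by auto
  have "0 < a" if "a \<in> range (\<lambda>l. norm (f l))" for a using that f0 by auto
  then obtain e where e: "0 < e" "\<And>a. a \<in> range (\<lambda>l. norm (f l)) \<Longrightarrow> e \<le> a"
    using finite_pos_lower_bound[of "range (\<lambda>l. norm (f l))"] finite by blast
  have "(\<lambda>k. \<Sum>i\<in>UNIV. norm (fk k i)) \<longlonglongrightarrow> (\<Sum>i\<in>UNIV. norm (f i))" by (intro tendsto_intros lim)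
  then have ev1: "\<forall>\<^sub>F k in sequentially. (\<Sum>i\<in>UNIV. norm (fk k i)) < B"
    by (rule order_tendstoD) (simp add: B_def)
  have "\<forall>\<^sub>F k in sequentially. \<forall>l\<in>UNIV. e / 2 < norm (fk k l)"
  proof (intro eventually_ball_finite finite ballI)
    fix l
    have "(\<lambda>k. norm (fk k l)) \<longlonglongrightarrow> norm (f l)" by (intro tendsto_intros lim)
    moreover have "e / 2 < norm (f l)" using e(1) e(2)[of "norm (f l)"] by auto
    ultimately show "\<forall>\<^sub>F k in sequentially. e / 2 < norm (fk k l)" by (rule order_tendstoD)
  qed
  with ev1 have "\<forall>\<^sub>F k in sequentially. (\<Sum>i\<in>UNIV. norm (fk k i)) \<le> B \<and> (\<forall>l. e / 2 \<le> norm (fk k l))"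
    by eventually_elim (auto simp: less_imp_le)
  then show ?thesis using B e(1) fB by (intro that[of B "e / 2"]) auto
qed

text \<open>The key construction: reset the signs of aperiodic types along clusters of nearly concurrent
  window lines at which the perturbed plane shows a pattern that the original plane does not have.\<close>

lemma signs_exist:
  assumes RC: "0 \<le> R" "0 \<le> C"
  shows "\<forall>\<^sub>F k in sequentially. \<exists>\<tau>. (\<forall>l n a. \<tau> l (n + axis l a) = \<tau> l n) \<and>
     (\<forall>l n. 1 \<le> \<bar>gap (fk k) (\<theta>k k) l n\<bar> \<longrightarrow> \<tau> l n = (0 < gap (fk k) (\<theta>k k) l n)) \<and>
     (\<forall>H. norm (win k H) \<le> C \<longrightarrow> (\<exists>H'. \<forall>l m. norm (rv m) \<le> R \<longrightarrow> \<tau> l (H + m) = sgp f \<theta> \<delta> l (H' + m)))"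
proof -
  obtain B m0 where B: "0 < B" and m0: "0 < m0" and fB: "\<And>l. norm (f l) \<le> B"
    and ev_const: "\<forall>\<^sub>F k in sequentially. (\<Sum>i\<in>UNIV. norm (fk k i)) \<le> B \<and> (\<forall>l. m0 \<le> norm (fk k l))"
    using constants by blast
  define D where "D = 2 * R + (2 * C + 2 * R * B) / m0"
  \<comment> \<open>What is seen within \<open>R\<close> from the bad base point is seen within
    \<open>R1\<close> from every base point of its cluster.\<close>
  define R1 where "R1 = 17 * D + R"
  have D0: "0 \<le> D" unfolding D_def using RC B m0 by simp
  have R1: "0 \<le> R1" "R \<le> R1" using D0 RC by (simp_all add: R1_def)
  define V where "V = {Q. norm Q \<le> C + 1 \<and> c \<bullet> (Q + \<theta>) \<in> \<int> \<and> pins R1 Q}"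
  have finV: "finite V" unfolding V_def by (rule finite_pinned)
  define M1 where "M1 = {m. norm (rv m) \<le> R1}"
  have finM: "finite M1" unfolding M1_def by (rule finite_rv_bounded)
  \<comment> \<open>\<open>e1\<close> separates distinct pinned positions, and \<open>e2\<close>
    below bounds from zero the distances of visible lines that miss a pinned position.\<close>
  let ?A1 = "{norm (Q - Q') | Q Q'. Q \<in> V \<and> Q' \<in> V \<and> Q \<noteq> Q'}"
  have "?A1 \<subseteq> (\<lambda>(Q, Q'). norm (Q - Q')) ` (V \<times> V)" by auto
  then have "finite ?A1" using finV by (meson finite_SigmaI finite_imageI finite_subset)
  moreover have "0 < a" if "a \<in> ?A1" for a using that by auto
  ultimately obtain e1 where e1: "0 < e1" "\<And>a. a \<in> ?A1 \<Longrightarrow> e1 \<le> a"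
    using finite_pos_lower_bound[of ?A1] by blast
  let ?p = "\<lambda>Q l m. det2 (f l) (Q + cmb f (rv m))"
  let ?A2 = "{\<bar>?p Q l m\<bar> | Q l m. Q \<in> V \<and> m \<in> M1 \<and> ?p Q l m \<noteq> 0}"
  have "?A2 \<subseteq> (\<lambda>(Q, l, m). \<bar>?p Q l m\<bar>) ` (V \<times> UNIV \<times> M1)" by force
  moreover have "finite (V \<times> (UNIV :: 4 set) \<times> M1)" using finV finM by simp
  ultimately have "finite ?A2" by (meson finite_imageI finite_subset)
  moreover have "0 < a" if "a \<in> ?A2" for a using that by auto
  ultimately obtain e2 where e2: "0 < e2" "\<And>a. a \<in> ?A2 \<Longrightarrow> e2 \<le> a"
    using finite_pos_lower_bound[of ?A2] by blast
  define \<zeta> where "\<zeta> = min e2 1"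
  have \<zeta>: "0 < \<zeta>" "\<zeta> \<le> 1" using e2 by (simp_all add: \<zeta>_def)
  \<comment> \<open>The factor 4 leaves room for two positions within \<open>2 * \<epsilon>\<close>
    of the same window point; the last term keeps the resulting error of a gap below
    \<open>\<zeta>\<close>.\<close>
  define \<epsilon> where "\<epsilon> = min (min e1 1) (\<zeta> / (2 * B)) / 4"
  have "4 * \<epsilon> \<le> \<zeta> / (2 * B)" by (simp add: \<epsilon>_def)
  then have "8 * \<epsilon> * B \<le> \<zeta>" using B by (simp add: field_simps)
  then have \<epsilon>: "0 < \<epsilon>" "4 * \<epsilon> \<le> e1" "4 * \<epsilon> \<le> 1" "8 * \<epsilon> * B \<le> \<zeta>"
    using e1(1) \<zeta>(1) B by (simp_all add: \<epsilon>_def)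
  have ev_f: "\<forall>\<^sub>F k in sequentially. \<forall>l\<in>UNIV. norm (fk k l - f l) * (C + B * R1) < \<zeta> / 4"
  proof (intro eventually_ball_finite finite ballI)
    fix l
    have "(\<lambda>k. norm (fk k l - f l) * (C + B * R1)) \<longlonglongrightarrow> norm (f l - f l) * (C + B * R1)"
      by (intro tendsto_intros lim)
    then show "\<forall>\<^sub>F k in sequentially. norm (fk k l - f l) * (C + B * R1) < \<zeta> / 4"
      using \<zeta> by (intro order_tendstoD) auto
  qed
  have ev_F: "\<forall>\<^sub>F k in sequentially. \<forall>m\<in>M1. norm (cmb (fk k) (rv m) - cmb f (rv m)) < \<epsilon>"
  proof (intro eventually_ball_finite finM ballI)
    fix m
    have "(\<lambda>k. norm (cmb (fk k) (rv m) - cmb f (rv m))) \<longlonglongrightarrow> norm (cmb f (rv m) - cmb f (rv m))"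
      by (intro tendsto_intros lim)
    then show "\<forall>\<^sub>F k in sequentially. norm (cmb (fk k) (rv m) - cmb f (rv m)) < \<epsilon>"
      using \<epsilon>(1) by (intro order_tendstoD) auto
  qed
  show ?thesis
    using ev_const ev_f ev_F shadow_exists[OF \<epsilon>(1), of C R] passive_signs persist
  proof eventually_elim
    case (elim k)
    note const = elim(1) and cf = elim(2)[rule_format, OF UNIV_I] and cF = elim(3) and sh = elim(4)
      and pas = elim(5)[rule_format] and per = elim(6)[rule_format]
    define K where "K = reset k R C \<epsilon>"
    \<comment> \<open>A second \<open>\<epsilon>\<close> is allowed because passing from the bad
      base point to another one of its cluster exchanges \<open>cmb (fk k)\<close> and
      \<open>cmb f\<close> on a bounded lattice vector.\<close>
    define near where "near H P \<longleftrightarrow> c \<bullet> (P + \<theta>) = 0 \<and> norm (win k H) \<le> C \<and>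
      norm (P + cmb f (rv H) - win k H) < 2 * \<epsilon> \<and> pins R1 (P + cmb f (rv H))" for H P
    have nearV: "P + cmb f (rv H) \<in> V" if "near H P" for H P
    proof -
      have "norm (P + cmb f (rv H)) \<le> norm (win k H) + norm (P + cmb f (rv H) - win k H)"
        by (metis add.commute diff_add_cancel norm_triangle_ineq)
      then have "norm (P + cmb f (rv H)) \<le> C + 1" using that \<epsilon> unfolding near_def by linarith
      moreover have "c \<bullet> (P + cmb f (rv H) + \<theta>) = c \<bullet> (P + \<theta>) + c \<bullet> cmb f (rv H)"
        by (simp add: inner_add_right)
      then have "c \<bullet> (P + cmb f (rv H) + \<theta>) \<in> \<int>" using that by (simp only: near_def c_cmb add_0_left Ints_of_int)
      ultimately show ?thesis using that by (simp add: V_def near_def)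
    qed
    have near_unique: "P = P'" if "near H P" "near H P'" for H P P'
    proof (rule ccontr)
      assume "P \<noteq> P'"
      let ?Q = "P + cmb f (rv H)" and ?Q' = "P' + cmb f (rv H)"
      have "?Q \<noteq> ?Q'" using \<open>P \<noteq> P'\<close> by simp
      then have "norm (?Q - ?Q') \<in> ?A1" using nearV[OF that(1)] nearV[OF that(2)] by blast
      then have "e1 \<le> norm (?Q - ?Q')" by (rule e1(2))
      moreover have eq: "?Q - ?Q' = (?Q - win k H) - (?Q' - win k H)" by simp
      have "norm (?Q - ?Q') < 4 * \<epsilon>"
        unfolding eq using that norm_triangle_ineq4[of "?Q - win k H" "?Q' - win k H"] unfolding near_def by linarith
      ultimately show False using \<epsilon>(2) by linarith
    qed
    \<comment> \<open>A quarter of \<open>\<zeta>\<close> is spent on the change of the line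
      direction and at most half of it on the change of position.\<close>
    have close: "\<bar>gap (fk k) (\<theta>k k) l (H + m) - pos P l (H + m)\<bar> < \<zeta>"
      if n: "near H P" and m: "m \<in> M1" for H P l m
    proof -
      let ?b' = "win k H + cmb (fk k) (rv m)" and ?b = "P + cmb f (rv H) + cmb f (rv m)"
      have "gap (fk k) (\<theta>k k) l (H + m) - pos P l (H + m) = det2 (fk k l - f l) ?b' + det2 (f l) (?b' - ?b)"
        unfolding gap_win by (simp add: rv_add cmb_add det2_linear)
      moreover have "\<bar>det2 (fk k l - f l) ?b'\<bar> < \<zeta> / 4"
      proof -
        have "norm (cmb (fk k) (rv m)) \<le> (\<Sum>i\<in>UNIV. norm (fk k i)) * norm (rv m)" by (rule norm_cmb_le)
        also have "\<dots> \<le> B * R1" using const m B by (intro mult_mono) (auto simp: M1_def)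
        finally have "norm ?b' \<le> C + B * R1"
          using norm_triangle_ineq[of "win k H" "cmb (fk k) (rv m)"] n by (simp add: near_def)
        then have "norm (fk k l - f l) * norm ?b' \<le> norm (fk k l - f l) * (C + B * R1)"
          by (intro mult_left_mono) auto
        then show ?thesis using abs_det2_le[of "fk k l - f l" ?b'] cf[of l] by linarith
      qed
      moreover have "\<bar>det2 (f l) (?b' - ?b)\<bar> \<le> B * (3 * \<epsilon>)"
      proof -
        have eq: "?b' - ?b = (cmb (fk k) (rv m) - cmb f (rv m)) - (P + cmb f (rv H) - win k H)" by simp
        have "norm (cmb (fk k) (rv m) - cmb f (rv m)) < \<epsilon>" using cF m by blast
        then have "norm (?b' - ?b) \<le> 3 * \<epsilon>"
          unfolding eq
          using norm_triangle_ineq4[of "cmb (fk k) (rv m) - cmb f (rv m)" "P + cmb f (rv H) - win k H"]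
            n unfolding near_def by linarith
        then have "norm (f l) * norm (?b' - ?b) \<le> B * (3 * \<epsilon>)"
          using fB[of l] B by (intro mult_mono) auto
        then show ?thesis using abs_det2_le[of "f l" "?b' - ?b"] by linarith
      qed
      moreover have "0 < B * \<epsilon>" using \<epsilon>(1) B by simp
      then have "B * (3 * \<epsilon>) \<le> \<zeta> / 2" using \<epsilon>(4) by (simp add: algebra_simps)
      ultimately show ?thesis using \<zeta>(1) by linarith
    qed
    have loose_sign: "sg k l (H + m) = (0 < pos P l (H + m))"
      if n: "near H P" and m: "m \<in> M1" and p: "pos P l (H + m) \<noteq> 0" for H P l m
    proof -
      have p': "pos P l (H + m) = ?p (P + cmb f (rv H)) l m" by (simp add: rv_add cmb_add add.assoc)
      then have "\<bar>pos P l (H + m)\<bar> \<in> ?A2" using nearV[OF n] m p by (auto intro!: exI)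
      then have "\<zeta> \<le> \<bar>pos P l (H + m)\<bar>" using e2(2) unfolding \<zeta>_def by fastforce
      then have "\<bar>gap (fk k) (\<theta>k k) l (H + m) - pos P l (H + m)\<bar> < \<bar>pos P l (H + m)\<bar>"
        using close[OF n m, of l] by linarith
      from sign_stable[OF this] show ?thesis by (simp add: sgp_def)
    qed
    have K_near: "near H' P" if l': "l' \<in> K P" and H': "norm (win k H') \<le> C" "vis R H' P l'" for l' P H'
    proof -
      obtain H where H: "bad k R C \<epsilon> H P"
        "\<And>H'. norm (win k H') \<le> C \<Longrightarrow> vis R H' P l' \<Longrightarrow> norm (rv (H' - H)) \<le> 17 * D"
        using reset_near[OF m0, of k B R C l' \<epsilon> P] const RC l' unfolding K_def D_def by blast
      have d: "norm (rv (H' - H)) \<le> 17 * D" by (rule H(2)[OF H'])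
      have s: "c \<bullet> (P + \<theta>) = 0" "norm (P + cmb f (rv H) - win k H) < \<epsilon>"
        using H(1) by (auto simp: bad_def shadow_def)
      have "H' - H \<in> M1" using d RC by (simp add: M1_def R1_def)
      then have "norm (cmb (fk k) (rv (H' - H)) - cmb f (rv (H' - H))) < \<epsilon>" using cF by blast
      moreover have eq: "P + cmb f (rv H') - win k H' =
          (P + cmb f (rv H) - win k H) - (cmb (fk k) (rv (H' - H)) - cmb f (rv (H' - H)))"
        by (simp add: win_def rv_diff cmb_diff)
      ultimately have "norm (P + cmb f (rv H') - win k H') < 2 * \<epsilon>"
        unfolding eq using s(2) norm_triangle_ineq4[of "P + cmb f (rv H) - win k H" "cmb (fk k) (rv (H' - H)) - cmb f (rv (H' - H))"]
        by linarith
      moreover have "pins R1 (P + cmb f (rv H'))"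
        unfolding pins_def
      proof (intro allI impI)
        fix v assume cv: "c \<bullet> v = 0"
          and kill: "\<forall>l m. norm (rv m) \<le> R1 \<longrightarrow> det2 (f l) (P + cmb f (rv H') + cmb f (rv m)) = 0 \<longrightarrow> det2 (f l) v = 0"
        have "det2 (f l) v = 0" if "norm (rv m) \<le> R" "det2 (f l) (P + cmb f (rv H) + cmb f (rv m)) = 0" for l m
        proof -
          have "norm (rv (m - (H' - H))) \<le> R1"
            using norm_triangle_ineq4[of "rv m" "rv (H' - H)"] that(1) d by (simp add: rv_diff R1_def)
          moreover have "P + cmb f (rv H') + cmb f (rv (m - (H' - H))) = P + cmb f (rv H) + cmb f (rv m)"
            by (simp add: rv_diff cmb_diff)
          ultimately show ?thesis using kill that(2) by metis
        qed
        then show "v = 0" using bad_pins[OF H(1)] cv unfolding pins_def by blast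
      qed
      ultimately show ?thesis using s(1) H'(1) by (simp add: near_def)
    qed
    obtain dd where dd: "\<And>P. c \<bullet> (P + \<theta>) = 0 \<Longrightarrow> c \<bullet> dd P = 0"
      "\<And>P l. c \<bullet> (P + \<theta>) = 0 \<Longrightarrow> active l \<Longrightarrow> det2 (f l) (dd P) \<noteq> 0"
      "\<And>P l n. c \<bullet> (P + \<theta>) = 0 \<Longrightarrow> l \<in> S \<Longrightarrow> active l \<Longrightarrow> pos P l n = 0 \<Longrightarrow>
        (0 < det2 (f l) (dd P)) = sg k l n"
      using per unfolding active_def[symmetric] by metis
    define ev where "ev l n P \<longleftrightarrow> pos P l n = 0 \<and> l \<in> K P" for l n P
    \<comment> \<open>For lines visible from a base point near the plane the choice of
      \<open>P\<close> is forced by \<open>near_unique\<close>, so the side of a single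
      \<open>dd P\<close> is used throughout a cluster.\<close>
    define \<tau> where "\<tau> l n = (if \<exists>P. ev l n P then 0 < det2 (f l) (dd (SOME P. ev l n P)) else sg k l n)" for l n
    have ev_near: "near H P" if "ev l (H + m) P" "norm (win k H) \<le> C" "norm (rv m) \<le> R" for l H m P
      using that K_near[of l P H] unfolding ev_def vis_def by blast
    have \<tau>_ev: "\<tau> l (H + m) = (0 < det2 (f l) (dd P))"
      if "ev l (H + m) P" "norm (win k H) \<le> C" "norm (rv m) \<le> R" for l H m P
    proof -
      have "ev l (H + m) (SOME P. ev l (H + m) P)" using that(1) by (rule someI)
      then have "(SOME P. ev l (H + m) P) = P" using ev_near that near_unique by blast
      then show ?thesis using that(1) by (auto simp: \<tau>_def)
    qed
    have pos_axis: "pos P l (n + axis l a) = pos P l n" for P l n a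
      by (simp add: rv_add cmb_add det2_linear)
    have gap_axis: "gap (fk k) (\<theta>k k) l (n + axis l a) = gap (fk k) (\<theta>k k) l n" for l n a
      by (simp add: gap_add det2_linear)
    have 1: "\<tau> l (n + axis l a) = \<tau> l n" for l n a
      unfolding \<tau>_def ev_def pos_axis sgp_def gap_axis ..
    \<comment> \<open>A reset line has a gap smaller than \<open>\<zeta>\<close>, which is at most
      1.\<close>
    have 2: "\<tau> l n = (0 < gap (fk k) (\<theta>k k) l n)" if g: "1 \<le> \<bar>gap (fk k) (\<theta>k k) l n\<bar>" for l n
    proof (cases "\<exists>P. ev l n P")
      case False
      then have "\<tau> l n = sg k l n" by (simp add: \<tau>_def)
      then show ?thesis using g by (auto simp: sgp_def)
    next
      case True
      then obtain P where P: "pos P l n = 0" "l \<in> K P" unfolding ev_def by blast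
      obtain H where H: "norm (win k H) \<le> C" "vis R H P l"
        using reset_vis(3)[OF P(2)[unfolded K_def]] by blast
      obtain m where m: "norm (rv m) \<le> R" "pos P l (H + m) = 0" using H(2) unfolding vis_def by blast
      have "m \<in> M1" using m(1) R1 by (simp add: M1_def)
      then have "\<bar>gap (fk k) (\<theta>k k) l (H + m)\<bar> < \<zeta>"
        using close[OF K_near[OF P(2) H], of m l] m(2) by simp
      moreover have "gap (fk k) (\<theta>k k) l (H + m) = gap (fk k) (\<theta>k k) l n"
        by (rule sg_cong(1)[OF m(2) P(1)])
      ultimately show ?thesis using g \<zeta>(2) by simp
    qed
    have 3: "\<exists>H'. \<forall>l m. norm (rv m) \<le> R \<longrightarrow> \<tau> l (H + m) = sgp f \<theta> \<delta> l (H' + m)" if H: "norm (win k H) \<le> C" for H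
    proof -
      have M1: "m \<in> M1" if "norm (rv m) \<le> R" for m using that R1 by (simp add: M1_def)
      have Kact: "l \<notin> S" "active l" if "ev l n P" for l n P
        using that reset_vis(1,2) unfolding ev_def K_def by blast+
      have plain: "\<tau> l n = sg k l n" if "\<not> active l \<or> l \<in> S" for l n
        using that Kact by (auto simp: \<tau>_def)
      show ?thesis
      proof (cases "\<exists>l m P. norm (rv m) \<le> R \<and> ev l (H + m) P")
        case True
        then obtain l0 m0 P where e0: "norm (rv m0) \<le> R" "ev l0 (H + m0) P" by blast
        have n: "near H P" using ev_near[OF e0(2) H e0(1)] .
        then have P: "c \<bullet> (P + \<theta>) = 0" by (simp add: near_def)
        obtain H' where "\<And>l m. norm (rv m) \<le> R \<Longrightarrow> \<tau> l (H + m) = sgp f \<theta> \<delta> l (H' + m)"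
        proof (rule realize[of P "dd P" R H \<tau>])
          show "c \<bullet> (P + \<theta>) = 0" by fact
          show "c \<bullet> dd P = 0" using P by (rule dd(1))
        next
          fix l m assume m: "norm (rv m) \<le> R" and l: "active l" and p: "pos P l (H + m) \<noteq> 0"
          have "\<not> ev l (H + m) P'" for P'
            using ev_near[OF _ H m, of l P'] near_unique[OF n, of P'] p by (auto simp: ev_def)
          then have "\<tau> l (H + m) = sg k l (H + m)" by (simp add: \<tau>_def)
          then show "\<tau> l (H + m) = (0 < pos P l (H + m))" using loose_sign[OF n M1[OF m] p] by simp
        next
          fix l m assume m: "norm (rv m) \<le> R" and l: "active l" and p: "pos P l (H + m) = 0"
          have "\<tau> l (H + m) = (0 < det2 (f l) (dd P))"
          proof (cases "l \<in> S")
            case True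
            then show ?thesis using plain[of l] dd(3)[OF P True l p] by simp
          next
            case False
            have v: "vis R H P l" "vis R H P l0" using m p e0 by (auto simp: vis_def ev_def)
            have l0: "l0 \<in> K P" "l0 \<notin> S" "active l0" using e0(2) Kact by (auto simp: ev_def)
            \<comment> \<open>\<open>l\<close> is visible together with the reset type
              \<open>l0\<close>, hence reset as well, and to the same side.\<close>
            then have "(l0, l) \<in> linked k R C P"
              using False l H v unfolding linked_def by blast
            then have "l \<in> K P"
              using l0(1) unfolding K_def reset_def by (blast intro: rtrancl_into_rtrancl)
            then have "ev l (H + m) P" using p by (simp add: ev_def)
            then show ?thesis by (rule \<tau>_ev[OF _ H m])
          qed
          then show "det2 (f l) (dd P) \<noteq> 0 \<and> \<tau> l (H + m) = (0 < det2 (f l) (dd P))"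
            using dd(2)[OF P l] by blast
        next
          fix l m assume m: "norm (rv m) \<le> R" and l: "\<not> active l"
          show "\<tau> l (H + m) = ts \<delta> (f l) (P + cmb f (rv (H + m)))"
            using plain[of l] pas[OF P l] l by simp
        qed blast
        then show ?thesis by blast
      next
        case False
        then have \<tau>: "\<tau> l (H + m) = sg k l (H + m)" if "norm (rv m) \<le> R" for l m
          using that by (auto simp: \<tau>_def)
        obtain P where P: "shadow k R \<epsilon> H P" using sh H by blast
        have P0: "c \<bullet> (P + \<theta>) = 0" using P by (simp add: shadow_def)
        \<comment> \<open>If the shadow were bad without any visible reset line, the active lines
          visible through it would all have types in \<open>S\<close>, and then \<open>dd P\<close>
          realizes their signs.\<close>
        have "good k R H P"
        proof (rule ccontr)
          assume "\<not> good k R H P"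
          then have b: "bad k R C \<epsilon> H P" using P H by (simp add: bad_def)
          have "l \<in> S" if "norm (rv m) \<le> R" "active l" "pos P l (H + m) = 0" for l m
          proof (rule ccontr)
            assume "l \<notin> S"
            then have "l \<in> K P" using b that unfolding K_def reset_def vis_def by blast
            then have "ev l (H + m) P" using that(3) by (simp add: ev_def)
            with False that(1) show False by blast
          qed
          then have "good k R H P"
            unfolding good_def using dd(1)[OF P0] dd(2,3)[OF P0] by (intro exI[of _ "dd P"]) blast
          with \<open>\<not> good k R H P\<close> show False ..
        qed
        then obtain d where d: "c \<bullet> d = 0"
          "\<And>l m. norm (rv m) \<le> R \<Longrightarrow> active l \<Longrightarrow> pos P l (H + m) = 0 \<Longrightarrow>
            det2 (f l) d \<noteq> 0 \<and> sg k l (H + m) = (0 < det2 (f l) d)"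
          unfolding good_def by blast
        obtain H' where "\<And>l m. norm (rv m) \<le> R \<Longrightarrow> \<tau> l (H + m) = sgp f \<theta> \<delta> l (H' + m)"
        proof (rule realize[of P d R H \<tau>])
          show "c \<bullet> (P + \<theta>) = 0" "c \<bullet> d = 0" by fact+
          show "\<tau> l (H + m) = (0 < pos P l (H + m))"
            if "norm (rv m) \<le> R" "active l" "pos P l (H + m) \<noteq> 0" for l m
            using \<tau> P that unfolding shadow_def by blast
          show "det2 (f l) d \<noteq> 0 \<and> \<tau> l (H + m) = (0 < det2 (f l) d)"
            if "norm (rv m) \<le> R" "active l" "pos P l (H + m) = 0" for l m
            using \<tau> d(2) that by blast
          show "\<tau> l (H + m) = ts \<delta> (f l) (P + cmb f (rv (H + m)))"
            if "norm (rv m) \<le> R" "\<not> active l" for l m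
            using \<tau>[OF that(1)] pas[OF P0 that(2)] by simp
        qed blast
        then show ?thesis by blast
      qed
    qed
    show ?case using 1 2 3 by blast
  qed
qed

end

section \<open>Rigidity under deformation\<close>

lemma (in chart) closed_faces_nonempty: "faces f (sgp f \<theta> \<delta>) \<noteq> {}"
proof (rule faces_of_signs_nonempty[where f' = f and B = 1 and \<theta>' = \<theta>, OF f_indep])
  show "sgp f \<theta> \<delta> l (n + axis l a) = sgp f \<theta> \<delta> l n" for l n a
    by (simp add: sgp_def gap_add det2_linear)
  show "sgp f \<theta> \<delta> l n = (0 < gap f \<theta> l n)" if "1 \<le> \<bar>gap f \<theta> l n\<bar>" for l n
    using that by (auto simp: sgp_def)
qed (use f_indep in auto)

text \<open>The edited sign systems stay near the deformed planes and show only patterns of the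
  original plane, so \<open>transfer\<close> makes the directions agree.\<close>

lemma (in chart) weak_local_rules_rigid:
  assumes "deform f \<theta> \<delta> c N S fk \<theta>k ck"
    and wl: "weak_local_rules v {x. cmb f x = \<theta>}"
  shows "\<forall>\<^sub>F k in sequentially. \<forall>x. cmb f x = 0 \<longrightarrow> cmb (fk k) x = 0"
proof -
  interpret deform f \<theta> \<delta> c N S fk \<theta>k ck by fact
  let ?FF' = "faces f (sgp f \<theta> \<delta>)"
  obtain \<eta> where \<eta>: "0 < \<eta>" "\<And>C. \<exists>R. \<forall>f' \<theta>' FF. (\<forall>i. norm (f' i - f i) < \<eta>) \<longrightarrow> FF \<noteq> {} \<longrightarrow>
      (\<forall>H i j. (H, i, j) \<in> FF \<longrightarrow> norm (cmb f' (rv H) - \<theta>') \<le> C) \<longrightarrow>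
      (\<forall>H i j. (H, i, j) \<in> FF \<longrightarrow> (\<exists>H'. patch FF H R = patch ?FF' H' R)) \<longrightarrow>
      (\<forall>x. cmb f x = 0 \<longrightarrow> cmb f' x = 0)"
    using transfer[OF \<delta> wl closed_faces_nonempty] by blast
  obtain B m0 where B: "0 < B" "\<forall>\<^sub>F k in sequentially. (\<Sum>i\<in>UNIV. norm (fk k i)) \<le> B \<and> (\<forall>l. m0 \<le> norm (fk k l))"
    using constants by blast
  let ?A = "(\<lambda>(i, j). \<bar>det2 (f i) (f j)\<bar>) ` {(i, j). i \<noteq> j}"
  have Apos: "0 < a" if "a \<in> ?A" for a using that f_indep by auto
  obtain b where b: "0 < b" "\<And>a. a \<in> ?A \<Longrightarrow> b \<le> a"
    by (rule finite_pos_lower_bound[of ?A]) (use Apos in \<open>blast intro: finite\<close>)+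
  have b': "b \<le> \<bar>det2 (f i) (f j)\<bar>" if "i \<noteq> j" for i j
    by (rule b(2), rule image_eqI[of _ _ "(i, j)"]) (use that in simp_all)
  \<comment> \<open>The bound of \<open>faces_of_signs_near\<close> for signs correct beyond gap 1
    and brackets of size at least \<open>b / 2\<close>; it does not depend on
    \<open>k\<close>.\<close>
  define C where "C = 2 * (1 / (b / 2) + 1) * B"
  have C0: "0 \<le> C" using B(1) b(1) by (simp add: C_def)
  obtain R where R: "\<forall>f' \<theta>' FF. (\<forall>i. norm (f' i - f i) < \<eta>) \<longrightarrow> FF \<noteq> {} \<longrightarrow>
      (\<forall>H i j. (H, i, j) \<in> FF \<longrightarrow> norm (cmb f' (rv H) - \<theta>') \<le> C) \<longrightarrow>
      (\<forall>H i j. (H, i, j) \<in> FF \<longrightarrow> (\<exists>H'. patch FF H R = patch ?FF' H' R)) \<longrightarrow>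
      (\<forall>x. cmb f x = 0 \<longrightarrow> cmb f' x = 0)"
    using \<eta>(2)[of C] by blast
  have ev_\<eta>: "\<forall>\<^sub>F k in sequentially. \<forall>i\<in>UNIV. norm (fk k i - f i) < \<eta>"
  proof (intro eventually_ball_finite finite ballI)
    fix i
    show "\<forall>\<^sub>F k in sequentially. norm (fk k i - f i) < \<eta>"
      using tendstoD[OF lim \<eta>(1), of i] by (simp add: dist_norm)
  qed
  have ev_sgn: "\<forall>\<^sub>F k in sequentially. \<forall>ij\<in>{(i, j). i \<noteq> j}.
      \<bar>det2 (fk k (fst ij)) (fk k (snd ij)) - det2 (f (fst ij)) (f (snd ij))\<bar> < b / 2"
  proof (intro eventually_ball_finite finite ballI)
    fix ij :: "4 \<times> 4"
    have "(\<lambda>k. det2 (fk k (fst ij)) (fk k (snd ij))) \<longlonglongrightarrow> det2 (f (fst ij)) (f (snd ij))"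
      by (intro tendsto_intros lim)
    then show "\<forall>\<^sub>F k in sequentially. \<bar>det2 (fk k (fst ij)) (fk k (snd ij)) - det2 (f (fst ij)) (f (snd ij))\<bar> < b / 2"
      using tendstoD[of _ _ _ "b / 2"] b(1) by (fastforce simp: dist_real_def)
  qed
  define R' where "R' = max 0 (R + 1)"
  have "0 \<le> R'" by (simp add: R'_def)
  show ?thesis
    using ev_\<eta> ev_sgn B(2) signs_exist[OF \<open>0 \<le> R'\<close> C0]
  proof eventually_elim
    case (elim k)
    obtain \<tau> where \<tau>: "\<And>l n a. \<tau> l (n + axis l a) = \<tau> l n"
      "\<And>l n. 1 \<le> \<bar>gap (fk k) (\<theta>k k) l n\<bar> \<Longrightarrow> \<tau> l n = (0 < gap (fk k) (\<theta>k k) l n)"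
      "\<And>H. norm (win k H) \<le> C \<Longrightarrow> \<exists>H'. \<forall>l m. norm (rv m) \<le> R' \<longrightarrow> \<tau> l (H + m) = sgp f \<theta> \<delta> l (H' + m)"
      using elim(4) by blast
    have br: "\<bar>det2 (fk k i) (fk k j) - det2 (f i) (f j)\<bar> < b / 2" if "i \<noteq> j" for i j
      using elim(2) that by force
    have br': "(0 < det2 (fk k i) (fk k j)) = (0 < det2 (f i) (f j)) \<and> det2 (fk k i) (fk k j) \<noteq> 0" if "i \<noteq> j" for i j
      using sign_stable[of "det2 (fk k i) (fk k j)" "det2 (f i) (f j)"] br[OF that] b'[OF that] b(1) by linarith
    have \<beta>: "b / 2 \<le> \<bar>det2 (fk k i) (fk k j)\<bar>" if "i \<noteq> j" for i j
      using br[OF that] b'[OF that] by linarith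
    have nB: "norm (fk k i) \<le> B" for i
      using member_le_sum[of i UNIV "\<lambda>i. norm (fk k i)"] elim(3) by simp
    let ?FF = "faces f \<tau>"
    have near: "norm (win k H) \<le> C" if "(H, i, j) \<in> ?FF" for H i j
      unfolding win_def C_def
      using faces_of_signs_near[of "fk k" f "b / 2" B 1 "\<theta>k k" \<tau> H i j] br' \<beta> b(1) nB \<tau>(2) that by simp
    have ne: "?FF \<noteq> {}"
      by (rule faces_of_signs_nonempty[where f' = "fk k" and B = 1, OF f_indep br' \<tau>(1,2)])
    have loc: "\<exists>H'. patch ?FF H R = patch ?FF' H' R" if F: "(H, i, j) \<in> ?FF" for H i j
    proof -
      obtain H' where H': "\<And>l m. norm (rv m) \<le> R' \<Longrightarrow> \<tau> l (H + m) = sgp f \<theta> \<delta> l (H' + m)"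
        using \<tau>(3)[OF near[OF F]] by blast
      have "patch ?FF H R = patch ?FF' H' R"
        by (rule patch_faces_cong, rule H') (simp add: R'_def)
      then show ?thesis by blast
    qed
    show ?case
      using R[rule_format, of "fk k" ?FF "\<theta>k k"] elim(1) ne near[unfolded win_def] loc by blast
  qed
qed

section \<open>Concurrent lines of periodic types\<close>

lemma no_rational_kernel:
  assumes no_int: "\<And>z. cmb f (rv z) = 0 \<Longrightarrow> z = 0"
    and y: "cmb f y = 0" "\<And>i. y $ i \<in> \<rat>"
  shows "y = 0"
proof -
  have "\<exists>a b. b > 0 \<and> y $ i = of_int a / of_int b" for i
    using y(2)[of i] by (elim Rats_cases') auto
  then obtain a b :: "4 \<Rightarrow> int" where ab: "\<And>i. b i > 0" "\<And>i. y $ i = of_int (a i) / of_int (b i)" by metis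
  define D where "D = (\<Prod>i\<in>UNIV. b i)"
  have D: "D > 0" unfolding D_def using ab(1) by (intro prod_pos) auto
  define z :: "int ^ 4" where "z = (\<chi> i. a i * (\<Prod>j\<in>UNIV - {i}. b j))"
  have "of_int (z $ i) = of_int D * y $ i" for i
  proof -
    have "D = b i * (\<Prod>j\<in>UNIV - {i}. b j)" unfolding D_def by (rule prod.remove) auto
    then show ?thesis using ab(1)[of i] by (simp add: z_def ab(2) field_simps)
  qed
  then have z: "rv z = of_int D *\<^sub>R y" by (simp add: vec_eq_iff)
  then have "cmb f (rv z) = 0" using y(1) by (simp add: cmb_scale)
  then have "z = 0" by (rule no_int)
  then show ?thesis using z D by simp
qed

text \<open>The cross product of the two coefficient vectors is rational and parallel to
  \<open>w\<close>. If it vanishes, the coefficient vectors are proportional; otherwise it exhibits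
  the ratios of \<open>w\<close> as rational.\<close>

lemma rational_orthogonal:
  fixes A B C A0 B0 C0 :: real
  assumes Q: "A \<in> \<rat>" "B \<in> \<rat>" "C \<in> \<rat>" "A0 \<in> \<rat>" "B0 \<in> \<rat>" "C0 \<in> \<rat>"
    and orth: "A * w1 + B * w2 + C * w3 = 0" "A0 * w1 + B0 * w2 + C0 * w3 = 0"
    and ne: "A0 \<noteq> 0 \<or> B0 \<noteq> 0 \<or> C0 \<noteq> 0" and w: "w1 \<noteq> 0" "w2 \<noteq> 0" "w3 \<noteq> 0"
  shows "(\<exists>u. A = u * A0 \<and> B = u * B0 \<and> C = u * C0) \<or> (w2 / w1 \<in> \<rat> \<and> w3 / w1 \<in> \<rat>)"
proof -
  define X Y Z where "X = B * C0 - C * B0" and "Y = C * A0 - A * C0" and "Z = A * B0 - B * A0"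
  have XYZ: "X \<in> \<rat>" "Y \<in> \<rat>" "Z \<in> \<rat>" using Q by (simp_all add: X_def Y_def Z_def)
  have rel: "X * w2 = Y * w1" "X * w3 = Z * w1" "Y * w3 = Z * w2"
    using orth unfolding X_def Y_def Z_def by algebra+
  show ?thesis
  proof (cases "X = 0")
    case False
    then have "w2 / w1 = Y / X" "w3 / w1 = Z / X" using rel w by (simp_all add: field_simps)
    then show ?thesis using XYZ by simp
  next
    case True
    then have "Y = 0" "Z = 0" using rel w by auto
    with True have 0: "B * C0 = C * B0" "C * A0 = A * C0" "A * B0 = B * A0"
      by (simp_all add: X_def Y_def Z_def)
    consider "A0 \<noteq> 0" | "B0 \<noteq> 0" | "C0 \<noteq> 0" using ne by blast
    then show ?thesis
    proof cases
      case 1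
      then show ?thesis using 0 by (intro disjI1 exI[of _ "A / A0"]) (simp add: field_simps)
    next
      case 2
      then show ?thesis using 0 by (intro disjI1 exI[of _ "B / B0"]) (simp add: field_simps)
    next
      case 3
      then show ?thesis using 0 by (intro disjI1 exI[of _ "C / C0"]) (simp add: field_simps)
    qed
  qed
qed

definition period :: "(4 \<Rightarrow> real ^ 2) \<Rightarrow> 4 \<Rightarrow> bool" where
  "period f l \<longleftrightarrow> (\<exists>z i. i \<noteq> l \<and> z $ i \<noteq> 0 \<and> det2 (f l) (cmb f (rv z)) = 0)"

lemma plucker: "det2 a b * det2 c d - det2 a c * det2 b d + det2 a d * det2 b c = 0"
  by (simp add: det2_def algebra_simps)

lemma det2_cmb_distinct4:
  assumes "distinct [a, b, c, d]"
  shows "det2 (f a) (cmb f (rv z)) =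
    of_int (z $ b) * det2 (f a) (f b) + of_int (z $ c) * det2 (f a) (f c) + of_int (z $ d) * det2 (f a) (f d)"
  unfolding det2_cmb sum_distinct4[OF assms] by simp

text \<open>Nonlinear coincidences among periodic types are consequences of the Pluecker relation and of the
  linear relations: with the periods, both are linear in the products of two of the three brackets.\<close>

locale int_deform =
  fixes f f' :: "4 \<Rightarrow> real ^ 2"
  assumes f_indep: "i \<noteq> j \<Longrightarrow> det2 (f i) (f j) \<noteq> 0"
    and no_int: "cmb f (rv z) = 0 \<Longrightarrow> z = 0"
    and rel: "det2 (f l) (cmb f (rv z)) = 0 \<Longrightarrow> det2 (f' l) (cmb f' (rv z)) = 0"
begin

text \<open>Two rational ratios among the three brackets make the linear relation between
  \<open>f a\<close>, \<open>f b\<close> and \<open>f c\<close> rational.\<close>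

lemma not_commensurable:
  assumes d: "distinct [a, b, c, d]" and q: "\<kappa> \<in> \<rat>" "\<mu> \<in> \<rat>"
    and e: "det2 (f a) (f c) = \<kappa> * det2 (f a) (f b)" "det2 (f b) (f c) = \<mu> * det2 (f a) (f b)"
  shows False
proof -
  define y :: "real ^ 4" where "y = axis a \<mu> - axis b \<kappa> + axis c 1"
  have "det2 (f a) (cmb f y) = 0" "det2 (f b) (cmb f y) = 0"
    using e det2_commute[of "f b" "f a"] by (simp_all add: y_def cmb_add cmb_diff det2_linear)
  then have "cmb f y = 0" using det2_both_zero f_indep[of a b] d by auto
  moreover have "y $ i \<in> \<rat>" for i using q by (simp add: y_def axis_def)
  ultimately have "y = 0" by (intro no_rational_kernel[OF no_int])
  moreover have "y $ c = 1" using d by (auto simp: y_def axis_def)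
  ultimately show False by simp
qed

text \<open>For pairwise independent vectors this vanishes exactly when the lines of types
  \<open>a\<close>, \<open>b\<close>, \<open>c\<close> through the images of the three lattice
  points are concurrent; the coefficients are those of the linear relation between the three
  directions.\<close>

definition conc :: "(4 \<Rightarrow> real ^ 2) \<Rightarrow> 4 \<Rightarrow> 4 \<Rightarrow> 4 \<Rightarrow> int ^ 4 \<Rightarrow> int ^ 4 \<Rightarrow> int ^ 4 \<Rightarrow> real" where
  "conc g a b c n n' n'' = det2 (g b) (g c) * det2 (g a) (cmb g (rv n)) +
     det2 (g c) (g a) * det2 (g b) (cmb g (rv n')) + det2 (g a) (g b) * det2 (g c) (cmb g (rv n''))"

lemma conc_cycle: "conc g a b c n n' n'' = conc g b c a n' n'' n"
  by (simp add: conc_def)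

lemma conc_expand:
  assumes d: "distinct [a, b, c, d]"
  shows "conc g a b c n n' n'' =
    det2 (g b) (g c) * (of_int (n $ b) * det2 (g a) (g b) + of_int (n $ c) * det2 (g a) (g c) + of_int (n $ d) * det2 (g a) (g d))
    - det2 (g a) (g c) * (- of_int (n' $ a) * det2 (g a) (g b) + of_int (n' $ c) * det2 (g b) (g c) + of_int (n' $ d) * det2 (g b) (g d))
    + det2 (g a) (g b) * (- of_int (n'' $ a) * det2 (g a) (g c) - of_int (n'' $ b) * det2 (g b) (g c) + of_int (n'' $ d) * det2 (g c) (g d))"
proof -
  have d2: "distinct [b, a, c, d]" and d3: "distinct [c, a, b, d]" using d by auto
  show ?thesis
    unfolding conc_def det2_cmb_distinct4[OF d] det2_cmb_distinct4[OF d2] det2_cmb_distinct4[OF d3]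
    using det2_commute[of "g b" "g a"] det2_commute[of "g c" "g a"] det2_commute[of "g c" "g b"]
    by (simp add: algebra_simps)
qed

lemma period_relation:
  assumes d: "distinct [a, b, c, d]" and p: "period f a"
  obtains \<alpha>1 \<alpha>2 \<alpha>3 :: int where "\<alpha>1 \<noteq> 0 \<or> \<alpha>2 \<noteq> 0 \<or> \<alpha>3 \<noteq> 0"
    "of_int \<alpha>1 * det2 (f a) (f b) + of_int \<alpha>2 * det2 (f a) (f c) + of_int \<alpha>3 * det2 (f a) (f d) = 0"
    "of_int \<alpha>1 * det2 (f' a) (f' b) + of_int \<alpha>2 * det2 (f' a) (f' c) + of_int \<alpha>3 * det2 (f' a) (f' d) = 0"
proof -
  obtain z i where z: "i \<noteq> a" "z $ i \<noteq> 0" "det2 (f a) (cmb f (rv z)) = 0" using p unfolding period_def by blast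
  have "i = b \<or> i = c \<or> i = d" using z(1) UNIV_distinct4[OF d] by blast
  then show ?thesis
    using that[of "z $ b" "z $ c" "z $ d"] z rel[OF z(3)] unfolding det2_cmb_distinct4[OF d] by blast
qed

lemma solve_third:
  fixes x y p :: real
  assumes "of_int \<alpha>1 * x + of_int \<alpha>2 * y + of_int \<alpha>3 * p = 0" "\<alpha>3 \<noteq> 0"
  shows "p = (- of_int \<alpha>1 / of_int \<alpha>3) * x + (- of_int \<alpha>2 / of_int \<alpha>3) * y"
  using assms by (simp add: field_simps)

text \<open>With \<open>\<kappa>\<close> rational, \<open>conc\<close> is one bracket times a
  combination of two brackets with rational coefficients \<open>A\<close> and \<open>B\<close> that
  do not involve the vectors. Vanishing at \<open>f\<close> makes the brackets commensurable unless
  \<open>A = B = 0\<close>.\<close>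

lemma conc_persists_aux:
  assumes d: "distinct [a, b, c, d]"
    and q: "q1 \<in> \<rat>" "q2 \<in> \<rat>" "r1 \<in> \<rat>" "r2 \<in> \<rat>" "\<kappa> \<in> \<rat>"
    and y: "det2 (f a) (f c) = \<kappa> * det2 (f a) (f b)" "det2 (f' a) (f' c) = \<kappa> * det2 (f' a) (f' b)"
    and qq: "det2 (f b) (f d) = q1 * det2 (f a) (f b) + q2 * det2 (f b) (f c)"
      "det2 (f' b) (f' d) = q1 * det2 (f' a) (f' b) + q2 * det2 (f' b) (f' c)"
    and rr: "det2 (f c) (f d) = r1 * det2 (f a) (f c) + r2 * det2 (f b) (f c)"
      "det2 (f' c) (f' d) = r1 * det2 (f' a) (f' c) + r2 * det2 (f' b) (f' c)"
    and e: "conc f a b c n n' n'' = 0"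
  shows "conc f' a b c n n' n'' = 0"
proof -
  define A B :: real where
    "A = of_int (n $ b) + \<kappa> * of_int (n $ c) + of_int (n $ d) * (\<kappa> * q2 - r2) - \<kappa> * of_int (n' $ c)
      - \<kappa> * of_int (n' $ d) * q2 - of_int (n'' $ b) + of_int (n'' $ d) * r2" and
    "B = of_int (n $ d) * (\<kappa> * q1 - \<kappa> * r1) + \<kappa> * of_int (n' $ a) - \<kappa> * of_int (n' $ d) * q1
      - \<kappa> * of_int (n'' $ a) + of_int (n'' $ d) * \<kappa> * r1"
  have AB: "A \<in> \<rat>" "B \<in> \<rat>" using q by (simp_all add: A_def B_def)
  have key: "conc g a b c n n' n'' = det2 (g a) (g b) * (A * det2 (g b) (g c) + B * det2 (g a) (g b))"
    if "det2 (g a) (g c) = \<kappa> * det2 (g a) (g b)"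
      "det2 (g b) (g d) = q1 * det2 (g a) (g b) + q2 * det2 (g b) (g c)"
      "det2 (g c) (g d) = r1 * det2 (g a) (g c) + r2 * det2 (g b) (g c)" for g
  proof -
    have zp: "det2 (g b) (g c) * det2 (g a) (g d) = det2 (g a) (g c) * det2 (g b) (g d) - det2 (g a) (g b) * det2 (g c) (g d)"
      using plucker[of "g a" "g b" "g c" "g d"] by (simp add: algebra_simps)
    have "conc g a b c n n' n'' = det2 (g b) (g c) * (of_int (n $ b) * det2 (g a) (g b) + of_int (n $ c) * det2 (g a) (g c))
      + of_int (n $ d) * (det2 (g b) (g c) * det2 (g a) (g d))
      - det2 (g a) (g c) * (- of_int (n' $ a) * det2 (g a) (g b) + of_int (n' $ c) * det2 (g b) (g c) + of_int (n' $ d) * det2 (g b) (g d))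
      + det2 (g a) (g b) * (- of_int (n'' $ a) * det2 (g a) (g c) - of_int (n'' $ b) * det2 (g b) (g c) + of_int (n'' $ d) * det2 (g c) (g d))"
      unfolding conc_expand[OF d] by (simp add: algebra_simps)
    then show ?thesis unfolding zp that by (simp add: A_def B_def algebra_simps)
  qed
  have ab: "det2 (f a) (f b) \<noteq> 0" using f_indep[of a b] d by auto
  have AB0: "A * det2 (f b) (f c) + B * det2 (f a) (f b) = 0"
    using key[OF y(1) qq(1) rr(1)] e ab by simp
  have "A = 0"
  proof (rule ccontr)
    assume "A \<noteq> 0"
    then have "det2 (f b) (f c) = (- B / A) * det2 (f a) (f b)" using AB0 by (simp add: field_simps)
    moreover have "- B / A \<in> \<rat>" using AB by simp
    ultimately show False using not_commensurable[OF d q(5) _ y(1)] by blast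
  qed
  then have "B = 0" using AB0 ab by simp
  with \<open>A = 0\<close> show ?thesis using key[OF y(2) qq(2) rr(2)] by simp
qed

text \<open>Covers a period relation of \<open>a\<close> without the fourth type. The relations of
  \<open>b\<close> and \<open>c\<close> must then involve it, since otherwise all three brackets
  would be commensurable.\<close>

lemma conc_persists_degenerate:
  assumes d: "distinct [a, b, c, d]" and p: "period f b" "period f c"
    and \<alpha>: "\<alpha>1 \<noteq> 0 \<or> \<alpha>2 \<noteq> (0 :: int)"
      "of_int \<alpha>1 * det2 (f a) (f b) + of_int \<alpha>2 * det2 (f a) (f c) = 0"
      "of_int \<alpha>1 * det2 (f' a) (f' b) + of_int \<alpha>2 * det2 (f' a) (f' c) = 0"
    and e: "conc f a b c n n' n'' = 0"
  shows "conc f' a b c n n' n'' = 0"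
proof -
  have nz: "det2 (f a) (f b) \<noteq> 0" "det2 (f a) (f c) \<noteq> 0" "det2 (f b) (f c) \<noteq> 0" using f_indep d by auto
  have a2: "\<alpha>2 \<noteq> 0" using \<alpha>(1,2) nz by auto
  define \<kappa> :: real where "\<kappa> = - of_int \<alpha>1 / of_int \<alpha>2"
  have \<kappa>: "\<kappa> \<in> \<rat>" by (simp add: \<kappa>_def)
  have y: "det2 (f a) (f c) = \<kappa> * det2 (f a) (f b)" "det2 (f' a) (f' c) = \<kappa> * det2 (f' a) (f' b)"
    using \<alpha>(2,3) a2 by (simp_all add: \<kappa>_def field_simps)
  have d2: "distinct [b, a, c, d]" and d3: "distinct [c, a, b, d]" using d by auto
  obtain \<beta>1 \<beta>2 \<beta>3 :: int where \<beta>: "\<beta>1 \<noteq> 0 \<or> \<beta>2 \<noteq> 0 \<or> \<beta>3 \<noteq> 0"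
    "of_int \<beta>1 * det2 (f b) (f a) + of_int \<beta>2 * det2 (f b) (f c) + of_int \<beta>3 * det2 (f b) (f d) = 0"
    "of_int \<beta>1 * det2 (f' b) (f' a) + of_int \<beta>2 * det2 (f' b) (f' c) + of_int \<beta>3 * det2 (f' b) (f' d) = 0"
    using period_relation[OF d2 p(1)] by blast
  obtain \<gamma>1 \<gamma>2 \<gamma>3 :: int where \<gamma>: "\<gamma>1 \<noteq> 0 \<or> \<gamma>2 \<noteq> 0 \<or> \<gamma>3 \<noteq> 0"
    "of_int \<gamma>1 * det2 (f c) (f a) + of_int \<gamma>2 * det2 (f c) (f b) + of_int \<gamma>3 * det2 (f c) (f d) = 0"
    "of_int \<gamma>1 * det2 (f' c) (f' a) + of_int \<gamma>2 * det2 (f' c) (f' b) + of_int \<gamma>3 * det2 (f' c) (f' d) = 0"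
    using period_relation[OF d3 p(2)] by blast
  note sw = det2_commute[of "f b" "f a"] det2_commute[of "f c" "f a"] det2_commute[of "f c" "f b"]
    det2_commute[of "f' b" "f' a"] det2_commute[of "f' c" "f' a"] det2_commute[of "f' c" "f' b"]
  have b3: "\<beta>3 \<noteq> 0"
  proof
    assume "\<beta>3 = 0"
    then have "of_int \<beta>2 * det2 (f b) (f c) = of_int \<beta>1 * det2 (f a) (f b)" "\<beta>2 \<noteq> 0"
      using \<beta>(1,2) nz sw(1) by auto
    then have "det2 (f b) (f c) = (of_int \<beta>1 / of_int \<beta>2) * det2 (f a) (f b)" by (simp add: field_simps)
    then show False using not_commensurable[OF d \<kappa> _ y(1), of "of_int \<beta>1 / of_int \<beta>2"] by simp
  qed
  have g3: "\<gamma>3 \<noteq> 0"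
  proof
    assume "\<gamma>3 = 0"
    then have "of_int \<gamma>2 * det2 (f b) (f c) = - of_int \<gamma>1 * det2 (f a) (f c)" "\<gamma>2 \<noteq> 0"
      using \<gamma>(1,2) nz sw(2,3) by auto
    then have "det2 (f b) (f c) = (- of_int \<gamma>1 / of_int \<gamma>2 * \<kappa>) * det2 (f a) (f b)"
      unfolding y(1) by (simp add: field_simps)
    then show False using not_commensurable[OF d \<kappa> _ y(1), of "- of_int \<gamma>1 / of_int \<gamma>2 * \<kappa>"] \<kappa> by simp
  qed
  have Q: "of_int \<beta>1 / of_int \<beta>3 \<in> (\<rat> :: real set)" "- of_int \<beta>2 / of_int \<beta>3 \<in> (\<rat> :: real set)"
    "of_int \<gamma>1 / of_int \<gamma>3 \<in> (\<rat> :: real set)" "of_int \<gamma>2 / of_int \<gamma>3 \<in> (\<rat> :: real set)"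
    by simp_all
  show ?thesis
    by (rule conc_persists_aux[OF d Q \<kappa> y _ _ _ _ e])
      (use solve_third[OF \<beta>(2) b3] solve_third[OF \<beta>(3) b3] solve_third[OF \<gamma>(2) g3] solve_third[OF \<gamma>(3) g3] sw
        in \<open>simp_all\<close>)
qed

lemma conc_persists:
  assumes d: "distinct [a, b, c, d]" and p: "period f a" "period f b" "period f c"
    and e: "conc f a b c n n' n'' = 0"
  shows "conc f' a b c n n' n'' = 0"
proof -
  have nz: "det2 (f a) (f b) \<noteq> 0" "det2 (f a) (f c) \<noteq> 0" "det2 (f b) (f c) \<noteq> 0" using f_indep d by auto
  have d2: "distinct [b, c, a, d]" and d3: "distinct [c, a, b, d]" using d by auto
  obtain \<alpha>1 \<alpha>2 \<alpha>3 :: int where \<alpha>: "\<alpha>1 \<noteq> 0 \<or> \<alpha>2 \<noteq> 0 \<or> \<alpha>3 \<noteq> 0"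
    "of_int \<alpha>1 * det2 (f a) (f b) + of_int \<alpha>2 * det2 (f a) (f c) + of_int \<alpha>3 * det2 (f a) (f d) = 0"
    "of_int \<alpha>1 * det2 (f' a) (f' b) + of_int \<alpha>2 * det2 (f' a) (f' c) + of_int \<alpha>3 * det2 (f' a) (f' d) = 0"
    using period_relation[OF d p(1)] by blast
  obtain \<beta>1 \<beta>2 \<beta>3 :: int where \<beta>: "\<beta>1 \<noteq> 0 \<or> \<beta>2 \<noteq> 0 \<or> \<beta>3 \<noteq> 0"
    "of_int \<beta>1 * det2 (f b) (f c) + of_int \<beta>2 * det2 (f b) (f a) + of_int \<beta>3 * det2 (f b) (f d) = 0"
    "of_int \<beta>1 * det2 (f' b) (f' c) + of_int \<beta>2 * det2 (f' b) (f' a) + of_int \<beta>3 * det2 (f' b) (f' d) = 0"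
    using period_relation[OF d2 p(2)] by blast
  obtain \<gamma>1 \<gamma>2 \<gamma>3 :: int where \<gamma>: "\<gamma>1 \<noteq> 0 \<or> \<gamma>2 \<noteq> 0 \<or> \<gamma>3 \<noteq> 0"
    "of_int \<gamma>1 * det2 (f c) (f a) + of_int \<gamma>2 * det2 (f c) (f b) + of_int \<gamma>3 * det2 (f c) (f d) = 0"
    "of_int \<gamma>1 * det2 (f' c) (f' a) + of_int \<gamma>2 * det2 (f' c) (f' b) + of_int \<gamma>3 * det2 (f' c) (f' d) = 0"
    using period_relation[OF d3 p(3)] by blast
  consider "\<alpha>3 = 0" | "\<beta>3 = 0" | "\<gamma>3 = 0" | "\<alpha>3 \<noteq> 0" "\<beta>3 \<noteq> 0" "\<gamma>3 \<noteq> 0" by blast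
  then show ?thesis
  proof cases
    case 1
    show ?thesis
      by (rule conc_persists_degenerate[OF d p(2,3) _ _ _ e, of \<alpha>1 \<alpha>2]) (use \<alpha> 1 in auto)
  next
    case 2
    have e': "conc f b c a n' n'' n = 0" using e conc_cycle by metis
    have "conc f' b c a n' n'' n = 0"
      by (rule conc_persists_degenerate[OF d2 p(3,1) _ _ _ e', of \<beta>1 \<beta>2]) (use \<beta> 2 in auto)
    then show ?thesis using conc_cycle by metis
  next
    case 3
    have e': "conc f c a b n'' n n' = 0" using e conc_cycle by metis
    have "conc f' c a b n'' n n' = 0"
      by (rule conc_persists_degenerate[OF d3 p(1,2) _ _ _ e', of \<gamma>1 \<gamma>2]) (use \<gamma> 3 in auto)
    then show ?thesis using conc_cycle by metis
  next
    case 4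
    \<comment> \<open>The period relations eliminate all brackets with the fourth type, leaving the
      products of two brackets among \<open>a\<close>, \<open>b\<close>, \<open>c\<close> as
      variables.\<close>
    define p1 p2 q1 q2 r1 r2 :: real where
      "p1 = - of_int \<alpha>1 / of_int \<alpha>3" and "p2 = - of_int \<alpha>2 / of_int \<alpha>3" and
      "q1 = of_int \<beta>2 / of_int \<beta>3" and "q2 = - of_int \<beta>1 / of_int \<beta>3" and
      "r1 = of_int \<gamma>1 / of_int \<gamma>3" and "r2 = of_int \<gamma>2 / of_int \<gamma>3"
    have Q: "p1 \<in> \<rat>" "p2 \<in> \<rat>" "q1 \<in> \<rat>" "q2 \<in> \<rat>" "r1 \<in> \<rat>" "r2 \<in> \<rat>"
      by (simp_all add: p1_def p2_def q1_def q2_def r1_def r2_def)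
    note sw = det2_commute[of "f b" "f a"] det2_commute[of "f c" "f a"] det2_commute[of "f c" "f b"]
      det2_commute[of "f' b" "f' a"] det2_commute[of "f' c" "f' a"] det2_commute[of "f' c" "f' b"]
    have P: "det2 (f a) (f d) = p1 * det2 (f a) (f b) + p2 * det2 (f a) (f c)"
      "det2 (f' a) (f' d) = p1 * det2 (f' a) (f' b) + p2 * det2 (f' a) (f' c)"
      "det2 (f b) (f d) = q1 * det2 (f a) (f b) + q2 * det2 (f b) (f c)"
      "det2 (f' b) (f' d) = q1 * det2 (f' a) (f' b) + q2 * det2 (f' b) (f' c)"
      "det2 (f c) (f d) = r1 * det2 (f a) (f c) + r2 * det2 (f b) (f c)"
      "det2 (f' c) (f' d) = r1 * det2 (f' a) (f' c) + r2 * det2 (f' b) (f' c)"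
      using solve_third[OF \<alpha>(2) 4(1)] solve_third[OF \<alpha>(3) 4(1)] solve_third[OF \<beta>(2) 4(2)]
        solve_third[OF \<beta>(3) 4(2)] solve_third[OF \<gamma>(2) 4(3)] solve_third[OF \<gamma>(3) 4(3)] sw
      by (simp_all add: p1_def p2_def q1_def q2_def r1_def r2_def)
    define A B C A0 B0 C0 :: real where
      "A = of_int (n $ b) - of_int (n'' $ b) + of_int (n $ d) * p1 + of_int (n'' $ d) * r2" and
      "B = of_int (n $ c) - of_int (n' $ c) + of_int (n $ d) * p2 - of_int (n' $ d) * q2" and
      "C = of_int (n' $ a) - of_int (n'' $ a) - of_int (n' $ d) * q1 + of_int (n'' $ d) * r1" and
      "A0 = r2 + p1" and "B0 = p2 - q2" and "C0 = r1 - q1"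
    have key: "conc g a b c n n' n'' = A * (det2 (g a) (g b) * det2 (g b) (g c))
        + B * (det2 (g a) (g c) * det2 (g b) (g c)) + C * (det2 (g a) (g b) * det2 (g a) (g c))"
      "0 = A0 * (det2 (g a) (g b) * det2 (g b) (g c))
        + B0 * (det2 (g a) (g c) * det2 (g b) (g c)) + C0 * (det2 (g a) (g b) * det2 (g a) (g c))"
      if "det2 (g a) (g d) = p1 * det2 (g a) (g b) + p2 * det2 (g a) (g c)"
        "det2 (g b) (g d) = q1 * det2 (g a) (g b) + q2 * det2 (g b) (g c)"
        "det2 (g c) (g d) = r1 * det2 (g a) (g c) + r2 * det2 (g b) (g c)" for g
    proof -
      show "conc g a b c n n' n'' = A * (det2 (g a) (g b) * det2 (g b) (g c))
        + B * (det2 (g a) (g c) * det2 (g b) (g c)) + C * (det2 (g a) (g b) * det2 (g a) (g c))"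
        unfolding conc_expand[OF d] that by (simp add: A_def B_def C_def algebra_simps)
      show "0 = A0 * (det2 (g a) (g b) * det2 (g b) (g c))
        + B0 * (det2 (g a) (g c) * det2 (g b) (g c)) + C0 * (det2 (g a) (g b) * det2 (g a) (g c))"
        using plucker[of "g a" "g b" "g c" "g d"] unfolding that
        by (simp add: A0_def B0_def C0_def algebra_simps)
    qed
    have "(\<exists>u. A = u * A0 \<and> B = u * B0 \<and> C = u * C0) \<or>
      (det2 (f a) (f c) * det2 (f b) (f c)) / (det2 (f a) (f b) * det2 (f b) (f c)) \<in> \<rat> \<and>
      (det2 (f a) (f b) * det2 (f a) (f c)) / (det2 (f a) (f b) * det2 (f b) (f c)) \<in> \<rat>"
    proof (rule rational_orthogonal)
      show "A \<in> \<rat>" "B \<in> \<rat>" "C \<in> \<rat>" "A0 \<in> \<rat>" "B0 \<in> \<rat>" "C0 \<in> \<rat>"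
        using Q by (simp_all add: A_def B_def C_def A0_def B0_def C0_def)
      show "A0 \<noteq> 0 \<or> B0 \<noteq> 0 \<or> C0 \<noteq> 0"
      proof (rule ccontr)
        assume "\<not> ?thesis"
        then have z: "r2 = - p1" "p2 = q2" "r1 = q1" by (simp_all add: A0_def B0_def C0_def)
        \<comment> \<open>If the Pluecker relation became trivial, the coefficients would assemble
          into a rational kernel vector.\<close>
        define y :: "real ^ 4" where "y = axis d 1 + axis a q1 - axis b p1 - axis c p2"
        have "det2 (f a) (cmb f y) = 0" "det2 (f b) (cmb f y) = 0"
          using P sw z by (simp_all add: y_def cmb_add cmb_diff det2_linear)
        then have "cmb f y = 0" using det2_both_zero nz(1) by blast
        moreover have "y $ i \<in> \<rat>" for i using Q by (simp add: y_def axis_def)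
        ultimately have "y = 0" by (intro no_rational_kernel[OF no_int])
        moreover have "y $ d = 1" using d by (auto simp: y_def axis_def)
        ultimately show False by simp
      qed
    qed (use nz key[OF P(1,3,5)] e in auto)
    then show ?thesis
    proof
      assume "\<exists>u. A = u * A0 \<and> B = u * B0 \<and> C = u * C0"
      then obtain u where l: "A = u * A0" "B = u * B0" "C = u * C0" by blast
      have "conc f' a b c n n' n'' = u * (A0 * (det2 (f' a) (f' b) * det2 (f' b) (f' c))
        + B0 * (det2 (f' a) (f' c) * det2 (f' b) (f' c)) + C0 * (det2 (f' a) (f' b) * det2 (f' a) (f' c)))"
        unfolding key(1)[OF P(2,4,6)] l by (simp add: algebra_simps)
      then show ?thesis using key(2)[OF P(2,4,6)] by simp
    next
      assume rat: "(det2 (f a) (f c) * det2 (f b) (f c)) / (det2 (f a) (f b) * det2 (f b) (f c)) \<in> \<rat> \<and>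
        (det2 (f a) (f b) * det2 (f a) (f c)) / (det2 (f a) (f b) * det2 (f b) (f c)) \<in> \<rat>"
      define \<kappa> where "\<kappa> = det2 (f a) (f c) / det2 (f a) (f b)"
      have \<kappa>: "\<kappa> \<in> \<rat>" using rat nz by (simp add: \<kappa>_def)
      have "det2 (f a) (f c) / det2 (f b) (f c) \<in> \<rat>" using rat nz by simp
      then have "\<kappa> / (det2 (f a) (f c) / det2 (f b) (f c)) \<in> \<rat>" using \<kappa> by (rule Rats_divide[rotated])
      then have "det2 (f b) (f c) / det2 (f a) (f b) \<in> \<rat>" using nz by (simp add: \<kappa>_def)
      then show ?thesis
        using not_commensurable[OF d \<kappa>, of "det2 (f b) (f c) / det2 (f a) (f b)"] nz by (simp add: \<kappa>_def)
    qed
  qed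
qed

end

section \<open>Rational deformations of the Grassmann coordinates\<close>

lemma sqrt_2_irrational: "sqrt 2 \<notin> \<rat>"
proof
  assume "sqrt 2 \<in> \<rat>"
  then obtain m n :: nat where n: "n \<noteq> 0" "\<bar>sqrt 2\<bar> = real m / real n" "coprime m n"
    by (rule Rats_abs_nat_div_natE)
  then have "sqrt 2 * real n = real m" by (simp add: field_simps)
  then have "(sqrt 2 * real n)\<^sup>2 = (real m)\<^sup>2" by simp
  then have "real (2 * n\<^sup>2) = real (m\<^sup>2)" by (simp add: power_mult_distrib)
  then have e: "2 * n\<^sup>2 = m\<^sup>2" by (simp only: of_nat_eq_iff)
  then have "even (m\<^sup>2)" by (metis dvd_triv_left)
  then have m: "even m" by simp
  then obtain k where "m = 2 * k" by blast
  with e have "n\<^sup>2 = 2 * k\<^sup>2" by (simp add: power2_eq_square)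
  then have "even n" by (metis dvd_triv_left even_power pos2)
  with m n(3) show False using coprime_common_divisor_nat[of m n 2] by simp
qed

lemma quadratic_field_of_root:
  fixes \<rho> :: real
  assumes Q: "p0 \<in> \<rat>" "p1 \<in> \<rat>" "p2 \<in> \<rat>" and ne: "p0 \<noteq> 0 \<or> p1 \<noteq> 0 \<or> p2 \<noteq> 0"
    and root: "p0 + p1 * \<rho> + p2 * \<rho>\<^sup>2 = 0"
  obtains K where "real_quadratic_field K" "\<And>a b. a \<in> \<rat> \<Longrightarrow> b \<in> \<rat> \<Longrightarrow> a + b * \<rho> \<in> K"
proof -
  note T = that
  \<comment> \<open>For a rational root any field of the required form contains the values; the
    square root of 2 is an arbitrary choice.\<close>
  have rat: thesis if r: "\<rho> \<in> \<rat>"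
  proof (rule T)
    show "real_quadratic_field {a + b * sqrt (real 2) | a b. a \<in> \<rat> \<and> b \<in> \<rat>}"
      unfolding real_quadratic_field_def using sqrt_2_irrational by (intro exI[of _ 2]) simp
    show "a + b * \<rho> \<in> {a + b * sqrt (real 2) | a b. a \<in> \<rat> \<and> b \<in> \<rat>}" if "a \<in> \<rat>" "b \<in> \<rat>" for a b
    proof -
      have "a + b * \<rho> = (a + b * \<rho>) + 0 * sqrt (real 2)" by simp
      moreover have "a + b * \<rho> \<in> \<rat>" "(0 :: real) \<in> \<rat>" using r that by simp_all
      ultimately show ?thesis by blast
    qed
  qed
  show thesis
  proof (cases "p2 = 0")
    case True
    then have "p1 \<noteq> 0" using ne root by auto
    then have "\<rho> = - p0 / p1" using root True by (simp add: field_simps)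
    then show ?thesis using rat Q by simp
  next
    case False
    define s where "s = 2 * p2 * \<rho> + p1"
    have s2: "s\<^sup>2 = p1\<^sup>2 - 4 * p0 * p2"
      using root unfolding s_def by (simp add: power2_eq_square algebra_simps) algebra
    then have "s\<^sup>2 \<in> \<rat>" using Q by simp
    then obtain a b where ab: "b > 0" "s\<^sup>2 = of_int a / of_int b" by (elim Rats_cases') auto
    have a: "0 \<le> a"
    proof -
      have "0 \<le> of_int a / (of_int b :: real)" using ab(2) zero_le_power2[of s] by simp
      then show ?thesis using ab(1) by (simp add: zero_le_divide_iff)
    qed
    \<comment> \<open>Multiplying the discriminant \<open>a / b\<close> by the square of
      \<open>b\<close> turns it into this integer.\<close>
    define d where "d = nat (a * b)"
    have d: "real d = of_int a * of_int b" using a ab(1) by (simp add: d_def)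
    have "(of_int b * s)\<^sup>2 = of_int b * (of_int b * s\<^sup>2)" by (simp add: power2_eq_square algebra_simps)
    also have "of_int b * s\<^sup>2 = of_int a" using ab by simp
    finally have "(of_int b * s)\<^sup>2 = real d" by (simp add: d mult.commute)
    then have "\<bar>of_int b * s\<bar> = sqrt (real d)" by (metis real_sqrt_abs)
    then have "of_int b * s = sqrt (real d) \<or> of_int b * s = - sqrt (real d)" by linarith
    then obtain \<epsilon> :: real where \<epsilon>: "\<epsilon> \<in> \<rat>" "of_int b * s = \<epsilon> * sqrt (real d)"
      by (metis Rats_1 Rats_minus_iff mult_1 mult_minus1)
    have \<rho>: "\<rho> = - p1 / (2 * p2) + (\<epsilon> / (2 * p2 * of_int b)) * sqrt (real d)"
    proof -
      have "s = \<epsilon> * sqrt (real d) / of_int b" using \<epsilon>(2) ab(1) by (simp add: field_simps)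
      moreover have "\<rho> = (s - p1) / (2 * p2)" using False by (simp add: s_def)
      ultimately show ?thesis by (simp add: diff_divide_distrib mult.commute mult.left_commute)
    qed
    show ?thesis
    proof (cases "sqrt (real d) \<in> \<rat>")
      case True
      then have "\<rho> \<in> \<rat>" unfolding \<rho> using Q \<epsilon> by simp
      then show ?thesis by (rule rat)
    next
      case irr: False
      show ?thesis
      proof (rule that)
        show "real_quadratic_field {a + b * sqrt (real d) | a b. a \<in> \<rat> \<and> b \<in> \<rat>}"
          unfolding real_quadratic_field_def using irr by blast
        fix u w :: real assume uw: "u \<in> \<rat>" "w \<in> \<rat>"
        have "u + w * \<rho> = (u + w * (- p1 / (2 * p2))) + (w * (\<epsilon> / (2 * p2 * of_int b))) * sqrt (real d)"
          by (subst \<rho>) (simp add: algebra_simps)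
        moreover have "u + w * (- p1 / (2 * p2)) \<in> \<rat>" "w * (\<epsilon> / (2 * p2 * of_int b)) \<in> \<rat>"
          using uw Q \<epsilon> by simp_all
        ultimately show "u + w * \<rho> \<in> {a + b * sqrt (real d) | a b. a \<in> \<rat> \<and> b \<in> \<rat>}" by blast
      qed
    qed
  qed
qed

text \<open>A basis over the rationals of the span of \<open>X\<close>, chosen inside
  \<open>X\<close>. The coordinate functions are extended additively to all reals, so that they can
  be applied to every integer combination of entries.\<close>

lemma rational_coordinates:
  fixes X :: "real set"
  assumes "finite X"
  obtains B e where "B \<subseteq> X" "finite B" "\<forall>b\<in>B. \<forall>x y. e b (x + y) = e b x + e b y"
    "\<forall>b\<in>B. \<forall>x\<in>X. e b x \<in> \<rat>" "\<forall>x\<in>X. x = (\<Sum>b\<in>B. e b x * b)"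
    "\<forall>b\<in>B. \<forall>b'\<in>B. e b b' = (if b' = b then 1 else (0 :: real))"
    "\<forall>q. (\<forall>b\<in>B. q b \<in> \<rat>) \<longrightarrow> (\<Sum>b\<in>B. q b * b) = 0 \<longrightarrow> (\<forall>b\<in>B. q b = 0)"
proof -
  interpret V: vector_space "\<lambda>(q :: rat) (x :: real). of_rat q * x"
    by unfold_locales (simp_all add: algebra_simps of_rat_add of_rat_mult)
  interpret VP: vector_space_pair "\<lambda>(q :: rat) (x :: real). of_rat q * x" "\<lambda>(q :: rat) (x :: real). of_rat q * x" ..
  obtain B where B: "B \<subseteq> X" "V.independent B" "X \<subseteq> V.span B" using V.maximal_independent_subset by blast
  have fin: "finite B" using B(1) assms by (rule finite_subset)
  define e where "e b = VP.construct B (\<lambda>b'. if b' = b then 1 else 0)" for b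
  have lin: "Vector_Spaces.linear (\<lambda>(q :: rat) (x :: real). of_rat q * x) (\<lambda>(q :: rat) (x :: real). of_rat q * x) (e b)" for b
    unfolding e_def using B(2) by (rule VP.linear_construct)
  have eb: "e b b' = (if b' = b then 1 else 0)" if "b' \<in> B" for b b'
    unfolding e_def using VP.construct_basis[OF B(2) that] by simp
  have esum: "e b (\<Sum>b'\<in>B. of_rat (u b') * b') = of_rat (u b)" if b: "b \<in> B" for u b
  proof -
    have "e b (\<Sum>b'\<in>B. of_rat (u b') * b') = (\<Sum>b'\<in>B. of_rat (u b') * e b b')"
      by (simp add: VP.linear_sum[OF lin] VP.linear_scale[OF lin])
    also have "\<dots> = (\<Sum>b'\<in>B. if b' = b then of_rat (u b') else 0)"
      by (intro sum.cong) (auto simp: eb)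
    also have "\<dots> = of_rat (u b)" using b fin by simp
    finally show ?thesis .
  qed
  have coord: "\<exists>u. x = (\<Sum>b\<in>B. of_rat (u b) * b)" if "x \<in> X" for x
    using B(3) that V.span_finite[OF fin] by blast
  have rat: "e b x \<in> \<rat>" if "b \<in> B" "x \<in> X" for b x
    using coord[OF that(2)] esum[OF that(1)] by (metis Rats_of_rat)
  have rep: "x = (\<Sum>b\<in>B. e b x * b)" if x: "x \<in> X" for x
  proof -
    obtain u where u: "x = (\<Sum>b\<in>B. of_rat (u b) * b)" using coord[OF x] by blast
    then have "e b x = of_rat (u b)" if "b \<in> B" for b using esum[OF that] by simp
    then show ?thesis using u by simp
  qed
  have indep: "q b = 0" if q: "\<forall>b\<in>B. q b \<in> \<rat>" "(\<Sum>b\<in>B. q b * b) = 0" and b: "b \<in> B" for q b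
  proof -
    have "\<forall>b\<in>B. \<exists>r. q b = of_rat r" using q(1) by (metis Rats_cases)
    then obtain u where u: "\<And>b. b \<in> B \<Longrightarrow> q b = of_rat (u b)" by metis
    have "(\<Sum>b\<in>B. of_rat (u b) * b) = 0" using q(2) u by simp
    then have "of_rat (u b) = e b 0" using esum[OF b, of u] by simp
    then show ?thesis using VP.linear_0[OF lin] u[OF b] by simp
  qed
  show ?thesis
    by (rule that[of B e, OF B(1) fin])
      (intro ballI allI impI; rule VP.linear_add[OF lin] rat rep eb indep; assumption)+
qed

text \<open>At \<open>c = s\<close> and \<open>c = - s\<close> the linear term dominates, so the
  polynomial changes sign in between. This corrects a move by \<open>s\<close> along a tangent of a
  quadric by a move \<open>c\<close> in a transversal direction.\<close>

lemma small_root: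
  fixes p q r w :: real
  assumes q: "q \<noteq> 0" and \<epsilon>: "0 < \<epsilon>"
  obtains s c where "0 < s" "s < \<epsilon>" "\<bar>c\<bar> \<le> s" "s\<^sup>2 * p + c * q + s * c * r + c\<^sup>2 * w = 0"
proof -
  define M where "M = \<bar>p\<bar> + \<bar>r\<bar> + \<bar>w\<bar> + 1"
  define s where "s = min (\<epsilon> / 2) (\<bar>q\<bar> / (2 * M))"
  have M: "0 < M" by (simp add: M_def)
  have s: "0 < s" "s < \<epsilon>" "s * M \<le> \<bar>q\<bar> / 2"
  proof -
    show "0 < s" using q \<epsilon> M by (simp add: s_def)
    show "s < \<epsilon>" using \<epsilon> by (simp add: s_def)
    have "s \<le> \<bar>q\<bar> / (2 * M)" by (simp add: s_def)
    then show "s * M \<le> \<bar>q\<bar> / 2" using M by (simp add: field_simps)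
  qed
  define g where "g c = s\<^sup>2 * p + c * q + s * c * r + c\<^sup>2 * w" for c
  have cont: "continuous_on A g" for A unfolding g_def by (intro continuous_intros)
  have small: "\<bar>s\<^sup>2 * p + s * c * r + c\<^sup>2 * w\<bar> \<le> s * \<bar>q\<bar> / 2" if c: "c = s \<or> c = - s" for c
  proof -
    have "\<bar>s\<^sup>2 * p + s * c * r + c\<^sup>2 * w\<bar> \<le> \<bar>s\<^sup>2 * p\<bar> + \<bar>s * c * r\<bar> + \<bar>c\<^sup>2 * w\<bar>" by linarith
    also have "\<dots> = s\<^sup>2 * (\<bar>p\<bar> + \<bar>r\<bar> + \<bar>w\<bar>)"
      using c s(1) by (auto simp: abs_mult power2_eq_square algebra_simps)
    also have "\<dots> \<le> s\<^sup>2 * M" by (intro mult_left_mono) (auto simp: M_def)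
    also have "\<dots> = s * (s * M)" by (simp add: power2_eq_square)
    also have "\<dots> \<le> s * (\<bar>q\<bar> / 2)" using s by (intro mult_left_mono) auto
    finally show ?thesis by simp
  qed
  have sq: "0 < s * \<bar>q\<bar>" using s q by simp
  have gs: "g c = c * q + (s\<^sup>2 * p + s * c * r + c\<^sup>2 * w)" for c by (simp add: g_def)
  have sm: "\<bar>g s - s * q\<bar> \<le> s * \<bar>q\<bar> / 2" "\<bar>g (- s) + s * q\<bar> \<le> s * \<bar>q\<bar> / 2"
    using small[of s] small[of "- s"] by (simp_all add: gs)
  have "\<exists>c. - s \<le> c \<and> c \<le> s \<and> g c = 0"
  proof (cases "0 < q")
    case True
    then have "s * \<bar>q\<bar> = s * q" by simp
    then have "g (- s) \<le> 0" "0 \<le> g s" using sm sq by linarith+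
    then show ?thesis using IVT'[of g "- s" 0 s] cont s(1) by auto
  next
    case False
    then have "s * \<bar>q\<bar> = - (s * q)" by simp
    then have "g s \<le> 0" "0 \<le> g (- s)" using sm sq by linarith+
    then show ?thesis using IVT2'[of g s 0 "- s"] cont s(1) by auto
  qed
  then obtain c where "- s \<le> c" "c \<le> s" "g c = 0" by blast
  then show ?thesis using s by (intro that[of s c]) (auto simp: g_def)
qed

text \<open>Polarization of the Pluecker quadric, evaluated at the images of the point under two
  maps; on the diagonal it is twice the quadratic form.\<close>

definition polar :: "real \<Rightarrow> real \<Rightarrow> real \<Rightarrow> real \<Rightarrow> real \<Rightarrow> real \<Rightarrow> (real \<Rightarrow> real) \<Rightarrow> (real \<Rightarrow> real) \<Rightarrow> real" where
  "polar x y z p q r \<phi> \<psi> = \<phi> x * \<psi> r + \<psi> x * \<phi> r - \<phi> y * \<psi> q - \<psi> y * \<phi> q + \<phi> z * \<psi> p + \<psi> z * \<phi> p"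

lemma polar_commute: "polar x y z p q r \<phi> \<psi> = polar x y z p q r \<psi> \<phi>"
  by (simp add: polar_def)

lemma polar_combine:
  "polar x y z p q r (\<lambda>t. \<phi> t + a * \<phi>' t) \<psi> = polar x y z p q r \<phi> \<psi> + a * polar x y z p q r \<phi>' \<psi>"
  by (simp add: polar_def algebra_simps)

lemma polar_sum:
  assumes "x = (\<Sum>b\<in>B. e b x * b)" "y = (\<Sum>b\<in>B. e b y * b)" "z = (\<Sum>b\<in>B. e b z * b)"
    "p = (\<Sum>b\<in>B. e b p * b)" "q = (\<Sum>b\<in>B. e b q * b)" "r = (\<Sum>b\<in>B. e b r * b)"
  shows "polar x y z p q r (\<lambda>t. t) \<psi> = (\<Sum>b\<in>B. polar x y z p q r (e b) \<psi> * b)"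
proof -
  have m: "polar x y z p q r (e b) \<psi> * b = (e b x * b) * \<psi> r + \<psi> x * (e b r * b) - (e b y * b) * \<psi> q
      - \<psi> y * (e b q * b) + (e b z * b) * \<psi> p + \<psi> z * (e b p * b)" for b
    by (simp add: polar_def algebra_simps)
  show ?thesis
    unfolding m sum.distrib sum_subtractf sum_distrib_left[symmetric] sum_distrib_right[symmetric]
      assms[symmetric] by (simp add: polar_def)
qed

text \<open>A real point of a rational quadric, in a rational subspace containing it in general position, is
  either quadratic or not isolated.\<close>

lemma quadratic_or_deformable:
  fixes x y z p q r :: real
  assumes ne: "x \<noteq> 0" and pl: "x * r - y * q + z * p = 0"
  defines "X \<equiv> {x, y, z, p, q, r}"
  shows "(\<exists>K u. real_quadratic_field K \<and> u \<noteq> 0 \<and> (\<forall>t\<in>X. u * t \<in> K)) \<or>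
    (\<forall>\<epsilon>>0. \<exists>\<Phi>. (\<forall>s t. \<Phi> (s + t) = \<Phi> s + \<Phi> t) \<and> (\<forall>t\<in>X. \<bar>\<Phi> t - t\<bar> < \<epsilon>) \<and>
       \<Phi> x * \<Phi> r - \<Phi> y * \<Phi> q + \<Phi> z * \<Phi> p = 0 \<and> \<not> (\<exists>u. \<forall>t\<in>X. \<Phi> t = u * t))"
proof -
  have finX: "finite X" by (simp add: X_def)
  obtain B e where B: "B \<subseteq> X" "finite B" and add0: "\<forall>b\<in>B. \<forall>s t. e b (s + t) = e b s + e b t"
    and rat0: "\<forall>b\<in>B. \<forall>t\<in>X. e b t \<in> \<rat>" and rep0: "\<forall>t\<in>X. t = (\<Sum>b\<in>B. e b t * b)"
    and dual0: "\<forall>b\<in>B. \<forall>b'\<in>B. e b b' = (if b' = b then 1 else (0 :: real))"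
    and indep0: "\<forall>q. (\<forall>b\<in>B. q b \<in> \<rat>) \<longrightarrow> (\<Sum>b\<in>B. q b * b) = 0 \<longrightarrow> (\<forall>b\<in>B. q b = 0)"
    by (rule rational_coordinates[OF finX])
  note add = add0[rule_format] and rat = rat0[rule_format] and rep = rep0[rule_format]
    and dual = dual0[rule_format]
  have indep: "q b = 0" if "\<And>b. b \<in> B \<Longrightarrow> q b \<in> \<rat>" "(\<Sum>b\<in>B. q b * b) = 0" "b \<in> B" for q b
    using indep0 that by blast
  let ?P = "polar x y z p q r"
  have PQ: "?P (e b) (e b') \<in> \<rat>" if "b \<in> B" "b' \<in> B" for b b'
    using rat that by (simp add: polar_def X_def)
  have Pid: "?P (\<lambda>t. t) \<psi> = (\<Sum>b\<in>B. ?P (e b) \<psi> * b)" for \<psi>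
  proof -
    have "t = (\<Sum>b\<in>B. e b t * b)" if "t \<in> {x, y, z, p, q, r}" for t using rep that by (simp add: X_def)
    then show ?thesis by (intro polar_sum) blast+
  qed
  have Ce: "?P (e b) (\<lambda>t. t) = ?P (\<lambda>t. t) (e b)" for b by (rule polar_commute)
  have Pid0: "?P (\<lambda>t. t) (\<lambda>t. t) = 0" using pl by (simp add: polar_def algebra_simps)
  have Pl: "\<Phi> x * \<Phi> r - \<Phi> y * \<Phi> q + \<Phi> z * \<Phi> p = 0" if "?P \<Phi> \<Phi> = 0" for \<Phi>
    using that by (simp add: polar_def algebra_simps)
  have b0: "b \<noteq> 0" if b: "b \<in> B" for b
  proof
    assume "b = 0"
    then have "(\<Sum>b'\<in>B. (if b' = b then 1 else 0) * b') = 0" by (intro sum.neutral) auto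
    then have "(if b = b then 1 else (0 :: real)) = 0"
      by (intro indep[of "\<lambda>b'. if b' = b then 1 else 0"]) (use b in auto)
    then show False by simp
  qed
  have "B \<noteq> {}" using rep[of x] ne by (auto simp: X_def)
  then obtain \<beta> where \<beta>: "\<beta> \<in> B" by blast
  have bound: "\<exists>M>0. \<forall>t\<in>X. \<bar>\<psi> t\<bar> \<le> M" for \<psi> :: "real \<Rightarrow> real"
  proof -
    define M where "M = \<bar>\<psi> x\<bar> + \<bar>\<psi> y\<bar> + \<bar>\<psi> z\<bar> + \<bar>\<psi> p\<bar> + \<bar>\<psi> q\<bar> + \<bar>\<psi> r\<bar> + 1"
    have "0 < M" "\<forall>t\<in>X. \<bar>\<psi> t\<bar> \<le> M" by (auto simp: M_def X_def)
    then show ?thesis by blast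
  qed
  show ?thesis
  proof (cases "B = {\<beta>}")
    case True
    \<comment> \<open>All entries are rational multiples of one number.\<close>
    obtain K where K0: "real_quadratic_field K" "\<And>a b. a \<in> \<rat> \<Longrightarrow> b \<in> \<rat> \<Longrightarrow> a + b * 0 \<in> K"
      by (rule quadratic_field_of_root[of 0 1 0 0]) auto
    have K: "real_quadratic_field K" "a \<in> K" if "a \<in> \<rat>" for a
      using K0(1) K0(2)[OF that Rats_0] by simp_all
    have "inverse \<beta> * t \<in> K" if t: "t \<in> X" for t
    proof -
      have "t = e \<beta> t * \<beta>" using rep[OF t] True by simp
      then have "inverse \<beta> * t = e \<beta> t" using b0[OF \<beta>] by (simp add: field_simps)
      then show ?thesis using K(2) rat[OF \<beta> t] by simp
    qed
    then show ?thesis using K0(1) b0[OF \<beta>] by (intro disjI1 exI[of _ K] exI[of _ "inverse \<beta>"]) simp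
  next
    case False
    then obtain \<gamma> where \<gamma>: "\<gamma> \<in> B" "\<gamma> \<noteq> \<beta>" using \<beta> by blast
    show ?thesis
    proof (cases "\<forall>b\<in>B. ?P (\<lambda>t. t) (e b) = 0")
      case True
      \<comment> \<open>The form is tangent to every coordinate direction at the point. Rational
        independence turns the vanishing of the sum into the vanishing of each term, so a whole line
        in direction \<open>e \<beta>\<close> lies on the quadric.\<close>
      have PB: "?P (e \<beta>) (e \<beta>) = 0"
        by (rule indep[of "\<lambda>b. ?P (e b) (e \<beta>)"]) (use PQ \<beta> True Pid in auto)
      show ?thesis
      proof (intro disjI2 allI impI)
        fix \<epsilon> :: real assume \<epsilon>: "0 < \<epsilon>"
        obtain M where M: "0 < M" "\<forall>t\<in>X. \<bar>e \<beta> t\<bar> \<le> M" using bound by blast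
        define s where "s = \<epsilon> / (2 * M)"
        have s: "0 < s" "s * M < \<epsilon>" using \<epsilon> M by (simp_all add: s_def)
        define \<Phi> where "\<Phi> t = t + s * e \<beta> t" for t
        have "?P \<Phi> \<Phi> = 0"
          unfolding \<Phi>_def polar_combine polar_commute[of x y z p q r _ "\<lambda>t. t + s * e \<beta> t"]
          using Pid0 PB True \<beta> polar_commute[of x y z p q r "e \<beta>" "\<lambda>t. t"] by simp
        moreover have "\<bar>\<Phi> t - t\<bar> < \<epsilon>" if "t \<in> X" for t
        proof -
          have "\<bar>\<Phi> t - t\<bar> = s * \<bar>e \<beta> t\<bar>" using s by (simp add: \<Phi>_def abs_mult)
          also have "\<dots> \<le> s * M" using M that s by (intro mult_left_mono) auto
          finally show ?thesis using s(2) by simp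
        qed
        moreover have "\<not> (\<exists>u. \<forall>t\<in>X. \<Phi> t = u * t)"
        proof
          assume "\<exists>u. \<forall>t\<in>X. \<Phi> t = u * t"
          then obtain u where u: "\<And>t. t \<in> X \<Longrightarrow> \<Phi> t = u * t" by blast
          have "\<gamma> = u * \<gamma>" using u[of \<gamma>] B(1) \<gamma> dual[OF \<beta> \<gamma>(1)] by (auto simp: \<Phi>_def)
          then have "u = 1" using b0[OF \<gamma>(1)] by simp
          then show False using u[of \<beta>] B(1) \<beta> dual[OF \<beta> \<beta>] s(1) by (auto simp: \<Phi>_def)
        qed
        moreover have "\<Phi> (t + t') = \<Phi> t + \<Phi> t'" for t t' using add[OF \<beta>] by (simp add: \<Phi>_def algebra_simps)
        ultimately show "\<exists>\<Phi>. (\<forall>s t. \<Phi> (s + t) = \<Phi> s + \<Phi> t) \<and> (\<forall>t\<in>X. \<bar>\<Phi> t - t\<bar> < \<epsilon>) \<and>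
           \<Phi> x * \<Phi> r - \<Phi> y * \<Phi> q + \<Phi> z * \<Phi> p = 0 \<and> \<not> (\<exists>u. \<forall>t\<in>X. \<Phi> t = u * t)"
          using Pl by blast
      qed
    next
      case False
      then obtain b where b: "b \<in> B" "?P (\<lambda>t. t) (e b) \<noteq> 0" by blast
      obtain b1 where b1: "b1 \<in> B" "b1 \<noteq> b" using \<beta> \<gamma> by metis
      show ?thesis
      proof (cases "B = {b, b1}")
        case True
        \<comment> \<open>With two basis elements the Pluecker relation is a rational quadratic
          equation for their quotient, nontrivial because of the choice of \<open>b\<close>.\<close>
        define \<rho> where "\<rho> = b1 / b"
        let ?p0 = "?P (e b) (e b)" and ?p1 = "?P (e b) (e b1)" and ?p2 = "?P (e b1) (e b1)"
        have sumB: "(\<Sum>b'\<in>B. h b') = h b + h b1" for h :: "real \<Rightarrow> real"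
          unfolding True using b1(2) by simp
        have "?P (\<lambda>t. t) (e b') = ?P (e b) (e b') * b + ?P (e b1) (e b') * b1" for b'
          using Pid[of "e b'"] sumB by simp
        note Pe = this
        have "0 = ?P (\<lambda>t. t) (e b) * b + ?P (\<lambda>t. t) (e b1) * b1"
          using Pid[of "\<lambda>t. t"] Pid0 sumB[of "\<lambda>b'. ?P (e b') (\<lambda>t. t) * b'"]
          by (simp add: Ce)
        also have "\<dots> = b\<^sup>2 * (?p0 + (2 * ?p1) * \<rho> + ?p2 * \<rho>\<^sup>2)"
          unfolding Pe \<rho>_def polar_commute[of x y z p q r "e b1" "e b"]
          using b0[OF b(1)] by (simp add: field_simps power2_eq_square)
        finally have root: "?p0 + (2 * ?p1) * \<rho> + ?p2 * \<rho>\<^sup>2 = 0" using b0[OF b(1)] by simp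
        have "?p0 \<noteq> 0 \<or> 2 * ?p1 \<noteq> 0 \<or> ?p2 \<noteq> 0"
          using b(2) unfolding Pe polar_commute[of x y z p q r "e b1" "e b"] by auto
        then obtain K where K: "real_quadratic_field K" "\<And>u w. u \<in> \<rat> \<Longrightarrow> w \<in> \<rat> \<Longrightarrow> u + w * \<rho> \<in> K"
          by (rule quadratic_field_of_root[of ?p0 "2 * ?p1" ?p2 \<rho>, rotated 3])
            (use PQ b b1 root in auto)
        have "inverse b * t \<in> K" if t: "t \<in> X" for t
        proof -
          have "t = e b t * b + e b1 t * b1" using rep[OF t] sumB by simp
          then have "inverse b * t = e b t + e b1 t * \<rho>" using b0[OF b(1)] by (simp add: \<rho>_def field_simps)
          then show ?thesis using K(2) rat[OF b(1) t] rat[OF b1(1) t] by simp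
        qed
        then show ?thesis using K(1) b0[OF b(1)] by (intro disjI1 exI[of _ K] exI[of _ "inverse b"]) simp
      next
        case False
        then obtain b2 where b2: "b2 \<in> B" "b2 \<noteq> b" "b2 \<noteq> b1" using b(1) b1(1) by blast
        \<comment> \<open>Makes \<open>\<kappa>\<close> tangent to the quadric at the point. The
          deformation built from \<open>\<kappa>\<close> and \<open>e b\<close> fixes
          \<open>b2\<close> and moves \<open>b1\<close>, hence is not a scaling.\<close>
        define a where "a = - ?P (\<lambda>t. t) (e b1) / ?P (\<lambda>t. t) (e b)"
        define \<kappa> where "\<kappa> t = e b1 t + a * e b t" for t
        have P\<kappa>: "?P \<kappa> (\<lambda>t. t) = 0"
          unfolding \<kappa>_def polar_combine Ce using b(2) by (simp add: a_def)
        show ?thesis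
        proof (intro disjI2 allI impI)
          fix \<epsilon> :: real assume \<epsilon>: "0 < \<epsilon>"
          obtain M1 where M1: "0 < M1" "\<forall>t\<in>X. \<bar>\<kappa> t\<bar> \<le> M1" using bound by blast
          obtain M2 where M2: "0 < M2" "\<forall>t\<in>X. \<bar>e b t\<bar> \<le> M2" using bound by blast
          have "2 * ?P (\<lambda>t. t) (e b) \<noteq> 0" "0 < \<epsilon> / (M1 + M2)" using b(2) \<epsilon> M1 M2 by simp_all
          then obtain s c where sc: "0 < s" "s < \<epsilon> / (M1 + M2)" "\<bar>c\<bar> \<le> s"
            "s\<^sup>2 * ?P \<kappa> \<kappa> + c * (2 * ?P (\<lambda>t. t) (e b)) + s * c * (2 * ?P \<kappa> (e b)) + c\<^sup>2 * ?P (e b) (e b) = 0"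
            by (rule small_root)
          define \<Phi> where "\<Phi> t = t + s * \<kappa> t + c * e b t" for t
          have ex: "?P \<Phi> \<psi> = ?P (\<lambda>t. t) \<psi> + s * ?P \<kappa> \<psi> + c * ?P (e b) \<psi>" for \<psi>
            unfolding \<Phi>_def polar_combine by simp
          have ex': "?P \<psi> \<Phi> = ?P \<psi> (\<lambda>t. t) + s * ?P \<psi> \<kappa> + c * ?P \<psi> (e b)" for \<psi>
            using ex[of \<psi>] by (metis polar_commute)
          have "?P (\<lambda>t. t) \<kappa> = 0" "?P (e b) \<kappa> = ?P \<kappa> (e b)"
            using P\<kappa> by (metis polar_commute)+
          then have "?P \<Phi> \<Phi> = 0"
            unfolding ex ex' Ce using Pid0 P\<kappa> sc(4)
            by (simp add: algebra_simps power2_eq_square)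
          moreover have "\<bar>\<Phi> t - t\<bar> < \<epsilon>" if "t \<in> X" for t
          proof -
            have "\<bar>\<Phi> t - t\<bar> \<le> s * \<bar>\<kappa> t\<bar> + \<bar>c\<bar> * \<bar>e b t\<bar>"
              using sc(1) abs_triangle_ineq[of "s * \<kappa> t" "c * e b t"] by (simp add: \<Phi>_def abs_mult)
            also have "\<dots> \<le> s * M1 + s * M2"
              using M1 M2 that sc by (intro add_mono mult_mono) auto
            also have "\<dots> < \<epsilon>" using sc(2) M1(1) M2(1) by (simp add: field_simps)
            finally show ?thesis .
          qed
          moreover have "\<not> (\<exists>u. \<forall>t\<in>X. \<Phi> t = u * t)"
          proof
            assume "\<exists>u. \<forall>t\<in>X. \<Phi> t = u * t"
            then obtain u where u: "\<And>t. t \<in> X \<Longrightarrow> \<Phi> t = u * t" by blast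
            have "b2 = u * b2"
              using u[of b2] B(1) b2 dual[OF b1(1) b2(1)] dual[OF b(1) b2(1)] by (auto simp: \<Phi>_def \<kappa>_def)
            then have "u = 1" using b0[OF b2(1)] by simp
            then show False
              using u[of b1] B(1) b1 dual[OF b1(1) b1(1)] dual[OF b(1) b1(1)] sc(1) by (auto simp: \<Phi>_def \<kappa>_def)
          qed
          moreover have "\<Phi> (t + t') = \<Phi> t + \<Phi> t'" for t t'
            using add[OF b(1)] add[OF b1(1)] by (simp add: \<Phi>_def \<kappa>_def algebra_simps)
          ultimately show "\<exists>\<Phi>. (\<forall>s t. \<Phi> (s + t) = \<Phi> s + \<Phi> t) \<and> (\<forall>t\<in>X. \<bar>\<Phi> t - t\<bar> < \<epsilon>) \<and>
             \<Phi> x * \<Phi> r - \<Phi> y * \<Phi> q + \<Phi> z * \<Phi> p = 0 \<and> \<not> (\<exists>u. \<forall>t\<in>X. \<Phi> t = u * t)"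
            using Pl by blast
        qed
      qed
    qed
  qed
qed

section \<open>The closure of the projected lattice\<close>

text \<open>Multiples of \<open>f 1\<close> are reduced modulo the lattice of \<open>f 3\<close> and
  \<open>f 4\<close> into a bounded set. Two of them come close, and their difference is nonzero
  because the multiples are different.\<close>

lemma arbitrarily_small_image:
  assumes f_indep: "\<And>i j. i \<noteq> j \<Longrightarrow> det2 (f i) (f j) \<noteq> 0"
    and no_int: "\<And>z. cmb f (rv z) = 0 \<Longrightarrow> z = 0" and e: "0 < e"
  shows "\<exists>z. z \<noteq> 0 \<and> norm (cmb f (rv z)) < e"
proof -
  define s where "s n = det2 (f 4) (of_nat n *\<^sub>R f 1) / det2 (f 4) (f 3)" for n :: nat
  define t where "t n = det2 (f 3) (of_nat n *\<^sub>R f 1) / det2 (f 3) (f 4)" for n :: nat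
  define z :: "nat \<Rightarrow> int ^ 4" where "z n = axis 1 (of_nat n) - axis 3 \<lfloor>s n\<rfloor> - axis 4 \<lfloor>t n\<rfloor>" for n
  have F: "cmb f (rv (z n)) = frac (s n) *\<^sub>R f 3 + frac (t n) *\<^sub>R f 4" for n
  proof -
    have "of_nat n *\<^sub>R f 1 = s n *\<^sub>R f 3 + t n *\<^sub>R f 4"
      unfolding s_def t_def by (rule det2_cramer) (use f_indep in simp)
    then show ?thesis
      unfolding z_def rv_diff cmb_diff rv_axis cmb_axis frac_def
      by (simp add: scaleR_left_diff_distrib)
  qed
  have bd: "cmb f (rv (z n)) \<in> cball 0 (norm (f 3) + norm (f 4))" for n
  proof -
    have "norm (cmb f (rv (z n))) \<le> norm (frac (s n) *\<^sub>R f 3) + norm (frac (t n) *\<^sub>R f 4)"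
      unfolding F by (rule norm_triangle_ineq)
    also have "\<dots> \<le> 1 * norm (f 3) + 1 * norm (f 4)"
      unfolding norm_scaleR by (intro add_mono mult_right_mono) (simp_all add: frac_lt_1 less_imp_le)
    finally show ?thesis by simp
  qed
  have "seq_compact (cball (0 :: real ^ 2) (norm (f 3) + norm (f 4)))"
    by (simp add: compact_imp_seq_compact)
  then obtain l r where r: "strict_mono (r :: nat \<Rightarrow> nat)" "((\<lambda>n. cmb f (rv (z n))) \<circ> r) \<longlonglongrightarrow> l"
    using bd unfolding seq_compact_def by metis
  then have "Cauchy ((\<lambda>n. cmb f (rv (z n))) \<circ> r)" using LIMSEQ_imp_Cauchy by blast
  then obtain M where M: "\<And>m n. m \<ge> M \<Longrightarrow> n \<ge> M \<Longrightarrow>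
      dist (cmb f (rv (z (r m)))) (cmb f (rv (z (r n)))) < e"
    using e unfolding Cauchy_def comp_def by metis
  have "z (r (Suc M)) - z (r M) \<noteq> 0"
  proof -
    have "r M < r (Suc M)" using r(1) by (simp add: strict_mono_def)
    then have "(z (r (Suc M)) - z (r M)) $ 1 \<noteq> 0" by (simp add: z_def axis_def)
    then show ?thesis by (metis zero_index)
  qed
  then show ?thesis
    using M[of "Suc M" M] by (intro exI[of _ "z (r (Suc M)) - z (r M)"]) (simp add: dist_norm rv_diff cmb_diff)
qed

text \<open>The directions of ever shorter lattice images accumulate at some \<open>u\<close>;
  integer multiples of these images follow the line through \<open>u\<close> in arbitrarily small
  steps.\<close>

lemma accumulation_direction:
  assumes small: "\<And>e. 0 < e \<Longrightarrow> \<exists>z. z \<noteq> 0 \<and> norm (cmb f (rv z)) < e"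
    and no_int: "\<And>z. cmb f (rv z) = 0 \<Longrightarrow> z = 0"
  obtains u where "norm u = 1"
    "\<forall>t e K. 0 < e \<longrightarrow> 0 < K \<longrightarrow> (\<exists>z j. norm (cmb f (rv z)) < K \<and> norm (of_int j *\<^sub>R cmb f (rv z) - t *\<^sub>R u) < e)"
proof -
  have "\<exists>z. \<forall>n :: nat. z n \<noteq> 0 \<and> norm (cmb f (rv (z n))) < inverse (real (Suc n))"
    by (intro choice allI small) simp
  then obtain z where z: "\<And>n. z n \<noteq> 0" "\<And>n. norm (cmb f (rv (z n))) < inverse (real (Suc n))" by blast
  define \<gamma> where "\<gamma> n = cmb f (rv (z n))" for n
  have \<gamma>0: "\<gamma> n \<noteq> 0" for n using z(1) no_int by (auto simp: \<gamma>_def)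
  have "seq_compact (sphere (0 :: real ^ 2) 1)" by (simp add: compact_imp_seq_compact)
  moreover have "\<forall>n. sgn (\<gamma> n) \<in> sphere 0 1" using \<gamma>0 by (simp add: norm_sgn)
  ultimately obtain u r where u0: "u \<in> sphere 0 1" "strict_mono (r :: nat \<Rightarrow> nat)" "((\<lambda>n. sgn (\<gamma> n)) \<circ> r) \<longlonglongrightarrow> u"
    by (rule seq_compactE)
  from u0(3) have "(\<lambda>n. sgn (\<gamma> (r n))) \<longlonglongrightarrow> u" by (simp add: comp_def)
  note u = u0(1,2) this
  have to0: "(\<lambda>n. norm (\<gamma> (r n))) \<longlonglongrightarrow> 0"
  proof -
    have "(\<lambda>n. norm (\<gamma> n)) \<longlonglongrightarrow> 0"
      by (rule tendsto_sandwich[OF _ _ tendsto_const LIMSEQ_inverse_real_of_nat])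
        (use z(2) in \<open>auto simp: \<gamma>_def less_imp_le\<close>)
    then show ?thesis using LIMSEQ_subseq_LIMSEQ[OF _ u(2)] by (simp add: comp_def)
  qed
  show ?thesis
  proof (rule that)
    show "norm u = 1" using u(1) by simp
    show "\<forall>t e K. 0 < e \<longrightarrow> 0 < K \<longrightarrow> (\<exists>z j. norm (cmb f (rv z)) < K \<and> norm (of_int j *\<^sub>R cmb f (rv z) - t *\<^sub>R u) < e)"
    proof (intro allI impI)
      fix t e K :: real assume e: "0 < e" and K: "0 < K"
      have "(\<lambda>n. \<bar>t\<bar> * norm (sgn (\<gamma> (r n)) - u) + norm (\<gamma> (r n))) \<longlonglongrightarrow> \<bar>t\<bar> * norm (u - u) + 0"
        by (intro tendsto_intros u(3) to0)
      then have "\<forall>\<^sub>F n in sequentially. \<bar>t\<bar> * norm (sgn (\<gamma> (r n)) - u) + norm (\<gamma> (r n)) < e"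
        using e by (auto dest!: order_tendstoD(2))
      moreover have "\<forall>\<^sub>F n in sequentially. norm (\<gamma> (r n)) < K" using to0 K by (rule order_tendstoD(2))
      ultimately have "\<forall>\<^sub>F n in sequentially. \<bar>t\<bar> * norm (sgn (\<gamma> (r n)) - u) + norm (\<gamma> (r n)) < e \<and> norm (\<gamma> (r n)) < K"
        by (rule eventually_conj)
      then obtain n where n: "\<bar>t\<bar> * norm (sgn (\<gamma> (r n)) - u) + norm (\<gamma> (r n)) < e" "norm (\<gamma> (r n)) < K"
        using eventually_happens'[OF sequentially_bot] by blast
      define g where "g = \<gamma> (r n)"
      define j where "j = \<lfloor>t / norm g\<rfloor>"
      have g: "0 < norm g" using \<gamma>0 by (simp add: g_def)
      have "of_int j *\<^sub>R g - t *\<^sub>R u = (of_int j - t / norm g) *\<^sub>R g + t *\<^sub>R (sgn g - u)"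
        using g by (simp add: sgn_div_norm algebra_simps divide_inverse)
      then have "norm (of_int j *\<^sub>R g - t *\<^sub>R u) \<le> norm ((of_int j - t / norm g) *\<^sub>R g) + norm (t *\<^sub>R (sgn g - u))"
        by (metis norm_triangle_ineq)
      also have "\<dots> \<le> 1 * norm g + \<bar>t\<bar> * norm (sgn g - u)"
        unfolding norm_scaleR real_norm_def j_def by (intro add_mono mult_right_mono) (linarith | simp)+
      also have "\<dots> < e" using n(1) by (simp add: g_def)
      finally have "norm (of_int j *\<^sub>R g - t *\<^sub>R u) < e" .
      then show "\<exists>z j. norm (cmb f (rv z)) < K \<and> norm (of_int j *\<^sub>R cmb f (rv z) - t *\<^sub>R u) < e"
        using n(2) unfolding g_def \<gamma>_def by blast
    qed
  qed
qed

lemma discrete_subgroup_generator: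
  fixes G :: "int ^ 4 \<Rightarrow> real"
  assumes diff: "\<And>x y. G (x - y) = G x - G y" and scale: "\<And>j x. G (j *s x) = of_int j * G x"
    and ne: "G z0 \<noteq> 0" and e: "0 < e" "\<And>z. G z = 0 \<or> e \<le> \<bar>G z\<bar>"
  obtains a where "0 < a" "\<And>z. \<exists>n. G z = of_int n * a"
proof -
  define P where "P = {G z | z. 0 < G z}"
  have "G ((-1) *s z0) = - G z0" using scale[of "-1" z0] by simp
  then have P: "P \<noteq> {}" using ne unfolding P_def by (cases "0 < G z0") (auto, metis linorder_neqE_linordered_idom neg_0_less_iff_less)
  have bdd: "bdd_below P" unfolding P_def by (intro bdd_belowI[of _ 0]) auto
  define a where "a = Inf P"
  have aP: "a \<in> P"
  proof -
    obtain p where p: "p \<in> P" "p < a + e"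
      using cInf_lessD[OF P, of "a + e"] e(1) by (auto simp: a_def)
    have "p \<le> q" if q: "q \<in> P" for q
    proof (rule ccontr)
      assume n: "\<not> p \<le> q"
      obtain x y where xy: "p = G x" "q = G y" using p(1) q by (auto simp: P_def)
      have "a \<le> q" unfolding a_def by (rule cInf_lower[OF q bdd])
      then show False using e(2)[of "x - y"] p(2) n xy by (simp add: diff)
    qed
    then have "a = p" unfolding a_def by (intro cInf_eq_minimum p(1))
    then show ?thesis using p by simp
  qed
  then obtain y where y: "a = G y" "0 < a" by (auto simp: P_def)
  show ?thesis
  proof (rule that[OF y(2)])
    fix z
    define n where "n = \<lfloor>G z / a\<rfloor>"
    have r: "G (z - n *s y) = G z - of_int n * a" by (simp add: diff scale y(1))
    have "of_int n \<le> G z / a" "G z / a < of_int n + 1" unfolding n_def by linarith+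
    then have b: "0 \<le> G z - of_int n * a" "G z - of_int n * a < a" using y(2) by (simp_all add: field_simps)
    have "G z - of_int n * a = 0"
    proof (rule ccontr)
      assume "G z - of_int n * a \<noteq> 0"
      then have "G z - of_int n * a \<in> P" using b(1) r unfolding P_def by (auto intro!: exI[of _ "z - n *s y"])
      then have "a \<le> G z - of_int n * a" unfolding a_def using bdd by (rule cInf_lower)
      with b(2) show False by simp
    qed
    then show "\<exists>n. G z = of_int n * a" by (intro exI[of _ n]) simp
  qed
qed

text \<open>The closure contains a full line along \<open>u\<close>. If the transverse component
  \<open>det2 u\<close> takes arbitrarily small nonzero values, the image is dense and
  \<open>c = 0\<close>; otherwise its values form a discrete group, and dividing by the generator
  gives an integral \<open>c\<close>.\<close>

lemma image_closure_direction:
  assumes f_indep: "\<And>i j. i \<noteq> j \<Longrightarrow> det2 (f i) (f j) \<noteq> 0"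
    and no_int: "\<And>z. cmb f (rv z) = 0 \<Longrightarrow> z = 0"
  obtains c :: "real ^ 2" and N :: "int ^ 4" where "\<forall>i. c \<bullet> f i = of_int (N $ i)"
    "\<forall>w e. c \<bullet> w = 0 \<longrightarrow> 0 < e \<longrightarrow> (\<exists>z. c \<bullet> cmb f (rv z) = 0 \<and> norm (cmb f (rv z) - w) < e)"
proof -
  have small: "\<exists>z. z \<noteq> 0 \<and> norm (cmb f (rv z)) < e" if "0 < e" for e
    by (rule arbitrarily_small_image[of f]) (use f_indep no_int that in auto)
  obtain u where u: "norm u = 1" and
    "\<forall>t e K. 0 < e \<longrightarrow> 0 < K \<longrightarrow> (\<exists>z j. norm (cmb f (rv z)) < K \<and> norm (of_int j *\<^sub>R cmb f (rv z) - t *\<^sub>R u) < e)"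
    by (rule accumulation_direction[of f, OF small no_int])
  note line = this(2)[rule_format]
  define u' :: "real ^ 2" where "u' = vector [- (u $ 2), u $ 1]"
  have u2: "(u $ 1)\<^sup>2 + (u $ 2)\<^sup>2 = 1"
    using u by (simp add: norm_vec_def L2_set_def sum_2)
  have uu': "det2 u u' = 1" using u2 by (simp add: det2_def u'_def vector_2 power2_eq_square)
  have nu': "norm u' = 1" using u2 by (simp add: norm_vec_def L2_set_def sum_2 u'_def vector_2 add.commute)
  have iu': "u' \<bullet> w = det2 u w" for w by (simp add: det2_def u'_def inner_vec_def sum_2 vector_2)
  have dec: "\<exists>t. w = t *\<^sub>R u + det2 u w *\<^sub>R u'" for w
    using det2_cramer[of u u' w] uu' by (metis div_by_1 zero_neq_one)
  let ?G = "\<lambda>z. det2 u (cmb f (rv z))"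
  show ?thesis
  proof (cases "\<forall>e>0. \<exists>z. 0 < \<bar>?G z\<bar> \<and> \<bar>?G z\<bar> < e")
    case True
    have "\<exists>z. norm (cmb f (rv z) - w) < e" if e: "0 < e" for w e
    proof -
      obtain z1 where z1: "0 < \<bar>?G z1\<bar>" "\<bar>?G z1\<bar> < e / 2" using True e by (meson half_gt_zero)
      \<comment> \<open>Cancels the transverse component up to one small step of \<open>z1\<close>;
        the rest is corrected along \<open>u\<close>.\<close>
      define m where "m = \<lfloor>det2 u w / ?G z1\<rfloor>"
      define w1 where "w1 = w - of_int m *\<^sub>R cmb f (rv z1)"
      have g0: "?G z1 \<noteq> 0" using z1(1) by auto
      have "det2 u w1 = (det2 u w / ?G z1 - of_int m) * ?G z1"
        using g0 by (simp add: w1_def det2_linear algebra_simps)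
      also have "\<bar>\<dots>\<bar> \<le> 1 * \<bar>?G z1\<bar>"
        unfolding abs_mult m_def by (intro mult_right_mono) (linarith | simp)+
      finally have d1: "\<bar>det2 u w1\<bar> < e / 2" using z1(2) by simp
      obtain t where t: "w1 = t *\<^sub>R u + det2 u w1 *\<^sub>R u'" using dec by blast
      obtain z2 j where z2: "norm (of_int j *\<^sub>R cmb f (rv z2) - t *\<^sub>R u) < e / 2" using line[of "e/2" 1 t] e by auto
      have "cmb f (rv (m *s z1 + j *s z2)) - w = (of_int j *\<^sub>R cmb f (rv z2) - t *\<^sub>R u) - det2 u w1 *\<^sub>R u'"
        using t unfolding w1_def by (simp add: rv_add rv_scale cmb_add cmb_scale algebra_simps)
      then have "norm (cmb f (rv (m *s z1 + j *s z2)) - w) \<le> norm (of_int j *\<^sub>R cmb f (rv z2) - t *\<^sub>R u) + norm (det2 u w1 *\<^sub>R u')"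
        by (metis norm_triangle_ineq4)
      then show ?thesis using z2 d1 nu' by (intro exI[of _ "m *s z1 + j *s z2"]) simp
    qed
    then show ?thesis by (intro that[of 0 0]) simp_all
  next
    case False
    then obtain e0 where e0: "0 < e0" "\<And>z. ?G z = 0 \<or> e0 \<le> \<bar>?G z\<bar>" by (metis abs_le_zero_iff not_le)
    obtain z0 where z0: "?G z0 \<noteq> 0"
    proof -
      have "u \<noteq> 0" using u by auto
      then have "det2 u (f 1) \<noteq> 0 \<or> det2 u (f 2) \<noteq> 0"
        using det2_both_zero[of "f 1" "f 2" u] f_indep[of 1 2] det2_commute[of u "f 1"] det2_commute[of u "f 2"] by auto
      then show ?thesis using that[of "axis 1 1"] that[of "axis 2 1"] by auto
    qed
    obtain a where a: "0 < a" "\<And>z. \<exists>n. ?G z = of_int n * a"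
      by (rule discrete_subgroup_generator[of ?G z0 e0])
        (use e0 z0 in \<open>simp_all add: rv_diff cmb_diff rv_scale cmb_scale det2_linear\<close>)
    have "\<exists>n. det2 u (f i) = of_int n * a" for i using a(2)[of "axis i 1"] by simp
    then obtain n where n: "\<And>i. det2 u (f i) = of_int (n i) * a" by metis
    define c where "c = (1 / a) *\<^sub>R u'"
    have ci: "c \<bullet> w = det2 u w / a" for w by (simp add: c_def iu')
    show ?thesis
    proof (rule that[of c "\<chi> i. n i"])
      show "\<forall>i. c \<bullet> f i = of_int ((\<chi> i. n i) $ i)" using n a(1) by (simp add: ci)
    next
      show "\<forall>w e. c \<bullet> w = 0 \<longrightarrow> 0 < e \<longrightarrow> (\<exists>z. c \<bullet> cmb f (rv z) = 0 \<and> norm (cmb f (rv z) - w) < e)"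
      proof (intro allI impI)
      fix w :: "real ^ 2" and e :: real assume w: "c \<bullet> w = 0" and e: "0 < e"
      then have "det2 u w = 0" using a(1) by (simp add: ci)
      then obtain t where t: "w = t *\<^sub>R u" using dec[of w] by auto
      obtain z j where z: "norm (cmb f (rv z)) < e0" "norm (of_int j *\<^sub>R cmb f (rv z) - t *\<^sub>R u) < e"
        using line[of e e0 t] e e0 by blast
      have "\<bar>?G z\<bar> < e0" using abs_det2_le[of u "cmb f (rv z)"] u z(1) by simp
      then have "?G z = 0" using e0(2)[of z] by auto
      then show "\<exists>z. c \<bullet> cmb f (rv z) = 0 \<and> norm (cmb f (rv z) - w) < e"
        using z(2) t by (intro exI[of _ "j *s z"]) (simp add: rv_scale cmb_scale ci det2_linear)
      qed
    qed
  qed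
qed

section \<open>Regions cut out by the lines along the \<open>f l\<close>\<close>

lemma tie_break:
  fixes g :: "4 \<Rightarrow> real ^ 2"
  assumes "\<And>l. det2 (g l) \<delta> \<noteq> 0"
  obtains x where "\<And>l. det2 (g l) x \<noteq> 0"
    "\<And>l. (0 < det2 (g l) x) = (0 < det2 (g l) a \<or> det2 (g l) a = 0 \<and> 0 < det2 (g l) \<delta>)"
proof -
  let ?Q = "\<lambda>\<eta> l. det2 (g l) (a + \<eta> *\<^sub>R \<delta>) \<noteq> 0 \<and>
    (0 < det2 (g l) (a + \<eta> *\<^sub>R \<delta>)) = (0 < det2 (g l) a \<or> det2 (g l) a = 0 \<and> 0 < det2 (g l) \<delta>)"
  have "\<forall>\<^sub>F \<eta> in at_right 0. ?Q \<eta> l" for l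
  proof (cases "det2 (g l) a = 0")
    case True
    show ?thesis
      using eventually_at_right_less[of "0 :: real"]
      by eventually_elim (use True assms[of l] in \<open>simp add: det2_linear zero_less_mult_iff\<close>)
  next
    case False
    have lim: "((\<lambda>\<eta>. det2 (g l) (a + \<eta> *\<^sub>R \<delta>)) \<longlongrightarrow> det2 (g l) (a + 0 *\<^sub>R \<delta>)) (at_right 0)"
      by (intro tendsto_intros)
    then have lim: "((\<lambda>\<eta>. det2 (g l) (a + \<eta> *\<^sub>R \<delta>)) \<longlongrightarrow> det2 (g l) a) (at_right 0)" by simp
    consider "0 < det2 (g l) a" | "det2 (g l) a < 0" using False by linarith
    then show ?thesis
    proof cases
      case 1
      show ?thesis using order_tendstoD(1)[OF lim 1] by eventually_elim (use 1 in simp)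
    next
      case 2
      show ?thesis using order_tendstoD(2)[OF lim 2] by eventually_elim (use 2 in simp)
    qed
  qed
  then have "\<forall>\<^sub>F \<eta> in at_right 0. \<forall>l. ?Q \<eta> l" by (rule eventually_all_finite)
  then obtain \<eta> :: real where "\<forall>l. ?Q \<eta> l"
    using eventually_happens'[OF trivial_limit_at_right_real] by blast
  then show ?thesis by (intro that[of "a + \<eta> *\<^sub>R \<delta>"]) blast+
qed

lemma generic_vector_exists:
  assumes f_indep: "\<And>i j. i \<noteq> j \<Longrightarrow> det2 (f i) (f j) \<noteq> 0"
  shows "\<exists>\<delta>. \<forall>l :: 4. det2 (f l) \<delta> \<noteq> 0"
proof -
  have "\<forall>\<^sub>F \<eta> in at_right 0. det2 (f l) (f 1 + \<eta> *\<^sub>R f 2) \<noteq> 0" for l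
  proof (cases "l = 1")
    case True
    show ?thesis using eventually_at_right_less[of "0 :: real"]
      by eventually_elim (use True f_indep[of 1 2] in \<open>simp add: det2_linear\<close>)
  next
    case False
    have "((\<lambda>\<eta>. det2 (f l) (f 1 + \<eta> *\<^sub>R f 2)) \<longlongrightarrow> det2 (f l) (f 1 + 0 *\<^sub>R f 2)) (at_right 0)"
      by (intro tendsto_intros)
    then show ?thesis using tendsto_imp_eventually_ne[of _ _ "at_right 0" 0] f_indep[OF False] by simp
  qed
  then have "\<forall>\<^sub>F \<eta> in at_right 0. \<forall>l. det2 (f l) (f 1 + \<eta> *\<^sub>R f 2) \<noteq> 0" by (rule eventually_all_finite)
  then show ?thesis using eventually_happens'[OF trivial_limit_at_right_real] by blast
qed

text \<open>The regions cut out by the lines along the \<open>f l\<close> are determined by the orientations of the pairs: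
  walk from \<open>x\<close> to the nearest line in a generic direction and copy the point reached.\<close>

lemma same_orientations_same_regions:
  fixes f g :: "4 \<Rightarrow> real ^ 2"
  assumes f_indep: "\<And>i j. i \<noteq> j \<Longrightarrow> det2 (f i) (f j) \<noteq> 0" and g_indep: "\<And>i j. i \<noteq> j \<Longrightarrow> det2 (g i) (g j) \<noteq> 0"
    and same: "\<And>i j. (0 < det2 (g i) (g j)) = (0 < det2 (f i) (f j))"
    and x: "\<And>l. det2 (g l) x \<noteq> 0"
  obtains d where "\<And>l. det2 (f l) d \<noteq> 0" "\<And>l. (0 < det2 (f l) d) = (0 < det2 (g l) x)"
proof -
  obtain u where u: "det2 x u \<noteq> 0"
    using x[of 1] det2_commute[of x "g 1"] by (metis neg_0_equal_iff_equal)
  have "det2 (g 1) u \<noteq> 0 \<or> det2 (g 2) u \<noteq> 0"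
    using det2_both_zero[of "g 1" "g 2" u] g_indep[of 1 2] u by auto
  then obtain m0 where "det2 (g m0) u \<noteq> 0" by blast
  then obtain t i where ti: "det2 (g i) x = t * det2 (g i) u"
    "\<And>m. 0 \<le> (det2 (g m) x - t * det2 (g m) u) * det2 (g m) x"
    by (rule hit_zero[where e = "\<lambda>m. det2 (g m) x" and w = "\<lambda>m. det2 (g m) u"]) blast
  have "g i \<noteq> 0" using x[of i] by auto
  moreover have "det2 (g i) (x - t *\<^sub>R u) = 0" using ti(1) by (simp add: det2_linear)
  ultimately obtain \<beta> where \<beta>: "x - t *\<^sub>R u = \<beta> *\<^sub>R g i" using det2_eq_0_iff_parallel by blast
  have "\<beta> \<noteq> 0"
  proof
    assume "\<beta> = 0"
    then have "x = t *\<^sub>R u" using \<beta> by simp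
    then show False using u by (simp add: det2_linear)
  qed
  have pos: "0 < (\<beta> * det2 (g m) (g i)) * det2 (g m) x" if "m \<noteq> i" for m
  proof -
    have "\<beta> * det2 (g m) (g i) = det2 (g m) x - t * det2 (g m) u"
      using arg_cong[OF \<beta>, of "det2 (g m)"] by (simp add: det2_linear)
    then have "0 \<le> (\<beta> * det2 (g m) (g i)) * det2 (g m) x" using ti(2) by simp
    moreover have "(\<beta> * det2 (g m) (g i)) * det2 (g m) x \<noteq> 0" using \<open>\<beta> \<noteq> 0\<close> g_indep[OF that] x by simp
    ultimately show ?thesis by linarith
  qed
  obtain j where j: "i \<noteq> j" using four_complement by (metis zero_neq_one)
  define u' where "u' = (det2 (g i) x / det2 (f i) (f j)) *\<^sub>R f j"
  have u': "det2 (f i) u' = det2 (g i) x" using f_indep[OF j] by (simp add: u'_def det2_linear)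
  let ?Q = "\<lambda>\<zeta> l. det2 (f l) (\<beta> *\<^sub>R f i + \<zeta> *\<^sub>R u') \<noteq> 0 \<and>
    (0 < det2 (f l) (\<beta> *\<^sub>R f i + \<zeta> *\<^sub>R u')) = (0 < det2 (g l) x)"
  have "\<forall>\<^sub>F \<zeta> in at_right 0. ?Q \<zeta> l" for l
  proof (cases "l = i")
    case True
    show ?thesis using eventually_at_right_less[of "0 :: real"]
      by eventually_elim (use True u' x in \<open>simp add: det2_linear zero_less_mult_iff\<close>)
  next
    case False
    have lim: "((\<lambda>\<zeta>. det2 (f l) (\<beta> *\<^sub>R f i + \<zeta> *\<^sub>R u')) \<longlongrightarrow> det2 (f l) (\<beta> *\<^sub>R f i + 0 *\<^sub>R u')) (at_right 0)"
      by (intro tendsto_intros)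
    then have lim: "((\<lambda>\<zeta>. det2 (f l) (\<beta> *\<^sub>R f i + \<zeta> *\<^sub>R u')) \<longlongrightarrow> \<beta> * det2 (f l) (f i)) (at_right 0)"
      by (simp add: det2_linear)
    have "(0 < \<beta> * det2 (f l) (f i)) = (0 < \<beta> * det2 (g l) (g i))"
      using same[of l i] f_indep[OF False] g_indep[OF False] by (auto simp: zero_less_mult_iff not_less_iff_gr_or_eq mult_less_0_iff)
    then have sg: "(0 < \<beta> * det2 (f l) (f i)) = (0 < det2 (g l) x)" and nz: "\<beta> * det2 (f l) (f i) \<noteq> 0"
      using pos[OF False] f_indep[OF False] \<open>\<beta> \<noteq> 0\<close>
      by (auto simp: zero_less_mult_iff mult_less_0_iff)
    consider "0 < \<beta> * det2 (f l) (f i)" | "\<beta> * det2 (f l) (f i) < 0" using nz by linarith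
    then show ?thesis
    proof cases
      case 1
      show ?thesis using order_tendstoD(1)[OF lim 1] by eventually_elim (use 1 sg in simp)
    next
      case 2
      show ?thesis using order_tendstoD(2)[OF lim 2] by eventually_elim (use 2 sg in simp)
    qed
  qed
  then have "\<forall>\<^sub>F \<zeta> in at_right 0. \<forall>l. ?Q \<zeta> l" by (rule eventually_all_finite)
  then obtain \<zeta> :: real where "\<forall>l. ?Q \<zeta> l"
    using eventually_happens'[OF trivial_limit_at_right_real] by blast
  then show ?thesis by (intro that[of "\<beta> *\<^sub>R f i + \<zeta> *\<^sub>R u'"]) blast+
qed

section \<open>Planes without integer directions\<close>

lemma additive_int_combination:
  fixes \<Phi> :: "real \<Rightarrow> real"
  assumes add: "\<And>s t. \<Phi> (s + t) = \<Phi> s + \<Phi> t"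
  shows "\<Phi> (of_int n * t) = of_int n * \<Phi> t" "\<Phi> 0 = 0" "\<Phi> (- t) = - \<Phi> t" "\<Phi> (s - t) = \<Phi> s - \<Phi> t"
    "\<Phi> (\<Sum>i\<in>A. h i) = (\<Sum>i\<in>A. \<Phi> (h i))"
proof -
  show z: "\<Phi> 0 = 0" using add[of 0 0] by simp
  show m: "\<Phi> (- t) = - \<Phi> t" for t using add[of t "- t"] z by simp
  show d: "\<Phi> (s - t) = \<Phi> s - \<Phi> t" for s t using add[of s "- t"] m by simp
  show "\<Phi> (\<Sum>i\<in>A. h i) = (\<Sum>i\<in>A. \<Phi> (h i))"
    by (induction A rule: infinite_finite_induct) (simp_all add: z add)
  show "\<Phi> (of_int n * t) = of_int n * \<Phi> t"
  proof (induction n rule: int_induct[of _ 0])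
    case (step1 i) then show ?case using add[of "of_int i * t" t] by (simp add: algebra_simps)
  next
    case (step2 i) then show ?case using d[of "of_int i * t" t] by (simp add: algebra_simps)
  qed (simp add: z)
qed

text \<open>Vectors with prescribed brackets \<open>B\<close>, the first lying on the second axis and the second being the
  first unit vector. The entries are linear in \<open>B\<close> up to a single denominator, so that deforming \<open>B\<close>
  linearly over the rationals preserves integer relations.\<close>

definition normf :: "(4 \<Rightarrow> 4 \<Rightarrow> real) \<Rightarrow> 4 \<Rightarrow> real ^ 2" where
  "normf B i = vector [B 1 i / B 1 2, B 2 i]"

lemma det2_normf:
  assumes anti: "\<And>i j. B i j = - B j i" and pl: "B 1 2 * B 3 4 - B 1 3 * B 2 4 + B 1 4 * B 2 3 = 0"
    and ne: "B 1 2 \<noteq> 0"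
  shows "det2 (normf B i) (normf B j) = B i j"
proof -
  have diag: "B i i = 0" for i using anti[of i i] by simp
  have "B 1 i * B 2 j - B 2 i * B 1 j = B 1 2 * B i j"
  proof -
    have "\<forall>i j. B 1 i * B 2 j - B 2 i * B 1 j = B 1 2 * B i j"
      unfolding forall_4 using anti[of 2 1] anti[of 3 1] anti[of 4 1] anti[of 3 2] anti[of 4 2] anti[of 4 3] diag pl
      by (simp add: algebra_simps)
    then show ?thesis by blast
  qed
  then show ?thesis using ne by (simp add: det2_def normf_def vector_2 field_simps)
qed

text \<open>The relation between three of the vectors has their brackets as coefficients. As it also
  lies in the kernel of \<open>cmb g\<close>, consecutive brackets are proportional, and the ratio
  propagates from the pair 1, 2.\<close>

lemma kernel_determines_brackets:
  assumes ker: "\<And>x. cmb f x = 0 \<Longrightarrow> cmb g x = 0" and ne: "det2 (f 1) (f 2) \<noteq> 0"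
  shows "det2 (g i) (g j) = det2 (g 1) (g 2) / det2 (f 1) (f 2) * det2 (f i) (f j)"
proof -
  have step: "det2 (f a) (f b) * det2 (g b) (g c) = det2 (f b) (f c) * det2 (g a) (g b)" for a b c
  proof -
    define y where "y = axis a (det2 (f b) (f c)) + axis b (det2 (f c) (f a)) + axis c (det2 (f a) (f b))"
    have "cmb f y = 0" by (simp add: y_def cmb_add vec_eq_iff forall_2 det2_def algebra_simps)
    then have "det2 (g b) (cmb g y) = 0" using ker by simp
    then show ?thesis using det2_commute[of "g b" "g a"] by (simp add: y_def cmb_add det2_linear algebra_simps)
  qed
  let ?u = "det2 (g 1) (g 2) / det2 (f 1) (f 2)"
  have r2: "det2 (g 2) (g c) = ?u * det2 (f 2) (f c)" for c
    using step[of 1 2 c] ne by (simp add: field_simps)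
  have r1: "det2 (g 1) (g c) = ?u * det2 (f 1) (f c)" for c
    using step[of 2 1 c] ne det2_commute[of "f 2" "f 1"] det2_commute[of "g 2" "g 1"] by (simp add: field_simps)
  show ?thesis
  proof (cases "det2 (f 1) (f i) = 0")
    case False
    then show ?thesis using step[of 1 i j] r1[of i] ne by (simp add: field_simps)
  next
    case True
    have "det2 (f 2) (f i) \<noteq> 0 \<or> f i = 0" using det2_both_zero[OF ne True] by blast
    then show ?thesis
    proof
      assume "det2 (f 2) (f i) \<noteq> 0"
      then show ?thesis using step[of 2 i j] r2[of i] ne by (simp add: field_simps)
    next
      assume "f i = 0"
      then have "cmb f (axis i 1) = 0" by simp
      then have "g i = 0" using ker[of "axis i 1"] by simp
      with \<open>f i = 0\<close> show ?thesis by simp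
    qed
  qed
qed

text \<open>Lines of one type in the position \<open>P\<close> stay together because coincidences of
  parallel lines persist. Two types fix \<open>h\<close>, and any further type follows by
  \<open>conc_persists\<close>.\<close>

lemma common_point:
  assumes idf: "int_deform f g" and g_indep: "\<And>i j. i \<noteq> j \<Longrightarrow> det2 (g i) (g j) \<noteq> 0"
    and S: "\<And>l. l \<in> S \<Longrightarrow> period f l"
  obtains h where "\<And>l n. l \<in> S \<Longrightarrow> det2 (f l) (P + cmb f (rv n)) = 0 \<Longrightarrow> det2 (g l) (cmb g (rv n)) = det2 (g l) h"
proof -
  interpret int_deform f g by (rule idf)
  define A where "A = {l \<in> S. \<exists>n. det2 (f l) (P + cmb f (rv n)) = 0}"
  define n where "n l = (SOME n. det2 (f l) (P + cmb f (rv n)) = 0)" for l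
  have n: "det2 (f l) (P + cmb f (rv (n l))) = 0" if "l \<in> A" for l
    using that someI_ex[of "\<lambda>n. det2 (f l) (P + cmb f (rv n)) = 0"] unfolding A_def n_def by blast
  have same: "det2 (g l) (cmb g (rv m)) = det2 (g l) (cmb g (rv (n l)))"
    if "l \<in> A" "det2 (f l) (P + cmb f (rv m)) = 0" for l m
  proof -
    have "det2 (f l) (cmb f (rv (m - n l))) = 0"
      using n[OF that(1)] that(2) by (simp add: rv_diff cmb_diff det2_linear)
    from rel[OF this] show ?thesis by (simp add: rv_diff cmb_diff det2_linear)
  qed
  have "\<exists>h. \<forall>l\<in>A. det2 (g l) (cmb g (rv (n l))) = det2 (g l) h"
  proof (cases "\<exists>a b. a \<in> A \<and> b \<in> A \<and> a \<noteq> b")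
    case False
    then have "A = {} \<or> (\<exists>a. A = {a})" by blast
    then show ?thesis by auto
  next
    case True
    then obtain a b where ab: "a \<in> A" "b \<in> A" "a \<noteq> b" by blast
    let ?\<alpha> = "det2 (g a) (cmb g (rv (n a)))" and ?\<beta> = "det2 (g b) (cmb g (rv (n b)))"
    define h where "h = (?\<beta> / det2 (g b) (g a)) *\<^sub>R g a + (?\<alpha> / det2 (g a) (g b)) *\<^sub>R g b"
    have h: "det2 (g a) h = ?\<alpha>" "det2 (g b) h = ?\<beta>"
      using g_indep[of a b] g_indep[of b a] ab(3) by (simp_all add: h_def det2_linear)
    have "det2 (g l) (cmb g (rv (n l))) = det2 (g l) h" if l: "l \<in> A" for l
    proof (cases "l = a \<or> l = b")
      case True then show ?thesis using h by auto
    next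
      case False
      have "\<exists>x. x \<notin> {a, b, l}"
      proof -
        obtain k m where "distinct [a, b, k, m]" using four_complement[OF ab(3)] by blast
        then show ?thesis using False by (cases "l = k") auto
      qed
      then obtain d where "d \<notin> {a, b, l}" by blast
      then have d: "distinct [a, b, l, d]" using ab(3) False by auto
      have "det2 (f a) P = - det2 (f a) (cmb f (rv (n a)))" "det2 (f b) P = - det2 (f b) (cmb f (rv (n b)))"
        "det2 (f l) P = - det2 (f l) (cmb f (rv (n l)))"
        using n[OF ab(1)] n[OF ab(2)] n[OF l] by (simp_all add: det2_linear)
      moreover have "det2 (f b) (f l) * det2 (f a) P + det2 (f l) (f a) * det2 (f b) P + det2 (f a) (f b) * det2 (f l) P = 0"
        by (simp add: det2_def algebra_simps)
      ultimately have "conc f a b l (n a) (n b) (n l) = 0" by (simp add: conc_def)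
      then have "conc g a b l (n a) (n b) (n l) = 0"
        using conc_persists[OF d] S ab l by (simp add: A_def)
      moreover have "det2 (g b) (g l) * det2 (g a) h + det2 (g l) (g a) * det2 (g b) h + det2 (g a) (g b) * det2 (g l) h = 0"
        by (simp add: det2_def algebra_simps)
      ultimately have "det2 (g a) (g b) * det2 (g l) (cmb g (rv (n l))) = det2 (g a) (g b) * det2 (g l) h"
        unfolding conc_def h by linarith
      then show ?thesis using g_indep[OF ab(3)] by simp
    qed
    then show ?thesis by blast
  qed
  then obtain h where h: "\<And>l. l \<in> A \<Longrightarrow> det2 (g l) (cmb g (rv (n l))) = det2 (g l) h" by blast
  show ?thesis
  proof (rule that[of h])
    fix l m assume "l \<in> S" "det2 (f l) (P + cmb f (rv m)) = 0"
    moreover from this have "l \<in> A" by (auto simp: A_def)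
    ultimately show "det2 (g l) (cmb g (rv m)) = det2 (g l) h" using same h by simp
  qed
qed

lemma eventually_same_orientations:
  assumes f_indep: "\<And>i j. i \<noteq> j \<Longrightarrow> det2 (f i) (f j) \<noteq> 0" and lim: "\<And>i. (\<lambda>k. fk k i) \<longlonglongrightarrow> f (i :: 4)"
  shows "\<forall>\<^sub>F k in sequentially. \<forall>i j. (0 < det2 (fk k i) (fk k j)) = (0 < det2 (f i) (f j)) \<and>
    (i \<noteq> j \<longrightarrow> det2 (fk k i) (fk k j) \<noteq> 0)"
proof (intro eventually_all_finite)
  fix i j :: 4
  show "\<forall>\<^sub>F k in sequentially. (0 < det2 (fk k i) (fk k j)) = (0 < det2 (f i) (f j)) \<and>
    (i \<noteq> j \<longrightarrow> det2 (fk k i) (fk k j) \<noteq> 0)"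
  proof (cases "i = j")
    case False
    have l: "(\<lambda>k. det2 (fk k i) (fk k j)) \<longlonglongrightarrow> det2 (f i) (f j)" by (intro tendsto_intros lim)
    consider "0 < det2 (f i) (f j)" | "det2 (f i) (f j) < 0" using f_indep[OF False] by linarith
    then show ?thesis
    proof cases
      case 1
      show ?thesis using order_tendstoD(1)[OF l 1] by eventually_elim (use 1 in simp)
    next
      case 2
      show ?thesis using order_tendstoD(2)[OF l 2] by eventually_elim (use 2 in simp)
    qed
  qed simp
qed

lemma (in chart) quadratic_if_no_integer_kernel:
  assumes norm: "f = normf B"
    and anti: "\<And>i j. B i j = - B j i" and pl: "B 1 2 * B 3 4 - B 1 3 * B 2 4 + B 1 4 * B 2 3 = 0"
    and no_int: "\<And>z. cmb f (rv z) = 0 \<Longrightarrow> z = 0"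
    and wl: "weak_local_rules v {x. cmb f x = \<theta>}"
  obtains K u where "real_quadratic_field K" "u \<noteq> 0"
    "\<And>t. t \<in> {B 1 2, B 1 3, B 1 4, B 2 3, B 2 4, B 3 4} \<Longrightarrow> u * t \<in> K"
proof -
  let ?X = "{B 1 2, B 1 3, B 1 4, B 2 3, B 2 4, B 3 4}"
  have B12: "B 1 2 \<noteq> 0"
  proof
    assume "B 1 2 = 0"
    then have "f 2 $ 2 = 0" "f 2 $ 1 = 0" using anti[of 2 2] by (simp_all add: norm normf_def vector_2)
    then have "f 2 = 0" by (simp add: vec_eq_iff forall_2)
    then show False using f_indep[of 1 2] by simp
  qed
  have br: "det2 (f i) (f j) = B i j" for i j unfolding norm by (rule det2_normf[OF anti pl B12])
  have BX: "B i j = 0 \<or> B i j \<in> ?X \<or> - B i j \<in> ?X" for i j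
  proof -
    have "\<forall>i j. B i j = 0 \<or> B i j \<in> ?X \<or> - B i j \<in> ?X"
      unfolding forall_4 using anti[of 1 1] anti[of 2 2] anti[of 3 3] anti[of 4 4] anti[of 2 1] anti[of 3 1]
        anti[of 4 1] anti[of 3 2] anti[of 4 2] anti[of 4 3] by simp
    then show ?thesis by blast
  qed
  consider (q) "\<exists>K u. real_quadratic_field K \<and> u \<noteq> 0 \<and> (\<forall>t\<in>?X. u * t \<in> K)"
    | (d) "\<forall>\<epsilon>>0. \<exists>\<Phi>. (\<forall>s t. \<Phi> (s + t) = \<Phi> s + \<Phi> t) \<and> (\<forall>t\<in>?X. \<bar>\<Phi> t - t\<bar> < \<epsilon>) \<and>
       \<Phi> (B 1 2) * \<Phi> (B 3 4) - \<Phi> (B 1 3) * \<Phi> (B 2 4) + \<Phi> (B 1 4) * \<Phi> (B 2 3) = 0 \<and> \<not> (\<exists>u. \<forall>t\<in>?X. \<Phi> t = u * t)"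
    using quadratic_or_deformable[OF B12 pl] by (elim disjE) (erule that(1), erule that(2))
  then show thesis
  proof cases
    case q
    then show ?thesis using that by blast
  next
    case d
    \<comment> \<open>The second bound keeps the bracket that is the denominator in
      \<open>normf\<close> from vanishing.\<close>
    define \<epsilon> where "\<epsilon> k = min (inverse (real (Suc k))) \<bar>B 1 2\<bar>" for k
    have \<epsilon>: "0 < \<epsilon> k" for k using B12 by (simp add: \<epsilon>_def)
    have "\<exists>\<Phi>. \<forall>k. (\<forall>s t. \<Phi> k (s + t) = \<Phi> k s + \<Phi> k t) \<and> (\<forall>t\<in>?X. \<bar>\<Phi> k t - t\<bar> < \<epsilon> k) \<and>
       \<Phi> k (B 1 2) * \<Phi> k (B 3 4) - \<Phi> k (B 1 3) * \<Phi> k (B 2 4) + \<Phi> k (B 1 4) * \<Phi> k (B 2 3) = 0 \<and>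
       \<not> (\<exists>u. \<forall>t\<in>?X. \<Phi> k t = u * t)"
      by (intro choice allI) (use d \<epsilon> in blast)
    then obtain \<Phi> where add: "\<And>k s t. \<Phi> k (s + t) = \<Phi> k s + \<Phi> k t"
      and near: "\<And>k t. t \<in> ?X \<Longrightarrow> \<bar>\<Phi> k t - t\<bar> < \<epsilon> k"
      and plk: "\<And>k. \<Phi> k (B 1 2) * \<Phi> k (B 3 4) - \<Phi> k (B 1 3) * \<Phi> k (B 2 4) + \<Phi> k (B 1 4) * \<Phi> k (B 2 3) = 0"
      and np: "\<And>k. \<not> (\<exists>u. \<forall>t\<in>?X. \<Phi> k t = u * t)"
      by blast
    note lin = additive_int_combination[where \<Phi> = "\<Phi> k" for k, OF add]
    define Bk where "Bk k i j = \<Phi> k (B i j)" for k i j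
    define fk where "fk k = normf (Bk k)" for k
    have antik: "Bk k i j = - Bk k j i" for k i j unfolding Bk_def using anti[of i j] lin(3) by metis
    have Bk12: "Bk k 1 2 \<noteq> 0" for k using near[of "B 1 2" k] by (auto simp: Bk_def \<epsilon>_def)
    have brk: "det2 (fk k i) (fk k j) = Bk k i j" for k i j
      unfolding fk_def by (rule det2_normf[OF antik _ Bk12]) (use plk in \<open>simp add: Bk_def\<close>)
    have limX: "(\<lambda>k. \<Phi> k t) \<longlonglongrightarrow> t" if t: "t \<in> ?X" for t
    proof (rule LIM_zero_cancel, rule tendsto_rabs_zero_cancel,
        rule tendsto_sandwich[OF _ _ tendsto_const LIMSEQ_inverse_real_of_nat])
      show "\<forall>\<^sub>F k in sequentially. \<bar>\<Phi> k t - t\<bar> \<le> inverse (real (Suc k))"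
        using near[OF t] by (intro always_eventually allI) (simp add: \<epsilon>_def less_imp_le)
    qed simp
    have limB: "(\<lambda>k. Bk k i j) \<longlonglongrightarrow> B i j" for i j
      using BX[of i j]
    proof (elim disjE)
      assume "B i j = 0" then show ?thesis by (simp add: Bk_def lin)
    next
      assume "B i j \<in> ?X" then show ?thesis unfolding Bk_def by (rule limX)
    next
      assume "- B i j \<in> ?X"
      then have "(\<lambda>k. - \<Phi> k (- B i j)) \<longlonglongrightarrow> - (- B i j)" by (intro tendsto_minus limX)
      then show ?thesis by (simp add: Bk_def lin)
    qed
    have lim: "(\<lambda>k. fk k i) \<longlonglongrightarrow> f i" for i
    proof (rule vec_tendstoI)
      have "\<forall>m. (\<lambda>k. fk k i $ m) \<longlonglongrightarrow> f i $ m"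
        unfolding forall_2 fk_def norm normf_def vector_2 by (intro conjI tendsto_intros limB B12)
      then show "(\<lambda>k. fk k i $ m) \<longlonglongrightarrow> f i $ m" for m by blast
    qed
    have parallel: "det2 (fk k l) (cmb (fk k) (rv z)) = 0" if z: "det2 (f l) (cmb f (rv z)) = 0" for k l z
    proof -
      have "(\<Sum>i\<in>UNIV. of_int (z $ i) * B l i) = 0" using z by (simp add: det2_cmb br)
      then have "\<Phi> k (\<Sum>i\<in>UNIV. of_int (z $ i) * B l i) = 0" by (simp add: lin)
      then show ?thesis unfolding lin(5) lin(1) by (simp add: det2_cmb brk Bk_def)
    qed
    obtain c N where cN0: "\<forall>i. c \<bullet> f i = of_int (N $ i)"
      and dense0: "\<forall>w e. c \<bullet> w = 0 \<longrightarrow> 0 < e \<longrightarrow> (\<exists>z. c \<bullet> cmb f (rv z) = 0 \<and> norm (cmb f (rv z) - w) < e)"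
      by (rule image_closure_direction[of f, OF f_indep no_int])
    note cN = cN0[rule_format] and dense = dense0[rule_format]
    have inner2: "(x :: real ^ 2) \<bullet> y = x $ 1 * y $ 1 + x $ 2 * y $ 2" for x y by (simp add: inner_vec_def sum_2)
    have diag: "B i i = 0" for i using anti[of i i] by simp
    \<comment> \<open>In the coordinates of \<open>normf\<close> the integers \<open>N\<close>
      determine \<open>c\<close> up to the single bracket \<open>B 1 2\<close>, so that
      \<open>ck\<close> can be defined by the same formula.\<close>
    have c1: "c $ 1 = of_int (N $ 2)"
      using cN[of 2] B12 by (simp add: inner2 norm normf_def vector_2 diag)
    have c2: "c $ 2 = - of_int (N $ 1) / B 1 2"
      using cN[of 1] B12 anti[of 2 1] by (simp add: inner2 norm normf_def vector_2 diag field_simps)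
    define ck :: "nat \<Rightarrow> real ^ 2" where "ck k = vector [of_int (N $ 2), - of_int (N $ 1) / Bk k 1 2]" for k
    have ck: "ck k \<bullet> fk k i = of_int (N $ i)" for k i
    proof -
      \<comment> \<open>Cleared of denominators, the condition on \<open>c\<close> is an integer
        relation between brackets, which every \<open>\<Phi> k\<close> preserves.\<close>
      have "of_int (N $ 2) * B 1 i - of_int (N $ 1) * B 2 i = of_int (N $ i) * B 1 2"
        using cN[of i] B12 by (simp add: inner2 c1 c2 norm normf_def vector_2 field_simps)
      then have "\<Phi> k (of_int (N $ 2) * B 1 i - of_int (N $ 1) * B 2 i) = \<Phi> k (of_int (N $ i) * B 1 2)" by simp
      then have "of_int (N $ 2) * Bk k 1 i - of_int (N $ 1) * Bk k 2 i = of_int (N $ i) * Bk k 1 2"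
        unfolding lin Bk_def .
      then show ?thesis using Bk12[of k] by (simp add: inner2 ck_def fk_def normf_def vector_2 field_simps)
    qed
    have ck_lim: "ck \<longlonglongrightarrow> c"
    proof (rule vec_tendstoI)
      have "\<forall>m. (\<lambda>k. ck k $ m) \<longlonglongrightarrow> c $ m"
        unfolding forall_2 ck_def vector_2 c1 c2 by (intro conjI tendsto_intros limB B12)
      then show "(\<lambda>k. ck k $ m) \<longlonglongrightarrow> c $ m" for m by blast
    qed
    have ck0: "ck k = 0 \<longleftrightarrow> c = 0" for k
      using Bk12[of k] B12 by (simp add: vec_eq_iff forall_2 ck_def vector_2 c1 c2)
    \<comment> \<open>The multiple of \<open>ck k\<close> with the prescribed product; for
      \<open>c = 0\<close> also \<open>ck k = 0\<close>, and this is 0.\<close>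
    define \<theta>k where "\<theta>k k = ((c \<bullet> \<theta>) / (ck k \<bullet> ck k)) *\<^sub>R ck k" for k
    have ck_\<theta>: "ck k \<bullet> \<theta>k k = c \<bullet> \<theta>" for k
      by (cases "c = 0") (use ck0[of k] in \<open>simp_all add: \<theta>k_def\<close>)
    define S where "S = {l. period f l}"
    obtain \<delta> where \<delta>: "\<And>l. det2 (f l) \<delta> \<noteq> 0" using generic_vector_exists[of f, OF f_indep] by blast
    let ?persist = "\<lambda>k. \<forall>P. c \<bullet> (P + \<theta>) = 0 \<longrightarrow> (\<exists>d. c \<bullet> d = 0 \<and>
      (\<forall>l. (\<exists>w. c \<bullet> w = 0 \<and> det2 (f l) w \<noteq> 0) \<longrightarrow> det2 (f l) d \<noteq> 0) \<and>
      (\<forall>l\<in>S. \<forall>n. (\<exists>w. c \<bullet> w = 0 \<and> det2 (f l) w \<noteq> 0) \<longrightarrow> det2 (f l) (P + cmb f (rv n)) = 0 \<longrightarrow>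
        (0 < det2 (f l) d) = sgp (fk k) (\<theta>k k) \<delta> l n))"
    have persist: "\<forall>\<^sub>F k in sequentially. ?persist k"
    proof (cases "c = 0")
      case False
      define d :: "real ^ 2" where "d = vector [- (c $ 2), c $ 1]"
      have dd: "det2 w d = c \<bullet> w" for w by (simp add: d_def det2_def inner2 vector_2)
      have "c \<bullet> d = 0" by (simp add: d_def inner2 vector_2)
      have act: "c \<bullet> f l \<noteq> 0" if w: "c \<bullet> w = 0" "det2 (f l) w \<noteq> 0" for l w
      proof
        assume "c \<bullet> f l = 0"
        have "d \<noteq> 0"
        proof
          assume "d = 0"
          then have "d $ 1 = 0" "d $ 2 = 0" by simp_all
          then have "c = 0" by (simp add: d_def vector_2 vec_eq_iff forall_2)
          then show False using False by simp
        qed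
        moreover have "det2 d w = 0" "det2 d (f l) = 0"
          using dd w(1) \<open>c \<bullet> f l = 0\<close> det2_commute by (metis neg_0_equal_iff_equal)+
        ultimately obtain s t where "w = s *\<^sub>R d" "f l = t *\<^sub>R d" using det2_eq_0_iff_parallel by metis
        then show False using w(2) by (simp add: det2_linear)
      qed
      \<comment> \<open>For nonzero \<open>c\<close> an active type has no period: \<open>c\<close>
        takes integer values on the period and on the axis of the type, so an integer combination of
        the two would be a nonzero integer vector in the kernel. Hence the condition on
        \<open>S\<close> is empty in this case.\<close>
      have no: False if w: "c \<bullet> w = 0" "det2 (f l) w \<noteq> 0" and l: "period f l" for l w
      proof -
        obtain z i where z: "i \<noteq> l" "z $ i \<noteq> 0" "det2 (f l) (cmb f (rv z)) = 0" using l unfolding period_def by blast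
        have "f l \<noteq> 0" using w(2) by auto
        then obtain t where t: "cmb f (rv z) = t *\<^sub>R f l" using z(3) det2_eq_0_iff_parallel by blast
        define M where "M = (\<Sum>i\<in>UNIV. z $ i * N $ i)"
        have "c \<bullet> cmb f (rv z) = of_int M" by (simp add: cmb_def inner_sum_right cN M_def)
        then have tM: "t * of_int (N $ l) = of_int M" by (simp add: t cN)
        have Nl: "N $ l \<noteq> 0" using act[OF w] cN by auto
        have "cmb f (rv ((N $ l) *s z - axis l M)) = (of_int (N $ l) * t - of_int M) *\<^sub>R f l"
          by (simp add: rv_diff rv_scale cmb_diff cmb_scale t algebra_simps)
        also have "\<dots> = 0" using tM by (simp add: mult.commute)
        finally have "(N $ l) *s z - axis l M = 0" by (rule no_int)
        then have "((N $ l) *s z - axis l M) $ i = 0" by simp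
        then show False using z(1,2) Nl by (simp add: axis_def)
      qed
      have "?persist k" for k
      proof (intro allI impI exI[of _ d] conjI ballI)
        show "c \<bullet> d = 0" by fact
        show "det2 (f l) d \<noteq> 0" if "\<exists>w. c \<bullet> w = 0 \<and> det2 (f l) w \<noteq> 0" for l using that act dd by auto
        show "(0 < det2 (f l) d) = sgp (fk k) (\<theta>k k) \<delta> l n"
          if "l \<in> S" "\<exists>w. c \<bullet> w = 0 \<and> det2 (f l) w \<noteq> 0" for l n using that no by (auto simp: S_def)
      qed
      then show ?thesis by simp
    next
      case c0: True
      have \<theta>k0: "\<theta>k k = 0" for k using c0 by (simp add: \<theta>k_def)
      have "\<forall>\<^sub>F k in sequentially. \<forall>l. det2 (fk k l) \<delta> \<noteq> 0"
      proof (intro eventually_all_finite)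
        fix l
        have "(\<lambda>k. det2 (fk k l) \<delta>) \<longlonglongrightarrow> det2 (f l) \<delta>" by (intro tendsto_intros lim)
        then show "\<forall>\<^sub>F k in sequentially. det2 (fk k l) \<delta> \<noteq> 0" using \<delta>[of l] by (rule tendsto_imp_eventually_ne)
      qed
      moreover have "\<forall>\<^sub>F k in sequentially. \<forall>i j. (0 < det2 (fk k i) (fk k j)) = (0 < det2 (f i) (f j)) \<and>
          (i \<noteq> j \<longrightarrow> det2 (fk k i) (fk k j) \<noteq> 0)"
        by (rule eventually_same_orientations[of f fk, OF f_indep lim])
      ultimately show ?thesis
      proof eventually_elim
        case (elim k)
        have gi: "\<And>i j. i \<noteq> j \<Longrightarrow> det2 (fk k i) (fk k j) \<noteq> 0" using elim(2) by blast
        show ?case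
        proof (intro allI impI)
          fix P
          have "int_deform f (fk k)" by unfold_locales (use f_indep no_int parallel in auto)
          \<comment> \<open>After the deformation the lines of periodic types in the position
            \<open>P\<close> still concur, as recorded by \<open>h\<close>. Ties are broken by
            \<open>\<delta>\<close>, and equal orientations carry the resulting region back to
            \<open>f\<close>.\<close>
          then obtain h where h: "\<And>l n. l \<in> S \<Longrightarrow> det2 (f l) (P + cmb f (rv n)) = 0 \<Longrightarrow>
              det2 (fk k l) (cmb (fk k) (rv n)) = det2 (fk k l) h"
            using common_point[of f "fk k" S P] gi by (auto simp: S_def)
          obtain x where x: "\<And>l. det2 (fk k l) x \<noteq> 0"
            "\<And>l. (0 < det2 (fk k l) x) = (0 < det2 (fk k l) h \<or> det2 (fk k l) h = 0 \<and> 0 < det2 (fk k l) \<delta>)"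
            using tie_break[of "fk k" \<delta> h] elim(1) by metis
          obtain d where d: "\<And>l. det2 (f l) d \<noteq> 0" "\<And>l. (0 < det2 (f l) d) = (0 < det2 (fk k l) x)"
            using same_orientations_same_regions[of f "fk k" x, OF f_indep gi _ x(1)] elim(2) by metis
          show "\<exists>d. c \<bullet> d = 0 \<and> (\<forall>l. (\<exists>w. c \<bullet> w = 0 \<and> det2 (f l) w \<noteq> 0) \<longrightarrow> det2 (f l) d \<noteq> 0) \<and>
              (\<forall>l\<in>S. \<forall>n. (\<exists>w. c \<bullet> w = 0 \<and> det2 (f l) w \<noteq> 0) \<longrightarrow> det2 (f l) (P + cmb f (rv n)) = 0 \<longrightarrow>
                (0 < det2 (f l) d) = sgp (fk k) (\<theta>k k) \<delta> l n)"
            by (intro exI[of _ d] conjI allI ballI impI) (use c0 d x(2) h in \<open>auto simp: sgp_def gap_def \<theta>k0\<close>)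
        qed
      qed
    qed
    have "deform f \<theta> \<delta> c N S fk \<theta>k ck"
      by unfold_locales
        (use f_indep \<delta> lim cN ck ck_lim ck_\<theta> dense parallel persist in \<open>auto simp: S_def period_def\<close>)
    then have "\<forall>\<^sub>F k in sequentially. \<forall>x. cmb f x = 0 \<longrightarrow> cmb (fk k) x = 0"
      using wl by (rule weak_local_rules_rigid)
    then obtain k where k: "\<And>x. cmb f x = 0 \<Longrightarrow> cmb (fk k) x = 0"
      using eventually_happens'[OF sequentially_bot] by blast
    have "\<Phi> k (B i j) = Bk k 1 2 / B 1 2 * B i j" for i j
      using kernel_determines_brackets[where f = f and g = "fk k" and i = i and j = j, OF k] B12 by (simp add: br brk) (simp add: Bk_def)
    then have "\<forall>t\<in>?X. \<Phi> k t = (Bk k 1 2 / B 1 2) * t" by auto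
    then show ?thesis using np[of k] by blast
  qed
qed

section \<open>Planes with an integer direction\<close>

context chart
begin

text \<open>Orthogonality makes the product with \<open>\<kappa>\<close> a height that is constant
  along the period \<open>\<Lambda>\<close>.\<close>

lemma kernel_frame:
  assumes \<Lambda>: "\<Lambda> \<noteq> 0" "cmb f \<Lambda> = 0"
  obtains \<kappa> where "\<kappa> \<noteq> 0" "cmb f \<kappa> = 0" "\<kappa> \<bullet> \<Lambda> = 0" "\<forall>x. cmb f x = 0 \<longrightarrow> (\<exists>s t. x = s *\<^sub>R \<Lambda> + t *\<^sub>R \<kappa>)"
proof -
  obtain a where a: "\<Lambda> $ a \<noteq> 0" using \<Lambda>(1) by (metis vec_eq_iff zero_index)
  obtain b where b: "a \<noteq> b" using four_complement by (metis zero_neq_one)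
  obtain c d where d: "distinct [a, b, c, d]" using four_complement[OF b] by blast
  define p where "p = axis b 1 - axis c (det2 (f d) (f b) / det2 (f d) (f c)) - axis d (det2 (f c) (f b) / det2 (f c) (f d))"
  have p: "cmb f p = 0" "p $ a = 0" "p $ b = 1"
  proof -
    have "f b = (det2 (f d) (f b) / det2 (f d) (f c)) *\<^sub>R f c + (det2 (f c) (f b) / det2 (f c) (f d)) *\<^sub>R f d"
      using d f_indep by (intro det2_cramer) auto
    then show "cmb f p = 0" unfolding p_def cmb_diff cmb_axis by (simp add: algebra_simps)
    show "p $ a = 0" "p $ b = 1" using d by (auto simp: p_def axis_def)
  qed
  define \<kappa> where "\<kappa> = p - ((p \<bullet> \<Lambda>) / (\<Lambda> \<bullet> \<Lambda>)) *\<^sub>R \<Lambda>"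
  show ?thesis
  proof (rule that[of \<kappa>])
    show "\<kappa> \<noteq> 0"
    proof
      assume "\<kappa> = 0"
      then have e: "p = ((p \<bullet> \<Lambda>) / (\<Lambda> \<bullet> \<Lambda>)) *\<^sub>R \<Lambda>" by (simp add: \<kappa>_def)
      have "p $ a = ((p \<bullet> \<Lambda>) / (\<Lambda> \<bullet> \<Lambda>)) * \<Lambda> $ a" by (subst e) simp
      then have "(p \<bullet> \<Lambda>) / (\<Lambda> \<bullet> \<Lambda>) = 0" using p(2) a by simp
      then have "p = 0" by (metis e scaleR_zero_left)
      then show False using p(3) by simp
    qed
    show "cmb f \<kappa> = 0" by (simp add: \<kappa>_def cmb_diff cmb_scale p \<Lambda>)
    show "\<kappa> \<bullet> \<Lambda> = 0" using \<Lambda>(1) by (simp add: \<kappa>_def inner_diff_left)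
    show "\<forall>x. cmb f x = 0 \<longrightarrow> (\<exists>s t. x = s *\<^sub>R \<Lambda> + t *\<^sub>R \<kappa>)"
    proof (intro allI impI)
      fix x assume x: "cmb f x = 0"
      define s where "s = x $ a / \<Lambda> $ a"
      define t where "t = x $ b - s * \<Lambda> $ b"
      have "x - s *\<^sub>R \<Lambda> - t *\<^sub>R p = 0"
      proof (rule cmb_two_zeros[OF f_indep _ _ _ b])
        show "cmb f (x - s *\<^sub>R \<Lambda> - t *\<^sub>R p) = 0" by (simp add: cmb_diff cmb_scale x p \<Lambda>)
        show "(x - s *\<^sub>R \<Lambda> - t *\<^sub>R p) $ a = 0" "(x - s *\<^sub>R \<Lambda> - t *\<^sub>R p) $ b = 0"
          using a by (simp_all add: s_def t_def p)
      qed
      then have "x = (s + t * ((p \<bullet> \<Lambda>) / (\<Lambda> \<bullet> \<Lambda>))) *\<^sub>R \<Lambda> + t *\<^sub>R \<kappa>"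
        by (simp add: \<kappa>_def algebra_simps)
      then show "\<exists>s t. x = s *\<^sub>R \<Lambda> + t *\<^sub>R \<kappa>" by blast
    qed
  qed
qed

lemma closed_faces_dense_in_plane:
  assumes \<delta>: "\<And>l. det2 (f l) \<delta> \<noteq> 0"
  obtains M where "0 < M" "\<forall>x. cmb f x = \<theta> \<longrightarrow> (\<exists>H i j. (H, i, j) \<in> faces f (sgp f \<theta> \<delta>) \<and> norm (rv H - x) \<le> M)"
proof -
  obtain \<eta> \<mu> where em: "0 < \<eta>" "0 < \<mu>"
    "\<And>f' d. (\<And>i. norm (f' i - f i) < \<eta>) \<Longrightarrow> \<mu> * norm d \<le> norm (cmb f' d) + norm (cmb v d)"
    using cmb_pair_bound_perturbed by blast
  have \<mu>: "\<mu> * norm d \<le> norm (cmb f d) + norm (cmb v d)" for d using em(1,3) by simp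
  let ?K = "4 * (\<Sum>i\<in>UNIV. norm (f i)) + 2 * (\<Sum>i\<in>UNIV. norm (v i))"
  have K: "0 \<le> ?K" by (intro add_nonneg_nonneg mult_nonneg_nonneg sum_nonneg) auto
  show ?thesis
  proof (rule that[of "?K / \<mu> + 1"])
    show "0 < ?K / \<mu> + 1" using K em(2) by (simp add: add_nonneg_pos)
    show "\<forall>x. cmb f x = \<theta> \<longrightarrow> (\<exists>H i j. (H, i, j) \<in> faces f (sgp f \<theta> \<delta>) \<and> norm (rv H - x) \<le> ?K / \<mu> + 1)"
    proof (intro allI impI)
      fix x assume x: "cmb f x = \<theta>"
      have "(\<Union>\<phi>\<in>faces f (sgp f \<theta> \<delta>). tile_of v \<phi>) = UNIV"
        using closed_tiling(1)[OF \<delta> em(2) \<mu> closed_faces_nonempty] by (simp add: octagonal_tiling_def)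
      then obtain H i j where H: "(H, i, j) \<in> faces f (sgp f \<theta> \<delta>)" "cmb v x \<in> tile_of v (H, i, j)"
        by (metis (no_types, lifting) UNIV_I UN_iff prod_cases3)
      have "norm (cmb v (rv H - x)) \<le> 2 * (\<Sum>i\<in>UNIV. norm (v i))"
        using tile_of_bounded[OF H(2)] by (simp add: dist_norm cmb_diff)
      moreover have "norm (cmb f (rv H - x)) \<le> 4 * (\<Sum>i\<in>UNIV. norm (f i))"
        using closed_near[OF H(1)] by (simp add: cmb_diff x)
      ultimately have "\<mu> * norm (rv H - x) \<le> ?K" using \<mu>[of "rv H - x"] by linarith
      then have "norm (rv H - x) \<le> ?K / \<mu> + 1" using em(2) by (simp add: field_simps)
      then show "\<exists>H i j. (H, i, j) \<in> faces f (sgp f \<theta> \<delta>) \<and> norm (rv H - x) \<le> ?K / \<mu> + 1" using H(1) by blast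
    qed
  qed
qed

text \<open>Only finitely many patterns of a given radius exist, while the points \<open>x n\<close>
  of the plane go to infinity in direction \<open>\<kappa>\<close>; two of them show the same
  pattern.\<close>

lemma recurrent_patch:
  assumes \<delta>: "\<And>l. det2 (f l) \<delta> \<noteq> 0" and \<kappa>: "\<kappa> \<noteq> 0" "cmb f \<kappa> = 0"
  obtains H1 H2 i j i' j' where "(H1, i, j) \<in> faces f (sgp f \<theta> \<delta>)" "(H2, i', j') \<in> faces f (sgp f \<theta> \<delta>)"
    "patch (faces f (sgp f \<theta> \<delta>)) H1 R = patch (faces f (sgp f \<theta> \<delta>)) H2 R" "D < \<kappa> \<bullet> rv (H2 - H1)"
proof -
  let ?FF = "faces f (sgp f \<theta> \<delta>)"
  obtain M where M: "0 < M" "\<forall>x. cmb f x = \<theta> \<longrightarrow> (\<exists>H i j. (H, i, j) \<in> ?FF \<and> norm (rv H - x) \<le> M)"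
    by (rule closed_faces_dense_in_plane[OF \<delta>])
  obtain x0 where x0: "cmb f x0 = \<theta>" using cmb_pair_surj by metis
  \<comment> \<open>Pays in advance for the two errors \<open>norm \<kappa> * M\<close> between
    points of the plane and nearby faces.\<close>
  define D' where "D' = \<bar>D\<bar> + 2 * (norm \<kappa> * M) + 1"
  have k2: "0 < \<kappa> \<bullet> \<kappa>" using \<kappa>(1) by simp
  define x where "x n = x0 + (real n * D' / (\<kappa> \<bullet> \<kappa>)) *\<^sub>R \<kappa>" for n :: nat
  have "\<exists>H. (\<exists>i j. (H, i, j) \<in> ?FF) \<and> norm (rv H - x n) \<le> M" for n
  proof -
    have "cmb f (x n) = \<theta>" by (simp add: x_def cmb_add cmb_scale x0 \<kappa>(2))
    then show ?thesis using M(2) by blast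
  qed
  then obtain H where H: "\<And>n. \<exists>i j. (H n, i, j) \<in> ?FF" "\<And>n. norm (rv (H n) - x n) \<le> M" by metis
  have "finite (range (\<lambda>n. patch ?FF (H n) R))"
  proof (rule finite_subset)
    show "range (\<lambda>n. patch ?FF (H n) R) \<subseteq> Pow ({m. norm (rv m) \<le> R} \<times> UNIV)" by (auto simp: patch_def)
    show "finite (Pow ({m. norm (rv m) \<le> R} \<times> (UNIV :: (4 \<times> 4) set)))"
      by (intro iffD2[OF finite_Pow_iff] finite_cartesian_product finite_rv_bounded) simp
  qed
  then have "\<not> inj (\<lambda>n. patch ?FF (H n) R)" using finite_imageD infinite_UNIV_nat by blast
  then obtain m n where mn: "patch ?FF (H m) R = patch ?FF (H n) R" "m < n"
    unfolding inj_def by (metis linorder_neqE_nat)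
  have near: "\<bar>\<kappa> \<bullet> rv (H n) - \<kappa> \<bullet> x n\<bar> \<le> norm \<kappa> * M" for n
  proof -
    have "\<bar>\<kappa> \<bullet> (rv (H n) - x n)\<bar> \<le> norm \<kappa> * norm (rv (H n) - x n)" by (rule Cauchy_Schwarz_ineq2)
    also have "\<dots> \<le> norm \<kappa> * M" by (intro mult_left_mono H(2)) simp
    finally show ?thesis by (simp add: inner_diff_right)
  qed
  have "\<kappa> \<bullet> x n = \<kappa> \<bullet> x0 + real n * D'" for n using k2 by (simp add: x_def inner_add_right)
  then have "\<kappa> \<bullet> x n - \<kappa> \<bullet> x m = (real n - real m) * D'" by (simp add: algebra_simps)
  moreover have "1 * D' \<le> (real n - real m) * D'"
    using mn(2) M(1) by (intro mult_right_mono) (simp_all add: D'_def)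
  ultimately have "D' \<le> \<kappa> \<bullet> x n - \<kappa> \<bullet> x m" by linarith
  then have "\<bar>D\<bar> + 2 * (norm \<kappa> * M) + 1 \<le> \<kappa> \<bullet> x n - \<kappa> \<bullet> x m" by (simp only: D'_def)
  then have "D < \<kappa> \<bullet> rv (H n) - \<kappa> \<bullet> rv (H m)" using near[of n] near[of m] by linarith
  then have "D < \<kappa> \<bullet> rv (H n - H m)" by (simp add: rv_diff inner_diff_right)
  then show ?thesis using that H(1) mn(1) by metis
qed

lemma sgp_kernel_shift:
  assumes "cmb f (rv z) = 0"
  shows "(H + z, i, j) \<in> faces f (sgp f \<theta> \<delta>) \<longleftrightarrow> (H, i, j) \<in> faces f (sgp f \<theta> \<delta>)"
proof -
  have "sgp f \<theta> \<delta> l (n + z) = sgp f \<theta> \<delta> l n" for l n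
    using assms by (simp add: sgp_def gap_def rv_add cmb_add)
  moreover have "H + z - axis k 1 = (H - axis k 1) + z" for k by simp
  ultimately show ?thesis unfolding faces_def mem_Collect_eq case_prod_conv by (simp only:)
qed

text \<open>Two occurrences of a large patch far apart allow to repeat the slab between them periodically; the
  slab is thick enough for the plane of the periodic tiling to be close to the original one.\<close>

lemma integer_kernel_spans:
  assumes wl: "weak_local_rules v {x. cmb f x = \<theta>}" and \<lambda>: "z \<noteq> 0" "cmb f (rv z) = 0"
  obtains \<mu> where "{x. cmb f x = 0} = span {rv z, rv \<mu>}"
proof -
  obtain \<delta> where \<delta>: "\<And>l. det2 (f l) \<delta> \<noteq> 0" using generic_vector_exists[of f, OF f_indep] by blast
  let ?FF = "faces f (sgp f \<theta> \<delta>)" and ?\<Lambda> = "rv z"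
  have \<Lambda>0: "?\<Lambda> \<noteq> 0" using \<lambda>(1) rv_eq_iff[of z 0] by simp
  obtain \<kappa> where \<kappa>: "\<kappa> \<noteq> 0" "cmb f \<kappa> = 0" "\<kappa> \<bullet> ?\<Lambda> = 0"
    "\<forall>x. cmb f x = 0 \<longrightarrow> (\<exists>s t. x = s *\<^sub>R ?\<Lambda> + t *\<^sub>R \<kappa>)"
    by (rule kernel_frame[OF \<Lambda>0 \<lambda>(2)])
  define C0 where "C0 = 4 * (\<Sum>i\<in>UNIV. norm (f i))"
  have C0: "0 \<le> C0" by (simp add: C0_def sum_nonneg)
  have near0: "norm (cmb f (rv H) - \<theta>) \<le> C0" if "(H, i, j) \<in> ?FF" for H i j
    using closed_near[OF that] by (simp add: C0_def)
  have near1: "norm (cmb f (rv (H - H'))) \<le> 2 * C0" if "(H, i, j) \<in> ?FF" "(H', i', j') \<in> ?FF" for H i j H' i' j'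
    using norm_triangle_ineq4[of "cmb f (rv H) - \<theta>" "cmb f (rv H') - \<theta>"] near0[OF that(1)] near0[OF that(2)]
    by (simp add: rv_diff cmb_diff)
  \<comment> \<open>The window part and the products with \<open>\<kappa>\<close> and the period are
    injective linear coordinates.\<close>
  obtain b where b: "0 < b" "\<And>x. b * norm x \<le> norm (cmb f x) + \<bar>\<kappa> \<bullet> x\<bar> + \<bar>?\<Lambda> \<bullet> x\<bar>"
  proof -
    let ?g = "\<lambda>x. (cmb f x, \<kappa> \<bullet> x, ?\<Lambda> \<bullet> x)"
    have lin: "linear ?g" by (intro linearI) (simp_all add: cmb_add cmb_scale inner_add_right)
    have "inj ?g"
      unfolding linear_injective_0[OF lin]
    proof (intro allI impI)
      fix x assume "?g x = 0"
      then have x: "cmb f x = 0" "\<kappa> \<bullet> x = 0" "?\<Lambda> \<bullet> x = 0" by (simp_all add: zero_prod_def)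
      then obtain s t where st: "x = s *\<^sub>R ?\<Lambda> + t *\<^sub>R \<kappa>" using \<kappa>(4) by blast
      have "x \<bullet> x = s * (?\<Lambda> \<bullet> x) + t * (\<kappa> \<bullet> x)" by (subst (1) st) (simp add: inner_add_left)
      then show "x = 0" using x by simp
    qed
    then obtain b where b: "0 < b" "\<And>x. b * norm x \<le> norm (?g x)"
      using linear_inj_bounded_below_pos[OF lin] by blast
    moreover have "norm (?g x) \<le> norm (cmb f x) + \<bar>\<kappa> \<bullet> x\<bar> + \<bar>?\<Lambda> \<bullet> x\<bar>" for x
      using norm_Pair_le[of "cmb f x" "(\<kappa> \<bullet> x, ?\<Lambda> \<bullet> x)"] norm_Pair_le[of "\<kappa> \<bullet> x" "?\<Lambda> \<bullet> x"] by simp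
    ultimately show ?thesis using that by (meson order_trans)
  qed
  obtain \<eta> where \<eta>: "0 < \<eta>" "\<And>C. \<exists>R. \<forall>f' \<theta>' FF. (\<forall>i. norm (f' i - f i) < \<eta>) \<longrightarrow> FF \<noteq> {} \<longrightarrow>
      (\<forall>H i j. (H, i, j) \<in> FF \<longrightarrow> norm (cmb f' (rv H) - \<theta>') \<le> C) \<longrightarrow>
      (\<forall>H i j. (H, i, j) \<in> FF \<longrightarrow> (\<exists>H'. patch FF H R = patch ?FF H' R)) \<longrightarrow>
      (\<forall>x. cmb f x = 0 \<longrightarrow> cmb f' x = 0)"
    using transfer[OF \<delta> wl closed_faces_nonempty] by blast
  obtain R where R: "\<forall>f' \<theta>' FF. (\<forall>i. norm (f' i - f i) < \<eta>) \<longrightarrow> FF \<noteq> {} \<longrightarrow>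
      (\<forall>H i j. (H, i, j) \<in> FF \<longrightarrow> norm (cmb f' (rv H) - \<theta>') \<le> 3 * C0) \<longrightarrow>
      (\<forall>H i j. (H, i, j) \<in> FF \<longrightarrow> (\<exists>H'. patch FF H R = patch ?FF H' R)) \<longrightarrow>
      (\<forall>x. cmb f x = 0 \<longrightarrow> cmb f' x = 0)"
    using \<eta>(2)[of "3 * C0"] by blast
  define R0 where "R0 = norm \<kappa> * \<bar>R\<bar>"
  have R0: "0 \<le> R0" by (simp add: R0_def)
  have small: "\<bar>\<kappa> \<bullet> rv m\<bar> \<le> R0" if m: "norm (rv m) \<le> R" for m
  proof -
    have "\<bar>\<kappa> \<bullet> rv m\<bar> \<le> norm \<kappa> * norm (rv m)" by (rule Cauchy_Schwarz_ineq2)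
    also have "\<dots> \<le> R0" unfolding R0_def using m by (intro mult_left_mono) auto
    finally show ?thesis .
  qed
  \<comment> \<open>Large enough to contain, up to multiples of the period \<open>z\<close>, every
    face whose height differs by at most \<open>R0\<close>.\<close>
  define R1 where "R1 = (2 * C0 + R0 + ?\<Lambda> \<bullet> ?\<Lambda>) / b"
  \<comment> \<open>The slab must be thicker than \<open>R0\<close>, so that patterns reach only
    into adjacent slabs, and thick enough for the tilt of the new plane to stay below
    \<open>\<eta>\<close>.\<close>
  define D where "D = R0 + 2 * C0 * norm \<kappa> / \<eta> + 1"
  obtain H1 H2 i1 j1 i2 j2 where H1: "(H1, i1, j1) \<in> ?FF" and H2: "(H2, i2, j2) \<in> ?FF"
    and same: "patch ?FF H1 R1 = patch ?FF H2 R1" and D: "D < \<kappa> \<bullet> rv (H2 - H1)"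
    by (rule recurrent_patch[OF \<delta> \<kappa>(1,2)])
  define \<mu> where "\<mu> = H2 - H1"
  define L where "L = \<kappa> \<bullet> rv \<mu>"
  have "0 \<le> 2 * C0 * norm \<kappa> / \<eta>" using C0 \<eta>(1) by simp
  then have L: "R0 < L" "2 * C0 * norm \<kappa> / \<eta> < L" "0 < L" using D R0 unfolding D_def L_def \<mu>_def by linarith+
  have F\<mu>: "norm (cmb f (rv \<mu>)) \<le> 2 * C0" unfolding \<mu>_def by (rule near1[OF H2 H1])
  have reach: "\<exists>k. norm (rv (H - H' + k *s z)) \<le> R1"
    if H: "(H, i, j) \<in> ?FF" "(H', i', j') \<in> ?FF" "\<bar>\<kappa> \<bullet> rv (H - H')\<bar> \<le> R0" for H i j H' i' j'
  proof -
    define q where "q = (?\<Lambda> \<bullet> rv (H - H')) / (?\<Lambda> \<bullet> ?\<Lambda>)"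
    define k where "k = - \<lfloor>q\<rfloor>"
    have LL: "0 < ?\<Lambda> \<bullet> ?\<Lambda>" using \<Lambda>0 by simp
    have "?\<Lambda> \<bullet> rv (H - H' + k *s z) = (q + of_int k) * (?\<Lambda> \<bullet> ?\<Lambda>)"
      unfolding rv_add rv_scale inner_add_right inner_scaleR_right using LL by (simp add: q_def distrib_right)
    moreover have "\<bar>q + of_int k\<bar> \<le> 1" unfolding k_def by linarith
    ultimately have 1: "\<bar>?\<Lambda> \<bullet> rv (H - H' + k *s z)\<bar> \<le> ?\<Lambda> \<bullet> ?\<Lambda>"
      using LL mult_right_mono[of "\<bar>q + of_int k\<bar>" 1 "?\<Lambda> \<bullet> ?\<Lambda>"] by (simp add: abs_mult)
    have 2: "\<kappa> \<bullet> rv (H - H' + k *s z) = \<kappa> \<bullet> rv (H - H')"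
      unfolding rv_add rv_scale inner_add_right inner_scaleR_right \<kappa>(3) by simp
    have 3: "cmb f (rv (H - H' + k *s z)) = cmb f (rv (H - H'))"
      unfolding rv_add rv_scale cmb_add cmb_scale \<lambda>(2) by simp
    have "b * norm (rv (H - H' + k *s z)) \<le> 2 * C0 + R0 + ?\<Lambda> \<bullet> ?\<Lambda>"
      using b(2)[of "rv (H - H' + k *s z)"] 1 near1[OF H(1,2)] H(3) unfolding 2 3 by linarith
    then have "norm (rv (H - H' + k *s z)) \<le> R1" using b(1) by (simp add: R1_def field_simps)
    then show ?thesis by blast
  qed
  have shift: "(H + k *s z, i, j) \<in> ?FF \<longleftrightarrow> (H, i, j) \<in> ?FF" for H k i j
    by (rule sgp_kernel_shift) (simp add: rv_scale cmb_scale \<lambda>(2))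
  have per: "(H + \<mu>, i, j) \<in> ?FF \<longleftrightarrow> (H, i, j) \<in> ?FF" if H: "\<bar>\<kappa> \<bullet> rv (H - H1)\<bar> \<le> R0" for H i j
  proof
    assume F: "(H, i, j) \<in> ?FF"
    then obtain k where "norm (rv (H - H1 + k *s z)) \<le> R1" using reach[OF _ H1 H] by blast
    from patch_eqD[OF same this, of i j] shift[of H k i j] shift[of "H + \<mu>" k i j] F
    show "(H + \<mu>, i, j) \<in> ?FF" by (simp add: \<mu>_def algebra_simps)
  next
    assume F: "(H + \<mu>, i, j) \<in> ?FF"
    have e: "H + \<mu> - H2 = H - H1" by (simp add: \<mu>_def)
    then obtain k where "norm (rv (H - H1 + k *s z)) \<le> R1" using reach[OF F H2] H unfolding e by blast
    from patch_eqD[OF same this, of i j] shift[of H k i j] shift[of "H + \<mu>" k i j] F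
    show "(H, i, j) \<in> ?FF" by (simp add: \<mu>_def algebra_simps)
  qed
  define lev where "lev H = \<lfloor>(\<kappa> \<bullet> rv (H - H1)) / L\<rfloor>" for H
  \<comment> \<open>Each face is shifted into the base slab and looked up there.\<close>
  define GG where "GG = {(H, i, j). (H - lev H *s \<mu>, i, j) \<in> ?FF}"
  have lev_shift: "lev (H + k *s \<mu>) = lev H + k" for H k
  proof -
    have "H + k *s \<mu> - H1 = (H - H1) + k *s \<mu>" by simp
    then have "\<kappa> \<bullet> rv (H + k *s \<mu> - H1) = \<kappa> \<bullet> rv (H - H1) + of_int k * L"
      by (simp only: rv_add rv_scale inner_add_right inner_scaleR_right L_def)
    then have "(\<kappa> \<bullet> rv (H + k *s \<mu> - H1)) / L = (\<kappa> \<bullet> rv (H - H1)) / L + of_int k"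
      using L(3) by (simp add: add_divide_distrib)
    then show ?thesis unfolding lev_def by simp
  qed
  have smul: "(a + b) *s \<mu> = a *s \<mu> + b *s \<mu>" "(- a) *s \<mu> = - (a *s \<mu>)" "(1 :: int) *s \<mu> = \<mu>" "(0 :: int) *s \<mu> = 0" for a b :: int
    by (simp_all add: vec_eq_iff algebra_simps)
  have GG_shift: "(H + k *s \<mu>, i, j) \<in> GG \<longleftrightarrow> (H, i, j) \<in> GG" for H k i j
    unfolding GG_def by (simp add: lev_shift smul)
  have lev0: "0 \<le> \<kappa> \<bullet> rv (H - lev H *s \<mu> - H1) \<and> \<kappa> \<bullet> rv (H - lev H *s \<mu> - H1) < L" for H
  proof -
    have "H - lev H *s \<mu> - H1 = (H - H1) - lev H *s \<mu>" by simp
    then have e: "\<kappa> \<bullet> rv (H - lev H *s \<mu> - H1) = \<kappa> \<bullet> rv (H - H1) - of_int (lev H) * L"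
      by (simp only: rv_diff rv_scale inner_diff_right inner_scaleR_right L_def)
    have "of_int (lev H) \<le> (\<kappa> \<bullet> rv (H - H1)) / L" "(\<kappa> \<bullet> rv (H - H1)) / L < of_int (lev H) + 1"
      unfolding lev_def by linarith+
    then show ?thesis unfolding e using L(3) by (simp add: field_simps)
  qed
  \<comment> \<open>Beyond either boundary of the base slab the copied faces agree with the original
    ones, because the patches at \<open>H1\<close> and \<open>H2\<close> do.\<close>
  have GG_near: "(H, i, j) \<in> GG \<longleftrightarrow> (H, i, j) \<in> ?FF"
    if H: "- R0 \<le> \<kappa> \<bullet> rv (H - H1)" "\<kappa> \<bullet> rv (H - H1) < L + R0" for H i j
  proof -
    consider "\<kappa> \<bullet> rv (H - H1) < 0" | "0 \<le> \<kappa> \<bullet> rv (H - H1)" "\<kappa> \<bullet> rv (H - H1) < L" | "L \<le> \<kappa> \<bullet> rv (H - H1)" by linarith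
    then show ?thesis
    proof cases
      case 1
      then have "lev H = - 1" unfolding lev_def using H L by (simp add: floor_eq_iff field_simps)
      then show ?thesis using per[of H i j] 1 H(1) by (simp add: GG_def smul)
    next
      case 2
      then have "lev H = 0" unfolding lev_def using L by (simp add: floor_eq_iff field_simps)
      then show ?thesis by (simp add: GG_def smul)
    next
      case 3
      then have "lev H = 1" unfolding lev_def using H L by (simp add: floor_eq_iff field_simps)
      moreover have "\<kappa> \<bullet> rv (H - \<mu> - H1) = \<kappa> \<bullet> rv (H - H1) - L"
        unfolding L_def by (simp add: rv_diff inner_diff_right)
      ultimately show ?thesis using per[of "H - \<mu>" i j] 3 H(2) by (simp add: GG_def smul)
    qed
  qed
  have loc: "\<exists>H'. patch GG H R = patch ?FF H' R" if F: "(H, i, j) \<in> GG" for H i j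
  proof -
    define H' where "H' = H - lev H *s \<mu>"
    have "(H + m, a, c) \<in> GG \<longleftrightarrow> (H' + m, a, c) \<in> ?FF" if m: "norm (rv m) \<le> R" for m a c
    proof -
      have e: "H' + m = (H + m) + (- lev H) *s \<mu>" by (simp add: H'_def smul)
      have "(H + m, a, c) \<in> GG \<longleftrightarrow> (H' + m, a, c) \<in> GG" unfolding e GG_shift ..
      also have "\<dots> \<longleftrightarrow> (H' + m, a, c) \<in> ?FF"
      proof (rule GG_near)
        have "H' + m - H1 = (H' - H1) + m" by simp
        then have "\<kappa> \<bullet> rv (H' + m - H1) = \<kappa> \<bullet> rv (H' - H1) + \<kappa> \<bullet> rv m"
          by (simp only: rv_add inner_add_right)
        then show "- R0 \<le> \<kappa> \<bullet> rv (H' + m - H1)" "\<kappa> \<bullet> rv (H' + m - H1) < L + R0"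
          using lev0[of H] small[OF m] unfolding H'_def by linarith+
      qed
      finally show ?thesis .
    qed
    then have "patch GG H R = patch ?FF H' R" unfolding patch_def by auto
    then show ?thesis by blast
  qed
  \<comment> \<open>The tilt: subtracting \<open>w\<close> times the height from
    \<open>cmb f\<close> annihilates the new period \<open>\<mu>\<close>.\<close>
  define w where "w = (1 / L) *\<^sub>R cmb f (rv \<mu>)"
  define f' where "f' i = f i - (\<kappa> $ i) *\<^sub>R w" for i
  have cf': "cmb f' x = cmb f x - (\<kappa> \<bullet> x) *\<^sub>R w" for x
    by (simp add: cmb_def f'_def scaleR_diff_right sum_subtractf inner_vec_def scaleR_sum_left mult.commute)
  have close: "norm (f' i - f i) < \<eta>" for i
  proof -
    have "norm (f' i - f i) = \<bar>\<kappa> $ i\<bar> * (norm (cmb f (rv \<mu>)) / L)"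
      using L(3) by (simp add: f'_def w_def)
    also have "\<dots> \<le> norm \<kappa> * (2 * C0 / L)"
      using F\<mu> L(3) C0 by (intro mult_mono component_le_norm_cart divide_right_mono) auto
    also have "\<dots> < \<eta>" using L(2,3) \<eta>(1) by (simp add: field_simps)
    finally show ?thesis .
  qed
  define \<theta>' where "\<theta>' = \<theta> - (\<kappa> \<bullet> rv H1) *\<^sub>R w"
  \<comment> \<open>\<open>C0\<close> comes from the original plane in the base slab, and at most
    \<open>2 * C0\<close> from the tilt across one slab.\<close>
  have near: "norm (cmb f' (rv H) - \<theta>') \<le> 3 * C0" if F: "(H, i, j) \<in> GG" for H i j
  proof -
    define H' where "H' = H - lev H *s \<mu>"
    have H': "(H', i, j) \<in> ?FF" using F by (simp add: GG_def H'_def)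
    have "cmb f' (rv \<mu>) = 0" using L(3) by (simp add: cf' w_def L_def)
    then have "cmb f' (rv H) = cmb f' (rv H')"
      by (simp add: H'_def rv_diff rv_scale cmb_diff cmb_scale)
    then have "cmb f' (rv H) - \<theta>' = (cmb f (rv H') - \<theta>) - (\<kappa> \<bullet> rv (H' - H1)) *\<^sub>R w"
      by (simp add: cf' \<theta>'_def rv_diff inner_diff_right algebra_simps)
    then have "norm (cmb f' (rv H) - \<theta>') \<le> norm (cmb f (rv H') - \<theta>) + \<bar>\<kappa> \<bullet> rv (H' - H1)\<bar> * norm w"
      by (metis norm_scaleR norm_triangle_ineq4 real_norm_def)
    also have "\<bar>\<kappa> \<bullet> rv (H' - H1)\<bar> * norm w \<le> L * norm w"
      using lev0[of H] unfolding H'_def by (intro mult_right_mono) auto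
    also have "L * norm w = norm (cmb f (rv \<mu>))" using L(3) by (simp add: w_def)
    finally show ?thesis using near0[OF H'] F\<mu> by linarith
  qed
  have "(H1, i1, j1) \<in> GG" using H1 by (simp add: GG_def lev_def smul)
  then have "GG \<noteq> {}" by blast
  then have ker: "cmb f' x = 0" if "cmb f x = 0" for x
    using R[rule_format, of f' GG \<theta>' x] close near loc that by blast
  \<comment> \<open>The two directions agree, so there is no tilt at all and \<open>\<mu>\<close> is
    a period of the original plane.\<close>
  have "(\<kappa> \<bullet> \<kappa>) *\<^sub>R w = 0" using ker[OF \<kappa>(2)] by (simp add: cf' \<kappa>(2))
  then have "w = 0" using \<kappa>(1) by simp
  then have \<mu>0: "cmb f (rv \<mu>) = 0" using L(3) by (simp add: w_def)
  show ?thesis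
  proof (rule that[of \<mu>], rule set_eqI, rule iffI)
    fix x assume "x \<in> {x. cmb f x = 0}"
    then obtain s t where x: "x = s *\<^sub>R ?\<Lambda> + t *\<^sub>R \<kappa>" using \<kappa>(4) by blast
    obtain s' t' where m: "rv \<mu> = s' *\<^sub>R ?\<Lambda> + t' *\<^sub>R \<kappa>" using \<kappa>(4) \<mu>0 by blast
    have "L = t' * (\<kappa> \<bullet> \<kappa>)" unfolding L_def m by (simp add: inner_add_right \<kappa>(3))
    then have t': "t' \<noteq> 0" using L(3) by auto
    have "x = (s - t * s' / t') *\<^sub>R ?\<Lambda> + (t / t') *\<^sub>R rv \<mu>" unfolding x m using t' by (simp add: algebra_simps)
    also have "\<dots> \<in> span {?\<Lambda>, rv \<mu>}" by (intro span_add span_scale span_base) auto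
    finally show "x \<in> span {?\<Lambda>, rv \<mu>}" .
  next
    fix x assume "x \<in> span {?\<Lambda>, rv \<mu>}"
    then obtain s t where "x = s *\<^sub>R ?\<Lambda> + t *\<^sub>R rv \<mu>"
      unfolding span_insert[of ?\<Lambda>] span_singleton by (auto simp: algebra_simps)
    then show "x \<in> {x. cmb f x = 0}" by (simp add: cmb_add cmb_scale \<lambda>(2) \<mu>0)
  qed
qed

end

section \<open>Ribbons of a planar tiling\<close>

text \<open>The centre of the first tile lies in the second. Their intersection would be a proper
  face of the first tile through an interior point, which is impossible.\<close>

lemma overlapping_translates_coincide:
  assumes e: "edge_to_edge \<T>" and d: "det2 a b \<noteq> 0"
    and T: "parallelogram y a b \<in> \<T>" "parallelogram y' a b \<in> \<T>"
    and near: "\<bar>det2 b (y - y') / det2 b a\<bar> < 1 / 2" "\<bar>det2 a (y - y') / det2 a b\<bar> < 1 / 2"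
  shows "parallelogram y a b = parallelogram y' a b"
proof (rule ccontr)
  assume ne: "\<not> ?thesis"
  let ?S = "parallelogram y a b" and ?T = "parallelogram y' a b"
  define s t where "s = det2 b (y - y') / det2 b a" and "t = det2 a (y - y') / det2 a b"
  define p where "p = y + (1 / 2) *\<^sub>R a + (1 / 2) *\<^sub>R b"
  have "y - y' = s *\<^sub>R a + t *\<^sub>R b" unfolding s_def t_def by (rule det2_cramer[OF d])
  then have y: "y = y' + s *\<^sub>R a + t *\<^sub>R b" by (metis add.assoc add.commute diff_add_cancel)
  have "p = y' + (s + 1 / 2) *\<^sub>R a + (t + 1 / 2) *\<^sub>R b" unfolding p_def y by (simp add: algebra_simps)
  moreover have st: "0 \<le> s + 1 / 2" "s + 1 / 2 \<le> 1" "0 \<le> t + 1 / 2" "t + 1 / 2 \<le> 1"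
    using near unfolding s_def[symmetric] t_def[symmetric] by linarith+
  ultimately have "p \<in> ?T" unfolding parallelogram_def by blast
  moreover have "p \<in> ?S"
    unfolding parallelogram_def p_def by (auto intro!: exI[of _ "1 / 2"])
  ultimately have p: "p \<in> ?S \<inter> ?T" by blast
  have whole: "F = ?S" if "F face_of ?S" "p \<in> F" for F
    by (rule face_through_interior[OF d that(1), of "1 / 2" "1 / 2"]) (use that(2) in \<open>simp_all add: p_def\<close>)
  have dim: "aff_dim ?S = 2" by (rule aff_dim_parallelogram[OF d])
  consider q where "q extreme_point_of ?S" "?S \<inter> ?T = {q}" | "(?S \<inter> ?T) edge_of ?S"
    using e T ne p unfolding edge_to_edge_def by blast
  then show False
  proof cases
    case 1
    then have "{p} face_of ?S" using p by (simp add: face_of_singleton)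
    then show False using whole[of "{p}"] dim by (metis aff_dim_sing singletonI zero_neq_numeral)
  next
    case 2
    then have "?S \<inter> ?T = ?S" using whole p by (auto simp: edge_of_def)
    then show False using 2 dim by (simp add: edge_of_def)
  qed
qed

text \<open>Substitute for local finiteness: tiles have finitely many shapes, and close translates of the same
  shape coincide.\<close>

lemma tile_along_sequence:
  assumes v: "\<And>i j. i \<noteq> j \<Longrightarrow> det2 (v i) (v j) \<noteq> 0" and oct: "octagonal_tiling v \<T>"
    and z: "z \<longlonglongrightarrow> l"
  obtains y p q n where "p \<noteq> q" "parallelogram y (v p) (v q) \<in> \<T>" "l \<in> parallelogram y (v p) (v q)"
    "z n \<in> parallelogram y (v p) (v q)"
proof -
  have T: "\<T> \<subseteq> tiles v" "\<Union>\<T> = UNIV" "edge_to_edge \<T>" using oct by (auto simp: octagonal_tiling_def)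
  have "\<exists>y pq. fst pq \<noteq> snd pq \<and> parallelogram y (v (fst pq)) (v (snd pq)) \<in> \<T> \<and>
      z n \<in> parallelogram y (v (fst pq)) (v (snd pq))" for n
  proof -
    obtain S where S: "S \<in> \<T>" "z n \<in> S" using T(2) by blast
    then obtain y i j where "S = parallelogram y (v i) (v j)" "i \<noteq> j" using T(1) unfolding tiles_def by blast
    then show ?thesis using S by (intro exI[of _ y] exI[of _ "(i, j)"]) simp
  qed
  then obtain y pq where Y: "\<And>n. fst (pq n) \<noteq> snd (pq n)"
    "\<And>n. parallelogram (y n) (v (fst (pq n))) (v (snd (pq n))) \<in> \<T>"
    "\<And>n. z n \<in> parallelogram (y n) (v (fst (pq n))) (v (snd (pq n)))" by metis
  have "\<exists>c\<in>UNIV. infinite {n \<in> UNIV. pq n = c}"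
    by (rule pigeonhole_infinite_rel[of UNIV UNIV "\<lambda>n c. pq n = c"]) auto
  then obtain c where c: "infinite {n. pq n = c}" by auto
  define a b where "a = v (fst c)" and "b = v (snd c)"
  obtain r :: "nat \<Rightarrow> nat" where r: "strict_mono r" "\<And>k. r k \<in> {n. pq n = c}"
    using infinite_enumerate[OF c] by blast
  have pr: "pq (r k) = c" for k using r(2) by blast
  have d: "det2 a b \<noteq> 0" using v Y(1)[of "r 0"] unfolding pr a_def b_def by blast
  have d': "det2 b a \<noteq> 0" using d det2_commute[of a b] by simp
  have T2: "parallelogram (y (r k)) a b \<in> \<T>" "z (r k) \<in> parallelogram (y (r k)) a b" for k
    using Y(2,3)[of "r k"] unfolding pr a_def b_def by auto
  have zr: "(\<lambda>k. z (r k)) \<longlonglongrightarrow> l" using LIMSEQ_subseq_LIMSEQ[OF z r(1)] by (simp add: comp_def)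
  have "bounded (range (\<lambda>k. z (r k)))" using zr convergent_imp_bounded by blast
  then obtain B where B: "\<And>k. norm (z (r k)) \<le> B" unfolding bounded_iff by blast
  have "y (r k) \<in> cball 0 (B + norm a + norm b)" for k
  proof -
    have "norm (y (r k)) \<le> norm (z (r k)) + dist (y (r k)) (z (r k))"
      unfolding dist_norm using norm_triangle_sub[of "y (r k)" "z (r k)"] by simp
    then show ?thesis using parallelogram_bounded[OF T2(2)[of k]] B[of k] by simp
  qed
  moreover have "seq_compact (cball (0 :: real ^ 2) (B + norm a + norm b))"
    by (simp add: compact_imp_seq_compact)
  ultimately obtain y' r' where "strict_mono (r' :: nat \<Rightarrow> nat)" "((\<lambda>k. y (r k)) \<circ> r') \<longlonglongrightarrow> y'"
    by (metis (no_types, lifting) seq_compactE)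
  then have r': "strict_mono r'" "(\<lambda>k. y (r (r' k))) \<longlonglongrightarrow> y'" by (simp_all add: comp_def)
  have zr': "(\<lambda>k. z (r (r' k))) \<longlonglongrightarrow> l" using LIMSEQ_subseq_LIMSEQ[OF zr r'(1)] by (simp add: comp_def)
  have "(\<lambda>k. det2 e (y (r (r' k)) - y')) \<longlonglongrightarrow> det2 e (y' - y')" for e
    by (intro tendsto_intros r'(2))
  then have "(\<lambda>k. det2 e (y (r (r' k)) - y')) \<longlonglongrightarrow> 0" for e by simp
  then have "(\<lambda>k. det2 b (y (r (r' k)) - y') / det2 b a) \<longlonglongrightarrow> 0"
    "(\<lambda>k. det2 a (y (r (r' k)) - y') / det2 a b) \<longlonglongrightarrow> 0" by (auto intro: tendsto_divide_zero)
  from this[THEN tendstoD, of "1 / 4"]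
  have "\<forall>\<^sub>F k in sequentially. \<bar>det2 b (y (r (r' k)) - y') / det2 b a\<bar> < 1 / 4 \<and>
      \<bar>det2 a (y (r (r' k)) - y') / det2 a b\<bar> < 1 / 4"
    by (simp add: dist_real_def eventually_conj_iff)
  then obtain k0 where k0: "\<And>k. k \<ge> k0 \<Longrightarrow> \<bar>det2 b (y (r (r' k)) - y') / det2 b a\<bar> < 1 / 4 \<and>
      \<bar>det2 a (y (r (r' k)) - y') / det2 a b\<bar> < 1 / 4"
    unfolding eventually_sequentially by blast
  define w where "w = y (r (r' k0))"
  have "z (r (r' k)) \<in> parallelogram w a b" if k: "k \<ge> k0" for k
  proof -
    have split: "det2 m (y (r (r' k)) - w) / e = det2 m (y (r (r' k)) - y') / e - det2 m (y (r (r' k0)) - y') / e" for m e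
      by (simp add: w_def det2_linear diff_divide_distrib)
    have "\<bar>det2 b (y (r (r' k)) - w) / det2 b a\<bar> < 1 / 2" "\<bar>det2 a (y (r (r' k)) - w) / det2 a b\<bar> < 1 / 2"
      unfolding split using k0[OF k] k0[OF order_refl] by linarith+
    then have "parallelogram (y (r (r' k))) a b = parallelogram w a b"
      using T2(1)[of "r' k"] T2(1)[of "r' k0"]
      by (intro overlapping_translates_coincide[OF T(3) d]) (auto simp: w_def)
    then show ?thesis using T2(2)[of "r' k"] by simp
  qed
  then have ev: "\<forall>\<^sub>F k in sequentially. z (r (r' k)) \<in> parallelogram w a b"
    unfolding eventually_sequentially by blast
  have "l \<in> parallelogram w a b"
    by (rule Lim_in_closed_set[OF closed_parallelogram[OF d] ev sequentially_bot zr'])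
  then show ?thesis
    using that[of "fst c" "snd c" w "r (r' k0)"] Y(1)[of "r 0"] T2[of "r' k0"]
    unfolding pr w_def a_def b_def by simp
qed

definition tiled_edge :: "(4 \<Rightarrow> real ^ 2) \<Rightarrow> (real ^ 2) set set \<Rightarrow> 4 \<Rightarrow> real ^ 2 \<Rightarrow> bool" where
  "tiled_edge v \<T> i x \<longleftrightarrow> (\<exists>m s. m \<noteq> i \<and> (s = 1 \<or> s = - 1) \<and> parallelogram x (v i) (s *\<^sub>R v m) \<in> \<T>)"

text \<open>If the known tile is on the wrong side, the midpoint of the edge is approached from the
  other side. Some tile contains a point of the sequence and the midpoint; as the midpoint is not a
  corner, the two tiles share the entire edge.\<close>

lemma tile_on_positive_side:
  assumes v: "\<And>i j. i \<noteq> j \<Longrightarrow> det2 (v i) (v j) \<noteq> 0" and oct: "octagonal_tiling v \<T>"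
    and x: "tiled_edge v \<T> i x"
  obtains m s where "m \<noteq> i" "s = 1 \<or> s = - 1" "parallelogram x (v i) (s *\<^sub>R v m) \<in> \<T>"
    "0 < s * det2 (v i) (v m)"
proof -
  let ?a = "v i"
  obtain m s where ms: "m \<noteq> i" "s = 1 \<or> s = - (1 :: real)" "parallelogram x ?a (s *\<^sub>R v m) \<in> \<T>"
    using x unfolding tiled_edge_def by blast
  show thesis
  proof (cases "0 < s * det2 ?a (v m)")
    case True
    with ms show ?thesis by (rule that)
  next
    case False
    let ?b = "s *\<^sub>R v m"
    have neg: "det2 ?a ?b < 0" using False v[of i m] ms(1,2) by (auto simp: det2_linear)
    then have d: "det2 ?a ?b \<noteq> 0" by simp
    let ?S = "parallelogram x ?a ?b"
    define mid where "mid = x + (1 / 2) *\<^sub>R ?a"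
    define z where "z n = mid - inverse (real (Suc n)) *\<^sub>R ?b" for n
    have "z \<longlonglongrightarrow> mid - 0 *\<^sub>R ?b"
      unfolding z_def by (intro tendsto_intros LIMSEQ_inverse_real_of_nat)
    then have lim: "z \<longlonglongrightarrow> mid" by simp
    obtain y p q n where T: "p \<noteq> q" "parallelogram y (v p) (v q) \<in> \<T>" "mid \<in> parallelogram y (v p) (v q)"
      "z n \<in> parallelogram y (v p) (v q)"
      by (rule tile_along_sequence[where v = v and z = z and l = mid, OF v oct lim])
    let ?T = "parallelogram y (v p) (v q)"
    have "z n - x = (1 / 2) *\<^sub>R ?a - inverse (real (Suc n)) *\<^sub>R ?b" by (simp add: z_def mid_def)
    then have "det2 ?a (z n - x) = - (inverse (real (Suc n)) * det2 ?a ?b)"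
      by (simp only: det2_linear det2_self)
    moreover have "inverse (real (Suc n)) * det2 ?a ?b < 0" by (rule mult_pos_neg[OF _ neg]) simp
    ultimately have zpos: "0 < det2 ?a (z n - x)" by linarith
    have Sneg: "det2 ?a (w - x) \<le> 0" if w: "w \<in> ?S" for w
    proof -
      obtain l m' where "w = x + l *\<^sub>R ?a + m' *\<^sub>R ?b" "0 \<le> m'" using w unfolding parallelogram_def by blast
      then have "det2 ?a (w - x) = m' * det2 ?a ?b" by (simp add: det2_linear)
      then show ?thesis using neg \<open>0 \<le> m'\<close> by (simp add: mult_nonneg_nonpos)
    qed
    have ne: "?S \<noteq> ?T" using Sneg[of "z n"] zpos T(4) by auto
    have midS: "mid \<in> ?S"
      unfolding parallelogram_def mid_def by (intro CollectI exI[of _ "1 / 2"] exI[of _ 0]) simp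
    have "x \<in> ?S"
      unfolding parallelogram_def by (intro CollectI exI[of _ 0]) simp
    have "x + ?a \<in> ?S"
      unfolding parallelogram_def by (intro CollectI exI[of _ 1] exI[of _ 0]) simp
    have a0: "?a \<noteq> 0" using neg by auto
    have not_extreme: "\<not> mid extreme_point_of ?S"
    proof
      assume "mid extreme_point_of ?S"
      moreover have "mid \<in> open_segment x (x + ?a)"
        unfolding in_segment mid_def using a0 by (auto simp: algebra_simps intro!: exI[of _ "1 / 2"])
      ultimately show False using \<open>x \<in> ?S\<close> \<open>x + ?a \<in> ?S\<close> unfolding extreme_point_of_def by blast
    qed
    have E: "(?S \<inter> ?T) edge_of ?S" "(?S \<inter> ?T) edge_of ?T"
    proof -
      have "?S \<inter> ?T = {} \<or> (\<exists>p. p extreme_point_of ?S \<and> p extreme_point_of ?T \<and> ?S \<inter> ?T = {p}) \<or>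
          (?S \<inter> ?T) edge_of ?S \<and> (?S \<inter> ?T) edge_of ?T"
        using oct ms(3) T(2) ne unfolding octagonal_tiling_def edge_to_edge_def by metis
      moreover have "mid \<in> ?S \<inter> ?T" using midS T(3) by simp
      ultimately have "(?S \<inter> ?T) edge_of ?S \<and> (?S \<inter> ?T) edge_of ?T" using not_extreme by force
      then show "(?S \<inter> ?T) edge_of ?S" "(?S \<inter> ?T) edge_of ?T" by simp_all
    qed
    have seg: "?S \<inter> ?T = closed_segment x (x + ?a)"
    proof -
      obtain \<mu> where \<mu>: "\<mu> = 0 \<or> \<mu> = (1 :: real)"
        "?S \<inter> ?T = closed_segment (x + \<mu> *\<^sub>R ?b) (x + \<mu> *\<^sub>R ?b + ?a) \<or>
         ?S \<inter> ?T = closed_segment (x + \<mu> *\<^sub>R ?a) (x + \<mu> *\<^sub>R ?a + ?b)"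
        using edge_of_parallelogram_is_side[OF d E(1)] by blast
      have mid: "mid \<in> ?S \<inter> ?T" using midS T(3) by blast
      show ?thesis
      proof (rule disjE[OF \<mu>(2)])
        assume S: "?S \<inter> ?T = closed_segment (x + \<mu> *\<^sub>R ?b) (x + \<mu> *\<^sub>R ?b + ?a)"
        then obtain t where "mid = (1 - t) *\<^sub>R (x + \<mu> *\<^sub>R ?b) + t *\<^sub>R (x + \<mu> *\<^sub>R ?b + ?a)"
          using mid unfolding closed_segment_def by auto
        then have "mid = x + \<mu> *\<^sub>R ?b + t *\<^sub>R ?a" by (simp add: algebra_simps)
        then have "det2 ?a (mid - x) = \<mu> * det2 ?a ?b" by (simp add: det2_linear)
        then have "\<mu> = 0" using d by (simp add: mid_def det2_linear)
        then show ?thesis using S by simp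
      next
        assume "?S \<inter> ?T = closed_segment (x + \<mu> *\<^sub>R ?a) (x + \<mu> *\<^sub>R ?a + ?b)"
        then obtain t where "mid = (1 - t) *\<^sub>R (x + \<mu> *\<^sub>R ?a) + t *\<^sub>R (x + \<mu> *\<^sub>R ?a + ?b)"
          using mid unfolding closed_segment_def by auto
        then have "mid = x + \<mu> *\<^sub>R ?a + t *\<^sub>R ?b" by (simp add: algebra_simps)
        then have "det2 ?b (mid - x) = \<mu> * det2 ?b ?a" by (simp add: det2_linear)
        then have "1 / 2 * det2 ?b ?a = \<mu> * det2 ?b ?a" by (simp add: mid_def det2_linear)
        then have "\<mu> = 1 / 2" using d det2_commute[of ?a ?b] by simp
        then show ?thesis using \<mu>(1) by auto
      qed
    qed
    have side: "e = i \<and> w = x" if S: "closed_segment x (x + ?a) = closed_segment w (w + v e)" for w e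
    proof -
      have "{x, x + ?a} = {w, w + v e}" using S by (simp add: closed_segment_eq)
      then consider "x = w" "x + ?a = w + v e" | "x = w + v e" "x + ?a = w" unfolding doubleton_eq_iff by blast
      then show ?thesis
      proof cases
        case 1
        then have "v e = ?a" by simp
        then show ?thesis using v[of i e] 1(1) by force
      next
        case 2
        then have a: "?a = - v e" by (simp add: eq_neg_iff_add_eq_0 add.assoc add.commute)
        then have "i = e" using v[of i e] by (force simp: det2_linear)
        then have "?a = - ?a" using a by simp
        then show ?thesis using a0 by (simp add: vec_eq_iff)
      qed
    qed
    have d': "det2 (v p) (v q) \<noteq> 0" using v T(1) by blast
    have "\<exists>m' s'. m' \<noteq> i \<and> (s' = 1 \<or> s' = - 1) \<and> ?T = parallelogram x ?a (s' *\<^sub>R v m')"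
    proof -
      have flip: "\<exists>s'. (s' = 1 \<or> s' = - 1) \<and> parallelogram y ?a w = parallelogram x ?a (s' *\<^sub>R w)"
        if "\<mu> = 0 \<or> \<mu> = (1 :: real)" "y + \<mu> *\<^sub>R w = x" for \<mu> w
        using that(1)
      proof
        assume "\<mu> = 0" then show ?thesis using that(2) by (intro exI[of _ 1]) simp
      next
        assume "\<mu> = 1"
        then have "y = x - w" using that(2) by (simp add: eq_diff_eq)
        then show ?thesis by (intro exI[of _ "- 1"]) (simp add: parallelogram_flip)
      qed
      obtain \<mu> where \<mu>: "\<mu> = 0 \<or> \<mu> = (1 :: real)"
        "closed_segment x (x + ?a) = closed_segment (y + \<mu> *\<^sub>R v q) (y + \<mu> *\<^sub>R v q + v p) \<or>
         closed_segment x (x + ?a) = closed_segment (y + \<mu> *\<^sub>R v p) (y + \<mu> *\<^sub>R v p + v q)"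
        using edge_of_parallelogram_is_side[OF d' E(2)[unfolded seg]] by blast
      show ?thesis
      proof (rule disjE[OF \<mu>(2)])
        assume "closed_segment x (x + ?a) = closed_segment (y + \<mu> *\<^sub>R v q) (y + \<mu> *\<^sub>R v q + v p)"
        then have "p = i" "y + \<mu> *\<^sub>R v q = x" using side by blast+
        then show ?thesis using flip[OF \<mu>(1)] T(1) by metis
      next
        assume "closed_segment x (x + ?a) = closed_segment (y + \<mu> *\<^sub>R v p) (y + \<mu> *\<^sub>R v p + v q)"
        then have "q = i" "y + \<mu> *\<^sub>R v p = x" using side by blast+
        then show ?thesis using flip[OF \<mu>(1)] T(1) parallelogram_commute by metis
      qed
    qed
    then obtain m' s' where m': "m' \<noteq> i" "s' = 1 \<or> s' = - 1" "?T = parallelogram x ?a (s' *\<^sub>R v m')" by blast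
    then obtain l k where "z n = x + l *\<^sub>R ?a + k *\<^sub>R s' *\<^sub>R v m'" "0 \<le> k"
      using T(4) unfolding parallelogram_def by auto
    then have "det2 ?a (z n - x) = k * (s' * det2 ?a (v m'))" by (simp add: det2_linear)
    then have "0 < s' * det2 ?a (v m')" using zpos \<open>0 \<le> k\<close> by (simp add: zero_less_mult_iff)
    then show ?thesis using that m' T(2) by metis
  qed
qed

text \<open>Crossing a tile from an edge of type \<open>i\<close> to the opposite one changes the
  lift by the other edge of the tile; leaving always on the positive side fixes the sign.\<close>

lemma walk_along_ribbon:
  assumes v: "\<And>i j. i \<noteq> j \<Longrightarrow> det2 (v i) (v j) \<noteq> 0" and oct: "octagonal_tiling v \<T>"
    and h: "is_lift v \<T> h" and x: "tiled_edge v \<T> i x"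
  obtains x' m where "tiled_edge v \<T> i x'" "m \<noteq> i" "h x' = h x + axis m (sgn (det2 (v i) (v m)))" "\<exists>y. tiled_edge v \<T> m y"
proof -
  obtain m s where ms: "m \<noteq> i" "s = 1 \<or> s = - 1" "parallelogram x (v i) (s *\<^sub>R v m) \<in> \<T>" "0 < s * det2 (v i) (v m)"
    by (rule tile_on_positive_side[of v, OF v oct x])
  have sg: "s = sgn (det2 (v i) (v m))" using ms(2,4) by (auto simp: sgn_if)
  define x' where "x' = x + s *\<^sub>R v m"
  have T': "parallelogram x' (v i) ((- s) *\<^sub>R v m) = parallelogram x (v i) (s *\<^sub>R v m)"
    using parallelogram_flip[of x' "v i" "s *\<^sub>R v m"] by (simp add: x'_def)
  have 1: "tiled_edge v \<T> i x'"
    unfolding tiled_edge_def using ms(1,2,3) by (intro exI[of _ m] exI[of _ "- s"]) (auto simp del: scaleR_minus_left simp: T')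
  have 2: "h x' = h x + axis m s" and 3: "\<exists>y. tiled_edge v \<T> m y"
  proof -
    have lift: "h (w + v m) = h w + axis m 1" if "parallelogram w (v i) (v m) \<in> \<T>" for w
      using h that ms(1) unfolding is_lift_def by metis
    have edge: "tiled_edge v \<T> m w" if "parallelogram w (v i) (v m) \<in> \<T>" for w
      unfolding tiled_edge_def using ms(1) that parallelogram_commute[of w "v i" "v m"]
      by (intro exI[of _ i] exI[of _ 1]) simp
    have "h x' = h x + axis m s \<and> (\<exists>y. tiled_edge v \<T> m y)" using ms(2)
    proof
      assume s: "s = 1"
      then show ?thesis using lift[of x] edge[of x] ms(3) by (auto simp: x'_def)
    next
      assume s: "s = - 1"
      then have T: "parallelogram (x - v m) (v i) (v m) \<in> \<T>" using ms(3) parallelogram_flip[of x "v i" "v m"] by simp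
      have "axis m (- 1) = - axis m (1 :: real)" by (simp add: vec_eq_iff axis_def)
      then show ?thesis using lift[OF T] edge[OF T] s by (auto simp: x'_def)
    qed
    then show "h x' = h x + axis m s" "\<exists>y. tiled_edge v \<T> m y" by blast+
  qed
  show ?thesis using that[of x' m] 1 ms(1) 2 3 sg by simp
qed

lemma lifted_vertex_near_plane:
  assumes h: "is_lift v \<T> h"
    and tube: "lift_surface v \<T> h \<subseteq> {x + y | x y. x \<in> {x. cmb f x = \<theta>} \<and> (\<forall>k. 0 \<le> y $ k \<and> y $ k \<le> t)}"
    and t: "0 \<le> t" and x: "tiled_edge v \<T> i x"
  shows "norm (cmb f (h x) - \<theta>) \<le> 4 * t * (\<Sum>i\<in>UNIV. norm (f i))"
proof -
  obtain m s where ms: "m \<noteq> i" "s = 1 \<or> s = - (1 :: real)" "parallelogram x (v i) (s *\<^sub>R v m) \<in> \<T>"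
    using x unfolding tiled_edge_def by blast
  have "h x \<in> lift_surface v \<T> h"
    using ms(2)
  proof
    assume "s = 1"
    then have T: "parallelogram x (v i) (v m) \<in> \<T>" using ms(3) by simp
    moreover have "h x \<in> parallelogram (h x) (axis i 1) (axis m 1)"
      unfolding parallelogram_def by (auto intro!: exI[of _ 0])
    ultimately show ?thesis unfolding lift_surface_def using ms(1) by blast
  next
    assume "s = - 1"
    then have T: "parallelogram (x - v m) (v i) (v m) \<in> \<T>" using ms(3) parallelogram_flip[of x "v i" "v m"] by simp
    then have "h (x - v m + v m) = h (x - v m) + axis m 1" using h ms(1) unfolding is_lift_def by metis
    then have "h x = h (x - v m) + 0 *\<^sub>R axis i 1 + 1 *\<^sub>R axis m 1" by simp
    then have "h x \<in> parallelogram (h (x - v m)) (axis i 1) (axis m 1)"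
      unfolding parallelogram_def by (intro CollectI exI[of _ 0] exI[of _ 1]) simp
    then show ?thesis unfolding lift_surface_def using ms(1) T by blast
  qed
  then obtain p y where p: "h x = p + y" "cmb f p = \<theta>" "\<And>k. 0 \<le> y $ k \<and> y $ k \<le> t" using tube by blast
  have "norm y \<le> (\<Sum>k\<in>(UNIV :: 4 set). t)"
    using p(3) by (intro order_trans[OF norm_le_l1_cart] sum_mono) auto
  then have "norm y \<le> 4 * t" by simp
  then have "(\<Sum>i\<in>UNIV. norm (f i)) * norm y \<le> (\<Sum>i\<in>UNIV. norm (f i)) * (4 * t)"
    by (intro mult_left_mono) (simp_all add: sum_nonneg)
  then show ?thesis using norm_cmb_le[of f y] p(1,2) by (simp add: cmb_add mult.commute mult.left_commute)
qed

text \<open>A walk along a ribbon is monotone in each coordinate and stays near the plane, so its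
  normalized displacement subconverges to a direction of the plane with the prescribed signs. The
  limit is nonzero and vanishes at \<open>i\<close>, hence nowhere else.\<close>

lemma ribbon_slope:
  assumes v: "\<And>i j. i \<noteq> j \<Longrightarrow> det2 (v i) (v j) \<noteq> 0" and oct: "octagonal_tiling v \<T>"
    and f: "\<And>i j. i \<noteq> j \<Longrightarrow> det2 (f i) (f j) \<noteq> 0"
    and h: "is_lift v \<T> h"
    and tube: "lift_surface v \<T> h \<subseteq> {x + y | x y. x \<in> {x. cmb f x = \<theta>} \<and> (\<forall>k. 0 \<le> y $ k \<and> y $ k \<le> t)}"
    and t: "0 \<le> t" and x: "tiled_edge v \<T> i x"
  shows "\<exists>c. c $ i = 0 \<and> cmb f c = 0 \<and> (\<forall>m. m \<noteq> i \<longrightarrow> 0 < c $ m * det2 (v i) (v m) \<and> (\<exists>y. tiled_edge v \<T> m y))"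
proof -
  define g where "g m = sgn (det2 (v i) (v m))" for m
  have gi: "g i = 0" by (simp add: g_def)
  have g1: "g m = 1 \<or> g m = - 1" if "m \<noteq> i" for m using v[of i m] that by (auto simp: g_def sgn_if)
  have step: "\<exists>x'. tiled_edge v \<T> i x' \<and> (\<exists>m. m \<noteq> i \<and> h x' = h x + axis m (g m) \<and> (\<exists>y. tiled_edge v \<T> m y))"
    if "tiled_edge v \<T> i x" for x
    using walk_along_ribbon[of v, OF v oct h that] unfolding g_def by metis
  have "\<exists>xs. \<forall>n :: nat. tiled_edge v \<T> i (xs n) \<and>
      (\<exists>m. m \<noteq> i \<and> h (xs (Suc n)) = h (xs n) + axis m (g m) \<and> (\<exists>y. tiled_edge v \<T> m y))"
    by (rule dependent_nat_choice) (use x step in blast)+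
  then obtain xs where xs: "\<And>n :: nat. tiled_edge v \<T> i (xs n)"
    "\<And>n. \<exists>m. m \<noteq> i \<and> h (xs (Suc n)) = h (xs n) + axis m (g m) \<and> (\<exists>y. tiled_edge v \<T> m y)"
    by blast
  define d where "d n = h (xs n) - h (xs 0)" for n
  have d: "d n $ i = 0 \<and> (\<forall>m. 0 \<le> g m * d n $ m) \<and> (\<Sum>m\<in>UNIV. g m * d n $ m) = real n \<and>
      (\<forall>m. d n $ m \<noteq> 0 \<longrightarrow> (\<exists>y. tiled_edge v \<T> m y))" for n
  proof (induction n)
    case 0
    show ?case by (simp add: d_def)
  next
    case (Suc n)
    obtain m where m: "m \<noteq> i" "h (xs (Suc n)) = h (xs n) + axis m (g m)" "\<exists>y. tiled_edge v \<T> m y" using xs(2) by blast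
    then have e: "d (Suc n) = d n + axis m (g m)" by (simp add: d_def)
    have gg: "g m * g m = 1" using g1[OF m(1)] by auto
    have "(\<Sum>k\<in>UNIV. g k * axis m (g m) $ k) = (\<Sum>k\<in>UNIV. if k = m then 1 else 0)"
      by (intro sum.cong) (auto simp: axis_def gg)
    then have s: "(\<Sum>k\<in>UNIV. g k * axis m (g m) $ k) = 1" by simp
    have "0 \<le> g k * axis m (g m) $ k" for k by (simp add: axis_def gg)
    then show ?case
      using Suc m(1,3) s unfolding e
      by (auto simp: distrib_left sum.distrib axis_def)
  qed
  \<comment> \<open>The absolute values of the coordinates sum to 1, which bounds the sequence and
    keeps its limits from being zero.\<close>
  define e where "e n = (1 / real (Suc n)) *\<^sub>R d (Suc n)" for n
  have e: "e n $ i = 0" "0 \<le> g m * e n $ m" "(\<Sum>m\<in>UNIV. g m * e n $ m) = 1" for n m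
  proof -
    show "e n $ i = 0" "0 \<le> g m * e n $ m" using d[of "Suc n"] by (simp_all add: e_def)
    have "(\<Sum>m\<in>UNIV. g m * e n $ m) = (\<Sum>m\<in>UNIV. g m * d (Suc n) $ m) / real (Suc n)"
      unfolding sum_divide_distrib by (simp add: e_def)
    then show "(\<Sum>m\<in>UNIV. g m * e n $ m) = 1" using d[of "Suc n"] by simp
  qed
  have "e n \<in> cball 0 1" for n
  proof -
    have "norm (e n) \<le> (\<Sum>m\<in>UNIV. \<bar>e n $ m\<bar>)" by (rule norm_le_l1_cart)
    also have "\<dots> = (\<Sum>m\<in>UNIV. g m * e n $ m)"
    proof (intro sum.cong refl)
      fix m
      show "\<bar>e n $ m\<bar> = g m * e n $ m" using g1[of m] e(1)[of n] e(2)[of m n] by (cases "m = i") auto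
    qed
    finally show ?thesis using e(3) by simp
  qed
  moreover have "seq_compact (cball (0 :: real ^ 4) 1)" by (simp add: compact_imp_seq_compact)
  ultimately obtain c r where r: "strict_mono (r :: nat \<Rightarrow> nat)" "(e \<circ> r) \<longlonglongrightarrow> c"
    by (metis (no_types, lifting) seq_compactE)
  have er: "(\<lambda>k. e (r k)) \<longlonglongrightarrow> c" using r(2) by (simp add: comp_def)
  have ec: "(\<lambda>k. e (r k) $ m) \<longlonglongrightarrow> c $ m" for m by (intro tendsto_intros er)
  have ci: "c $ i = 0" using ec[of i] e(1) by (simp add: LIMSEQ_const_iff)
  have cg: "0 \<le> g m * c $ m" for m
    by (rule tendsto_lowerbound[OF tendsto_mult_left[OF ec]]) (simp_all add: e(2))
  have "(\<lambda>k. \<Sum>m\<in>UNIV. g m * e (r k) $ m) \<longlonglongrightarrow> (\<Sum>m\<in>UNIV. g m * c $ m)" by (intro tendsto_intros ec)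
  then have "(\<Sum>m\<in>UNIV. g m * c $ m) = 1" by (simp add: e(3) LIMSEQ_const_iff)
  then have c0: "c \<noteq> 0" by auto
  define C where "C = 4 * t * (\<Sum>i\<in>UNIV. norm (f i))"
  have near: "norm (cmb f (h (xs n)) - \<theta>) \<le> C" for n
    unfolding C_def by (rule lifted_vertex_near_plane[OF h tube t xs(1)])
  have "norm (cmb f (d n)) \<le> 2 * C" for n
    using norm_triangle_ineq4[of "cmb f (h (xs n)) - \<theta>" "cmb f (h (xs 0)) - \<theta>"] near[of n] near[of 0]
    by (simp add: d_def cmb_diff)
  then have le: "norm (cmb f (e n)) \<le> 2 * C * inverse (real (Suc n))" for n
    by (simp add: e_def cmb_scale divide_inverse mult.commute mult_left_mono)
  have "(\<lambda>n. 2 * C * inverse (real (Suc n))) \<longlonglongrightarrow> 2 * C * 0"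
    by (intro tendsto_mult tendsto_const LIMSEQ_inverse_real_of_nat)
  then have "(\<lambda>n. 2 * C * inverse (real (Suc n))) \<longlonglongrightarrow> 0" by (simp only: mult_zero_right)
  then have "(\<lambda>n. cmb f (e n)) \<longlonglongrightarrow> 0"
    by (rule Lim_null_comparison[OF always_eventually, rotated]) (intro allI le)
  then have "(\<lambda>k. cmb f (e (r k))) \<longlonglongrightarrow> 0" using LIMSEQ_subseq_LIMSEQ[OF _ r(1), of "\<lambda>n. cmb f (e n)"] by (simp add: comp_def)
  moreover have "(\<lambda>k. cmb f (e (r k))) \<longlonglongrightarrow> cmb f c" by (intro tendsto_intros er)
  ultimately have fc: "cmb f c = 0" using LIMSEQ_unique by blast
  have cm: "c $ m \<noteq> 0" if "m \<noteq> i" for m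
    using cmb_two_zeros[of f c i m, OF f fc ci] that c0 by metis
  have "0 < c $ m * det2 (v i) (v m) \<and> (\<exists>y. tiled_edge v \<T> m y)" if m: "m \<noteq> i" for m
  proof
    have "0 < g m * c $ m" using cg[of m] cm[OF m] g1[OF m] by auto
    then show "0 < c $ m * det2 (v i) (v m)"
      by (auto simp: g_def sgn_if zero_less_mult_iff split: if_splits)
    show "\<exists>y. tiled_edge v \<T> m y"
    proof (rule ccontr)
      assume "\<not> ?thesis"
      then have "e (r k) $ m = 0" for k using d[of "Suc (r k)"] by (auto simp: e_def)
      then show False using ec[of m] cm[OF m] by (simp add: LIMSEQ_const_iff)
    qed
  qed
  then show ?thesis using ci fc by blast
qed

text \<open>A single tile starts a ribbon of one type; its slope shows that this ribbon crosses
  tiles of every other type, so ribbons of all types are available.\<close>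

lemma planar_tiling_compatible:
  assumes v: "\<And>i j. i \<noteq> j \<Longrightarrow> det2 (v i) (v j) \<noteq> 0" and f: "\<And>i j. i \<noteq> j \<Longrightarrow> det2 (f i) (f j) \<noteq> 0"
    and pl: "planar_tiling v {x. cmb f x = \<theta>} t \<T>" and t: "0 \<le> t"
  shows "chart v f"
proof
  fix i j :: 4
  show "i \<noteq> j \<Longrightarrow> det2 (v i) (v j) \<noteq> 0" "i \<noteq> j \<Longrightarrow> det2 (f i) (f j) \<noteq> 0" by (fact v f)+
next
  fix i
  obtain h where oct: "octagonal_tiling v \<T>" and h: "is_lift v \<T> h"
    and tube: "lift_surface v \<T> h \<subseteq> {x + y | x y. x \<in> {x. cmb f x = \<theta>} \<and> (\<forall>k. 0 \<le> y $ k \<and> y $ k \<le> t)}"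
    using pl unfolding planar_tiling_def by blast
  note slope = ribbon_slope[of v \<T> f h \<theta> t, OF v oct f h tube t]
  obtain S where "S \<in> \<T>" using oct unfolding octagonal_tiling_def by blast
  moreover from this obtain y a b where "S = parallelogram y (v a) (v b)" "a \<noteq> b"
    using oct unfolding octagonal_tiling_def tiles_def by blast
  ultimately have "tiled_edge v \<T> a y"
    unfolding tiled_edge_def by (intro exI[of _ b] exI[of _ 1]) auto
  then have "\<exists>y. tiled_edge v \<T> i y" using slope by (cases "i = a") blast+
  then show "\<exists>c. c $ i = 0 \<and> cmb f c = 0 \<and> (\<forall>m. m \<noteq> i \<longrightarrow> 0 < c $ m * det2 (v i) (v m))"
    using slope by blast
qed

section \<open>The quadratic field\<close>

text \<open>The entries of \<open>normf\<close> are brackets with \<open>g 1\<close> and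
  \<open>g 2\<close> up to a common factor per row, so it is an invertible change of window
  coordinates.\<close>

lemma kernel_normf:
  assumes "det2 (g 1) (g 2) \<noteq> 0"
  shows "cmb (normf (\<lambda>i j. det2 (g i) (g j))) x = 0 \<longleftrightarrow> cmb g x = 0"
proof -
  have "cmb (normf (\<lambda>i j. det2 (g i) (g j))) x = vector [det2 (g 1) (cmb g x) / det2 (g 1) (g 2), det2 (g 2) (cmb g x)]"
    unfolding det2_cmb
    by (simp add: vec_eq_iff forall_2 cmb_def normf_def vector_2 sum_divide_distrib)
  then have "cmb (normf (\<lambda>i j. det2 (g i) (g j))) x = 0 \<longleftrightarrow> det2 (g 1) (cmb g x) = 0 \<and> det2 (g 2) (cmb g x) = 0"
    using assms by (simp add: vec_eq_iff forall_2 vector_2)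
  then show ?thesis using det2_both_zero[OF assms] by auto
qed

text \<open>The vectors \<open>g i\<close> are the columns of two linear equations of the plane.\<close>

lemma span_as_kernel:
  fixes u w :: "real ^ 4"
  assumes G: "\<And>i j. i \<noteq> j \<Longrightarrow> grassmann u w i j \<noteq> 0"
  obtains g where "\<forall>i j. i \<noteq> j \<longrightarrow> det2 (g i) (g j) \<noteq> 0" "span {u, w} = {x. cmb g x = 0}"
proof -
  let ?G = "grassmann u w"
  define g :: "4 \<Rightarrow> real ^ 2" where "g i = (if i = 1 then vector [?G 2 3, ?G 2 4] else
    if i = 2 then vector [- ?G 1 3, - ?G 1 4] else if i = 3 then vector [?G 1 2, 0] else vector [0, ?G 1 2])" for i
  have g: "g 1 = vector [?G 2 3, ?G 2 4]" "g 2 = vector [- ?G 1 3, - ?G 1 4]" "g 3 = vector [?G 1 2, 0]" "g 4 = vector [0, ?G 1 2]"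
    by (simp_all add: g_def)
  have "det2 (g 1) (g 2) = ?G 1 2 * ?G 3 4"
    unfolding g det2_def vector_2 grassmann_def by (simp add: algebra_simps)
  then have indep: "\<forall>i j. i \<noteq> j \<longrightarrow> det2 (g i) (g j) \<noteq> 0"
    unfolding forall_4 using G[of 1 2] G[of 3 4] G[of 2 4] G[of 2 3] G[of 1 4] G[of 1 3]
      det2_commute[of "g 2" "g 1"]
    by (simp add: g det2_def vector_2)
  have ker: "cmb g x = 0 \<longleftrightarrow> x $ 1 * ?G 2 3 - x $ 2 * ?G 1 3 + x $ 3 * ?G 1 2 = 0 \<and>
      x $ 1 * ?G 2 4 - x $ 2 * ?G 1 4 + x $ 4 * ?G 1 2 = 0" for x
    by (simp add: cmb_def sum_4 g vec_eq_iff forall_2 vector_2)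
  have uw: "cmb g u = 0" "cmb g w = 0"
    unfolding ker by (simp_all add: grassmann_def algebra_simps)
  have "span {u, w} = {x. cmb g x = 0}"
  proof (intro set_eqI iffI)
    fix x assume "x \<in> span {u, w}"
    then obtain s t where "x = s *\<^sub>R u + t *\<^sub>R w"
      unfolding span_insert[of u] span_singleton by (auto simp: algebra_simps)
    then show "x \<in> {x. cmb g x = 0}" by (simp add: cmb_add cmb_scale uw)
  next
    fix x assume x: "x \<in> {x. cmb g x = 0}"
    define s where "s = (x $ 1 * w $ 2 - x $ 2 * w $ 1) / ?G 1 2"
    define t where "t = (u $ 1 * x $ 2 - u $ 2 * x $ 1) / ?G 1 2"
    have G12: "?G 1 2 \<noteq> 0" using G[of 1 2] by simp
    have "x - s *\<^sub>R u - t *\<^sub>R w = 0"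
    proof (rule cmb_two_zeros[of g _ 1 2])
      show "i \<noteq> j \<Longrightarrow> det2 (g i) (g j) \<noteq> 0" for i j using indep by blast
      show "cmb g (x - s *\<^sub>R u - t *\<^sub>R w) = 0" using x uw by (simp add: cmb_diff cmb_scale)
      have "?G 1 2 * x $ 1 = (s * ?G 1 2) * u $ 1 + (t * ?G 1 2) * w $ 1"
        "?G 1 2 * x $ 2 = (s * ?G 1 2) * u $ 2 + (t * ?G 1 2) * w $ 2"
        using G12 by (simp_all add: s_def t_def) (simp_all add: grassmann_def algebra_simps)
      then have "?G 1 2 * x $ 1 = ?G 1 2 * (s * u $ 1 + t * w $ 1)"
        "?G 1 2 * x $ 2 = ?G 1 2 * (s * u $ 2 + t * w $ 2)" by (simp_all add: algebra_simps)
      then show "(x - s *\<^sub>R u - t *\<^sub>R w) $ 1 = 0" "(x - s *\<^sub>R u - t *\<^sub>R w) $ 2 = 0"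
        using G12 by simp_all
    qed simp
    then have "x = s *\<^sub>R u + t *\<^sub>R w" by (simp add: algebra_simps)
    then show "x \<in> span {u, w}" by (simp add: span_add span_scale span_base)
  qed
  with indep show ?thesis by (rule that)
qed

lemma affine_plane_as_level_set:
  assumes "affine E" "E \<noteq> {}" and dir: "direction E = {x. cmb f x = 0}"
  obtains \<theta> where "E = {x. cmb f x = \<theta>}"
proof -
  obtain e where e: "e \<in> E" using assms(2) by blast
  have "E = {x. cmb f x = cmb f e}"
  proof (intro set_eqI iffI)
    fix x assume "x \<in> E"
    then have "x - e \<in> direction E" using e unfolding direction_def by blast
    then show "x \<in> {x. cmb f x = cmb f e}" unfolding dir by (simp add: cmb_diff)
  next
    fix x assume "x \<in> {x. cmb f x = cmb f e}"
    then have "x - e \<in> direction E" unfolding dir by (simp add: cmb_diff)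
    then obtain a b where ab: "x - e = a - b" "a \<in> E" "b \<in> E" unfolding direction_def by blast
    have "e + 1 *\<^sub>R (a - b) \<in> E" by (rule mem_affine_3_minus[OF assms(1) e ab(2,3)])
    then show "x \<in> E" unfolding ab(1)[symmetric] by simp
  qed
  then show ?thesis by (rule that)
qed

lemma det2_nonzero_of_noncollinear:
  assumes "pairwise_noncollinear v" "i \<noteq> j"
  shows "det2 (v i) (v j) \<noteq> 0"
proof
  assume 0: "det2 (v i) (v j) = 0"
  have nc: "\<not> collinear {0, v i, v j}" using assms by (simp add: pairwise_noncollinear_def)
  then have "v i \<noteq> 0" unfolding collinear_lemma by blast
  then obtain t where "v j = t *\<^sub>R v i" using 0 det2_eq_0_iff_parallel by blast
  then show False using nc unfolding collinear_lemma by blast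
qed

lemma real_quadratic_field_closed:
  assumes "real_quadratic_field K"
  shows "0 \<in> K" "a \<in> K \<Longrightarrow> - a \<in> K"
proof -
  obtain d :: nat where K: "K = {a + b * sqrt (real d) | a b. a \<in> \<rat> \<and> b \<in> \<rat>}"
    using assms unfolding real_quadratic_field_def by blast
  have "(0 :: real) = 0 + 0 * sqrt (real d)" by simp
  then show "0 \<in> K" unfolding K using Rats_0 by blast
  assume "a \<in> K"
  then obtain p q where pq: "a = p + q * sqrt (real d)" "p \<in> \<rat>" "q \<in> \<rat>" unfolding K by blast
  then have "- a = - p + (- q) * sqrt (real d)" "- p \<in> \<rat>" "- q \<in> \<rat>" by simp_all
  then show "- a \<in> K" unfolding K by blast
qed

text \<open>Three-term relations between the \<open>f i\<close> have brackets as coefficients;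
  scaled by \<open>u\<close> they have entries in \<open>K\<close>, and two of them span the
  kernel.\<close>

lemma kernel_generated_over:
  assumes K: "real_quadratic_field K" and f: "\<And>i j. i \<noteq> j \<Longrightarrow> det2 (f i) (f j) \<noteq> 0" and u: "u \<noteq> 0"
    and br: "\<And>i j. u * det2 (f i) (f j) \<in> K"
  shows "generated_over K {x. cmb f x = 0}"
proof -
  define y where "y a = axis a (u * det2 (f 3) (f 4)) + axis 3 (u * det2 (f 4) (f a)) + axis 4 (u * det2 (f a) (f 3))" for a
  have ker: "cmb f (y a) = 0" for a
    by (simp add: y_def cmb_add vec_eq_iff forall_2 det2_def algebra_simps)
  have y12: "y 1 $ 1 = u * det2 (f 3) (f 4)" "y 1 $ 2 = 0" "y 2 $ 1 = 0" "y 2 $ 2 = u * det2 (f 3) (f 4)"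
    by (simp_all add: y_def axis_def)
  have nz: "u * det2 (f 3) (f 4) \<noteq> 0" using u f[of 3 4] by simp
  have "y a $ k \<in> K" if "a = 1 \<or> a = 2" for a k
  proof -
    have "\<forall>k. y a $ k \<in> K"
      unfolding forall_4 using that br real_quadratic_field_closed(1)[OF K]
      by (auto simp: y_def axis_def)
    then show ?thesis by blast
  qed
  then have "\<forall>z\<in>{y 1, y 2}. \<forall>k. z $ k \<in> K" by blast
  moreover have "{x. cmb f x = 0} = span {y 1, y 2}"
  proof (intro set_eqI iffI)
    fix x assume x: "x \<in> {x. cmb f x = 0}"
    define s t where "s = x $ 1 / (u * det2 (f 3) (f 4))" and "t = x $ 2 / (u * det2 (f 3) (f 4))"
    have "x - s *\<^sub>R y 1 - t *\<^sub>R y 2 = 0"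
    proof (rule cmb_two_zeros[of f _ 1 2])
      show "i \<noteq> j \<Longrightarrow> det2 (f i) (f j) \<noteq> 0" for i j by (rule f)
      show "cmb f (x - s *\<^sub>R y 1 - t *\<^sub>R y 2) = 0" using x ker by (simp add: cmb_diff cmb_scale)
      show "(x - s *\<^sub>R y 1 - t *\<^sub>R y 2) $ 1 = 0" "(x - s *\<^sub>R y 1 - t *\<^sub>R y 2) $ 2 = 0"
        using nz by (simp_all add: y12 s_def t_def)
    qed simp
    then have "x = s *\<^sub>R y 1 + t *\<^sub>R y 2" by (simp add: algebra_simps)
    then show "x \<in> span {y 1, y 2}" by (simp add: span_add span_scale span_base)
  next
    fix x assume "x \<in> span {y 1, y 2}"
    then obtain s t where "x = s *\<^sub>R y 1 + t *\<^sub>R y 2"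
      unfolding span_insert[of "y 1"] span_singleton by (auto simp: algebra_simps)
    then show "x \<in> {x. cmb f x = 0}" by (simp add: cmb_add cmb_scale ker)
  qed
  ultimately show ?thesis unfolding generated_over_def by blast
qed

theorem corollary2:
  fixes v :: "4 \<Rightarrow> real ^ 2" and E :: "(real ^ 4) set"
  assumes "pairwise_noncollinear v"
    and "affine_plane E"
    and "nondegenerate E"
    and "\<exists>\<T>. planar_tiling v E 1 \<T>"
    and "weak_local_rules v E"
  shows "\<exists>K. real_quadratic_field K \<and> generated_over K (direction E)"
proof -
  obtain u0 w0 where uw: "direction E = span {u0, w0}" "\<forall>i j. i \<noteq> j \<longrightarrow> grassmann u0 w0 i j \<noteq> 0"
    using assms(3) unfolding nondegenerate_def by (elim exE conjE)
  obtain g where g0: "\<forall>i j. i \<noteq> j \<longrightarrow> det2 (g i) (g j) \<noteq> 0" and span_g: "span {u0, w0} = {x. cmb g x = 0}"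
    by (rule span_as_kernel[of u0 w0, OF uw(2)[rule_format]])
  note g = g0[rule_format] and dirg = uw(1)[unfolded span_g]
  define B where "B i j = det2 (g i) (g j)" for i j
  define f where "f = normf B"
  have anti: "B i j = - B j i" for i j unfolding B_def by (rule det2_commute)
  have pl: "B 1 2 * B 3 4 - B 1 3 * B 2 4 + B 1 4 * B 2 3 = 0" unfolding B_def by (rule plucker)
  have B12: "B 1 2 \<noteq> 0" using g[of 1 2] by (simp add: B_def)
  have br: "det2 (f i) (f j) = B i j" for i j unfolding f_def by (rule det2_normf[OF anti pl B12])
  have f_indep: "det2 (f i) (f j) \<noteq> 0" if "i \<noteq> j" for i j using g[OF that] by (simp add: br B_def)
  have dir: "direction E = {x. cmb f x = 0}"
    unfolding dirg f_def B_def by (subst kernel_normf) (use g[of 1 2] in simp_all)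
  have "affine E" "E \<noteq> {}" using assms(2) unfolding affine_plane_def by auto
  then obtain \<theta> where E: "E = {x. cmb f x = \<theta>}" using affine_plane_as_level_set dir by metis
  obtain \<T> where T: "planar_tiling v {x. cmb f x = \<theta>} 1 \<T>" using assms(4) unfolding E by blast
  interpret chart v f
    by (rule planar_tiling_compatible[of v f, OF det2_nonzero_of_noncollinear[OF assms(1)] f_indep T]) simp_all
  have wl: "weak_local_rules v {x. cmb f x = \<theta>}" using assms(5) unfolding E .
  show ?thesis
  proof (cases "\<exists>z. z \<noteq> 0 \<and> cmb f (rv z) = 0")
    case True
    then obtain z \<mu> where s: "{x. cmb f x = 0} = span {rv z, rv \<mu>}" using integer_kernel_spans[OF wl] by metis
    \<comment> \<open>The plane is rational, so any quadratic field serves; this one is obtained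
      from the root 0.\<close>
    obtain K where K: "real_quadratic_field K" "\<And>a b. a \<in> \<rat> \<Longrightarrow> b \<in> \<rat> \<Longrightarrow> a + b * 0 \<in> K"
      by (rule quadratic_field_of_root[of 0 1 0 0]) auto
    have "\<forall>y\<in>{rv z, rv \<mu>}. \<forall>k. y $ k \<in> K" using K(2)[OF Rats_of_int Rats_0] by auto
    then have "generated_over K (direction E)" unfolding generated_over_def dir s by blast
    then show ?thesis using K(1) by blast
  next
    case False
    then have no_int: "\<And>z. cmb f (rv z) = 0 \<Longrightarrow> z = 0" by blast
    show ?thesis
    proof (rule quadratic_if_no_integer_kernel[OF f_def anti pl no_int wl])
      fix K u
      assume K: "real_quadratic_field K" "u \<noteq> 0"
        "\<And>t. t \<in> {B 1 2, B 1 3, B 1 4, B 2 3, B 2 4, B 3 4} \<Longrightarrow> u * t \<in> K"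
      have neg: "u * B j i \<in> K" if "u * B i j \<in> K" for i j
        using real_quadratic_field_closed(2)[OF K(1) that] anti[of j i] by simp
      have diag: "u * B i i \<in> K" for i using real_quadratic_field_closed(1)[OF K(1)] by (simp add: B_def)
      have "\<forall>i j. u * B i j \<in> K"
        unfolding forall_4 using K(3) neg diag by simp
      then have "generated_over K {x. cmb f x = 0}"
        by (intro kernel_generated_over[OF K(1) f_indep K(2)]) (simp_all add: br)
      then show ?thesis using K(1) dir by auto
    qed
  qed
qed

end
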